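(* Let $M_1$ be a complex manifold with a closed real-analytic real $(1,1)$-form $\omega_{M_1}$ (possibly indefinite or degenerate). Assume that $(M_1,\omega_{M_1})$ locally admits a potential function $\varphi$ with polarization $\varphi(\xi,\overline\eta)$, such that $\omega_{M_1}=4\sqrt{-1}\,\partial\overline\partial\varphi(\xi,\overline\xi)$ in local holomorphic coordinates $\xi$. 1. If $\varphi(\xi,\overline\eta)$ is Nash algebraic, then $(M_1,\omega_{M_1})$ and $(M_2,\omega_{M_2})$ do not share common complex submanifolds for $$(M_2,\omega_{M_2})=\Bigl(\prod_{j=1}^m N_j,\ \bigoplus_{j=1}^m c_j\,\omega_{N_j}\Bigr),$$ where the $c_j$ are real constants and each $N_j$ is either an indefinite complex projective space $\mathbb{CP}^{n_j}_{\kappa_j}(b_j)$ or an indefinite complex hyperbolic space $\mathbb{CH}^{n_j}_{\kappa_j}(b_j)$. 2. If $\exp\{\varphi(\xi,\overline\eta)\}$ is Nash algebraic, then $(M_1,\omega_{M_1})$ and $(M_2,\omega_{M_2})$ do not share common complex submanifolds for $$(M_2,\omega_{M_2})=\Bigl(\prod_{j=1}^m N_j,\ \bigoplus_{j=1}^m c_j\,\omega_{N_j}\Bigr),$$ where the $c_j$ are real constants and each $N_j=\mathbb{C}^{n_j}_{\kappa_j}$ is an indefinite complex Euclidean space.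
   Context: Indefinite complex space forms ($0\le\kappa\le N$): - $\mathbb{C}^N_\kappa=\mathbb{C}^N$ with $\omega_{\mathbb{C}^N_\kappa}=4\sqrt{-1}\,\partial\overline\partial\bigl(\sum_{i=\kappa+1}^{N}|z_i|^2-\sum_{j=1}^{\kappa}|z_j|^2\bigr)$. - For $b>0$, $\mathbb{CP}^N_\kappa(b)$ is the open complex submanifold $\{(\xi_0,\dots,\xi_N)\in\mathbb{C}^{N+1}:\sum_{i=0}^{N-\kappa}|\xi_i|^2-\sum_{j=0}^{\kappa-1}|\xi_{N-j}|^2>0\}/\mathbb{C}^*$ of $\mathbb{CP}^N$ with $\omega_{\mathbb{CP}^N_\kappa(b)}=\frac{4\sqrt{-1}}{b}\partial\overline\partial\log\bigl(\sum_{i=0}^{N-\kappa}|\xi_i|^2-\sum_{j=0}^{\kappa-1}|\xi_{N-j}|^2\bigr)$. - For $b<0$, $\mathbb{CH}^N_\kappa(b)$ is the complex manifold $\mathbb{CP}^N_{N-\kappa}(-b)$ with $\omega_{\mathbb{CH}^N_\kappa(b)}=-\frac{4\sqrt{-1}}{(-b)}\partial\overline\partial\log\bigl(\sum_{i=0}^{\kappa}|\xi_i|^2-\sum_{j=0}^{N-\kappa-1}|\xi_{N-j}|^2\bigr)$. On a product, $\bigoplus_j c_j\omega_{N_j}$ denotes $\sum_j c_j\,\pi_j^*\omega_{N_j}$, with $\pi_j$ the projection to the $j$-th factor. The polarization $\varphi(\xi,\overline\eta)$ is the function, holomorphic in the independent variables $(\xi,\overline\eta)$, that restricts to $\varphi(\xi,\overline\xi)$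 when $\eta=\xi$. A holomorphic function $f$ on a domain of $\mathbb{C}^n$ is Nash algebraic if there is a non-zero polynomial $P(x,y)$, $(x,y)\in\mathbb{C}^n\times\mathbb{C}$, with $P(x,f(x))\equiv0$; for $\varphi(\xi,\overline\eta)$ and its exponential this is meant in the variables $(\xi,\overline\eta)$. $(M_1,\omega_{M_1})$ and $(M_2,\omega_{M_2})$ share a common complex submanifold if a complex submanifold of $M_1$ endowed with the induced metric (the restriction of $\omega_{M_1}$) is biholomorphically isometric to a complex submanifold of $M_2$ endowed with the induced metric (the restriction of $\omega_{M_2}$).
   Formalization: A common complex submanifold is required to have an induced form that is not identically zero; otherwise the claim fails, since points are always shared, and C with the zero form is isometric to the null curve [1:z:z] in the indefinite projective plane with κ=1. *)

theory Defs
  imports "HOL-Analysis.Analysis"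
begin

section \<open>Functions on complex coordinate spaces\<close>

text \<open>The space of complex \<open>n\<close>-tuples indexed by a finite set \<open>I\<close> with \<open>n\<close> elements; its points
  are the functions in \<open>PiE I (\<lambda>_. UNIV)\<close>. Working with index sets instead of index types lets the
  dimensions of the factors of a product vary.\<close>

definition cspace :: "'i set \<Rightarrow> ('i \<Rightarrow> complex) topology" where
  "cspace I = product_topology (\<lambda>_. euclidean) I"

text \<open>Holomorphy in several variables: continuity and holomorphy in each variable separately.\<close>

definition mholomorphic_on ::
  "'i set \<Rightarrow> ('i \<Rightarrow> complex) set \<Rightarrow> (('i \<Rightarrow> complex) \<Rightarrow> complex) \<Rightarrow> bool" where
  "mholomorphic_on I U f \<longleftrightarrow>
     openin (cspace I) U \<and>
     continuous_map (subtopology (cspace I) U) euclidean f \<and>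
     (\<forall>x\<in>U. \<forall>i\<in>I. (\<lambda>w. f (x(i := w))) field_differentiable (at (x i)))"

text \<open>Real analyticity, as expansion into unconditionally convergent power series in the real and
  imaginary parts of the coordinates; \<open>\<mu>\<close> and \<open>\<nu>\<close> range over all multi-indices on \<open>I\<close>.\<close>

definition mreal_analytic_on ::
  "'i set \<Rightarrow> ('i \<Rightarrow> complex) set \<Rightarrow> (('i \<Rightarrow> complex) \<Rightarrow> complex) \<Rightarrow> bool" where
  "mreal_analytic_on I U f \<longleftrightarrow>
     (\<forall>a\<in>U. \<exists>T (c :: ('i \<Rightarrow> nat) \<Rightarrow> ('i \<Rightarrow> nat) \<Rightarrow> complex).
        openin (cspace I) T \<and> a \<in> T \<and>
        (\<forall>x\<in>T.
          ((\<lambda>(\<mu>, \<nu>). c \<mu> \<nu> *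
               (\<Prod>i\<in>I. of_real (Re (x i - a i)) ^ \<mu> i * of_real (Im (x i - a i)) ^ \<nu> i))
            has_sum f x)
          ((I \<rightarrow>\<^sub>E UNIV) \<times> (I \<rightarrow>\<^sub>E UNIV))))"

text \<open>The derivative of \<open>f\<close> at \<open>x\<close> in the real direction \<open>u\<close> of the \<open>i\<close>-th coordinate plane, and the
  Wirtinger derivatives with respect to the \<open>i\<close>-th coordinate and its conjugate.\<close>

definition pderiv_dir ::
  "(('i \<Rightarrow> complex) \<Rightarrow> complex) \<Rightarrow> 'i \<Rightarrow> complex \<Rightarrow> ('i \<Rightarrow> complex) \<Rightarrow> complex" where
  "pderiv_dir f i u x = vector_derivative (\<lambda>t. f (x(i := x i + of_real t * u))) (at 0)"

definition wirt :: "(('i \<Rightarrow> complex) \<Rightarrow> complex) \<Rightarrow> 'i \<Rightarrow> ('i \<Rightarrow> complex) \<Rightarrow> complex" where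
  "wirt f i x = (pderiv_dir f i 1 x - \<i> * pderiv_dir f i \<i> x) / 2"

definition wirt_bar :: "(('i \<Rightarrow> complex) \<Rightarrow> complex) \<Rightarrow> 'i \<Rightarrow> ('i \<Rightarrow> complex) \<Rightarrow> complex" where
  "wirt_bar f i x = (pderiv_dir f i 1 x + \<i> * pderiv_dir f i \<i> x) / 2"

definition levi :: "(('i \<Rightarrow> complex) \<Rightarrow> real) \<Rightarrow> ('i \<Rightarrow> complex) \<Rightarrow> 'i \<Rightarrow> 'i \<Rightarrow> complex" where
  "levi \<phi> x j k = wirt (wirt_bar (\<lambda>z. of_real (\<phi> z)) k) j x"

text \<open>The variables of the polarization \<open>\<Phi>(\<xi>, \<zeta>)\<close>, where \<open>\<zeta>\<close> stands for the conjugate of \<open>\<eta>\<close>, are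
  indexed by \<open>I <+> I\<close>: \<open>\<xi>\<close> on the left and \<open>\<zeta>\<close> on the right.\<close>

definition conj_vec :: "'i set \<Rightarrow> ('i \<Rightarrow> complex) \<Rightarrow> 'i \<Rightarrow> complex" where
  "conj_vec I \<xi> = (\<lambda>i\<in>I. cnj (\<xi> i))"

definition is_polarization ::
  "'i set \<Rightarrow> ('i \<Rightarrow> complex) set \<Rightarrow> (('i \<Rightarrow> complex) \<Rightarrow> real) \<Rightarrow>
   ('i + 'i \<Rightarrow> complex) set \<Rightarrow> (('i + 'i \<Rightarrow> complex) \<Rightarrow> complex) \<Rightarrow> bool" where
  "is_polarization I V \<phi> W \<Phi> \<longleftrightarrow>
     connectedin (cspace (I <+> I)) W \<and> mholomorphic_on (I <+> I) W \<Phi> \<and>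
     (\<forall>\<xi>\<in>V. case_sum \<xi> (conj_vec I \<xi>) \<in> W \<and>
            \<Phi> (case_sum \<xi> (conj_vec I \<xi>)) = of_real (\<phi> \<xi>))"

text \<open>The polynomial \<open>P(x, y)\<close> is given by its coefficients \<open>c (\<mu>, k)\<close> at the monomials
  \<open>x\<^sup>\<mu> y\<^sup>k\<close>, where the pairs \<open>(\<mu>, k)\<close> range over a finite set \<open>A\<close>.\<close>

definition nash_algebraic_on ::
  "'i set \<Rightarrow> ('i \<Rightarrow> complex) set \<Rightarrow> (('i \<Rightarrow> complex) \<Rightarrow> complex) \<Rightarrow> bool" where
  "nash_algebraic_on I W f \<longleftrightarrow>
     openin (cspace I) W \<and> connectedin (cspace I) W \<and> mholomorphic_on I W f \<and>
     (\<exists>A (c :: ('i \<Rightarrow> nat) \<times> nat \<Rightarrow> complex).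
        finite A \<and> A \<subseteq> (I \<rightarrow>\<^sub>E UNIV) \<times> UNIV \<and> (\<exists>\<alpha>\<in>A. c \<alpha> \<noteq> 0) \<and>
        (\<forall>x\<in>W. (\<Sum>(\<mu>, k)\<in>A. c (\<mu>, k) * (\<Prod>i\<in>I. x i ^ \<mu> i) * f x ^ k) = 0))"


section \<open>Complex manifolds and real (1,1)-forms\<close>

text \<open>A manifold is a topological space with an atlas, indexed by \<open>cm_index\<close>, of charts
  \<open>cm_chart M \<alpha>\<close> from \<open>cm_dom M \<alpha>\<close> into \<open>cspace (cm_coords M)\<close>. The atlas need not be maximal.\<close>

record ('a, 'i, 'c) cmanifold =
  cm_top :: "'a topology"
  cm_coords :: "'i set"
  cm_index :: "'c set"
  cm_dom :: "'c \<Rightarrow> 'a set"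
  cm_chart :: "'c \<Rightarrow> 'a \<Rightarrow> 'i \<Rightarrow> complex"

definition cm_image :: "('a, 'i, 'c) cmanifold \<Rightarrow> 'c \<Rightarrow> ('i \<Rightarrow> complex) set" where
  "cm_image M \<alpha> = cm_chart M \<alpha> ` cm_dom M \<alpha>"

definition loc_rep ::
  "('a, 'i, 'c) cmanifold \<Rightarrow> 'c \<Rightarrow> ('a \<Rightarrow> 'b) \<Rightarrow> ('b, 'j, 'd) cmanifold \<Rightarrow> 'd \<Rightarrow>
   ('i \<Rightarrow> complex) \<Rightarrow> 'j \<Rightarrow> complex" where
  "loc_rep M \<alpha> f N \<beta> x = cm_chart N \<beta> (f (inv_into (cm_dom M \<alpha>) (cm_chart M \<alpha>) x))"

definition jac ::
  "('a, 'i, 'c) cmanifold \<Rightarrow> 'c \<Rightarrow> ('a \<Rightarrow> 'b) \<Rightarrow> ('b, 'j, 'd) cmanifold \<Rightarrow> 'd \<Rightarrow>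
   ('i \<Rightarrow> complex) \<Rightarrow> 'j \<Rightarrow> 'i \<Rightarrow> complex" where
  "jac M \<alpha> f N \<beta> x a j = deriv (\<lambda>w. loc_rep M \<alpha> f N \<beta> (x(j := w)) a) (x j)"

definition holomorphic_map ::
  "('a, 'i, 'c) cmanifold \<Rightarrow> ('b, 'j, 'd) cmanifold \<Rightarrow> ('a \<Rightarrow> 'b) \<Rightarrow> bool" where
  "holomorphic_map M N f \<longleftrightarrow>
     continuous_map (cm_top M) (cm_top N) f \<and>
     (\<forall>\<alpha>\<in>cm_index M. \<forall>\<beta>\<in>cm_index N. \<forall>a\<in>cm_coords N.
        mholomorphic_on (cm_coords M)
          (cm_chart M \<alpha> ` {p \<in> cm_dom M \<alpha>. f p \<in> cm_dom N \<beta>})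
          (\<lambda>x. loc_rep M \<alpha> f N \<beta> x a))"

text \<open>The condition on \<open>id\<close> says that all coordinate changes are holomorphic.\<close>

definition complex_manifold :: "('a, 'i, 'c) cmanifold \<Rightarrow> bool" where
  "complex_manifold M \<longleftrightarrow>
     Hausdorff_space (cm_top M) \<and> second_countable (cm_top M) \<and> finite (cm_coords M) \<and>
     (\<Union>\<alpha>\<in>cm_index M. cm_dom M \<alpha>) = topspace (cm_top M) \<and>
     (\<forall>\<alpha>\<in>cm_index M.
        openin (cm_top M) (cm_dom M \<alpha>) \<and>
        openin (cspace (cm_coords M)) (cm_image M \<alpha>) \<and>
        homeomorphic_map (subtopology (cm_top M) (cm_dom M \<alpha>))
          (subtopology (cspace (cm_coords M)) (cm_image M \<alpha>)) (cm_chart M \<alpha>)) \<and>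
     holomorphic_map M M id"

text \<open>A (1,1)-form \<open>\<omega>\<close> is given by its coefficients in all charts: \<open>\<omega> \<alpha> x j k\<close> is the coefficient of
  \<open>\<i> dz\<^sub>j \<and> d(cnj z\<^sub>k)\<close> at the point with coordinates \<open>x\<close> in the chart \<open>\<alpha>\<close>.\<close>

type_synonym ('i, 'c) form11 = "'c \<Rightarrow> ('i \<Rightarrow> complex) \<Rightarrow> 'i \<Rightarrow> 'i \<Rightarrow> complex"

definition is_pullback ::
  "('a, 'i, 'c) cmanifold \<Rightarrow> ('a \<Rightarrow> 'b) \<Rightarrow> ('b, 'j, 'd) cmanifold \<Rightarrow>
   ('i, 'c) form11 \<Rightarrow> ('j, 'd) form11 \<Rightarrow> bool" where
  "is_pullback M f N \<theta> \<omega> \<longleftrightarrow>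
     (\<forall>\<alpha>\<in>cm_index M. \<forall>\<beta>\<in>cm_index N. \<forall>p\<in>cm_dom M \<alpha>. f p \<in> cm_dom N \<beta> \<longrightarrow>
        (\<forall>j\<in>cm_coords M. \<forall>k\<in>cm_coords M.
           \<theta> \<alpha> (cm_chart M \<alpha> p) j k =
             (\<Sum>a\<in>cm_coords N. \<Sum>b\<in>cm_coords N.
                \<omega> \<beta> (cm_chart N \<beta> (f p)) a b *
                jac M \<alpha> f N \<beta> (cm_chart M \<alpha> p) a j *
                cnj (jac M \<alpha> f N \<beta> (cm_chart M \<alpha> p) b k))))"

text \<open>The first condition is the transformation law under coordinate changes. The form is real iff its
  coefficient matrices are Hermitian. The two conditions on derivatives say that the (2,1)- and
  (1,2)-parts of \<open>d\<omega>\<close> vanish.\<close>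

definition closed_real_analytic_form11 ::
  "('a, 'i, 'c) cmanifold \<Rightarrow> ('i, 'c) form11 \<Rightarrow> bool" where
  "closed_real_analytic_form11 M \<omega> \<longleftrightarrow>
     is_pullback M id M \<omega> \<omega> \<and>
     (\<forall>\<alpha>\<in>cm_index M. \<forall>j\<in>cm_coords M. \<forall>k\<in>cm_coords M.
        mreal_analytic_on (cm_coords M) (cm_image M \<alpha>) (\<lambda>x. \<omega> \<alpha> x j k) \<and>
        (\<forall>x\<in>cm_image M \<alpha>.
           \<omega> \<alpha> x k j = cnj (\<omega> \<alpha> x j k) \<and>
           (\<forall>l\<in>cm_coords M.
              wirt (\<lambda>y. \<omega> \<alpha> y j k) l x = wirt (\<lambda>y. \<omega> \<alpha> y l k) j x \<and>
              wirt_bar (\<lambda>y. \<omega> \<alpha> y j k) l x = wirt_bar (\<lambda>y. \<omega> \<alpha> y j l) k x)))"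

text \<open>\<open>\<phi>\<close>, defined on the neighbourhood \<open>V\<close> of \<open>p\<close> in the coordinates of the chart \<open>\<alpha>\<close>, is a local
  potential of \<open>\<omega>\<close>, and \<open>\<Phi>\<close>, defined on \<open>W\<close>, is its polarization.\<close>

definition local_potential ::
  "('a, 'i, 'c) cmanifold \<Rightarrow> ('i, 'c) form11 \<Rightarrow> 'a \<Rightarrow> 'c \<Rightarrow> ('i \<Rightarrow> complex) set \<Rightarrow>
   (('i \<Rightarrow> complex) \<Rightarrow> real) \<Rightarrow> ('i + 'i \<Rightarrow> complex) set \<Rightarrow> (('i + 'i \<Rightarrow> complex) \<Rightarrow> complex) \<Rightarrow>
   bool" where
  "local_potential M \<omega> p \<alpha> V \<phi> W \<Phi> \<longleftrightarrow>
     \<alpha> \<in> cm_index M \<and> p \<in> cm_dom M \<alpha> \<and>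
     openin (cspace (cm_coords M)) V \<and> V \<subseteq> cm_image M \<alpha> \<and> cm_chart M \<alpha> p \<in> V \<and>
     is_polarization (cm_coords M) V \<phi> W \<Phi> \<and>
     (\<forall>\<xi>\<in>V. \<forall>j\<in>cm_coords M. \<forall>k\<in>cm_coords M. \<omega> \<alpha> \<xi> j k = 4 * levi \<phi> \<xi> j k)"


section \<open>Common complex submanifolds\<close>

text \<open>An (immersed) complex submanifold of \<open>M\<close> is a complex manifold whose point set is contained in
  \<open>M\<close> and whose inclusion is a holomorphic immersion. Embedded submanifolds are the special case in
  which the topology is the subspace topology.\<close>

definition complex_submanifold ::
  "('a, 'i, 'c) cmanifold \<Rightarrow> ('a, 'j, 'd) cmanifold \<Rightarrow> bool" where
  "complex_submanifold S M \<longleftrightarrow>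
     complex_manifold S \<and> topspace (cm_top S) \<subseteq> topspace (cm_top M) \<and>
     holomorphic_map S M id \<and>
     (\<forall>\<alpha>\<in>cm_index S. \<forall>\<beta>\<in>cm_index M. \<forall>p\<in>cm_dom S \<alpha> \<inter> cm_dom M \<beta>. \<forall>v.
        (\<forall>a\<in>cm_coords M. (\<Sum>j\<in>cm_coords S. jac S \<alpha> id M \<beta> (cm_chart S \<alpha> p) a j * v j) = 0)
        \<longrightarrow> (\<forall>j\<in>cm_coords S. v j = 0))"

definition biholomorphism ::
  "('a, 'i, 'c) cmanifold \<Rightarrow> ('b, 'j, 'd) cmanifold \<Rightarrow> ('a \<Rightarrow> 'b) \<Rightarrow> bool" where
  "biholomorphism S T F \<longleftrightarrow>
     holomorphic_map S T F \<and>
     (\<exists>G. holomorphic_map T S G \<and>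
          (\<forall>p\<in>topspace (cm_top S). G (F p) = p) \<and> (\<forall>q\<in>topspace (cm_top T). F (G q) = q))"

text \<open>The atlas of a submanifold of \<open>M\<close> can be indexed by points of \<open>M\<close>, since one chart about each
  point suffices.

  The induced form has to be a metric in the weak sense that it does not vanish identically. Some such
  condition is implicit in the notion: every (1,1)-form vanishes on a point, and indefinite space forms
  have null curves. For example, the form of the indefinite projective plane with \<open>\<kappa> = 1\<close> vanishes on
  the curve of points \<open>[1 : z : z]\<close>. Nondegeneracy of the induced form on a submanifold that is
  nonempty and of positive dimension implies the condition used here.\<close>

definition share_common_submanifold ::
  "('a, 'i, 'c) cmanifold \<Rightarrow> ('i, 'c) form11 \<Rightarrow> ('b, 'j, 'd) cmanifold \<Rightarrow> ('j, 'd) form11 \<Rightarrow> bool"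
  where
  "share_common_submanifold M\<^sub>1 \<omega>\<^sub>1 M\<^sub>2 \<omega>\<^sub>2 \<longleftrightarrow>
     (\<exists>(S\<^sub>1 :: ('a, nat, 'a) cmanifold) \<theta>\<^sub>1 (S\<^sub>2 :: ('b, nat, 'b) cmanifold) \<theta>\<^sub>2 F.
        complex_submanifold S\<^sub>1 M\<^sub>1 \<and> is_pullback S\<^sub>1 id M\<^sub>1 \<theta>\<^sub>1 \<omega>\<^sub>1 \<and>
        complex_submanifold S\<^sub>2 M\<^sub>2 \<and> is_pullback S\<^sub>2 id M\<^sub>2 \<theta>\<^sub>2 \<omega>\<^sub>2 \<and>
        biholomorphism S\<^sub>1 S\<^sub>2 F \<and> is_pullback S\<^sub>1 F S\<^sub>2 \<theta>\<^sub>1 \<theta>\<^sub>2 \<and>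
        (\<exists>\<alpha>\<in>cm_index S\<^sub>1. \<exists>x\<in>cm_image S\<^sub>1 \<alpha>. \<exists>j\<in>cm_coords S\<^sub>1. \<exists>k\<in>cm_coords S\<^sub>1.
           \<theta>\<^sub>1 \<alpha> x j k \<noteq> 0))"


section \<open>Indefinite complex space forms\<close>

text \<open>The coordinates \<open>z\<^sub>1, \<dots>, z\<^sub>N\<close> are numbered from \<open>0\<close> to \<open>N - 1\<close>.\<close>

definition euclid :: "nat \<Rightarrow> (nat \<Rightarrow> complex, nat, unit) cmanifold" where
  "euclid N = \<lparr>cm_top = cspace {..<N}, cm_coords = {..<N}, cm_index = {()},
     cm_dom = (\<lambda>_. topspace (cspace {..<N})), cm_chart = (\<lambda>_ z. z)\<rparr>"

definition euclid_form :: "nat \<Rightarrow> nat \<Rightarrow> (nat, unit) form11" where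
  "euclid_form N \<kappa> _ x j k =
     4 * levi (\<lambda>z. (\<Sum>i\<in>{\<kappa>..<N}. (cmod (z i))\<^sup>2) - (\<Sum>i\<in>{..<\<kappa>}. (cmod (z i))\<^sup>2)) x j k"

definition hquad :: "nat \<Rightarrow> nat \<Rightarrow> (nat \<Rightarrow> complex) \<Rightarrow> real" where
  "hquad N \<kappa> \<xi> = (\<Sum>i\<in>{..N - \<kappa>}. (cmod (\<xi> i))\<^sup>2) - (\<Sum>j\<in>{..<\<kappa>}. (cmod (\<xi> (N - j)))\<^sup>2)"

definition hcone :: "nat \<Rightarrow> nat \<Rightarrow> (nat \<Rightarrow> complex) set" where
  "hcone N \<kappa> = {\<xi> \<in> {..N} \<rightarrow>\<^sub>E UNIV. hquad N \<kappa> \<xi> > 0}"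

text \<open>The point of projective space with homogeneous coordinates \<open>\<xi>\<close>.\<close>

definition hclass :: "nat \<Rightarrow> (nat \<Rightarrow> complex) \<Rightarrow> (nat \<Rightarrow> complex) set" where
  "hclass N \<xi> = {\<lambda>k\<in>{..N}. t * \<xi> k | t. t \<noteq> 0}"

definition proj_top :: "nat \<Rightarrow> nat \<Rightarrow> (nat \<Rightarrow> complex) set topology" where
  "proj_top N \<kappa> = topology (\<lambda>U. U \<subseteq> hclass N ` hcone N \<kappa> \<and>
     openin (cspace {..N}) {\<xi> \<in> hcone N \<kappa>. hclass N \<xi> \<in> U})"

text \<open>The homogeneous coordinates, normalised by \<open>\<xi>\<^sub>i = 1\<close>, of the point with affine coordinates
  \<open>z\<close>.\<close>

definition hlift :: "nat \<Rightarrow> nat \<Rightarrow> (nat \<Rightarrow> complex) \<Rightarrow> nat \<Rightarrow> complex" where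
  "hlift N i z = (\<lambda>k\<in>{..N}. if k < i then z k else if k = i then 1 else z (k - 1))"

definition affine_part :: "nat \<Rightarrow> nat \<Rightarrow> nat \<Rightarrow> (nat \<Rightarrow> complex) set" where
  "affine_part N \<kappa> i = {z \<in> {..<N} \<rightarrow>\<^sub>E UNIV. hlift N i z \<in> hcone N \<kappa>}"

definition cp :: "nat \<Rightarrow> nat \<Rightarrow> ((nat \<Rightarrow> complex) set, nat, nat) cmanifold" where
  "cp N \<kappa> = \<lparr>cm_top = proj_top N \<kappa>, cm_coords = {..<N}, cm_index = {..N},
     cm_dom = (\<lambda>i. (\<lambda>z. hclass N (hlift N i z)) ` affine_part N \<kappa> i),
     cm_chart = (\<lambda>i. inv_into (affine_part N \<kappa> i) (\<lambda>z. hclass N (hlift N i z)))\<rparr>"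

text \<open>In an affine chart, the form on homogeneous coordinates is pulled back along the holomorphic
  section \<open>hlift\<close>.\<close>

definition cp_form :: "nat \<Rightarrow> nat \<Rightarrow> real \<Rightarrow> (nat, nat) form11" where
  "cp_form N \<kappa> b i x j k =
     of_real (4 / b) * levi (\<lambda>z. ln (hquad N \<kappa> (hlift N i z))) x j k"

definition ch :: "nat \<Rightarrow> nat \<Rightarrow> ((nat \<Rightarrow> complex) set, nat, nat) cmanifold" where
  "ch N \<kappa> = cp N (N - \<kappa>)"

definition ch_form :: "nat \<Rightarrow> nat \<Rightarrow> real \<Rightarrow> (nat, nat) form11" where
  "ch_form N \<kappa> b i x j k =
     of_real (- (4 / (- b))) * levi (\<lambda>z. ln (hquad N (N - \<kappa>) (hlift N i z))) x j k"

lemma openin_proj_top: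
  "openin (proj_top N \<kappa>) U \<longleftrightarrow>
     U \<subseteq> hclass N ` hcone N \<kappa> \<and> openin (cspace {..N}) {\<xi> \<in> hcone N \<kappa>. hclass N \<xi> \<in> U}"
proof -
  let ?P = "\<lambda>U. U \<subseteq> hclass N ` hcone N \<kappa> \<and>
    openin (cspace {..N}) {\<xi> \<in> hcone N \<kappa>. hclass N \<xi> \<in> U}"
  have "?P (U \<inter> V)" if "?P U" "?P V" for U V
  proof -
    have "{\<xi> \<in> hcone N \<kappa>. hclass N \<xi> \<in> U \<inter> V} =
        {\<xi> \<in> hcone N \<kappa>. hclass N \<xi> \<in> U} \<inter> {\<xi> \<in> hcone N \<kappa>. hclass N \<xi> \<in> V}"
      by auto
    with that show ?thesis by (auto intro: openin_Int)
  qed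
  moreover have "?P (\<Union>\<K>)" if "\<forall>K\<in>\<K>. ?P K" for \<K>
  proof -
    have "{\<xi> \<in> hcone N \<kappa>. hclass N \<xi> \<in> \<Union>\<K>} = (\<Union>K\<in>\<K>. {\<xi> \<in> hcone N \<kappa>. hclass N \<xi> \<in> K})"
      by auto
    moreover have "openin (cspace {..N}) (\<Union>K\<in>\<K>. {\<xi> \<in> hcone N \<kappa>. hclass N \<xi> \<in> K})"
      using that by (intro openin_Union) auto
    ultimately show ?thesis using that by auto
  qed
  ultimately have "istopology ?P"
    unfolding istopology_def by blast
  then show ?thesis
    by (simp add: proj_top_def topology_inverse')
qed


section \<open>Products\<close>

definition prod_cm ::
  "nat \<Rightarrow> (nat \<Rightarrow> ('a, 'i, 'c) cmanifold) \<Rightarrow> (nat \<Rightarrow> 'a, nat \<times> 'i, nat \<Rightarrow> 'c) cmanifold" where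
  "prod_cm m N = \<lparr>cm_top = product_topology (\<lambda>j. cm_top (N j)) {..<m},
     cm_coords = (SIGMA j:{..<m}. cm_coords (N j)),
     cm_index = (\<Pi>\<^sub>E j\<in>{..<m}. cm_index (N j)),
     cm_dom = (\<lambda>\<gamma>. \<Pi>\<^sub>E j\<in>{..<m}. cm_dom (N j) (\<gamma> j)),
     cm_chart = (\<lambda>\<gamma> p. \<lambda>(j, i)\<in>(SIGMA j:{..<m}. cm_coords (N j)). cm_chart (N j) (\<gamma> j) (p j) i)\<rparr>"

text \<open>The sum of the pullbacks of the forms \<open>c j * \<omega> j\<close> under the projections has a block diagonal
  coefficient matrix.\<close>

definition prod_form ::
  "nat \<Rightarrow> (nat \<Rightarrow> ('a, 'i, 'c) cmanifold) \<Rightarrow> (nat \<Rightarrow> real) \<Rightarrow> (nat \<Rightarrow> ('i, 'c) form11) \<Rightarrow>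
   (nat \<times> 'i, nat \<Rightarrow> 'c) form11" where
  "prod_form m N c \<omega> \<gamma> x = (\<lambda>(j, a) (k, b).
     if j = k then of_real (c j) * \<omega> j (\<gamma> j) (\<lambda>i\<in>cm_coords (N j). x (j, i)) a b else 0)"

end

theory Submission
  imports Defs "Jordan_Normal_Form.Char_Poly" "HOL-Computational_Algebra.Computational_Algebra"
    "HOL-Complex_Analysis.Complex_Analysis" "HOL-Real_Asymp.Real_Asymp"
begin

text \<open>Two forms that agree on a common submanifold already agree on a holomorphic curve in it, so
  everything can be restricted to a disc with coordinate \<open>z\<close>. The form induced on the submanifold is
  nonzero at some point, hence nonzero on some tangent vector there, and a line in the direction of
  this vector in local coordinates is mapped to curves in both manifolds along which the forms pull
  back to the same multiple of \<open>\<i> dz \<and> d(cnj z)\<close>, nonzero at \<open>z = 0\<close> (\<open>common_curve\<close>). If a form is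
  given by a potential, this multiple is the mixed derivative of the potential along the curve.
  Polarization, that is, replacing \<open>cnj z\<close> by an independent variable \<open>w\<close>, turns the potential of
  \<open>M\<^sub>1\<close> into a holomorphic function \<open>A(z, w)\<close> near the origin of \<open>\<complex>\<^sup>2\<close>, and equality on the totally
  real plane \<open>w = cnj z\<close> extends to a neighbourhood (\<open>antidiagonal_zero\<close>). In the projective and
  hyperbolic case, the result is
  \<open>\<partial>\<^sub>z \<partial>\<^sub>w A = \<Sum>\<^sub>j (c\<^sub>j / b\<^sub>j) \<partial>\<^sub>z \<partial>\<^sub>w log H\<^sub>j\<close>, where \<open>H\<^sub>j(z, w)\<close> is a Hermitian form in functions of
  \<open>z\<close> on one side and functions of \<open>w\<close> on the other; in the Euclidean case, it is
  \<open>\<partial>\<^sub>z \<partial>\<^sub>w A = \<partial>\<^sub>z \<partial>\<^sub>w B\<close>, where \<open>B\<close> itself is such a form. The theorem follows once these identities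
  are seen to force \<open>\<partial>\<^sub>z \<partial>\<^sub>w A = 0\<close> at the origin.

  Integration in \<open>z\<close> gives \<open>\<partial>\<^sub>w A = \<Sum>\<^sub>j (c\<^sub>j / b\<^sub>j) \<partial>\<^sub>w H\<^sub>j / H\<^sub>j + q(w)\<close> with an unknown function \<open>q\<close>,
  and respectively \<open>\<partial>\<^sub>w B = \<partial>\<^sub>w E / E + q(w)\<close> with \<open>E = exp A\<close>. All functions are now expanded in powers
  of \<open>w\<close> over the field \<open>K\<close> of Laurent series in \<open>z\<close>. Let \<open>L\<close> be the subfield of \<open>K((w))\<close> generated by
  \<open>K\<close> and by the series with constant coefficients. It contains the \<open>H\<^sub>j\<close> and \<open>B\<close>, and a Nash algebraic
  function of the coordinates of a polarized curve is algebraic over \<open>L\<close>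
  (\<open>nash_algebraic_pullback\<close>). So in both cases the equation has the shape
  \<open>\<partial>\<^sub>w U = \<Sum>\<^sub>j c\<^sub>j \<partial>\<^sub>w V\<^sub>j / V\<^sub>j + q\<close> with \<open>U\<close> and \<open>V\<^sub>j\<close> algebraic over \<open>L\<close>, and it suffices to show that
  the coefficient \<open>g\<close> of \<open>w\<close> in \<open>U\<close>, a function of \<open>z\<close>, is constant: its derivative at \<open>0\<close> is the mixed
  derivative in question.

  This is a statement about differential fields (\<open>log_derivative_coefficients\<close>). If \<open>g\<close> is not
  constant, then \<open>K\<close> has a derivation that vanishes on \<open>\<complex>\<close> and maps \<open>g\<close> to \<open>1\<close>, and for which \<open>K\<close> is
  algebraic over the field generated by \<open>g\<close> and its kernel (\<open>derivation_exists\<close>, by two applications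
  of Zorn's lemma). Applied to coefficients, it gives a derivation \<open>\<delta>\<close> of \<open>K((w))\<close> that commutes with
  \<open>\<partial>\<^sub>w\<close> and kills \<open>q\<close>. Therefore \<open>\<partial>\<^sub>w\<close> kills \<open>\<delta> U - \<Sum>\<^sub>j c\<^sub>j \<delta> V\<^sub>j / V\<^sub>j\<close>, and after a normalization of
  the constant terms, \<open>\<delta> U = \<Sum>\<^sub>j c\<^sub>j \<delta> V\<^sub>j / V\<^sub>j\<close>. Everything here is algebraic over the field
  generated by \<open>g\<close> and the kernel of \<open>\<delta>\<close>, which has transcendence degree one over the kernel. In this
  situation, a theorem in the style of Liouville and Rosenlicht (\<open>liouville_log_derivatives\<close>) says that
  the sum cannot be the derivative of an algebraic element unless it vanishes: otherwise \<open>U\<close> could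
  serve as the variable, with \<open>\<delta> U\<close> scaled to \<open>1\<close>, and taking traces down to the rational functions of
  \<open>U\<close> (\<open>trace_log_derivative\<close>) would express a positive integer by logarithmic derivatives of rational
  functions, in which numerators have smaller degree than denominators. But \<open>\<delta> U\<close> does not vanish, as
  its coefficient at \<open>w\<close> is \<open>1\<close>.\<close>

section \<open>Algebraic elements\<close>

definition is_subring :: "'a::comm_ring_1 set \<Rightarrow> bool" where
  "is_subring R \<longleftrightarrow> 0 \<in> R \<and> 1 \<in> R \<and>
     (\<forall>x\<in>R. - x \<in> R \<and> (\<forall>y\<in>R. x + y \<in> R \<and> x * y \<in> R))"

definition is_subfield :: "'a::field set \<Rightarrow> bool" where
  "is_subfield B \<longleftrightarrow> is_subring B \<and> (\<forall>x\<in>B. inverse x \<in> B)"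

context
  fixes R :: "'a::comm_ring_1 set"
  assumes R: "is_subring R"
begin

lemma subring_0: "0 \<in> R" and subring_1: "1 \<in> R"
  and subring_uminus: "x \<in> R \<Longrightarrow> - x \<in> R"
  and subring_add: "x \<in> R \<Longrightarrow> y \<in> R \<Longrightarrow> x + y \<in> R"
  and subring_mult: "x \<in> R \<Longrightarrow> y \<in> R \<Longrightarrow> x * y \<in> R"
  using R unfolding is_subring_def by blast+

lemma subring_diff: "x \<in> R \<Longrightarrow> y \<in> R \<Longrightarrow> x - y \<in> R"
  using subring_add[OF _ subring_uminus, of x y] by simp

lemma subring_sum: "(\<And>i. i \<in> I \<Longrightarrow> f i \<in> R) \<Longrightarrow> sum f I \<in> R"
  by (induction I rule: infinite_finite_induct) (auto intro: subring_0 subring_add)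

lemma subring_prod: "(\<And>i. i \<in> I \<Longrightarrow> f i \<in> R) \<Longrightarrow> prod f I \<in> R"
  by (induction I rule: infinite_finite_induct) (auto intro: subring_1 subring_mult)

lemma subring_power: "x \<in> R \<Longrightarrow> x ^ n \<in> R"
  by (induction n) (auto intro: subring_1 subring_mult)

lemma subring_of_nat: "of_nat n \<in> R"
  by (induction n) (auto intro: subring_0 subring_1 subring_add)

end

lemma subfield_subring: "is_subfield B \<Longrightarrow> is_subring B"
  by (simp add: is_subfield_def)

lemma subfield_divide: "is_subfield B \<Longrightarrow> x \<in> B \<Longrightarrow> y \<in> B \<Longrightarrow> x / y \<in> B"
  by (metis divide_inverse is_subfield_def subring_mult)

definition Polys :: "'a::comm_ring_1 set \<Rightarrow> 'a poly set" where
  "Polys R = {p. \<forall>i. coeff p i \<in> R}"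

lemma coeff_Polys: "p \<in> Polys R \<Longrightarrow> coeff p i \<in> R"
  by (simp add: Polys_def)

lemma Polys_pCons: "is_subring R \<Longrightarrow> pCons a p \<in> Polys R \<longleftrightarrow> a \<in> R \<and> p \<in> Polys R"
  unfolding Polys_def
  by (auto simp: coeff_pCons split: nat.splits)

lemma Polys_0: "is_subring R \<Longrightarrow> 0 \<in> Polys R"
  by (simp add: Polys_def subring_0)

lemma Polys_mono: "R \<subseteq> S \<Longrightarrow> Polys R \<subseteq> Polys S"
  by (auto simp: Polys_def)

lemma subring_Polys:
  assumes "is_subring R" shows "is_subring (Polys R)"
  using assms unfolding is_subring_def[of "Polys R"]
  by (auto simp: Polys_def coeff_mult coeff_1 subring_0 subring_1 split: nat.splits
      intro!: subring_sum subring_mult subring_add subring_uminus)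

lemma Polys_monom: "is_subring R \<Longrightarrow> a \<in> R \<Longrightarrow> monom a n \<in> Polys R"
  by (auto simp: Polys_def coeff_monom subring_0)

lemma Polys_smult: "is_subring R \<Longrightarrow> a \<in> R \<Longrightarrow> p \<in> Polys R \<Longrightarrow> Polynomial.smult a p \<in> Polys R"
  by (auto simp: Polys_def intro: subring_mult)

lemma Polys_pderiv: "is_subring R \<Longrightarrow> p \<in> Polys R \<Longrightarrow> pderiv p \<in> Polys R"
  by (auto simp: Polys_def coeff_pderiv simp del: of_nat_Suc intro!: subring_mult subring_of_nat)

lemma poly_in_subring:
  assumes "is_subring R" "p \<in> Polys R" "x \<in> R" shows "poly p x \<in> R"
  using assms by (auto simp: poly_altdef intro!: subring_sum subring_mult subring_power coeff_Polys)

lemma det_in_subring: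
  assumes R: "is_subring R" and A: "A \<in> carrier_mat n n"
    and entries: "\<And>i j. i < n \<Longrightarrow> j < n \<Longrightarrow> A $$ (i, j) \<in> R"
  shows "det A \<in> R"
  unfolding det_def'[OF A]
proof (intro subring_sum[OF R] subring_mult[OF R] subring_prod[OF R])
  fix p assume "p \<in> {p. p permutes {0..<n}}"
  then have p: "p permutes {0..<n}" by simp
  show "signof p \<in> R"
    using subring_1[OF R] subring_uminus[OF R] by (auto simp: sign_def)
  fix i assume "i \<in> {0..<n}"
  then show "A $$ (i, p i) \<in> R"
    using p by (intro entries) (use permutes_in_image[OF p, of i] in auto)
qed

definition alg :: "'a::field set \<Rightarrow> 'a \<Rightarrow> bool" where
  "alg R x \<longleftrightarrow> (\<exists>p\<in>Polys R. p \<noteq> 0 \<and> poly p x = 0)"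

lemma alg_mono: "R \<subseteq> S \<Longrightarrow> alg R x \<Longrightarrow> alg S x"
  using Polys_mono unfolding alg_def by blast

lemma alg_base:
  assumes "is_subring R" "x \<in> R" shows "alg R x"
  unfolding alg_def using assms
  by (intro bexI[of _ "[:- x, 1:]"]) (auto simp: Polys_pCons Polys_0 subring_1 subring_uminus)

inductive_set lspan :: "'a::field set \<Rightarrow> 'a set \<Rightarrow> 'a set" for B S where
  lspan_0: "0 \<in> lspan B S"
| lspan_step: "b \<in> B \<Longrightarrow> s \<in> S \<Longrightarrow> y \<in> lspan B S \<Longrightarrow> b * s + y \<in> lspan B S"

lemma lspan_add: "x \<in> lspan B S \<Longrightarrow> y \<in> lspan B S \<Longrightarrow> x + y \<in> lspan B S"
  by (induction x rule: lspan.induct) (auto simp: add.assoc intro: lspan.intros)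

lemma lspan_base: "is_subring B \<Longrightarrow> s \<in> S \<Longrightarrow> s \<in> lspan B S"
  using lspan_step[OF subring_1 _ lspan_0, of B s S] by simp

lemma lspan_mono: "S \<subseteq> T \<Longrightarrow> lspan B S \<subseteq> lspan B T"
proof
  fix x assume "S \<subseteq> T" "x \<in> lspan B S"
  from this(2) this(1) show "x \<in> lspan B T"
    by (induction rule: lspan.induct) (auto intro: lspan.intros)
qed

lemma lspan_smult:
  assumes "is_subring B" "b \<in> B" "x \<in> lspan B S"
  shows "b * x \<in> lspan B S"
  using assms(3,1,2)
proof (induction x rule: lspan.induct)
  case (lspan_step c s y)
  then show ?case
    using lspan.lspan_step[of "b * c" B s S "b * y"]
    by (auto simp: algebra_simps subring_mult)
qed (simp add: lspan_0)

lemma lspan_least: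
  assumes "is_subring B" "S \<subseteq> M" "0 \<in> M" "\<And>x y. x \<in> M \<Longrightarrow> y \<in> M \<Longrightarrow> x + y \<in> M"
    "\<And>b x. b \<in> B \<Longrightarrow> x \<in> M \<Longrightarrow> b * x \<in> M"
  shows "lspan B S \<subseteq> M"
proof
  fix x assume "x \<in> lspan B S"
  then show "x \<in> M" using assms by (induction rule: lspan.induct) auto
qed

lemma lspan_sum: "(\<And>i. i \<in> I \<Longrightarrow> f i \<in> lspan B S) \<Longrightarrow> sum f I \<in> lspan B S"
  by (induction I rule: infinite_finite_induct) (auto intro: lspan_0 lspan_add)

lemma lspan_finite:
  assumes B: "is_subring B" and "finite S" "x \<in> lspan B S"
  shows "\<exists>b. (\<forall>s. b s \<in> B) \<and> x = (\<Sum>s\<in>S. b s * s)"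
  using assms(3)
proof (induction rule: lspan.induct)
  case lspan_0
  then show ?case using subring_0[OF B] by (intro exI[of _ "\<lambda>_. 0"]) auto
next
  case (lspan_step c s y)
  then obtain b where b: "\<And>s. b s \<in> B" "y = (\<Sum>s\<in>S. b s * s)" by blast
  have "c * s + y = (\<Sum>t\<in>S. (if t = s then c else 0) * t) + (\<Sum>s\<in>S. b s * s)"
    using lspan_step(2) \<open>finite S\<close> b by (simp add: if_distrib[of "\<lambda>x. x * _"] cong: if_cong)
  also have "\<dots> = (\<Sum>t\<in>S. (b(s := b s + c)) t * t)"
    by (simp flip: sum.distrib add: if_distrib[of "\<lambda>x. x * _"] distrib_right cong: if_cong)
       (auto intro!: sum.cong simp: algebra_simps)
  finally show ?case
    using b lspan_step(1) by (intro exI[of _ "b(s := b s + c)"]) (auto intro: subring_add[OF B])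
qed

text \<open>A ring between \<open>B\<close> and the ambient field that has finite dimension over \<open>B\<close>. Over a subfield
  \<open>B\<close> such a ring is itself a field; it plays the role of a finite extension, and the use of subsets
  of one field avoids embeddings between different types.\<close>

definition fdalg :: "'a::field set \<Rightarrow> 'a set \<Rightarrow> bool" where
  "fdalg B M \<longleftrightarrow> is_subring M \<and> B \<subseteq> M \<and> (\<exists>S. finite S \<and> M = lspan B S)"

lemma fdalg_refl: "is_subfield B \<Longrightarrow> fdalg B B"
  unfolding fdalg_def
proof (intro conjI exI[of _ "{1}"])
  assume B: "is_subfield B"
  note R = subfield_subring[OF B]
  show "B = lspan B {1}"
  proof
    show "B \<subseteq> lspan B {1}"
      using lspan_step[of _ B 1 "{1}" 0] by (auto intro: lspan_0)
    show "lspan B {1} \<subseteq> B"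
      by (rule lspan_least) (auto simp: R subring_1 subring_0 subring_add subring_mult)
  qed
qed (auto simp: subfield_subring)

text \<open>Multiplication by \<open>x\<close> is given, on finitely many generators, by a matrix over \<open>B\<close>. The vector
  of the generators is an eigenvector for the eigenvalue \<open>x\<close>, so \<open>x\<close> is a root of the characteristic
  polynomial.\<close>

lemma fdalg_algebraic:
  assumes B: "is_subfield B" and M: "fdalg B M" and x: "x \<in> M"
  shows "alg B x"
proof -
  note RB = subfield_subring[OF B]
  from M obtain S where RM: "is_subring M" and S: "finite S" "M = lspan B S"
    by (auto simp: fdalg_def)
  define n where "n = card S"
  obtain e where e: "bij_betw e {..<n} S"
    using ex_bij_betw_nat_finite[OF S(1)] unfolding atLeast0LessThan n_def by blast
  have "\<exists>b. (\<forall>s. b s \<in> B) \<and> x * e i = (\<Sum>s\<in>S. b s * s)" if "i < n" for i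
  proof (rule lspan_finite[OF RB S(1)])
    have "e i \<in> S" using e that by (auto simp: bij_betw_def)
    then show "x * e i \<in> lspan B S"
      using S(2) RM x lspan_base[OF RB] by (auto intro: subring_mult)
  qed
  then obtain b where b: "\<And>i s. i < n \<Longrightarrow> b i s \<in> B"
    "\<And>i. i < n \<Longrightarrow> x * e i = (\<Sum>s\<in>S. b i s * s)" by metis
  have b': "x * e i = (\<Sum>j<n. b i (e j) * e j)" if "i < n" for i
    using b(2)[OF that] sum.reindex_bij_betw[OF e, of "\<lambda>s. b i s * s"] by simp
  define A where "A = mat n n (\<lambda>(i, j). b i (e j))"
  have A: "A \<in> carrier_mat n n" by (simp add: A_def)
  \<comment> \<open>An eigenvector has to be nonzero.\<close>
  have ex: "\<exists>i<n. e i \<noteq> 0"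
  proof (rule ccontr)
    assume "\<not> ?thesis"
    then have "S \<subseteq> {0}" using e by (auto simp: bij_betw_def)
    then have "M \<subseteq> {0}"
      unfolding S(2) by (intro lspan_least[OF RB]) auto
    then show False using subring_1[OF RM] by auto
  qed
  have "eigenvalue A x"
    unfolding eigenvalue_def eigenvector_def
  proof (intro exI conjI)
    show "vec n e \<in> carrier_vec (dim_row A)" using A by simp
    show "vec n e \<noteq> 0\<^sub>v (dim_row A)" using ex A by (auto simp: vec_eq_iff)
    show "A *\<^sub>v vec n e = x \<cdot>\<^sub>v vec n e"
      by (auto simp: A_def vec_eq_iff scalar_prod_def b' atLeast0LessThan)
  qed
  then have root: "poly (char_poly A) x = 0" by (simp add: eigenvalue_root_char_poly[OF A])
  have "char_poly A \<in> Polys B"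
    unfolding char_poly_defs
  proof (rule det_in_subring[OF subring_Polys[OF RB]])
    show "[:0, 1:] \<cdot>\<^sub>m 1\<^sub>m (dim_row A) + map_mat (\<lambda>a. [:- a:]) A \<in> carrier_mat n n"
      using A by simp
    fix i j assume ij: "i < n" "j < n"
    have 0: "[:0, 1:] \<in> Polys B" by (auto simp: Polys_pCons RB Polys_0 subring_0 subring_1)
    have 1: "[:- b i (e j):] \<in> Polys B"
      using b(1) ij by (auto simp: Polys_pCons RB Polys_0 subring_0 subring_uminus)
    show "([:0, 1:] \<cdot>\<^sub>m 1\<^sub>m (dim_row A) + map_mat (\<lambda>a. [:- a:]) A) $$ (i, j) \<in> Polys B"
      using ij A 0 1 subring_add[OF subring_Polys[OF RB] 0 1] by (auto simp: A_def one_pCons)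
  qed
  moreover have "char_poly A \<noteq> 0"
    using degree_monic_char_poly[OF A] by auto
  ultimately show ?thesis using root unfolding alg_def by blast
qed

text \<open>A polynomial relation for \<open>x \<noteq> 0\<close> can be chosen with nonzero constant term; then it exhibits
  that constant as a multiple of \<open>x\<close>.\<close>

lemma fdalg_inverse:
  assumes B: "is_subfield B" and M: "fdalg B M" and x: "x \<in> M"
  shows "inverse x \<in> M"
proof (cases "x = 0")
  case False
  note RB = subfield_subring[OF B]
  have RM: "is_subring M" and BM: "B \<subseteq> M" using M by (auto simp: fdalg_def)
  obtain p where p: "p \<in> Polys B" "p \<noteq> 0" "poly p x = 0"
    using fdalg_algebraic[OF B M x] by (auto simp: alg_def)
  have "\<exists>q. q \<in> Polys B \<and> poly q x = 0 \<and> coeff q 0 \<noteq> 0"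
    using p
  proof (induction p)
    case (pCons a q)
    show ?case
    proof (cases "a = 0")
      case True
      then show ?thesis using pCons \<open>x \<noteq> 0\<close> by (auto simp: Polys_pCons[OF RB])
    next
      case False
      then show ?thesis using pCons by (intro exI[of _ "pCons a q"]) auto
    qed
  qed simp
  then obtain q where q: "q \<in> Polys B" "poly q x = 0" "coeff q 0 \<noteq> 0" by blast
  obtain a r where ar: "q = pCons a r" by (cases q)
  have a: "a \<noteq> 0" "a \<in> B" and r: "r \<in> Polys B" using q ar by (auto simp: Polys_pCons[OF RB])
  have "a = x * (- poly r x)" using q ar by (simp add: eq_neg_iff_add_eq_0)
  then have "inverse x = - poly r x * inverse a"
    using a \<open>x \<noteq> 0\<close> by (simp add: field_simps)
  moreover have "poly r x \<in> M"
    using r BM Polys_mono x by (intro poly_in_subring[OF RM]) blast+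
  moreover have "inverse a \<in> M" using a B BM by (auto simp: is_subfield_def)
  ultimately show ?thesis using RM by (auto intro: subring_mult subring_uminus)
qed (use M in \<open>auto simp: fdalg_def subring_0\<close>)

lemma fdalg_subfield: "is_subfield B \<Longrightarrow> fdalg B M \<Longrightarrow> is_subfield M"
  using fdalg_inverse by (auto simp: is_subfield_def fdalg_def)

text \<open>If \<open>x\<close> is a root of a polynomial of degree \<open>d\<close> over the field \<open>M\<close>, the powers of \<open>x\<close> below \<open>d\<close>
  already span the ring generated by \<open>M\<close> and \<open>x\<close>, because the relation expresses \<open>x ^ d\<close> by them.\<close>

lemma fdalg_adjoin:
  assumes B: "is_subfield B" and M: "fdalg B M" and x: "alg M x"
  shows "\<exists>M'. fdalg B M' \<and> M \<subseteq> M' \<and> x \<in> M'"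
proof -
  note RB = subfield_subring[OF B]
  from M obtain S where RM: "is_subring M" and S: "finite S" "M = lspan B S" and BM: "B \<subseteq> M"
    by (auto simp: fdalg_def)
  obtain p where p: "p \<in> Polys M" "p \<noteq> 0" "poly p x = 0"
    using x by (auto simp: alg_def)
  define d where "d = degree p"
  define T where "T = (\<lambda>(s, j). s * x ^ j) ` (S \<times> {..<d})"
  define M' where "M' = lspan B T"
  have MT: "m * x ^ j \<in> M'" if "m \<in> M" "j < d" for m j
    using that(1) unfolding S(2)
  proof (induction rule: lspan.induct)
    case (lspan_step b s y)
    have "s * x ^ j \<in> T" using lspan_step that by (auto simp: T_def)
    then have "b * (s * x ^ j) + y * x ^ j \<in> M'"
      using lspan_step unfolding M'_def by (intro lspan.lspan_step) auto
    then show ?case by (simp add: algebra_simps)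
  qed (simp add: M'_def lspan_0)
  have inv: "inverse (coeff p d) \<in> M"
    using p by (auto intro!: fdalg_inverse[OF B M] coeff_Polys)
  have xd: "x ^ d = (\<Sum>i<d. (- inverse (coeff p d) * coeff p i) * x ^ i)"
  proof -
    have "0 = (\<Sum>i<d. coeff p i * x ^ i) + coeff p d * x ^ d"
      using p(3) unfolding poly_altdef d_def[symmetric] lessThan_Suc_atMost[symmetric] by simp
    then have "x ^ d = - inverse (coeff p d) * (\<Sum>i<d. coeff p i * x ^ i)"
      using p(2) unfolding d_def by (simp add: field_simps eq_neg_iff_add_eq_0)
    then show ?thesis by (simp only: sum_distrib_left mult.assoc)
  qed
  have pow: "m * x ^ j \<in> M'" if "m \<in> M" for m j
    using that
  proof (induction j arbitrary: m rule: less_induct)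
    case (less j)
    show ?case
    proof (cases "j < d")
      case False
      then have "m * x ^ j = m * x ^ (j - d) * x ^ d" by (simp flip: power_add)
      also have "\<dots> = (\<Sum>i<d. (m * (- inverse (coeff p d) * coeff p i)) * x ^ (j - d + i))"
        unfolding xd by (simp add: sum_distrib_left power_add mult_ac)
      also have "\<dots> \<in> M'"
        unfolding M'_def
      proof (intro lspan_sum, fold M'_def)
        fix i assume "i \<in> {..<d}"
        then show "(m * (- inverse (coeff p d) * coeff p i)) * x ^ (j - d + i) \<in> M'"
          using False less.prems inv p
          by (intro less.IH) (auto intro!: subring_mult[OF RM] subring_uminus[OF RM] coeff_Polys)
      qed
      finally show ?thesis .
    qed (use MT less in auto)
  qed
  have mem: "M \<subseteq> M'" using pow[of _ 0] by auto
  \<comment> \<open>Both factors are decomposed into generators \<open>s * x ^ j\<close>, one after the other.\<close>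
  have prod: "a * b \<in> M'" if a: "a \<in> M'" and b: "b \<in> M'" for a b
    using a unfolding M'_def
  proof (induction rule: lspan.induct)
    case (lspan_step c t y)
    then obtain s j where t: "t = s * x ^ j" "s \<in> S" by (auto simp: T_def)
    have "t * b \<in> M'" using b unfolding M'_def
    proof (induction rule: lspan.induct)
      case (lspan_step c t' y)
      then obtain s' j' where t': "t' = s' * x ^ j'" "s' \<in> S" by (auto simp: T_def)
      have "s * s' \<in> M" using t t' S(2) RM lspan_base[OF RB] by (auto intro: subring_mult)
      then have "s * s' * x ^ (j + j') \<in> M'" by (rule pow)
      then have "t * t' \<in> M'" using t t' by (simp add: power_add mult_ac)
      then have "c * (t * t') \<in> M'"
        using lspan_smult[OF RB lspan_step(1)] unfolding M'_def by blast
      then show ?case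
        using lspan_step lspan_add[of "c * (t * t')" B T "t * y"] unfolding M'_def
        by (simp add: algebra_simps)
    qed (simp add: lspan_0)
    then have "c * (t * b) \<in> M'" using lspan_smult[OF RB lspan_step(1)] unfolding M'_def by blast
    then show ?case
        using lspan_step lspan_add[of "c * (t * b)" B T "y * b"] unfolding M'_def
        by (simp add: algebra_simps)
  qed (simp add: lspan_0)
  have "is_subring M'"
    unfolding is_subring_def
  proof (intro conjI ballI)
    show "0 \<in> M'" "1 \<in> M'" using mem RM by (auto simp: subring_0 subring_1)
    fix a assume a: "a \<in> M'"
    then show "- a \<in> M'"
      using prod[OF _ a, of "- 1"] mem subring_uminus[OF RM subring_1[OF RM]] by auto
    fix b assume "b \<in> M'"
    then show "a + b \<in> M'" "a * b \<in> M'" using a prod by (auto simp: M'_def lspan_add)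
  qed
  then have "fdalg B M'"
    using mem BM S(1) unfolding fdalg_def
    by (auto intro!: exI[of _ T] simp: M'_def T_def)
  moreover have "x \<in> M'" using pow[of 1 1] subring_1[OF RM] by simp
  ultimately show ?thesis using mem by blast
qed

lemma fdalg_finite_set:
  assumes B: "is_subfield B" and "finite X" "\<And>x. x \<in> X \<Longrightarrow> alg B x"
  shows "\<exists>M. fdalg B M \<and> X \<subseteq> M"
  using assms(2,3)
proof (induction)
  case empty
  then show ?case using fdalg_refl[OF B] by auto
next
  case (insert x X)
  then obtain M where M: "fdalg B M" "X \<subseteq> M" by auto
  have "alg M x" using insert M by (auto intro: alg_mono simp: fdalg_def)
  from fdalg_adjoin[OF B M(1) this] M(2) show ?case by auto
qed

text \<open>Two algebraic elements lie in one finite-dimensional ring, which is a field of algebraic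
  elements.\<close>

lemma subfield_alg:
  assumes B: "is_subfield B" shows "is_subfield {x. alg B x}"
proof -
  have *: "alg B x \<Longrightarrow> alg B y \<Longrightarrow> alg B (x + y) \<and> alg B (x * y) \<and> alg B (- x) \<and> alg B (inverse x)"
    for x y
  proof -
    assume "alg B x" "alg B y"
    then obtain M where M: "fdalg B M" "x \<in> M" "y \<in> M"
      using fdalg_finite_set[OF B, of "{x, y}"] by auto
    then have "x + y \<in> M" "x * y \<in> M" "- x \<in> M" "inverse x \<in> M"
      using fdalg_inverse[OF B M(1)] by (auto simp: fdalg_def subring_add subring_mult subring_uminus)
    then show ?thesis using fdalg_algebraic[OF B M(1)] by blast
  qed
  then show ?thesis
    using alg_base[OF subfield_subring[OF B]] subfield_subring[OF B]
    unfolding is_subfield_def is_subring_def by blast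
qed

text \<open>The finitely many coefficients of a polynomial with root \<open>x\<close> lie in one finite-dimensional
  ring, to which \<open>x\<close> can be adjoined.\<close>

lemma alg_trans:
  assumes B: "is_subfield B" and x: "alg {x. alg B x} x"
  shows "alg B x"
proof -
  obtain p where p: "p \<in> Polys {x. alg B x}" "p \<noteq> 0" "poly p x = 0"
    using x by (auto simp: alg_def)
  have "finite (set (coeffs p))" by simp
  moreover have "\<And>c. c \<in> set (coeffs p) \<Longrightarrow> alg B c"
    using p(1) by (auto simp: Polys_def coeffs_def split: if_splits)
  ultimately obtain M where M: "fdalg B M" "set (coeffs p) \<subseteq> M"
    using fdalg_finite_set[OF B, of "set (coeffs p)"] by blast
  have "0 \<in> M" using M by (auto simp: fdalg_def subring_0)
  have "coeff p i \<in> M" for i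
  proof (cases "i \<le> degree p")
    case True
    then have "coeff p i \<in> set (coeffs p)"
      using p(2) by (simp add: coeff_in_coeffs)
    then show ?thesis using M by auto
  qed (use \<open>0 \<in> M\<close> in \<open>simp add: coeff_eq_0\<close>)
  then have "alg M x" using p by (auto simp: alg_def Polys_def)
  from fdalg_adjoin[OF B M(1) this] show ?thesis
    using fdalg_algebraic[OF B] by blast
qed

section \<open>Derivations and traces\<close>

definition derivation :: "('a::field \<Rightarrow> 'a) \<Rightarrow> bool" where
  "derivation d \<longleftrightarrow> (\<forall>x y. d (x + y) = d x + d y \<and> d (x * y) = d x * y + x * d y)"

context
  fixes d :: "'a::field \<Rightarrow> 'a"
  assumes d: "derivation d"
begin

lemma derivation_add: "d (x + y) = d x + d y"
  and derivation_mult: "d (x * y) = d x * y + x * d y"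
  using d unfolding derivation_def by blast+

lemma derivation_0 [simp]: "d 0 = 0"
  using derivation_add[of 0 0] by (metis add.right_neutral add_left_cancel)

lemma derivation_1 [simp]: "d 1 = 0"
  using derivation_mult[of 1 1] by (metis add.right_neutral add_left_cancel mult_1 mult_1_right)

lemma derivation_uminus: "d (- x) = - d x"
  using derivation_add[of x "- x"] by (simp add: eq_neg_iff_add_eq_0 add.commute)

lemma derivation_diff: "d (x - y) = d x - d y"
  using derivation_add[of x "- y"] by (simp add: derivation_uminus)

lemma derivation_sum: "d (sum f I) = (\<Sum>i\<in>I. d (f i))"
  by (induction I rule: infinite_finite_induct) (auto simp: derivation_add)

lemma derivation_prod:
  "finite I \<Longrightarrow> d (prod f I) = (\<Sum>i\<in>I. d (f i) * prod f (I - {i}))"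
proof (induction I rule: finite_induct)
  case (insert x I)
  have "(\<Sum>i\<in>I. d (f i) * prod f (insert x I - {i})) = f x * (\<Sum>i\<in>I. d (f i) * prod f (I - {i}))"
    unfolding sum_distrib_left
  proof (rule sum.cong[OF refl])
    fix i assume "i \<in> I"
    then have "insert x I - {i} = insert x (I - {i})" "x \<notin> I - {i}" using insert by auto
    then show "d (f i) * prod f (insert x I - {i}) = f x * (d (f i) * prod f (I - {i}))"
      using insert by simp
  qed
  moreover have "insert x I - {x} = I" using insert by auto
  ultimately show ?case using insert by (simp add: derivation_mult)
qed simp

lemma derivation_inverse: "d (inverse x) = - d x / x\<^sup>2"
proof (cases "x = 0")
  case False
  then have "0 = d x * inverse x + x * d (inverse x)"
    using derivation_mult[of x "inverse x"] by simp
  with False show ?thesis by (simp add: field_simps power2_eq_square eq_neg_iff_add_eq_0)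
qed simp

lemma derivation_divide: "y \<noteq> 0 \<Longrightarrow> d (x / y) = (d x * y - x * d y) / y\<^sup>2"
proof -
  assume y: "y \<noteq> 0"
  have "d (x / y) = d x * inverse y + x * (- d y / y\<^sup>2)"
    using derivation_mult[of x "inverse y"] by (simp add: derivation_inverse divide_inverse[of x])
  then show ?thesis using y by (simp add: field_simps power2_eq_square)
qed

lemma derivation_of_nat: "d (of_nat n) = 0"
  by (induction n) (auto simp: derivation_add)

lemma derivation_sign: "d (signof p) = 0"
  by (simp add: sign_def derivation_uminus)

lemma coeff_map_derivation [simp]: "coeff (map_poly d p) i = d (coeff p i)"
  by (rule coeff_map_poly) simp

lemma map_derivation_pCons: "map_poly d (pCons a p) = pCons (d a) (map_poly d p)"
  by (rule poly_eqI) (simp add: coeff_pCons split: nat.splits)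

lemma derivation_poly:
  "d (poly p x) = poly (map_poly d p) x + poly (pderiv p) x * d x"
  by (induction p)
     (auto simp: derivation_add derivation_mult map_derivation_pCons pderiv_pCons algebra_simps)

lemma subfield_kernel: "is_subfield {x. d x = 0}"
  unfolding is_subfield_def is_subring_def
  by (auto simp: derivation_add derivation_mult derivation_uminus derivation_inverse)

lemma map_derivation_kernel: "p \<in> Polys {x. d x = 0} \<Longrightarrow> map_poly d p = 0"
  by (rule poly_eqI) (simp add: Polys_def)

text \<open>By the Leibniz rule, the derivative of a determinant is the sum of the determinants in which
  one row has been differentiated; each is expanded along that row.\<close>

lemma derivation_det:
  assumes A: "A \<in> carrier_mat n n"
  shows "d (det A) = (\<Sum>i<n. \<Sum>j<n. d (A $$ (i, j)) * cofactor A i j)"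
proof -
  define R where "R i = mat n n (\<lambda>(k, j). if k = i then d (A $$ (k, j)) else A $$ (k, j))" for i
  have R: "R i \<in> carrier_mat n n" for i by (simp add: R_def)
  have "d (det A) = (\<Sum>p | p permutes {0..<n}. \<Sum>i\<in>{0..<n}.
      signof p * (d (A $$ (i, p i)) * (\<Prod>k\<in>{0..<n} - {i}. A $$ (k, p k))))"
    unfolding det_def'[OF A]
    by (simp add: derivation_sum derivation_mult derivation_sign derivation_prod sum_distrib_left)
  also have "\<dots> = (\<Sum>i\<in>{0..<n}. \<Sum>p | p permutes {0..<n}.
      signof p * (d (A $$ (i, p i)) * (\<Prod>k\<in>{0..<n} - {i}. A $$ (k, p k))))"
    by (rule sum.swap)
  also have "\<dots> = (\<Sum>i\<in>{0..<n}. det (R i))"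
  proof (rule sum.cong[OF refl])
    fix i assume i: "i \<in> {0..<n}"
    have "(\<Prod>k = 0..<n. R i $$ (k, p k)) =
        d (A $$ (i, p i)) * (\<Prod>k\<in>{0..<n} - {i}. A $$ (k, p k))" if p: "p permutes {0..<n}" for p
    proof -
      have pl: "p k < n" if "k < n" for k using permutes_in_image[OF p, of k] that by auto
      have "(\<Prod>k = 0..<n. R i $$ (k, p k)) = R i $$ (i, p i) * (\<Prod>k\<in>{0..<n} - {i}. R i $$ (k, p k))"
        using i by (intro prod.remove) auto
      also have "(\<Prod>k\<in>{0..<n} - {i}. R i $$ (k, p k)) = (\<Prod>k\<in>{0..<n} - {i}. A $$ (k, p k))"
        by (rule prod.cong) (auto simp: R_def pl)
      also have "R i $$ (i, p i) = d (A $$ (i, p i))" using i pl by (auto simp: R_def)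
      finally show ?thesis .
    qed
    then show "(\<Sum>p | p permutes {0..<n}.
        signof p * (d (A $$ (i, p i)) * (\<Prod>k\<in>{0..<n} - {i}. A $$ (k, p k)))) = det (R i)"
      unfolding det_def'[OF R] by (intro sum.cong) auto
  qed
  also have "\<dots> = (\<Sum>i\<in>{0..<n}. \<Sum>j<n. d (A $$ (i, j)) * cofactor A i j)"
  proof (rule sum.cong[OF refl])
    fix i assume i: "i \<in> {0..<n}"
    have "mat_delete (R i) i j = mat_delete A i j" if "j < n" for j
      using i that A by (intro eq_matI) (auto simp: mat_delete_def R_def)
    then show "det (R i) = (\<Sum>j<n. d (A $$ (i, j)) * cofactor A i j)"
      using i by (subst laplace_expansion_row[OF R, of i]) (auto simp: cofactor_def R_def intro!: sum.cong)
  qed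
  finally show ?thesis by (simp add: atLeast0LessThan)
qed

end

text \<open>A spanning set of least cardinality is linearly independent.\<close>

lemma lspan_independent_basis:
  fixes B :: "'a::field set"
  assumes B: "is_subfield B" and fin: "\<exists>S. finite S \<and> M = lspan B S"
  obtains S where "finite S" "M = lspan B S"
    "\<And>b. (\<And>s. s \<in> S \<Longrightarrow> b s \<in> B) \<Longrightarrow> (\<Sum>s\<in>S. b s * s) = 0 \<Longrightarrow> \<forall>s\<in>S. b s = 0"
proof -
  note RB = subfield_subring[OF B]
  let ?P = "\<lambda>S. finite S \<and> M = lspan B S"
  obtain S0 where S0: "?P S0" using fin by (rule exE)
  obtain S where PS: "?P S \<and> (\<forall>T. ?P T \<longrightarrow> card S \<le> card T)"
    using ex_has_least_nat[of ?P S0 card, OF S0] by (rule exE)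
  then have S: "finite S" "M = lspan B S" and min: "\<And>T. ?P T \<Longrightarrow> card S \<le> card T"
    by simp_all
  have "b t = 0" if b: "\<And>s. s \<in> S \<Longrightarrow> b s \<in> B" "(\<Sum>s\<in>S. b s * s) = 0" and t: "t \<in> S" for b t
  proof (rule ccontr)
    assume nz: "b t \<noteq> 0"
    let ?T = "S - {t}"
    have "b t * t = - (\<Sum>s\<in>?T. b s * s)"
      using b(2) sum.remove[OF S(1) t, of "\<lambda>s. b s * s"] by (simp add: eq_neg_iff_add_eq_0)
    then have "t = (\<Sum>s\<in>?T. (- b s / b t) * s)"
      using nz by (simp add: field_simps sum_negf flip: sum_divide_distrib)
    also have "\<dots> \<in> lspan B ?T"
      using b(1) t by (intro lspan_sum lspan_smult[OF RB] lspan_base[OF RB])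
        (auto intro!: subfield_divide[OF B] subring_uminus[OF RB])
    finally have "t \<in> lspan B ?T" .
    then have "S \<subseteq> lspan B ?T" using lspan_base[OF RB, of _ ?T] by auto
    then have "lspan B S \<subseteq> lspan B ?T"
      by (intro lspan_least[OF RB]) (auto intro: lspan_0 lspan_add lspan_smult[OF RB])
    then have "M = lspan B ?T" using S lspan_mono[of ?T S B] by auto
    then have "card S \<le> card ?T" using min[of ?T] S by auto
    then show False using S(1) t by (metis card_Diff1_less not_less)
  qed
  then show thesis using that S by blast
qed

text \<open>A polynomial of least degree with root \<open>x\<close>. Its derivative is nonzero, as the characteristic
  is \<open>0\<close>, and has smaller degree; so it does not vanish at \<open>x\<close>.\<close>

lemma minimal_polynomial:
  fixes x :: "'a::field_char_0"
  assumes R: "is_subring R" and x: "alg R x"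
  obtains p where "p \<in> Polys R" "p \<noteq> 0" "poly p x = 0" "poly (pderiv p) x \<noteq> 0"
    "\<And>q. q \<in> Polys R \<Longrightarrow> q \<noteq> 0 \<Longrightarrow> poly q x = 0 \<Longrightarrow> degree p \<le> degree q"
proof -
  let ?P = "\<lambda>p. p \<in> Polys R \<and> p \<noteq> 0 \<and> poly p x = 0"
  obtain p0 where p0: "?P p0" using x unfolding alg_def by auto
  obtain p where Pp: "?P p \<and> (\<forall>q. ?P q \<longrightarrow> degree p \<le> degree q)"
    using ex_has_least_nat[of ?P p0 degree, OF p0] by (rule exE)
  then have p: "p \<in> Polys R" "p \<noteq> 0" "poly p x = 0"
    and min: "\<And>q. q \<in> Polys R \<Longrightarrow> q \<noteq> 0 \<Longrightarrow> poly q x = 0 \<Longrightarrow> degree p \<le> degree q"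
    by simp_all
  have deg: "degree p \<noteq> 0"
  proof
    assume "degree p = 0"
    then obtain a where "p = [:a:]" by (auto elim: degree_eq_zeroE)
    then show False using p by auto
  qed
  have "poly (pderiv p) x \<noteq> 0"
  proof
    assume "poly (pderiv p) x = 0"
    moreover have "pderiv p \<noteq> 0" using deg by (simp add: pderiv_eq_0_iff)
    ultimately have "degree p \<le> degree (pderiv p)"
      using min[of "pderiv p"] Polys_pderiv[OF R p(1)] by blast
    then show False using deg by (simp add: degree_pderiv)
  qed
  then show thesis by (rule that[OF p _ min])
qed

text \<open>Differentiating \<open>p(x) = 0\<close> for a minimal polynomial \<open>p\<close> and solving for \<open>d x\<close> gives
  \<open>d x = - p\<^sup>d(x) / p'(x)\<close>, where \<open>p\<^sup>d\<close> has the differentiated coefficients.\<close>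

lemma derivation_maps_fdalg:
  fixes d :: "'a::field_char_0 \<Rightarrow> 'a"
  assumes d: "derivation d" and B: "is_subfield B" and dB: "\<And>b. b \<in> B \<Longrightarrow> d b \<in> B"
    and M: "fdalg B M" and x: "x \<in> M"
  shows "d x \<in> M"
proof -
  note RB = subfield_subring[OF B]
  have RM: "is_subring M" and BM: "B \<subseteq> M" and FM: "is_subfield M"
    using M fdalg_subfield[OF B M] by (auto simp: fdalg_def)
  obtain p where p: "p \<in> Polys B" "p \<noteq> 0" "poly p x = 0" "poly (pderiv p) x \<noteq> 0"
    by (rule minimal_polynomial[OF RB fdalg_algebraic[OF B M x]]) (rule that)
  have "0 = poly (map_poly d p) x + poly (pderiv p) x * d x"
    using derivation_poly[OF d, of p x] p derivation_0[OF d] by simp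
  then have "d x = - poly (map_poly d p) x / poly (pderiv p) x"
    using p(4) by (simp add: field_simps eq_neg_iff_add_eq_0)
  moreover have "map_poly d p \<in> Polys B"
    using p dB by (auto simp: Polys_def coeff_map_derivation[OF d])
  ultimately show ?thesis
    using Polys_pderiv[OF RB p(1)] Polys_mono[OF BM] x
    by (auto intro!: subfield_divide[OF FM] subring_uminus[OF RM] poly_in_subring[OF RM])
qed

definition mat_trace :: "nat \<Rightarrow> 'a::comm_ring_1 mat \<Rightarrow> 'a" where
  "mat_trace n A = (\<Sum>i<n. A $$ (i, i))"

lemma mat_trace_comm:
  "A \<in> carrier_mat n n \<Longrightarrow> C \<in> carrier_mat n n \<Longrightarrow> mat_trace n (A * C) = mat_trace n (C * A)"
  unfolding mat_trace_def
  by (simp add: scalar_prod_def atLeast0LessThan) (subst sum.swap, simp add: mult.commute)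

text \<open>The trace of a finite field extension maps the logarithmic derivative of \<open>x\<close> to that of the
  norm of \<open>x\<close>. In terms of a basis \<open>e\<close> of \<open>M\<close>, let \<open>A x\<close> be the matrix of multiplication by \<open>x\<close> and \<open>G\<close>
  the matrix of \<open>d\<close>. Differentiating \<open>x * e i\<close> in two ways gives
  \<open>d (A x) + A x * G = A (d x) + G * A x\<close>. So up to terms whose traces cancel, multiplication by
  \<open>d x / x\<close> has the matrix \<open>d (A x) * (A x)\<^sup>-\<^sup>1\<close>, and the trace of the latter is the logarithmic
  derivative of \<open>det (A x)\<close> by Jacobi's formula \<open>derivation_det\<close>. This avoids conjugates, and thus
  the construction of a splitting field.\<close>

lemma trace_log_derivative:
  fixes d :: "'a::field_char_0 \<Rightarrow> 'a"
  assumes d: "derivation d" and B: "is_subfield B" and dB: "\<And>b. b \<in> B \<Longrightarrow> d b \<in> B"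
    and M: "fdalg B M"
  obtains tr :: "'a \<Rightarrow> 'a" and n :: nat where
    "n > 0" "tr 1 = of_nat n"
    "\<And>x y. x \<in> M \<Longrightarrow> y \<in> M \<Longrightarrow> tr (x + y) = tr x + tr y"
    "\<And>b x. b \<in> B \<Longrightarrow> x \<in> M \<Longrightarrow> tr (b * x) = b * tr x"
    "\<And>x. x \<in> M \<Longrightarrow> x \<noteq> 0 \<Longrightarrow> \<exists>D\<in>B. D \<noteq> 0 \<and> tr (d x / x) = d D / D"
proof -
  note RB = subfield_subring[OF B]
  have RM: "is_subring M" and BM: "B \<subseteq> M" and FM: "is_subfield M"
    using M fdalg_subfield[OF B M] by (auto simp: fdalg_def)
  have dM: "\<And>x. x \<in> M \<Longrightarrow> d x \<in> M"
    using derivation_maps_fdalg[OF d B dB M] .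
  obtain S where S: "finite S" "M = lspan B S"
    and ind: "\<And>b. (\<And>s. s \<in> S \<Longrightarrow> b s \<in> B) \<Longrightarrow> (\<Sum>s\<in>S. b s * s) = 0 \<Longrightarrow> \<forall>s\<in>S. b s = 0"
    using lspan_independent_basis[OF B, of M] M by (auto simp: fdalg_def)
  define n where "n = card S"
  obtain e where e: "bij_betw e {..<n} S"
    using ex_bij_betw_nat_finite[OF S(1)] unfolding atLeast0LessThan n_def by blast
  have eM: "e i \<in> M" if "i < n" for i
    using e that S(2) lspan_base[OF RB] by (auto simp: bij_betw_def)
  have n: "n > 0"
  proof (rule ccontr)
    assume "\<not> n > 0"
    then have "S = {}" using S(1) by (simp add: n_def)
    then have "M \<subseteq> {0}" unfolding S(2) by (intro lspan_least[OF RB]) auto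
    then show False using subring_1[OF RM] by auto
  qed
  have "\<exists>b. (\<forall>i. b i \<in> B) \<and> x = (\<Sum>i<n. b i * e i)" if x: "x \<in> M" for x
  proof -
    obtain b where b: "\<And>s. b s \<in> B" "x = (\<Sum>s\<in>S. b s * s)"
      using lspan_finite[OF RB S(1)] x S(2) by blast
    have "x = (\<Sum>i<n. b (e i) * e i)"
      unfolding b(2) using sum.reindex_bij_betw[OF e, of "\<lambda>s. b s * s"] by simp
    then show ?thesis using b by (intro exI[of _ "\<lambda>i. b (e i)"]) auto
  qed
  then obtain c where cB: "\<And>x i. x \<in> M \<Longrightarrow> c x i \<in> B"
    and c: "\<And>x. x \<in> M \<Longrightarrow> x = (\<Sum>i<n. c x i * e i)" by metis
  have uniq: "a i = b i" if ab: "\<And>i. i < n \<Longrightarrow> a i \<in> B" "\<And>i. i < n \<Longrightarrow> b i \<in> B"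
    "(\<Sum>i<n. a i * e i) = (\<Sum>i<n. b i * e i)" and i: "i < n" for a b :: "nat \<Rightarrow> 'a" and i
  proof -
    let ?e = "inv_into {..<n} e"
    have inv: "?e (e i) = i" if "i < n" for i
      using e that by (auto simp: bij_betw_def inv_into_f_f)
    have "(\<Sum>s\<in>S. (a (?e s) - b (?e s)) * s) = (\<Sum>i<n. (a (?e (e i)) - b (?e (e i))) * e i)"
      using sum.reindex_bij_betw[OF e, of "\<lambda>s. (a (?e s) - b (?e s)) * s"] by simp
    also have "\<dots> = 0" using ab(3) by (simp add: inv left_diff_distrib sum_subtractf)
    finally have "\<forall>s\<in>S. a (?e s) - b (?e s) = 0"
      using ab e by (intro ind) (auto intro!: subring_diff[OF RB] simp: bij_betw_def inv_into_f_f)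
    then have "a (?e (e i)) - b (?e (e i)) = 0" using e i by (auto simp: bij_betw_def)
    then show ?thesis using inv[OF i] by simp
  qed
  have c_eq: "c x i = b i" if "x \<in> M" "\<And>i. i < n \<Longrightarrow> b i \<in> B" "x = (\<Sum>i<n. b i * e i)" "i < n" for x b i
    by (rule uniq[OF cB[OF that(1)] that(2) trans[OF c[OF that(1), symmetric] that(3)] that(4)])
  \<comment> \<open>Row \<open>i\<close> of \<open>A x\<close> contains the coordinates of \<open>x * e i\<close>. With this convention \<open>A\<close> reverses the
    order of products.\<close>
  define A where "A x = mat n n (\<lambda>(i, j). c (x * e i) j)" for x
  define G where "G = mat n n (\<lambda>(i, j). c (d (e i)) j)"
  have A [simp]: "A x \<in> carrier_mat n n" and G [simp]: "G \<in> carrier_mat n n" for x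
    by (simp_all add: A_def G_def)
  have dims [simp]: "dim_row (A x) = n" "dim_col (A x) = n" "dim_row G = n" "dim_col G = n" for x
    by (simp_all add: A_def G_def)
  have xe: "x * e i \<in> M" if "x \<in> M" "i < n" for x i
    using that eM by (intro subring_mult[OF RM])
  have AB: "A x $$ (i, j) \<in> B" if "x \<in> M" "i < n" "j < n" for x i j
    using that xe by (auto simp: A_def intro: cB)
  have GB: "G $$ (i, j) \<in> B" if "i < n" "j < n" for i j
    using that eM dM by (auto simp: G_def intro: cB)
  have A_eq: "x * e i = (\<Sum>j<n. A x $$ (i, j) * e j)" if "x \<in> M" "i < n" for x i
  proof -
    have eq: "(\<Sum>j<n. c (x * e i) j * e j) = (\<Sum>j<n. A x $$ (i, j) * e j)"
      using that by (intro sum.cong) (auto simp: A_def)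
    show ?thesis by (rule trans[OF c[OF xe[OF that]] eq])
  qed
  have G_eq: "d (e i) = (\<Sum>j<n. G $$ (i, j) * e j)" if "i < n" for i
  proof -
    have eq: "(\<Sum>j<n. c (d (e i)) j * e j) = (\<Sum>j<n. G $$ (i, j) * e j)"
      using that by (intro sum.cong) (auto simp: G_def)
    show ?thesis by (rule trans[OF c[OF dM[OF eM[OF that]]] eq])
  qed
  have expand: "(\<Sum>l<n. X $$ (i, l) * (\<Sum>j<n. Y $$ (l, j) * e j)) = (\<Sum>j<n. (X * Y) $$ (i, j) * e j)"
    if "X \<in> carrier_mat n n" "Y \<in> carrier_mat n n" "i < n" for X Y i
  proof -
    have "(\<Sum>l<n. X $$ (i, l) * (\<Sum>j<n. Y $$ (l, j) * e j)) =
        (\<Sum>j<n. \<Sum>l<n. X $$ (i, l) * Y $$ (l, j) * e j)"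
      by (subst sum.swap) (simp add: sum_distrib_left mult.assoc)
    also have "\<dots> = (\<Sum>j<n. (X * Y) $$ (i, j) * e j)"
      using that by (intro sum.cong) (auto simp: scalar_prod_def atLeast0LessThan sum_distrib_right)
    finally show ?thesis .
  qed
  have multB: "(X * Y) $$ (i, j) \<in> B"
    if "X \<in> carrier_mat n n" "Y \<in> carrier_mat n n" "i < n" "j < n"
      "\<And>i j. i < n \<Longrightarrow> j < n \<Longrightarrow> X $$ (i, j) \<in> B" "\<And>i j. i < n \<Longrightarrow> j < n \<Longrightarrow> Y $$ (i, j) \<in> B" for X Y i j
    using that by (auto simp: scalar_prod_def intro!: subring_sum[OF RB] subring_mult[OF RB])
  have A_mult: "A (x * y) = A y * A x" if x: "x \<in> M" and y: "y \<in> M" for x y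
  proof (rule eq_matI)
    fix i j assume "i < dim_row (A y * A x)" "j < dim_col (A y * A x)"
    then have ij: "i < n" "j < n" by auto
    have "(x * y) * e i = x * (\<Sum>l<n. A y $$ (i, l) * e l)"
      using A_eq[OF y ij(1)] by (simp add: mult.assoc)
    also have "\<dots> = (\<Sum>l<n. A y $$ (i, l) * (x * e l))"
      by (simp add: sum_distrib_left mult_ac)
    also have "\<dots> = (\<Sum>l<n. A y $$ (i, l) * (\<Sum>j<n. A x $$ (l, j) * e j))"
      by (intro sum.cong) (auto simp: A_eq[OF x])
    also have "\<dots> = (\<Sum>j<n. (A y * A x) $$ (i, j) * e j)"
      using ij by (intro expand) auto
    finally have eq: "(x * y) * e i = (\<Sum>j<n. (A y * A x) $$ (i, j) * e j)" .
    have "c (x * y * e i) j = (A y * A x) $$ (i, j)"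
    proof (rule c_eq[OF _ _ eq ij(2)])
      show "x * y * e i \<in> M" by (rule xe[OF subring_mult[OF RM x y] ij(1)])
      show "(A y * A x) $$ (i, j) \<in> B" if "j < n" for j
        by (rule multB[OF A A ij(1) that AB[OF y] AB[OF x]])
    qed
    then show "A (x * y) $$ (i, j) = (A y * A x) $$ (i, j)"
      using ij by (simp add: A_def)
  qed auto
  have A_1: "A 1 = 1\<^sub>m n"
  proof (rule eq_matI)
    fix i j assume "i < dim_row (1\<^sub>m n :: 'a mat)" "j < dim_col (1\<^sub>m n :: 'a mat)"
    then have ij: "i < n" "j < n" by auto
    have "c (1 * e i) j = (if i = j then 1 else 0)"
    proof (rule c_eq[OF _ _ _ ij(2)])
      show "1 * e i \<in> M" using eM[OF ij(1)] by simp
      show "(if i = j then 1 else 0) \<in> B" for j using RB by (simp add: subring_0 subring_1)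
      show "1 * e i = (\<Sum>j<n. (if i = j then 1 else 0) * e j)"
        using ij by (simp add: if_distrib[of "\<lambda>x. x * _"] cong: if_cong)
    qed
    then show "A 1 $$ (i, j) = 1\<^sub>m n $$ (i, j)" using ij by (simp add: A_def)
  qed auto
  \<comment> \<open>Both sides have the coordinates of \<open>d (x * e i)\<close> in row \<open>i\<close>.\<close>
  have A_d: "map_mat d (A x) + A x * G = A (d x) + G * A x" if x: "x \<in> M" for x
  proof (rule eq_matI)
    fix i j assume "i < dim_row (A (d x) + G * A x)" "j < dim_col (A (d x) + G * A x)"
    then have ij: "i < n" "j < n" by auto
    note comm_simps = distrib_right sum.distrib
    have "(\<Sum>j<n. (map_mat d (A x) + A x * G) $$ (i, j) * e j) =
        (\<Sum>j<n. d (A x $$ (i, j)) * e j) + (\<Sum>j<n. (A x * G) $$ (i, j) * e j)"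
      using ij by (simp add: comm_simps del: index_mult_mat(1))
    also have "(\<Sum>j<n. (A x * G) $$ (i, j) * e j) = (\<Sum>l<n. A x $$ (i, l) * d (e l))"
      using ij by (subst expand[symmetric]) (auto intro!: sum.cong simp: G_eq)
    also have "(\<Sum>j<n. d (A x $$ (i, j)) * e j) + (\<Sum>l<n. A x $$ (i, l) * d (e l)) = d (x * e i)"
      unfolding A_eq[OF x ij(1)]
      by (simp add: derivation_sum[OF d] derivation_mult[OF d] sum.distrib)
    also have "\<dots> = d x * e i + x * d (e i)" by (rule derivation_mult[OF d])
    also have "x * d (e i) = (\<Sum>l<n. G $$ (i, l) * (x * e l))"
      unfolding G_eq[OF ij(1)] by (simp add: sum_distrib_left mult_ac)
    also have "\<dots> = (\<Sum>l<n. G $$ (i, l) * (\<Sum>j<n. A x $$ (l, j) * e j))"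
      by (intro sum.cong) (auto simp: A_eq[OF x])
    also have "\<dots> = (\<Sum>j<n. (G * A x) $$ (i, j) * e j)" using ij by (intro expand) auto
    also have "d x * e i = (\<Sum>j<n. A (d x) $$ (i, j) * e j)" using A_eq[OF dM[OF x] ij(1)] .
    also have "(\<Sum>j<n. A (d x) $$ (i, j) * e j) + (\<Sum>j<n. (G * A x) $$ (i, j) * e j) =
        (\<Sum>j<n. (A (d x) + G * A x) $$ (i, j) * e j)"
      using ij by (simp add: comm_simps del: index_mult_mat(1))
    finally have *: "(\<Sum>j<n. (map_mat d (A x) + A x * G) $$ (i, j) * e j) =
      (\<Sum>j<n. (A (d x) + G * A x) $$ (i, j) * e j)" .
    have 1: "(map_mat d (A x) + A x * G) $$ (i, j) \<in> B" if "j < n" for j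
      using ij that subring_add[OF RB dB[OF AB[OF x ij(1) that]] multB[OF A G ij(1) that AB[OF x] GB]]
      by (simp del: index_mult_mat(1))
    have 2: "(A (d x) + G * A x) $$ (i, j) \<in> B" if "j < n" for j
      using ij that subring_add[OF RB AB[OF dM[OF x] ij(1) that] multB[OF G A ij(1) that GB AB[OF x]]]
      by (simp del: index_mult_mat(1))
    show "(map_mat d (A x) + A x * G) $$ (i, j) = (A (d x) + G * A x) $$ (i, j)"
      by (rule uniq[OF 1 2 * ij(2)])
  qed auto
  define tr where "tr x = mat_trace n (A x)" for x
  show thesis
  proof
    show "n > 0" by (rule n)
    show "tr 1 = of_nat n" by (simp add: tr_def A_1 mat_trace_def)
    show "tr (x + y) = tr x + tr y" if x: "x \<in> M" and y: "y \<in> M" for x y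
    proof -
      have "A (x + y) $$ (i, i) = A x $$ (i, i) + A y $$ (i, i)" if i: "i < n" for i
      proof -
        have "c ((x + y) * e i) i = A x $$ (i, i) + A y $$ (i, i)"
        proof (rule c_eq[where b = "\<lambda>j. A x $$ (i, j) + A y $$ (i, j)", OF _ _ _ i])
          show "(x + y) * e i \<in> M" by (rule xe[OF subring_add[OF RM x y] i])
          show "A x $$ (i, j) + A y $$ (i, j) \<in> B" if "j < n" for j
            by (rule subring_add[OF RB AB[OF x i that] AB[OF y i that]])
          show "(x + y) * e i = (\<Sum>j<n. (A x $$ (i, j) + A y $$ (i, j)) * e j)"
            unfolding distrib_right sum.distrib A_eq[OF x i, symmetric] A_eq[OF y i, symmetric] ..
        qed
        then show ?thesis using i by (simp add: A_def)
      qed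
      then show ?thesis by (simp add: tr_def mat_trace_def sum.distrib)
    qed
    show "tr (b * x) = b * tr x" if b: "b \<in> B" and x: "x \<in> M" for b x
    proof -
      have "A (b * x) $$ (i, i) = b * A x $$ (i, i)" if i: "i < n" for i
      proof -
        have "c ((b * x) * e i) i = b * A x $$ (i, i)"
        proof (rule c_eq[where b = "\<lambda>j. b * A x $$ (i, j)", OF _ _ _ i])
          show "(b * x) * e i \<in> M" using b BM x by (intro xe[OF subring_mult[OF RM] i]) auto
          show "b * A x $$ (i, j) \<in> B" if "j < n" for j
            by (rule subring_mult[OF RB b AB[OF x i that]])
          show "(b * x) * e i = (\<Sum>j<n. (b * A x $$ (i, j)) * e j)"
            unfolding mult.assoc sum_distrib_left[symmetric] A_eq[OF x i, symmetric] ..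
        qed
        then show ?thesis using i by (simp add: A_def)
      qed
      then show ?thesis by (simp add: tr_def mat_trace_def sum_distrib_left)
    qed
    show "\<exists>D\<in>B. D \<noteq> 0 \<and> tr (d x / x) = d D / D" if x: "x \<in> M" and nz: "x \<noteq> 0" for x
    proof (intro bexI conjI)
      let ?y = "d x / x" and ?D = "det (A x)" and ?J = "adj_mat (A x)"
      have y: "?y \<in> M" using x dM by (intro subfield_divide[OF FM])
      have ix: "inverse x \<in> M" using x FM by (simp add: is_subfield_def)
      note J = adj_mat[OF A[of x]]
      show "?D \<in> B" using AB[OF x] by (intro det_in_subring[OF RB A]) auto
      have "?D * det (A (inverse x)) = det (A (inverse x * x))"
        unfolding A_mult[OF ix x] by (rule det_mult[OF A A, symmetric])
      also have "\<dots> = 1" using nz by (simp add: A_1)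
      finally show D: "?D \<noteq> 0" by auto
      have dA: "map_mat d (A x) = A ?y * A x + G * A x - A x * G"
      proof -
        have "A (d x) = A ?y * A x"
          using A_mult[OF x y] nz by simp
        then have *: "map_mat d (A x) + A x * G = A ?y * A x + G * A x"
          using A_d[OF x] by simp
        show ?thesis
        proof (rule eq_matI)
          fix i j assume "i < dim_row (A ?y * A x + G * A x - A x * G)"
            "j < dim_col (A ?y * A x + G * A x - A x * G)"
          then have "i < n" "j < n" by auto
          then show "map_mat d (A x) $$ (i, j) = (A ?y * A x + G * A x - A x * G) $$ (i, j)"
            using arg_cong[OF *, of "\<lambda>X. X $$ (i, j)"] by (simp del: index_mult_mat(1) add: algebra_simps)
        qed auto
      qed
      \<comment> \<open>With the adjugate matrix \<open>?J\<close> in place of the inverse, the terms with \<open>G\<close> cancel by the cyclic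
        property of the trace.\<close>
      have "d ?D = mat_trace n (map_mat d (A x) * ?J)"
        unfolding derivation_det[OF d A] mat_trace_def
        by (intro sum.cong) (auto simp: scalar_prod_def adj_mat_def atLeast0LessThan)
      also have "map_mat d (A x) * ?J = A ?y * A x * ?J + G * A x * ?J - A x * G * ?J"
      proof -
        have c: "A ?y * A x \<in> carrier_mat n n" "G * A x \<in> carrier_mat n n" "A x * G \<in> carrier_mat n n"
          by (rule mult_carrier_mat[OF A A] mult_carrier_mat[OF G A] mult_carrier_mat[OF A G])+
        show ?thesis
          unfolding dA minus_mult_distrib_mat[OF add_carrier_mat[OF c(2)] c(3) J(1)]
            add_mult_distrib_mat[OF c(1,2) J(1)] ..
      qed
      also have "mat_trace n \<dots> = mat_trace n (A ?y * A x * ?J) + mat_trace n (G * A x * ?J) - mat_trace n (A x * G * ?J)"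
        using J(1) by (auto simp: mat_trace_def sum.distrib sum_subtractf simp del: index_mult_mat(1))
      also have "mat_trace n (A x * G * ?J) = mat_trace n (?J * (A x * G))"
        using J(1) by (intro mat_trace_comm) auto
      also have "?J * (A x * G) = (?J * A x) * G"
        using J(1) by (intro assoc_mult_mat[symmetric]) auto
      also have "mat_trace n ((?J * A x) * G) = mat_trace n (G * (?J * A x))"
        using J(1) by (intro mat_trace_comm) auto
      also have "A ?y * A x * ?J = A ?y * (A x * ?J)"
        using J(1) by (intro assoc_mult_mat) auto
      also have "G * A x * ?J = G * (A x * ?J)"
        using J(1) by (intro assoc_mult_mat) auto
      also have "mat_trace n (A ?y * (A x * ?J)) + mat_trace n (G * (A x * ?J)) - mat_trace n (G * (?J * A x)) =
          mat_trace n (A ?y * (?D \<cdot>\<^sub>m 1\<^sub>m n))"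
        unfolding J by simp
      also have "A ?y * (?D \<cdot>\<^sub>m 1\<^sub>m n) = ?D \<cdot>\<^sub>m A ?y"
        by (simp add: mult_smult_distrib[of _ n n _ n])
      also have "mat_trace n (?D \<cdot>\<^sub>m A ?y) = ?D * tr ?y"
        by (simp add: mat_trace_def tr_def sum_distrib_left)
      finally show "tr ?y = d ?D / ?D" using D by (simp add: field_simps)
    qed
  qed
qed

section \<open>Logarithmic derivatives of algebraic functions of one variable\<close>

definition adjoin :: "'a::field set \<Rightarrow> 'a \<Rightarrow> 'a set" where
  "adjoin k g = (\<lambda>p. poly p g) ` Polys k"

text \<open>Zero denominators do no harm: such a quotient is \<open>0\<close>.\<close>

definition fracs :: "'a::field set \<Rightarrow> 'a set" where
  "fracs R = {x / y |x y. x \<in> R \<and> y \<in> R}"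

lemma fracsI: "x \<in> R \<Longrightarrow> y \<in> R \<Longrightarrow> x / y \<in> fracs R"
  by (auto simp: fracs_def)

lemma adjoinI: "p \<in> Polys k \<Longrightarrow> poly p g \<in> adjoin k g"
  by (auto simp: adjoin_def)

lemma subring_adjoin:
  assumes k: "is_subring k" shows "is_subring (adjoin k g)"
proof -
  note P = subring_Polys[OF k]
  have "poly p g + poly q g \<in> adjoin k g" "poly p g * poly q g \<in> adjoin k g" "- poly p g \<in> adjoin k g"
    if "p \<in> Polys k" "q \<in> Polys k" for p q
    using that subring_add[OF P, of p q] subring_mult[OF P, of p q] subring_uminus[OF P, of p]
    unfolding adjoin_def by (metis image_eqI poly_add, metis image_eqI poly_mult, metis image_eqI poly_minus)
  moreover have "0 \<in> adjoin k g" "1 \<in> adjoin k g"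
    using subring_0[OF P] subring_1[OF P] unfolding adjoin_def by (metis image_eqI poly_0, metis image_eqI poly_1)
  ultimately show ?thesis unfolding is_subring_def adjoin_def by auto
qed

lemma adjoin_base: "is_subring k \<Longrightarrow> k \<subseteq> adjoin k g"
  by (auto simp: adjoin_def Polys_pCons Polys_0 intro!: image_eqI[of _ _ "[:_:]"])

lemma adjoin_gen: "is_subring k \<Longrightarrow> g \<in> adjoin k g"
  by (auto simp: adjoin_def Polys_pCons Polys_0 subring_0 subring_1 intro!: image_eqI[of _ _ "[:0, 1:]"])

lemma adjoin_least: "is_subring R \<Longrightarrow> k \<subseteq> R \<Longrightarrow> g \<in> R \<Longrightarrow> adjoin k g \<subseteq> R"
  using Polys_mono[of k R] by (auto simp: adjoin_def intro!: poly_in_subring[of R])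

lemma fracs_base: "is_subring R \<Longrightarrow> R \<subseteq> fracs R"
  using subring_1[of R] by (force simp: fracs_def)

lemma subfield_fracs:
  assumes R: "is_subring R" shows "is_subfield (fracs R)"
proof -
  have 1: "a / b + c / e \<in> fracs R" if "a \<in> R" "b \<in> R" "c \<in> R" "e \<in> R" for a b c e
  proof (cases "b = 0 \<or> e = 0")
    case True
    then show ?thesis using that by (auto intro: fracsI)
  next
    case False
    then have "a / b + c / e = (a * e + c * b) / (b * e)" by (simp add: field_simps)
    then show ?thesis using that R by (auto intro!: fracsI subring_add subring_mult)
  qed
  have 2: "(a / b) * (c / e) \<in> fracs R" if "a \<in> R" "b \<in> R" "c \<in> R" "e \<in> R" for a b c e
    using that R fracsI[of "a * c" R "b * e"] by (simp add: subring_mult)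
  have 3: "- (a / b) \<in> fracs R" if "a \<in> R" "b \<in> R" for a b
    using that R fracsI[of "- a" R b] by (simp add: subring_uminus)
  have 4: "inverse (a / b) \<in> fracs R" if "a \<in> R" "b \<in> R" for a b
    using that fracsI[of b R a] by simp
  have 5: "0 \<in> fracs R" "1 \<in> fracs R"
    using fracs_base[OF R] subring_0[OF R] subring_1[OF R] by auto
  show ?thesis unfolding is_subfield_def is_subring_def
  proof (intro conjI ballI)
    fix x assume "x \<in> fracs R"
    then obtain a b where x: "x = a / b" "a \<in> R" "b \<in> R" by (auto simp: fracs_def)
    show "- x \<in> fracs R" "inverse x \<in> fracs R" unfolding x using x 3 4 by auto
    fix y assume "y \<in> fracs R"
    then obtain c e where y: "y = c / e" "c \<in> R" "e \<in> R" by (auto simp: fracs_def)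
    show "x + y \<in> fracs R" "x * y \<in> fracs R" unfolding x y using x y 1 2 by auto
  qed (use 5 in auto)
qed

text \<open>Denominators of the coefficients can be cleared.\<close>

lemma alg_fracs:
  assumes R: "is_subring R" and x: "alg (fracs R) x"
  shows "alg R x"
proof -
  have clear: "\<exists>r\<in>R. r \<noteq> 0 \<and> Polynomial.smult r p \<in> Polys R" if "p \<in> Polys (fracs R)" for p
    using that
  proof (induction p)
    case 0
    then show ?case using R by (intro bexI[of _ 1]) (auto simp: subring_1 Polys_0)
  next
    case (pCons a p)
    have RF: "is_subring (fracs R)" using subfield_subring[OF subfield_fracs[OF R]] .
    from pCons obtain r where r: "r \<in> R" "r \<noteq> 0" "Polynomial.smult r p \<in> Polys R"
      by (auto simp: Polys_pCons[OF RF])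
    have "a \<in> fracs R" using pCons by (auto simp: Polys_pCons[OF RF])
    then obtain y z where yz: "a = y / z" "y \<in> R" "z \<in> R" by (auto simp: fracs_def)
    show ?case
    proof (cases "z = 0")
      case True
      then show ?thesis using r yz subring_0[OF R] by (intro bexI[of _ r]) (auto simp: Polys_pCons[OF R])
    next
      case False
      have "Polynomial.smult (z * r) (pCons a p) = pCons (r * y) (Polynomial.smult z (Polynomial.smult r p))"
        using False yz by simp
      moreover have "\<dots> \<in> Polys R"
        using r yz R by (auto simp: Polys_pCons simp del: smult_smult intro!: subring_mult Polys_smult)
      ultimately show ?thesis using False r yz R by (intro bexI[of _ "z * r"]) (auto intro: subring_mult)
    qed
  qed
  obtain p where p: "p \<in> Polys (fracs R)" "p \<noteq> 0" "poly p x = 0" using x by (auto simp: alg_def)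
  from clear[OF p(1)] obtain r where r: "r \<in> R" "r \<noteq> 0" "Polynomial.smult r p \<in> Polys R" by auto
  show ?thesis unfolding alg_def using p r by (intro bexI[of _ "Polynomial.smult r p"]) auto
qed

text \<open>The exchange property of algebraic dependence. A relation for \<open>u\<close> over \<open>k[g]\<close> is a polynomial
  in two variables over \<open>k\<close>. Read as a polynomial in \<open>g\<close> over \<open>k[u]\<close>, it remains nontrivial because \<open>u\<close>
  is transcendental over \<open>k\<close>.\<close>

lemma exchange:
  assumes k: "is_subring k" and u: "alg (adjoin k g) u" and tr: "\<not> alg k u"
  shows "alg (adjoin k u) g"
proof -
  obtain p where p: "p \<in> Polys (adjoin k g)" "p \<noteq> 0" "poly p u = 0" using u by (auto simp: alg_def)
  note Rg = subring_adjoin[OF k, of g]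
  have "\<exists>P. P \<in> Polys (Polys k) \<and> map_poly (\<lambda>q. poly q g) P = p" using p(1)
  proof (induction p)
    case 0
    then show ?case by (intro exI[of _ 0]) (auto simp: Polys_0 subring_Polys[OF k])
  next
    case (pCons a p)
    then obtain P where P: "P \<in> Polys (Polys k)" "map_poly (\<lambda>q. poly q g) P = p"
      by (auto simp: Polys_pCons[OF Rg])
    obtain q where q: "q \<in> Polys k" "a = poly q g"
      using pCons.prems unfolding Polys_pCons[OF Rg] by (auto simp: adjoin_def)
    have "map_poly (\<lambda>q. poly q g) (pCons q P) = pCons a p"
      using q P by (intro poly_eqI) (auto simp: coeff_map_poly coeff_pCons split: nat.splits)
    then show ?case using P q by (intro exI[of _ "pCons q P"]) (auto simp: Polys_pCons[OF subring_Polys[OF k]])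
  qed
  then obtain P where P: "P \<in> Polys (Polys k)" "map_poly (\<lambda>q. poly q g) P = p" by blast
  then have P0: "P \<noteq> 0" using p by auto
  \<comment> \<open>The outer variable of \<open>P\<close> stands for \<open>u\<close> and the inner one for \<open>g\<close>; substituting \<open>u\<close> leaves a
    polynomial in the inner variable.\<close>
  define Q where "Q = poly P [:u:]"
  have eval: "poly (poly S [:u:]) g = poly (map_poly (\<lambda>q. poly q g) S) u" for S
  proof (induction S)
    case (pCons a S)
    have "map_poly (\<lambda>q. poly q g) (pCons a S) = pCons (poly a g) (map_poly (\<lambda>q. poly q g) S)"
      by (intro poly_eqI) (auto simp: coeff_map_poly coeff_pCons split: nat.splits)
    then show ?case using pCons by simp
  qed simp
  have coeff: "coeff (poly S [:u:]) i = poly (map_poly (\<lambda>q. coeff q i) S) u" for S i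
  proof (induction S)
    case (pCons a S)
    have "map_poly (\<lambda>q. coeff q i) (pCons a S) = pCons (coeff a i) (map_poly (\<lambda>q. coeff q i) S)"
      by (intro poly_eqI) (auto simp: coeff_map_poly coeff_pCons split: nat.splits)
    then show ?case using pCons by (simp add: coeff_mult_0 coeff_pCons split: nat.splits)
  qed simp
  have memk: "map_poly (\<lambda>q. coeff q i) P \<in> Polys k" for i
    using P by (auto simp: Polys_def coeff_map_poly)
  have "Q \<in> Polys (adjoin k u)"
    using memk by (auto simp: Polys_def Q_def coeff adjoin_def)
  moreover have "poly Q g = 0" using P p by (simp add: Q_def eval)
  moreover have "Q \<noteq> 0"
  proof
    assume "Q = 0"
    then have "poly (map_poly (\<lambda>q. coeff q i) P) u = 0" for i by (metis Q_def coeff coeff_0)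
    then have "map_poly (\<lambda>q. coeff q i) P = 0" for i using tr memk unfolding alg_def by blast
    then have "coeff (coeff P j) i = 0" for i j
      by (metis coeff_0 coeff_map_poly)
    then have "P = 0" by (intro poly_eqI) (auto intro!: poly_eqI)
    then show False using P0 by simp
  qed
  ultimately show ?thesis unfolding alg_def by blast
qed

text \<open>Applying \<open>d\<close> to \<open>p(u) = 0\<close> gives \<open>p'(u) = 0\<close>, a relation of smaller degree.\<close>

lemma transcendental_if_derivation_1:
  fixes d :: "'a::field_char_0 \<Rightarrow> 'a"
  assumes d: "derivation d" and u: "d u = 1" and p: "p \<in> Polys {x. d x = 0}" "poly p u = 0"
  shows "p = 0"
  using p
proof (induction "degree p" arbitrary: p rule: less_induct)
  case less
  note k = subfield_subring[OF subfield_kernel[OF d]]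
  have *: "poly (pderiv p) u = 0"
    using derivation_poly[OF d, of p u] less.prems map_derivation_kernel[OF d, of p] u derivation_0[OF d]
    by simp
  have "pderiv p = 0"
  proof (cases "degree p = 0")
    case False
    then have "degree (pderiv p) < degree p" by (simp add: degree_pderiv)
    then show ?thesis using less.hyps * Polys_pderiv[OF k less.prems(1)] by blast
  qed (simp add: pderiv_eq_0_iff)
  then obtain a where "p = [:a:]" by (auto simp: pderiv_eq_0_iff elim: degree_eq_zeroE)
  then show ?case using less.prems by simp
qed

text \<open>The values at \<open>u\<close> of the rational functions that vanish at infinity. Logarithmic derivatives
  of rational functions are of this kind, while nonzero constants are not.\<close>

definition proper_fracs :: "'a::field set \<Rightarrow> 'a \<Rightarrow> 'a set" where
  "proper_fracs k u = {poly a u / poly b u | a b. a \<in> Polys k \<and> b \<in> Polys k \<and> b \<noteq> 0 \<and>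
     (a = 0 \<or> degree a < degree b)}"

text \<open>Here \<open>d\<close> restricts to \<open>d/du\<close> on the rational functions of \<open>u\<close>. If the sum were \<open>1\<close>, its trace
  down from a finite extension that contains all \<open>v j\<close> would be the degree of that extension on the
  one hand, and on the other hand a combination of logarithmic derivatives of rational functions of
  \<open>u\<close>, hence a function that vanishes at infinity.\<close>

lemma liouville_aux:
  fixes d :: "'a::field_char_0 \<Rightarrow> 'a"
  assumes d: "derivation d" and u: "d u = 1" and k: "k = {x. d x = 0}" and J: "finite J"
    and v: "\<And>j. j \<in> J \<Longrightarrow> alg (fracs (adjoin k u)) (v j) \<and> v j \<noteq> 0"
    and c: "\<And>j. j \<in> J \<Longrightarrow> c j \<in> k"
  shows "(\<Sum>j\<in>J. c j * (d (v j) / v j)) \<noteq> 1"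
proof
  assume one: "(\<Sum>j\<in>J. c j * (d (v j) / v j)) = 1"
  define B where "B = fracs (adjoin k u)"
  have Rk: "is_subring k" using subfield_subring[OF subfield_kernel[OF d]] k by simp
  note RP = subring_Polys[OF Rk]
  have B: "is_subfield B" unfolding B_def by (intro subfield_fracs subring_adjoin Rk)
  have kB: "k \<subseteq> B"
    unfolding B_def using adjoin_base[OF Rk] fracs_base[OF subring_adjoin[OF Rk]] by blast
  have tr: "p = 0" if "p \<in> Polys k" "poly p u = 0" for p
    using transcendental_if_derivation_1[OF d u] that k by blast
  have dpoly: "d (poly p u) = poly (pderiv p) u" if "p \<in> Polys k" for p
    using derivation_poly[OF d, of p u] that k u map_derivation_kernel[OF d, of p] by simp
  have Bform: "\<exists>p q. p \<in> Polys k \<and> q \<in> Polys k \<and> q \<noteq> 0 \<and> b = poly p u / poly q u" if b: "b \<in> B" for b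
  proof -
    obtain p q where pq: "p \<in> Polys k" "q \<in> Polys k" "b = poly p u / poly q u"
      using b by (auto simp: B_def fracs_def adjoin_def)
    show ?thesis
    proof (cases "q = 0")
      case True
      then show ?thesis using pq RP by (intro exI[of _ 0] exI[of _ 1]) (auto simp: subring_0 subring_1)
    qed (use pq in blast)
  qed
  have dB: "d b \<in> B" if b: "b \<in> B" for b
  proof -
    obtain p q where pq: "p \<in> Polys k" "q \<in> Polys k" "q \<noteq> 0" "b = poly p u / poly q u"
      using Bform[OF b] by blast
    have q0: "poly q u \<noteq> 0" using tr pq by blast
    have "d b = (poly (pderiv p) u * poly q u - poly p u * poly (pderiv q) u) / (poly q u)\<^sup>2"
      using derivation_divide[OF d q0, of "poly p u"] pq by (simp add: dpoly)
    also have "\<dots> = poly (pderiv p * q - p * pderiv q) u / poly (q\<^sup>2) u"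
      by (simp add: poly_power)
    also have "\<dots> \<in> B"
      unfolding B_def using pq RP Rk
      by (intro fracsI adjoinI subring_diff subring_mult subring_power Polys_pderiv)
    finally show ?thesis .
  qed
  let ?m = "proper_fracs k u"
  have m0: "0 \<in> ?m"
    unfolding proper_fracs_def using RP
    by (intro CollectI exI[of _ 0] exI[of _ 1]) (auto simp: subring_0 subring_1)
  have madd: "x + y \<in> ?m" if x: "x \<in> ?m" and y: "y \<in> ?m" for x y
  proof -
    obtain a b where ab: "a \<in> Polys k" "b \<in> Polys k" "b \<noteq> 0" "a = 0 \<or> degree a < degree b"
      "x = poly a u / poly b u" using x by (auto simp: proper_fracs_def)
    obtain e f where ef: "e \<in> Polys k" "f \<in> Polys k" "f \<noteq> 0" "e = 0 \<or> degree e < degree f"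
      "y = poly e u / poly f u" using y by (auto simp: proper_fracs_def)
    have nz: "poly b u \<noteq> 0" "poly f u \<noteq> 0" using tr ab ef by blast+
    have "x + y = poly (a * f + e * b) u / poly (b * f) u"
      unfolding ab(5) ef(5) using nz by (simp add: field_simps)
    moreover have "a * f + e * b = 0 \<or> degree (a * f + e * b) < degree (b * f)"
    proof (cases "a = 0"; cases "e = 0")
      assume "a \<noteq> 0" "e \<noteq> 0"
      then have "degree (a * f) < degree (b * f)" "degree (e * b) < degree (b * f)"
        using ab ef by (auto simp: degree_mult_eq)
      then show ?thesis using degree_add_less by blast
    qed (use ab ef in \<open>auto simp: degree_mult_eq\<close>)
    moreover have "a * f + e * b \<in> Polys k" "b * f \<in> Polys k" "b * f \<noteq> 0"
      using ab ef RP by (auto intro!: subring_add subring_mult)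
    ultimately show ?thesis unfolding proper_fracs_def by blast
  qed
  have mc: "c * x \<in> ?m" if c: "c \<in> k" and x: "x \<in> ?m" for c x
  proof -
    obtain a b where ab: "a \<in> Polys k" "b \<in> Polys k" "b \<noteq> 0" "a = 0 \<or> degree a < degree b"
      "x = poly a u / poly b u" using x by (auto simp: proper_fracs_def)
    have "Polynomial.smult c a = 0 \<or> degree (Polynomial.smult c a) < degree b"
      using ab by auto
    moreover have "c * x = poly (Polynomial.smult c a) u / poly b u" using ab by simp
    ultimately show ?thesis
      using ab Polys_smult[OF Rk c ab(1)] unfolding proper_fracs_def by blast
  qed
  have mpoly: "poly (pderiv p) u / poly p u \<in> ?m" if p: "p \<in> Polys k" "p \<noteq> 0" for p
  proof -
    have "pderiv p = 0 \<or> degree (pderiv p) < degree p"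
      by (cases "degree p = 0") (auto simp: pderiv_eq_0_iff degree_pderiv)
    then show ?thesis using p Polys_pderiv[OF Rk p(1)] unfolding proper_fracs_def by blast
  qed
  have mlog: "d D / D \<in> ?m" if D: "D \<in> B" "D \<noteq> 0" for D
  proof -
    obtain p q where pq: "p \<in> Polys k" "q \<in> Polys k" "q \<noteq> 0" "D = poly p u / poly q u"
      using Bform[OF D(1)] by blast
    have q0: "poly q u \<noteq> 0" and p0: "poly p u \<noteq> 0" and p: "p \<noteq> 0" using tr pq D by auto
    have "d D / D = poly (pderiv p) u / poly p u + (- 1) * (poly (pderiv q) u / poly q u)"
      unfolding pq(4) derivation_divide[OF d q0] dpoly[OF pq(1)] dpoly[OF pq(2)]
      using p0 q0 by (simp add: field_simps power2_eq_square)
    then show ?thesis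
      using madd[OF mpoly[OF pq(1) p] mc[OF _ mpoly[OF pq(2,3)]], of "- 1"]
        subring_uminus[OF Rk subring_1[OF Rk]] by simp
  qed
  obtain M where M: "fdalg B M" "v ` J \<subseteq> M"
    using fdalg_finite_set[OF B, of "v ` J"] J v B_def by auto
  have RM: "is_subring M" and BM: "B \<subseteq> M" and FM: "is_subfield M"
    using M fdalg_subfield[OF B M(1)] by (auto simp: fdalg_def)
  obtain T n where T: "n > 0" "T 1 = of_nat n"
    "\<And>x y. x \<in> M \<Longrightarrow> y \<in> M \<Longrightarrow> T (x + y) = T x + T y"
    "\<And>b x. b \<in> B \<Longrightarrow> x \<in> M \<Longrightarrow> T (b * x) = b * T x"
    "\<And>x. x \<in> M \<Longrightarrow> x \<noteq> 0 \<Longrightarrow> \<exists>D\<in>B. D \<noteq> 0 \<and> T (d x / x) = d D / D"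
    using trace_log_derivative[OF d B dB M(1)] by metis
  have vM: "v j \<in> M" "d (v j) / v j \<in> M" if "j \<in> J" for j
    using that M derivation_maps_fdalg[OF d B dB M(1), of "v j"] by (auto intro!: subfield_divide[OF FM])
  have T0: "T 0 = 0" using T(4)[of 0 0] subring_0[OF subfield_subring[OF B]] BM by auto
  have "(\<Sum>j\<in>I. c j * (d (v j) / v j)) \<in> M \<and> T (\<Sum>j\<in>I. c j * (d (v j) / v j)) \<in> ?m"
    if "I \<subseteq> J" for I
    using finite_subset[OF that J] that
  proof (induction I)
    case empty
    then show ?case using T0 m0 RM by (simp add: subring_0)
  next
    case (insert j I)
    have j: "j \<in> J" "c j \<in> k" "c j \<in> B" using insert c kB by auto
    obtain D where D: "D \<in> B" "D \<noteq> 0" "T (d (v j) / v j) = d D / D"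
      using T(5)[of "v j"] vM[OF j(1)] v j by auto
    have 1: "c j * (d (v j) / v j) \<in> M" using j vM BM by (intro subring_mult[OF RM]) auto
    have "T (c j * (d (v j) / v j)) = c j * (d D / D)"
      using T(4)[OF j(3) vM(2)[OF j(1)]] D by simp
    then have 2: "T (c j * (d (v j) / v j)) \<in> ?m" using mc[OF j(2) mlog[OF D(1,2)]] by simp
    have 3: "(\<Sum>j\<in>I. c j * (d (v j) / v j)) \<in> M" "T (\<Sum>j\<in>I. c j * (d (v j) / v j)) \<in> ?m"
      using insert by auto
    show ?case
      using insert.hyps subring_add[OF RM 1 3(1)] madd[OF 2 3(2)] T(3)[OF 1 3(1)] by simp
  qed
  \<comment> \<open>A nonzero integer is not the value of a proper fraction at the transcendental \<open>u\<close>.\<close>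
  from this[of J] have "of_nat n \<in> ?m" using one T(2) by simp
  then obtain a b where ab: "a \<in> Polys k" "b \<in> Polys k" "b \<noteq> 0" "a = 0 \<or> degree a < degree b"
      "of_nat n = poly a u / poly b u" by (auto simp: proper_fracs_def)
  have "poly b u \<noteq> 0" using tr ab by blast
  then have "poly (Polynomial.smult (of_nat n) b - a) u = 0" using ab(5) by (simp add: field_simps)
  moreover have "Polynomial.smult (of_nat n) b - a \<in> Polys k"
    using ab by (intro subring_diff[OF RP] Polys_smult[OF Rk] subring_of_nat[OF Rk])
  ultimately have "a = Polynomial.smult (of_nat n) b" using tr by fastforce
  moreover have "of_nat n \<noteq> (0::'a)" using T(1) by simp
  ultimately have "degree a = degree b" "a \<noteq> 0" using ab(3) by (simp_all del: of_nat_eq_0_iff)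
  then show False using ab(4) by simp
qed

text \<open>If \<open>d u\<close> is not \<open>0\<close>, then \<open>d/(d u)\<close> is a derivation with the same constants that maps \<open>u\<close> to
  \<open>1\<close>. In particular \<open>u\<close> is transcendental over the constants, and by the exchange property everything
  that is algebraic over \<open>k[g]\<close> is algebraic over \<open>k(u)\<close>. So \<open>liouville_aux\<close> applies.\<close>

theorem liouville_log_derivatives:
  fixes d :: "'a::field_char_0 \<Rightarrow> 'a"
  assumes d: "derivation d" and k: "k = {x. d x = 0}" and J: "finite J"
    and u: "alg (adjoin k g) u"
    and v: "\<And>j. j \<in> J \<Longrightarrow> alg (adjoin k g) (v j) \<and> v j \<noteq> 0"
    and c: "\<And>j. j \<in> J \<Longrightarrow> c j \<in> k"
    and eq: "d u = (\<Sum>j\<in>J. c j * (d (v j) / v j))"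
  shows "d u = 0"
proof (rule ccontr)
  assume du: "d u \<noteq> 0"
  define e where "e x = d x / d u" for x
  have e: "derivation e"
    using d by (auto simp: derivation_def e_def add_divide_distrib)
  have ke: "k = {x. e x = 0}" using du by (auto simp: k e_def)
  have eu: "e u = 1" using du by (simp add: e_def)
  have Rk: "is_subring k" using subfield_subring[OF subfield_kernel[OF d]] k by simp
  have "\<not> alg k u"
    using transcendental_if_derivation_1[OF e eu] ke unfolding alg_def by blast
  then have g: "alg (adjoin k u) g" using exchange[OF Rk u] by blast
  define B where "B = fracs (adjoin k u)"
  have B: "is_subfield B" unfolding B_def by (intro subfield_fracs subring_adjoin Rk)
  have sub: "adjoin k u \<subseteq> B" unfolding B_def by (intro fracs_base subring_adjoin Rk)
  have alB: "is_subfield {x. alg B x}" by (rule subfield_alg[OF B])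
  have "adjoin k g \<subseteq> {x. alg B x}"
  proof (rule adjoin_least)
    show "is_subring {x. alg B x}" by (rule subfield_subring[OF alB])
    show "k \<subseteq> {x. alg B x}" using adjoin_base[OF Rk, of u] sub alg_base[OF subfield_subring[OF B]] by blast
    show "g \<in> {x. alg B x}" using alg_mono[OF sub g] by simp
  qed
  then have v': "alg B (v j)" if "j \<in> J" for j
    using v[OF that] alg_mono alg_trans[OF B] by blast
  have "(\<Sum>j\<in>J. c j * (e (v j) / v j)) = (\<Sum>j\<in>J. c j * (d (v j) / v j)) / d u"
    by (simp add: e_def sum_divide_distrib mult.commute)
  also have "\<dots> = 1" using eq du by simp
  finally show False
    using liouville_aux[OF e eu ke J, of v c] v v' c unfolding B_def by blast
qed

section \<open>Construction of derivations\<close>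

text \<open>A polynomial has finitely many coefficients.\<close>

lemma chain_finite_poly:
  assumes "\<C> \<noteq> {}" "subset.chain \<A> \<C>" "\<And>K. K \<in> \<C> \<Longrightarrow> is_subring K" "p \<in> Polys (\<Union>\<C>)"
  shows "\<exists>K\<in>\<C>. p \<in> Polys K"
proof -
  have "\<exists>K\<in>\<C>. \<forall>i<n. coeff p i \<in> K" for n
  proof (induction n)
    case (Suc n)
    then obtain K where K: "K \<in> \<C>" "\<forall>i<n. coeff p i \<in> K" by blast
    obtain L where L: "L \<in> \<C>" "coeff p n \<in> L" using assms(4) by (auto simp: Polys_def)
    have "K \<subseteq> L \<or> L \<subseteq> K" using assms(2) K L unfolding subset_chain_def by blast
    then show ?case
    proof
      assume "K \<subseteq> L"
      then show ?thesis using K L by (intro bexI[of _ L]) (auto simp: less_Suc_eq)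
    next
      assume "L \<subseteq> K"
      then show ?thesis using K L by (intro bexI[of _ K]) (auto simp: less_Suc_eq)
    qed
  qed (use assms(1) in auto)
  then obtain K where K: "K \<in> \<C>" "\<forall>i<Suc (degree p). coeff p i \<in> K" by blast
  then have "coeff p i \<in> K" for i
    using assms(3)[OF K(1)] by (cases "i \<le> degree p") (auto simp: coeff_eq_0 subring_0)
  then show ?thesis using K by (auto simp: Polys_def)
qed

lemma subring_chain_Union:
  assumes "\<C> \<noteq> {}" "subset.chain \<A> \<C>" "\<And>K. K \<in> \<C> \<Longrightarrow> is_subring K"
  shows "is_subring (\<Union>\<C>)"
  unfolding is_subring_def
proof (intro conjI ballI)
  obtain K0 where K0: "K0 \<in> \<C>" using assms(1) by blast
  then show "0 \<in> \<Union>\<C>" "1 \<in> \<Union>\<C>" using assms(3)[OF K0] by (auto intro: subring_0 subring_1)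
  fix x assume x: "x \<in> \<Union>\<C>"
  then show "- x \<in> \<Union>\<C>" using assms(3) by (auto intro: subring_uminus)
  fix y assume y: "y \<in> \<Union>\<C>"
  obtain K L where KL: "K \<in> \<C>" "L \<in> \<C>" "x \<in> K" "y \<in> L" using x y by blast
  have "K \<subseteq> L \<or> L \<subseteq> K" using assms(2) KL unfolding subset_chain_def by blast
  then obtain N where "N \<in> \<C>" "x \<in> N" "y \<in> N" using KL by blast
  then show "x + y \<in> \<Union>\<C>" "x * y \<in> \<Union>\<C>" using assms(3) by (auto intro: subring_add subring_mult)
qed

text \<open>A maximal subring \<open>K\<close> over which \<open>g\<close> is transcendental exists by Zorn's lemma. If \<open>x\<close> is not in
  \<open>K\<close>, then \<open>g\<close> is algebraic over \<open>K[x]\<close> by maximality, and by the exchange property \<open>x\<close> is algebraic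
  over \<open>K[g]\<close>.\<close>

lemma maximal_transcendental_subring:
  assumes C: "is_subring C" and g: "\<not> alg C g"
  obtains K where "is_subring K" "C \<subseteq> K" "\<not> alg K g" "\<And>x. alg (adjoin K g) x"
proof -
  let ?F = "{K. is_subring K \<and> C \<subseteq> K \<and> \<not> alg K g}"
  have "\<exists>M\<in>?F. \<forall>X\<in>?F. M \<subseteq> X \<longrightarrow> X = M"
  proof (rule subset_Zorn_nonempty)
    show "?F \<noteq> {}" using C g by auto
    fix \<C> assume ne: "\<C> \<noteq> {}" and ch: "subset.chain ?F \<C>"
    then have mem: "K \<in> \<C> \<Longrightarrow> is_subring K \<and> C \<subseteq> K \<and> \<not> alg K g" for K
      unfolding subset_chain_def by blast
    have "\<not> alg (\<Union>\<C>) g"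
      using chain_finite_poly[OF ne ch] mem unfolding alg_def by blast
    then show "\<Union>\<C> \<in> ?F" using subring_chain_Union[OF ne ch] mem ne by auto
  qed
  then obtain K where KF: "K \<in> ?F" and KM: "\<forall>X\<in>?F. K \<subseteq> X \<longrightarrow> X = K"
    by (rule bexE)
  have K: "is_subring K" "C \<subseteq> K" "\<not> alg K g" using KF by simp_all
  have max: "X = K" if "is_subring X" "C \<subseteq> X" "\<not> alg X g" "K \<subseteq> X" for X
    using KM that by simp
  have "alg (adjoin K g) x" for x
  proof (cases "x \<in> K")
    case True
    then show ?thesis using adjoin_base[OF K(1)] by (intro alg_base subring_adjoin K) auto
  next
    case False
    have "adjoin K x \<noteq> K" using False adjoin_gen[OF K(1), of x] by auto
    then have "alg (adjoin K x) g"
      using max[of "adjoin K x"] subring_adjoin[OF K(1)] adjoin_base[OF K(1), of x] K(2) by blast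
    then show ?thesis using exchange[OF K(1)] K(3) by blast
  qed
  then show thesis using that K by blast
qed

text \<open>Derivations that are defined on a part of the field, as graphs, so that extension is inclusion
  and Zorn's lemma applies. By additivity, it is enough to demand a unique value at \<open>0\<close>.\<close>

definition der_graph :: "('a::field \<times> 'a) set \<Rightarrow> bool" where
  "der_graph D \<longleftrightarrow> (\<forall>s. (0, s) \<in> D \<longrightarrow> s = 0) \<and>
     (\<forall>x s. (x, s) \<in> D \<longrightarrow> (- x, - s) \<in> D \<and>
       (\<forall>y t. (y, t) \<in> D \<longrightarrow> (x + y, s + t) \<in> D \<and> (x * y, s * y + x * t) \<in> D))"

lemma der_graphD: assumes D: "der_graph D"
 shows "(0, s) \<in> D \<Longrightarrow> s = 0"
  "(x, s) \<in> D \<Longrightarrow> (- x, - s) \<in> D"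
    and "(x, s) \<in> D \<Longrightarrow> (y, t) \<in> D \<Longrightarrow> (x + y, s + t) \<in> D"
    and "(x, s) \<in> D \<Longrightarrow> (y, t) \<in> D \<Longrightarrow> (x * y, s * y + x * t) \<in> D"
  using D by (simp_all add: der_graph_def)
lemma der_graph_unique: "der_graph D \<Longrightarrow> (x, s) \<in> D \<Longrightarrow> (x, t) \<in> D \<Longrightarrow> s = t"
proof -
  assume D: "der_graph D" and s: "(x, s) \<in> D" and t: "(x, t) \<in> D"
  have "(x + - x, s + - t) \<in> D" by (rule der_graphD(3)[OF D s der_graphD(2)[OF D t]])
  then have "(0, s - t) \<in> D" by simp
  then have "s - t = 0" by (rule der_graphD(1)[OF D])
  then show "s = t" by simp
qed

text \<open>With a minimal polynomial \<open>m\<close> of \<open>e\<close>, the value \<open>s\<close> at \<open>e\<close> has to be the solution of the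
  differentiated equation \<open>m(e) = 0\<close>, and then \<open>p(e)\<close> has to be mapped to \<open>p\<^sup>D(e) + p'(e) s\<close>. This is
  well defined because, up to multiplication by powers of the leading coefficient, every polynomial
  with root \<open>e\<close> is a multiple of \<open>m\<close>.\<close>

lemma der_graph_extend:
  fixes D :: "('a::field_char_0 \<times> 'a) set"
  assumes D: "der_graph D" and one: "(1, 0) \<in> D" and e: "alg (Domain D) e"
  obtains D' where "der_graph D'" "D \<subseteq> D'" "e \<in> Domain D'"
proof -
  define E where "E = Domain D"
  define f where "f x = (SOME s. (x, s) \<in> D)" for x
  have f: "(x, f x) \<in> D" if "x \<in> E" for x
    unfolding f_def by (rule someI_ex) (use that in \<open>simp add: E_def Domain_iff\<close>)
  have f_eq: "f x = s" if "(x, s) \<in> D" for x s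
    using der_graph_unique[OF D f that] DomainI[OF that] by (simp add: E_def)
  have Dneg: "(x, s) \<in> D \<Longrightarrow> (- x, - s) \<in> D"
    and Dadd: "(x, s) \<in> D \<Longrightarrow> (y, t) \<in> D \<Longrightarrow> (x + y, s + t) \<in> D"
    and Dmult: "(x, s) \<in> D \<Longrightarrow> (y, t) \<in> D \<Longrightarrow> (x * y, s * y + x * t) \<in> D" for x y s t
    using der_graphD[OF D] by simp_all
  have zero: "(0, 0) \<in> D" using Dadd[OF one Dneg[OF one]] by simp
  have RE: "is_subring E"
    unfolding is_subring_def E_def
  proof (intro conjI ballI)
    show "0 \<in> Domain D" "1 \<in> Domain D" using zero one by (auto intro: DomainI)
    fix x assume "x \<in> Domain D"
    then obtain s where s: "(x, s) \<in> D" by blast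
    show "- x \<in> Domain D" by (rule DomainI[OF Dneg[OF s]])
    fix y assume "y \<in> Domain D"
    then obtain t where t: "(y, t) \<in> D" by blast
    show "x + y \<in> Domain D" "x * y \<in> Domain D"
      by (rule DomainI[OF Dadd[OF s t]], rule DomainI[OF Dmult[OF s t]])
  qed
  note PE = subring_Polys[OF RE]
  have f0 [simp]: "f 0 = 0" using f_eq[OF zero] .
  have fadd: "f (x + y) = f x + f y" and fmult: "f (x * y) = f x * y + x * f y"
    if "x \<in> E" "y \<in> E" for x y
    by (rule f_eq[OF Dadd[OF f f]] f_eq[OF Dmult[OF f f]]; rule that)+
  have fneg: "f (- x) = - f x" if "x \<in> E" for x by (rule f_eq[OF Dneg[OF f[OF that]]])
  have fsum: "f (sum h I) = (\<Sum>i\<in>I. f (h i))" if "\<And>i. i \<in> I \<Longrightarrow> h i \<in> E" for h :: "nat \<Rightarrow> 'a" and I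
    using that by (induction I rule: infinite_finite_induct) (auto simp: fadd subring_sum[OF RE])
  have fmap [simp]: "coeff (map_poly f p) i = f (coeff p i)" for p i by (rule coeff_map_poly) simp
  have fmap_add: "map_poly f (p + q) = map_poly f p + map_poly f q"
    and fmap_mult: "map_poly f (p * q) = map_poly f p * q + p * map_poly f q"
    if "p \<in> Polys E" "q \<in> Polys E" for p q
    using that
    by (auto intro!: poly_eqI simp: fadd coeff_Polys coeff_mult fsum subring_mult[OF RE] fmult sum.distrib)
  have fmap_neg: "map_poly f (- p) = - map_poly f p" if "p \<in> Polys E" for p
    using that by (auto intro!: poly_eqI simp: fneg coeff_Polys)
  obtain m where m: "m \<in> Polys E" "m \<noteq> 0" "poly m e = 0" and m': "poly (pderiv m) e \<noteq> 0"
    and min: "\<And>q. q \<in> Polys E \<Longrightarrow> q \<noteq> 0 \<Longrightarrow> poly q e = 0 \<Longrightarrow> degree m \<le> degree q"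
    by (rule minimal_polynomial[OF RE e[folded E_def]]) (rule that)
  define s where "s = - poly (map_poly f m) e / poly (pderiv m) e"
  define \<Delta> where "\<Delta> p = poly (map_poly f p) e + poly (pderiv p) e * s" for p
  have \<Delta>_add: "\<Delta> (p + q) = \<Delta> p + \<Delta> q" and \<Delta>_mult: "\<Delta> (p * q) = \<Delta> p * poly q e + poly p e * \<Delta> q"
    if "p \<in> Polys E" "q \<in> Polys E" for p q
    using that by (simp_all add: \<Delta>_def fmap_add fmap_mult pderiv_add pderiv_mult algebra_simps)
  have \<Delta>_neg: "\<Delta> (- p) = - \<Delta> p" if "p \<in> Polys E" for p
    using that by (simp add: \<Delta>_def fmap_neg pderiv_minus)
  have \<Delta>m: "\<Delta> m = 0" using m' by (simp add: \<Delta>_def s_def)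
  \<comment> \<open>Multiplying by the leading coefficient of \<open>m\<close> and subtracting a multiple of \<open>m\<close> lowers the degree.\<close>
  have fun0: "\<Delta> p = 0" if "p \<in> Polys E" "poly p e = 0" for p
    using that
  proof (induction "degree p" arbitrary: p rule: less_induct)
    case less
    show ?case
    proof (cases "p = 0 \<or> degree p < degree m")
      case True
      then have "p = 0" using min[of p] less.prems by fastforce
      then show ?thesis by (simp add: \<Delta>_def)
    next
      case False
      define a where "a = [:lead_coeff m:]"
      define b where "b = monom (lead_coeff p) (degree p - degree m)"
      define q where "q = a * p + - (b * m)"
      have aE: "a \<in> Polys E" and bE: "b \<in> Polys E"
        using m less.prems
        by (auto simp: a_def b_def Polys_pCons[OF RE] Polys_0[OF RE] coeff_Polys intro!: Polys_monom RE)
      have qE: "q \<in> Polys E"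
        using aE bE m less.prems unfolding q_def
        by (intro subring_add[OF PE] subring_mult[OF PE] subring_uminus[OF PE]) auto
      have qe: "poly q e = 0" using m less.prems by (simp add: q_def)
      have "coeff q (degree p) = lead_coeff m * lead_coeff p - lead_coeff p * lead_coeff m"
        using False by (simp add: q_def a_def b_def coeff_monom_mult)
      then have "coeff q (degree p) = 0" by (simp add: mult.commute)
      moreover have "degree q \<le> degree p"
        unfolding q_def a_def b_def using False
        by (intro degree_add_le) (auto intro!: degree_le simp: coeff_monom_mult coeff_eq_0)
      ultimately have "q = 0 \<or> degree q < degree p"
        by (metis eq_zero_or_degree_less)
      then have "\<Delta> q = 0" using less.hyps[OF _ qE qe] by (auto simp: \<Delta>_def)
      moreover have "\<Delta> q = \<Delta> (a * p) + - \<Delta> (b * m)"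
        using \<Delta>_add[OF subring_mult[OF PE aE less.prems(1)] subring_uminus[OF PE subring_mult[OF PE bE m(1)]]]
          \<Delta>_neg[OF subring_mult[OF PE bE m(1)]] by (simp add: q_def)
      moreover have "\<Delta> (b * m) = 0" using \<Delta>_mult[OF bE m(1)] m \<Delta>m by simp
      moreover have "\<Delta> (a * p) = lead_coeff m * \<Delta> p"
        using \<Delta>_mult[OF aE less.prems(1)] less.prems by (simp add: a_def)
      ultimately show ?thesis using m by simp
    qed
  qed
  define D' where "D' = (\<lambda>p. (poly p e, \<Delta> p)) ` Polys E"
  have D'I: "(poly p e, \<Delta> p) \<in> D'" if "p \<in> Polys E" for p using that by (auto simp: D'_def)
  show thesis
  proof
    show "der_graph D'"
      unfolding der_graph_def
    proof (intro conjI allI impI)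
      fix t assume "(0, t) \<in> D'"
      then show "t = 0" using fun0 by (auto simp: D'_def)
    next
      fix x t assume "(x, t) \<in> D'"
      then obtain p where p: "p \<in> Polys E" "x = poly p e" "t = \<Delta> p" by (auto simp: D'_def)
      show "(- x, - t) \<in> D'"
        using D'I[OF subring_uminus[OF PE p(1)]] p by (simp add: \<Delta>_neg)
      fix y r assume "(y, r) \<in> D'"
      then obtain q where q: "q \<in> Polys E" "y = poly q e" "r = \<Delta> q" by (auto simp: D'_def)
      show "(x + y, t + r) \<in> D'" using D'I[OF subring_add[OF PE p(1) q(1)]] p q by (simp add: \<Delta>_add)
      show "(x * y, t * y + x * r) \<in> D'"
        using D'I[OF subring_mult[OF PE p(1) q(1)]] p q by (simp add: \<Delta>_mult)
    qed
    show "D \<subseteq> D'"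
    proof safe
      fix x t assume xt: "(x, t) \<in> D"
      then have "x \<in> E" by (auto simp: E_def)
      then have "[:x:] \<in> Polys E" by (simp add: Polys_pCons[OF RE] Polys_0[OF RE])
      moreover have "map_poly f [:x:] = [:f x:]"
        by (rule poly_eqI) (simp add: coeff_pCons split: nat.splits)
      then have "\<Delta> [:x:] = t" using f_eq[OF xt] by (simp add: \<Delta>_def)
      ultimately show "(x, t) \<in> D'" using D'I[of "[:x:]"] by simp
    qed
    have "[:0, 1:] \<in> Polys E" by (simp add: Polys_pCons[OF RE] Polys_0[OF RE] subring_0[OF RE] subring_1[OF RE])
    then show "e \<in> Domain D'" using D'I[of "[:0, 1:]"] by auto
  qed
qed

text \<open>On \<open>K[g]\<close>, for the maximal subring \<open>K\<close> from \<open>maximal_transcendental_subring\<close>, the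
  derivation is the formal one with respect to \<open>g\<close>. A maximal extension of it is defined everywhere,
  because every element is algebraic over \<open>K[g]\<close>.\<close>

lemma derivation_exists:
  fixes g :: "'a::field_char_0"
  assumes C: "is_subring C" and g: "\<not> alg C g"
  obtains d where "derivation d" "\<And>c. c \<in> C \<Longrightarrow> d c = 0" "d g = 1"
    "\<And>x. alg (adjoin {x. d x = 0} g) x"
proof -
  obtain K where K: "is_subring K" "C \<subseteq> K" "\<not> alg K g" and algK: "\<And>x. alg (adjoin K g) x"
    by (rule maximal_transcendental_subring[OF C g]) (rule that)
  note PK = subring_Polys[OF K(1)]
  define D0 where "D0 = (\<lambda>p. (poly p g, poly (pderiv p) g)) ` Polys K"
  have D0I: "(poly p g, poly (pderiv p) g) \<in> D0" if "p \<in> Polys K" for p using that by (auto simp: D0_def)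
  have D0: "der_graph D0"
    unfolding der_graph_def
  proof (intro conjI allI impI)
    fix t assume "(0, t) \<in> D0"
    then show "t = 0" using K(3) by (auto simp: D0_def alg_def)
  next
    fix x t assume "(x, t) \<in> D0"
    then obtain p where p: "p \<in> Polys K" "x = poly p g" "t = poly (pderiv p) g" by (auto simp: D0_def)
    show "(- x, - t) \<in> D0"
      using D0I[OF subring_uminus[OF PK p(1)]] p by (simp add: pderiv_minus)
    fix y r assume "(y, r) \<in> D0"
    then obtain q where q: "q \<in> Polys K" "y = poly q g" "r = poly (pderiv q) g" by (auto simp: D0_def)
    show "(x + y, t + r) \<in> D0" using D0I[OF subring_add[OF PK p(1) q(1)]] p q by (simp add: pderiv_add)
    show "(x * y, t * y + x * r) \<in> D0"
      using D0I[OF subring_mult[OF PK p(1) q(1)]] p q by (simp add: pderiv_mult algebra_simps)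
  qed
  have D0K: "(x, 0) \<in> D0" if "x \<in> K" for x
    using D0I[of "[:x:]"] that by (simp add: Polys_pCons[OF K(1)] Polys_0[OF K(1)])
  have D0g: "(g, 1) \<in> D0"
    using D0I[of "[:0, 1:]"]
    by (simp add: Polys_pCons[OF K(1)] Polys_0[OF K(1)] subring_0[OF K(1)] subring_1[OF K(1)] pderiv_pCons)
  let ?F = "{D. der_graph D \<and> D0 \<subseteq> D}"
  have "\<exists>M\<in>?F. \<forall>X\<in>?F. M \<subseteq> X \<longrightarrow> X = M"
  proof (rule subset_Zorn_nonempty)
    show "?F \<noteq> {}" using D0 by auto
    fix \<C> assume ne: "\<C> \<noteq> {}" and ch: "subset.chain ?F \<C>"
    then have mem: "der_graph D" "D0 \<subseteq> D" if "D \<in> \<C>" for D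
      using that unfolding subset_chain_def by blast+
    have "der_graph (\<Union>\<C>)"
      unfolding der_graph_def
    proof (intro conjI allI impI)
      fix s assume "(0, s) \<in> \<Union>\<C>"
      then obtain A where "A \<in> \<C>" "(0, s) \<in> A" by (rule UnionE)
      then show "s = 0" by (metis der_graphD(1) mem(1))
    next
      fix x s assume x: "(x, s) \<in> \<Union>\<C>"
      then obtain A where A: "A \<in> \<C>" "(x, s) \<in> A" by (rule UnionE)
      show "(- x, - s) \<in> \<Union>\<C>" by (rule UnionI[OF A(1) der_graphD(2)[OF mem(1)[OF A(1)] A(2)]])
      fix y t assume "(y, t) \<in> \<Union>\<C>"
      then obtain B where B: "B \<in> \<C>" "(y, t) \<in> B" by (rule UnionE)
      have "A \<subseteq> B \<or> B \<subseteq> A" using ch A(1) B(1) unfolding subset_chain_def by simp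
      then obtain N where N: "N \<in> \<C>" "(x, s) \<in> N" "(y, t) \<in> N" using A B by (metis subsetD)
      show "(x + y, s + t) \<in> \<Union>\<C>" "(x * y, s * y + x * t) \<in> \<Union>\<C>"
        by (rule UnionI[OF N(1) der_graphD(3)[OF mem(1)[OF N(1)] N(2,3)]]
            UnionI[OF N(1) der_graphD(4)[OF mem(1)[OF N(1)] N(2,3)]])+
    qed
    then show "\<Union>\<C> \<in> ?F" using mem ne by auto
  qed
  then obtain D where DF: "D \<in> ?F" and DM: "\<forall>X\<in>?F. D \<subseteq> X \<longrightarrow> X = D"
    by (rule bexE)
  have D: "der_graph D" "D0 \<subseteq> D" using DF by simp_all
  have max: "X = D" if "der_graph X" "D0 \<subseteq> X" "D \<subseteq> X" for X
    using DM that by simp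
  have "(1, 0) \<in> D" using D(2) D0K[OF subring_1[OF K(1)]] by (rule subsetD)
  have sub: "adjoin K g \<subseteq> Domain D" using D(2) by (auto simp: adjoin_def D0_def Domain_iff)
  have total: "x \<in> Domain D" for x
  proof -
    have "alg (Domain D) x" using alg_mono[OF sub algK] .
    from der_graph_extend[OF D(1) \<open>(1, 0) \<in> D\<close> this] obtain D' where
      D': "der_graph D'" "D \<subseteq> D'" "x \<in> Domain D'" by blast
    then have "D' = D" using max D(2) by blast
    then show ?thesis using D' by simp
  qed
  define d where "d x = (SOME s. (x, s) \<in> D)" for x
  have d: "(x, d x) \<in> D" for x
    unfolding d_def by (rule someI_ex) (use total[of x] in \<open>simp add: Domain_iff\<close>)
  have d_eq: "d x = s" if "(x, s) \<in> D" for x s using der_graph_unique[OF D(1) d that] .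
  have "derivation d"
    unfolding derivation_def
    using d_eq[OF der_graphD(3)[OF D(1) d d]] d_eq[OF der_graphD(4)[OF D(1) d d]] by simp
  moreover have dK: "d x = 0" if "x \<in> K" for x by (rule d_eq[OF subsetD[OF D(2) D0K[OF that]]])
  moreover have "d g = 1" by (rule d_eq[OF subsetD[OF D(2) D0g]])
  moreover have "alg (adjoin {x. d x = 0} g) x" for x
  proof (rule alg_mono[OF _ algK])
    show "adjoin K g \<subseteq> adjoin {x. d x = 0} g"
      unfolding adjoin_def using dK Polys_mono[of K "{x. d x = 0}"] by blast
  qed
  ultimately show thesis using that[of d] K(2) by blast
qed

section \<open>Logarithmic derivatives of Laurent series\<close>

definition fls_map :: "('a::zero \<Rightarrow> 'b::zero) \<Rightarrow> 'a fls \<Rightarrow> 'b fls" where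
  "fls_map f F = Abs_fls (\<lambda>n. f (fls_nth F n))"

lemma fls_map_nth: "f 0 = 0 \<Longrightarrow> fls_nth (fls_map f F) n = f (fls_nth F n)"
  unfolding fls_map_def
  by (rule nth_Abs_fls_ex_lower_bound) (auto intro!: exI[of _ "fls_subdegree F"])

text \<open>The convolution may run over any range that covers both supports. A common range for several
  products makes them comparable term by term.\<close>

lemma fls_times_nth_bounds:
  fixes F G :: "'a::comm_ring_1 fls"
  assumes "\<And>n. n < a \<Longrightarrow> fls_nth F n = 0" "\<And>n. n < b \<Longrightarrow> fls_nth G n = 0"
  shows "fls_nth (F * G) n = (\<Sum>i=a..n - b. fls_nth F i * fls_nth G (n - i))"
proof -
  let ?h = "\<lambda>i. fls_nth F i * fls_nth G (n - i)"
  let ?A = "{fls_subdegree F..n - fls_subdegree G}" and ?B = "{a..n - b}"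
  have 1: "?h i = 0" if "i \<notin> ?A" for i
    using that by (auto simp: not_le)
  have 2: "?h i = 0" if "i \<notin> ?B" for i
    using that assms by (auto simp: not_le)
  have "fls_nth (F * G) n = sum ?h ?A" by (rule fls_times_nth(2))
  also have "\<dots> = sum ?h (?A \<inter> ?B)" using 2 by (intro sum.mono_neutral_right) auto
  also have "\<dots> = sum ?h ?B" using 1 by (intro sum.mono_neutral_left) auto
  finally show ?thesis .
qed

lemma derivation_fls_map:
  assumes d: "derivation d"
  shows "derivation (fls_map d)"
proof -
  note [simp] = fls_map_nth[of d, OF derivation_0[OF d]] derivation_0[OF d]
  have "fls_map d (F + G) = fls_map d F + fls_map d G" for F G
    by (rule fls_eqI) (simp add: derivation_add[OF d])
  moreover have "fls_map d (F * G) = fls_map d F * G + F * fls_map d G" for F G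
  proof (rule fls_eqI)
    fix n
    note b = fls_times_nth_bounds[where a = "fls_subdegree F" and b = "fls_subdegree G" and n = n]
    show "fls_nth (fls_map d (F * G)) n = fls_nth (fls_map d F * G + F * fls_map d G) n"
      using b[of F G] b[of "fls_map d F" G] b[of F "fls_map d G"]
      by (simp add: derivation_sum[OF d] derivation_mult[OF d] sum.distrib)
  qed
  ultimately show ?thesis by (simp add: derivation_def)
qed

text \<open>The subfield generated by the coefficient field and by the series with coefficients in \<open>C\<close>.\<close>

definition compositum :: "'a::field set \<Rightarrow> 'a fls set" where
  "compositum C = \<Inter>{B. is_subfield B \<and> range fls_const \<subseteq> B \<and> {F. \<forall>n. fls_nth F n \<in> C} \<subseteq> B}"

text \<open>Suppose that the coefficient \<open>g\<close> of the linear term of \<open>U\<close> is not in \<open>C\<close>, and take a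
  derivation \<open>d\<close> of the coefficient field with \<open>d g = 1\<close> that vanishes on \<open>C\<close>. Acting on the
  coefficients, \<open>d\<close> becomes a derivation \<open>\<delta>\<close> of the Laurent series that commutes with the derivative
  of the series, and it kills \<open>q\<close> and the \<open>c j\<close>. So the equation says that
  \<open>\<delta> U - (\<Sum>j\<in>J. c j * \<delta> (V j) / V j)\<close> has derivative \<open>0\<close>, i.e. is a constant series. If the constant
  term of \<open>U\<close> is subtracted and the \<open>V j\<close> are divided by theirs, this constant becomes \<open>0\<close>. All
  elements of the compositum are algebraic over the field generated by \<open>g\<close> and the kernel of \<open>\<delta>\<close>, so
  Liouville's theorem shows that \<open>\<delta> U\<close> is constant, in contradiction to \<open>d g = 1\<close>.\<close>

theorem log_derivative_coefficients:
  fixes C :: "'a::field_char_0 set" and U :: "'a fps" and q :: "'a fls" and V :: "'j \<Rightarrow> 'a fps"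
  assumes C: "is_subfield C" and closed: "\<And>x. alg C x \<Longrightarrow> x \<in> C"
    and J: "finite J" and c: "\<And>j. j \<in> J \<Longrightarrow> c j \<in> C"
    and U: "alg (compositum C) (fps_to_fls U)"
    and V: "\<And>j. j \<in> J \<Longrightarrow> alg (compositum C) (fps_to_fls (V j)) \<and> fps_nth (V j) 0 \<noteq> 0"
    and q: "\<And>n. fls_nth q n \<in> C"
    and eq: "fls_deriv (fps_to_fls U) =
      (\<Sum>j\<in>J. fls_const (c j) * (fls_deriv (fps_to_fls (V j)) / fps_to_fls (V j))) + q"
  shows "fps_nth U 1 \<in> C"
proof (rule ccontr)
  define g where "g = fps_nth U 1"
  assume "fps_nth U 1 \<notin> C"
  then have "\<not> alg C g" using closed g_def by blast
  then obtain d where d: "derivation d" and dC: "\<And>c. c \<in> C \<Longrightarrow> d c = 0" and dg: "d g = 1"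
    and algd: "\<And>x. alg (adjoin {x. d x = 0} g) x"
    using derivation_exists[OF subfield_subring[OF C]] by metis
  define \<delta> where "\<delta> = fls_map d"
  have \<delta>: "derivation \<delta>" unfolding \<delta>_def by (rule derivation_fls_map[OF d])
  have \<delta>_nth [simp]: "fls_nth (\<delta> F) n = d (fls_nth F n)" for F n
    unfolding \<delta>_def by (rule fls_map_nth) (rule derivation_0[OF d])
  have d0 [simp]: "d 0 = 0" by (rule derivation_0[OF d])
  define k where "k = {F. \<delta> F = 0}"
  have kI: "F \<in> k" if "\<And>n. d (fls_nth F n) = 0" for F unfolding k_def using that by (auto intro: fls_eqI)
  have Rk: "is_subring k" unfolding k_def by (rule subfield_subring[OF subfield_kernel[OF \<delta>]])
  define A where "A = {F. alg (fracs (adjoin k (fls_const g))) F}"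
  have Bf: "is_subfield (fracs (adjoin k (fls_const g)))"
    by (intro subfield_fracs subring_adjoin Rk)
  have A: "is_subfield A" unfolding A_def by (rule subfield_alg[OF Bf])
  have sub: "adjoin k (fls_const g) \<subseteq> fracs (adjoin k (fls_const g))"
    by (intro fracs_base subring_adjoin Rk)
  \<comment> \<open>Constant series are algebraic because the coefficient field is algebraic over the subring generated
    by \<open>g\<close> and the kernel of \<open>d\<close>, and series over \<open>C\<close> are killed by \<open>\<delta>\<close>.\<close>
  have "compositum C \<subseteq> A"
  proof -
    have "fls_const x \<in> A" for x
    proof -
      obtain p where p: "p \<in> Polys (adjoin {x. d x = 0} g)" "p \<noteq> 0" "poly p x = 0"
        using algd[of x] by (auto simp: alg_def)
      define P where "P = map_poly fls_const p"
      have cP: "coeff P i = fls_const (coeff p i)" for i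
        unfolding P_def by (rule coeff_map_poly) simp
      have hom: "fls_const (poly r y) = poly (map_poly fls_const r) (fls_const y)" for r :: "'a poly" and y
      proof (induction r)
        case (pCons a r)
        have "map_poly fls_const (pCons a r) = pCons (fls_const a) (map_poly fls_const r)"
          by (rule poly_eqI) (simp add: coeff_map_poly coeff_pCons split: nat.splits)
        then show ?case by (simp add: pCons(2)[symmetric] fls_plus_const fls_const_mult_const)
      qed simp
      have "coeff P i \<in> adjoin k (fls_const g)" for i
      proof -
        obtain r where r: "r \<in> Polys {x. d x = 0}" "coeff p i = poly r g"
          using p(1) by (auto simp: Polys_def adjoin_def)
        have "map_poly fls_const r \<in> Polys k"
          using r by (auto simp: Polys_def coeff_map_poly intro!: kI)
        then show ?thesis unfolding cP r hom by (rule adjoinI)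
      qed
      moreover have "P \<noteq> 0" using p(2) cP by (metis coeff_0 fls_const_eq_0_iff poly_eqI)
      moreover have "poly P (fls_const x) = 0" using hom[of p x] p(3) by (simp add: P_def)
      ultimately have "alg (adjoin k (fls_const g)) (fls_const x)"
        unfolding alg_def Polys_def by blast
      then show ?thesis unfolding A_def using alg_mono[OF sub] by blast
    qed
    moreover have "F \<in> A" if "\<forall>n. fls_nth F n \<in> C" for F
    proof -
      have "F \<in> k" using that dC by (intro kI) auto
      then have "F \<in> fracs (adjoin k (fls_const g))" using adjoin_base[OF Rk] sub by blast
      then show ?thesis unfolding A_def using alg_base[OF subfield_subring[OF Bf]] by blast
    qed
    ultimately show ?thesis using A unfolding compositum_def by blast
  qed
  then have algA: "F \<in> A" if "alg (compositum C) F" for F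
    using alg_mono[OF _ that] alg_trans[OF Bf] unfolding A_def by blast
  have AI: "fls_const x \<in> A" for x
    using \<open>compositum C \<subseteq> A\<close> unfolding compositum_def by blast
  have alg_k: "alg (adjoin k (fls_const g)) F" if "F \<in> A" for F
    using that alg_fracs[OF subring_adjoin[OF Rk]] by (simp add: A_def)
  define u where "u = fps_to_fls U - fls_const (fps_nth U 0)"
  define W where "W j = fps_to_fls (V j)" for j
  define v where "v j = W j / fls_const (fps_nth (V j) 0)" for j
  have uA: "u \<in> A"
    unfolding u_def by (intro subring_diff[OF subfield_subring[OF A]] algA U AI)
  have W0: "W j \<noteq> 0" if "j \<in> J" for j using V[OF that] by (auto simp: W_def)
  have vA: "v j \<in> A" "v j \<noteq> 0" if "j \<in> J" for j
  proof -
    have "W j \<in> A" unfolding W_def using V[OF that] by (intro algA) blast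
    then show "v j \<in> A" unfolding v_def by (rule subfield_divide[OF A _ AI])
    show "v j \<noteq> 0" using W0[OF that] V[OF that] by (simp add: v_def)
  qed
  have comm: "\<delta> (fls_deriv F) = fls_deriv (\<delta> F)" for F
  proof (rule fls_eqI)
    have "d (of_int n) = 0" for n
      by (cases n) (simp_all add: derivation_of_nat[OF d] derivation_uminus[OF d] derivation_diff[OF d] del: of_nat_Suc)
    then show "fls_nth (\<delta> (fls_deriv F)) n = fls_nth (fls_deriv (\<delta> F)) n" for n
      by (simp add: derivation_mult[OF d] del: of_int_add)
  qed
  have \<partial>: "derivation (fls_deriv :: 'a fls \<Rightarrow> 'a fls)"
    by (simp add: derivation_def)
  have \<delta>const: "\<delta> (fls_const x) = fls_const (d x)" for x
    by (rule fls_eqI) simp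
  define X where "X = \<delta> (fps_to_fls U) - (\<Sum>j\<in>J. fls_const (c j) * (\<delta> (W j) / W j))"
  \<comment> \<open>Both sides are mixed second derivatives of a formal logarithm.\<close>
  have swap: "\<delta> (fls_deriv F / F) = fls_deriv (\<delta> F / F)" if "F \<noteq> 0" for F
    by (simp add: derivation_divide[OF \<delta> that] derivation_divide[OF \<partial> that] comm mult.commute)
  have "fls_deriv (\<delta> (fps_to_fls U)) = \<delta> (fls_deriv (fps_to_fls U))" by (simp add: comm)
  also have "\<dots> = (\<Sum>j\<in>J. \<delta> (fls_const (c j) * (fls_deriv (W j) / W j))) + \<delta> q"
    unfolding eq W_def by (simp only: derivation_add[OF \<delta>] derivation_sum[OF \<delta>])
  also have "\<delta> q = 0" by (rule fls_eqI) (simp add: dC q)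
  also have "(\<Sum>j\<in>J. \<delta> (fls_const (c j) * (fls_deriv (W j) / W j))) =
      (\<Sum>j\<in>J. fls_deriv (fls_const (c j) * (\<delta> (W j) / W j)))"
  proof (rule sum.cong[OF refl])
    fix j assume j: "j \<in> J"
    show "\<delta> (fls_const (c j) * (fls_deriv (W j) / W j)) = fls_deriv (fls_const (c j) * (\<delta> (W j) / W j))"
      unfolding derivation_mult[OF \<delta>, of "fls_const (c j)"] derivation_mult[OF \<partial>, of "fls_const (c j)"]
        swap[OF W0[OF j]] \<delta>const dC[OF c[OF j]] by simp
  qed
  finally have "fls_deriv X = 0"
    unfolding X_def by (simp only: derivation_diff[OF \<partial>] derivation_sum[OF \<partial>]) simp
  then obtain r where r: "X = fls_const r" using fls_deriv_eq_0_iff by blast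
  have \<delta>v: "\<delta> (v j) / v j = \<delta> (W j) / W j - fls_const (d (fps_nth (V j) 0) / fps_nth (V j) 0)" if "j \<in> J" for j
  proof -
    define w where "w = fls_const (fps_nth (V j) 0)"
    have w: "w \<noteq> 0" "\<delta> w / w = fls_const (d (fps_nth (V j) 0) / fps_nth (V j) 0)"
      using V[OF that] by (auto simp: w_def \<delta>const fls_const_divide_const)
    have "\<delta> (v j) / v j = \<delta> (W j) / W j - \<delta> w / w"
      unfolding v_def w_def[symmetric] derivation_divide[OF \<delta> w(1)]
      using W0[OF that] w(1) by (simp add: field_simps power2_eq_square)
    then show ?thesis using w(2) by simp
  qed
  have "\<delta> u - (\<Sum>j\<in>J. fls_const (c j) * (\<delta> (v j) / v j)) =
      X - fls_const (d (fps_nth U 0)) +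
      (\<Sum>j\<in>J. fls_const (c j) * fls_const (d (fps_nth (V j) 0) / fps_nth (V j) 0))"
    by (simp add: u_def X_def derivation_diff[OF \<delta>] \<delta>const \<delta>v right_diff_distrib sum_subtractf)
  also have "\<exists>r. \<dots> = fls_const r"
  proof -
    have "(\<Sum>j\<in>I. fls_const (c j) * fls_const (d (fps_nth (V j) 0) / fps_nth (V j) 0)) =
        fls_const (\<Sum>j\<in>I. c j * (d (fps_nth (V j) 0) / fps_nth (V j) 0))" for I
      by (induction I rule: infinite_finite_induct) (auto simp: fls_plus_const)
    then show ?thesis unfolding r by (metis fls_minus_const fls_plus_const)
  qed
  finally obtain r' where r': "\<delta> u - (\<Sum>j\<in>J. fls_const (c j) * (\<delta> (v j) / v j)) = fls_const r'" ..
  have "fls_nth (\<delta> (v j) / v j) 0 = 0" if "j \<in> J" for j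
  proof -
    define v' where "v' = fps_const (inverse (fps_nth (V j) 0)) * V j"
    have v': "v j = fps_to_fls v'" "fps_nth v' 0 = 1"
      using V[OF that]
      by (auto simp: v_def v'_def W_def fls_times_fps_to_fls divide_inverse fls_inverse_const mult.commute)
    define x where "x = Abs_fps (\<lambda>n. d (fps_nth v' n))"
    have "\<delta> (v j) = fps_to_fls x" unfolding v' x_def by (rule fls_eqI) simp
    moreover have "inverse (v j) = fps_to_fls (inverse v')"
      unfolding v' using v'(2) by (intro fls_inverse_fps_to_fls) (simp add: subdegree_eq_0_iff)
    ultimately have "\<delta> (v j) / v j = fps_to_fls (x * inverse v')"
      by (simp add: divide_inverse fls_times_fps_to_fls)
    moreover have "fps_nth x 0 = 0" by (simp add: x_def v' derivation_1[OF d])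
    ultimately show ?thesis by simp
  qed
  moreover have "fls_nth (\<delta> u) 0 = 0" by (simp add: u_def)
  ultimately have "fls_nth (\<delta> u - (\<Sum>j\<in>J. fls_const (c j) * (\<delta> (v j) / v j))) 0 = 0"
    by (simp add: fls_nth_sum del: times_divide_eq_right)
  then have "r' = 0" unfolding r' by simp
  then have "\<delta> u = (\<Sum>j\<in>J. fls_const (c j) * (\<delta> (v j) / v j))" using r' by simp
  moreover have "fls_const (c j) \<in> k" if "j \<in> J" for j using dC c[OF that] by (auto intro!: kI)
  ultimately have "\<delta> u = 0"
    using vA by (intro liouville_log_derivatives[OF \<delta> k_def J alg_k[OF uA], of v "\<lambda>j. fls_const (c j)"] conjI alg_k) auto
  then have "fls_nth (\<delta> u) 1 = 0" by simp
  then show False using dg by (simp add: u_def g_def)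
qed

section \<open>Holomorphic functions of several variables\<close>

lemma topspace_cspace [simp]: "topspace (cspace I) = I \<rightarrow>\<^sub>E UNIV"
  by (simp add: cspace_def)

text \<open>For a finite index set, the topology of the coordinate space is that of the maximum norm; this
  relation gives access to it by \<open>\<epsilon>\<close>-\<open>\<delta>\<close> arguments.\<close>

definition near :: "'i set \<Rightarrow> real \<Rightarrow> ('i \<Rightarrow> complex) \<Rightarrow> ('i \<Rightarrow> complex) \<Rightarrow> bool" where
  "near I e x y \<longleftrightarrow> (\<forall>i\<in>I. dist (y i) (x i) < e)"

lemma near_mono: "near I d x y \<Longrightarrow> d \<le> e \<Longrightarrow> near I e x y"
  unfolding near_def by force

lemma openin_cspace_near:
  assumes I: "finite I"
  shows "openin (cspace I) U \<longleftrightarrow> U \<subseteq> (I \<rightarrow>\<^sub>E UNIV) \<and>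
    (\<forall>x\<in>U. \<exists>e>0. \<forall>y\<in>I \<rightarrow>\<^sub>E UNIV. near I e x y \<longrightarrow> y \<in> U)" (is "?L = ?R")
proof
  assume L: ?L
  show ?R
  proof (intro conjI ballI)
    show "U \<subseteq> I \<rightarrow>\<^sub>E UNIV" using openin_subset[OF L] by simp
    fix x assume x: "x \<in> U"
    have "\<exists>V. finite {i \<in> I. V i \<noteq> topspace euclidean} \<and> (\<forall>i\<in>I. openin euclidean (V i)) \<and>
        x \<in> Pi\<^sub>E I V \<and> Pi\<^sub>E I V \<subseteq> U"
      using L x unfolding cspace_def openin_product_topology_alt by (rule bspec)
    then obtain V where V': "finite {i \<in> I. V i \<noteq> topspace euclidean} \<and> (\<forall>i\<in>I. openin euclidean (V i)) \<and>
        x \<in> Pi\<^sub>E I V \<and> Pi\<^sub>E I V \<subseteq> U" by (rule exE)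
    then have V: "\<And>i. i \<in> I \<Longrightarrow> open (V i)" "x \<in> Pi\<^sub>E I V" "Pi\<^sub>E I V \<subseteq> U"
      by simp_all
    have "\<exists>e>0. ball (x i) e \<subseteq> V i" if "i \<in> I" for i
      using V(1)[OF that] V(2) that by (auto simp: open_contains_ball PiE_def Pi_def)
    then obtain e where e: "\<And>i. i \<in> I \<Longrightarrow> e i > 0 \<and> ball (x i) (e i) \<subseteq> V i" by metis
    define d where "d = Min (insert 1 (e ` I))"
    have d: "d > 0" "\<And>i. i \<in> I \<Longrightarrow> d \<le> e i" using I e by (auto simp: d_def)
    show "\<exists>e>0. \<forall>y\<in>I \<rightarrow>\<^sub>E UNIV. near I e x y \<longrightarrow> y \<in> U"
    proof (intro exI[of _ d] conjI ballI impI d)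
      fix y assume y: "y \<in> I \<rightarrow>\<^sub>E UNIV" "near I d x y"
      have "y i \<in> V i" if "i \<in> I" for i
        using e[OF that] y(2) d(2)[OF that] that by (force simp: near_def dist_commute subset_iff)
      then show "y \<in> U" using y(1) V(3) by (auto simp: PiE_def Pi_def)
    qed
  qed
next
  assume R: ?R
  show ?L unfolding cspace_def openin_product_topology_alt
  proof (intro ballI)
    fix x assume x: "x \<in> U"
    then obtain e where e: "e > 0" "\<And>y. y \<in> I \<rightarrow>\<^sub>E UNIV \<Longrightarrow> near I e x y \<Longrightarrow> y \<in> U" using R by blast
    show "\<exists>V. finite {i \<in> I. V i \<noteq> topspace euclidean} \<and> (\<forall>i\<in>I. openin euclidean (V i)) \<and>
        x \<in> Pi\<^sub>E I V \<and> Pi\<^sub>E I V \<subseteq> U"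
    proof (intro exI[of _ "\<lambda>i. ball (x i) e"] conjI)
      show "x \<in> (\<Pi>\<^sub>E i\<in>I. ball (x i) e)" using x R e(1) by (auto simp: PiE_def Pi_def)
      show "(\<Pi>\<^sub>E i\<in>I. ball (x i) e) \<subseteq> U"
      proof
        fix y assume "y \<in> (\<Pi>\<^sub>E i\<in>I. ball (x i) e)"
        then have "y \<in> I \<rightarrow>\<^sub>E UNIV" "near I e x y"
          by (auto simp: near_def PiE_def Pi_def dist_commute)
        then show "y \<in> U" by (rule e(2))
      qed
    qed (use I in auto)
  qed
qed

lemma continuous_cspace_near:
  fixes f :: "('i \<Rightarrow> complex) \<Rightarrow> complex"
  assumes I: "finite I" and U: "openin (cspace I) U"
  shows "continuous_map (subtopology (cspace I) U) euclidean f \<longleftrightarrow>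
    (\<forall>x\<in>U. \<forall>e>0. \<exists>d>0. \<forall>y\<in>U. near I d x y \<longrightarrow> dist (f y) (f x) < e)" (is "?L = ?R")
proof
  assume L: ?L
  show ?R
  proof (intro ballI allI impI)
    fix x and e :: real assume x: "x \<in> U" and e: "e > 0"
    have "openin (subtopology (cspace I) U) {y \<in> topspace (subtopology (cspace I) U). f y \<in> ball (f x) e}"
      using L by (rule openin_continuous_map_preimage) auto
    then have "openin (cspace I) {y \<in> topspace (subtopology (cspace I) U). f y \<in> ball (f x) e}"
      using U openin_trans_full by blast
    moreover have "x \<in> {y \<in> topspace (subtopology (cspace I) U). f y \<in> ball (f x) e}"
      using x e openin_subset[OF U] by auto
    ultimately obtain d where d: "d > 0" and dd: "\<forall>y\<in>I \<rightarrow>\<^sub>E UNIV. near I d x y \<longrightarrow>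
        y \<in> {y \<in> topspace (subtopology (cspace I) U). f y \<in> ball (f x) e}"
      unfolding openin_cspace_near[OF I] by blast
    show "\<exists>d>0. \<forall>y\<in>U. near I d x y \<longrightarrow> dist (f y) (f x) < e"
    proof (intro exI[of _ d] conjI d ballI impI)
      fix y assume "y \<in> U" "near I d x y"
      then have "f y \<in> ball (f x) e"
        using dd openin_subset[OF U] by auto
      then show "dist (f y) (f x) < e" by (simp add: dist_commute)
    qed
  qed
next
  assume R: ?R
  show ?L
    unfolding continuous_map_def
  proof (intro conjI allI impI)
    fix V :: "complex set" assume "openin euclidean V"
    then have V: "open V" by simp
    have "openin (cspace I) {x \<in> U. f x \<in> V}"
      unfolding openin_cspace_near[OF I]
    proof (intro conjI ballI)
      show "{x \<in> U. f x \<in> V} \<subseteq> I \<rightarrow>\<^sub>E UNIV" using openin_subset[OF U] by auto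
      fix x assume "x \<in> {x \<in> U. f x \<in> V}"
      then have x: "x \<in> U" "f x \<in> V" by auto
      obtain e where e: "e > 0" "ball (f x) e \<subseteq> V" using V x by (auto simp: open_contains_ball)
      obtain d1 where d1: "d1 > 0" "\<And>y. y \<in> U \<Longrightarrow> near I d1 x y \<Longrightarrow> dist (f y) (f x) < e"
        using R x e by blast
      obtain d2 where d2: "d2 > 0" "\<And>y. y \<in> I \<rightarrow>\<^sub>E UNIV \<Longrightarrow> near I d2 x y \<Longrightarrow> y \<in> U"
        using U x unfolding openin_cspace_near[OF I] by blast
      show "\<exists>e>0. \<forall>y\<in>I \<rightarrow>\<^sub>E UNIV. near I e x y \<longrightarrow> y \<in> {x \<in> U. f x \<in> V}"
      proof (intro exI[of _ "min d1 d2"] conjI ballI impI)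
        fix y assume y: "y \<in> I \<rightarrow>\<^sub>E UNIV" "near I (min d1 d2) x y"
        have "y \<in> U" using d2(2)[OF y(1)] near_mono[OF y(2)] by simp
        moreover have "dist (f y) (f x) < e" using d1(2)[OF calculation] near_mono[OF y(2)] by simp
        ultimately show "y \<in> {x \<in> U. f x \<in> V}" using e(2) by (auto simp: dist_commute)
      qed (use d1 d2 in auto)
    qed
    moreover have "{x \<in> topspace (subtopology (cspace I) U). f x \<in> V} = {x \<in> U. f x \<in> V} \<inter> U"
      using openin_subset[OF U] by auto
    ultimately show "openin (subtopology (cspace I) U) {x \<in> topspace (subtopology (cspace I) U). f x \<in> V}"
      unfolding openin_subtopology by blast
  qed auto
qed

lemma mholomorphicD:
  assumes I: "finite I" and f: "mholomorphic_on I U f"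
  shows "U \<subseteq> I \<rightarrow>\<^sub>E UNIV"
    and "\<And>x. x \<in> U \<Longrightarrow> \<exists>e>0. \<forall>y\<in>I \<rightarrow>\<^sub>E UNIV. near I e x y \<longrightarrow> y \<in> U"
    and "\<And>x e. x \<in> U \<Longrightarrow> e > 0 \<Longrightarrow> \<exists>d>0. \<forall>y\<in>U. near I d x y \<longrightarrow> dist (f y) (f x) < e"
    and "\<And>x i. x \<in> U \<Longrightarrow> i \<in> I \<Longrightarrow> (\<lambda>w. f (x(i := w))) field_differentiable (at (x i))"
  using f continuous_cspace_near[OF I, of U f] openin_cspace_near[OF I, of U]
  unfolding mholomorphic_on_def by blast+

lemma mholomorphicI:
  assumes I: "finite I" and U: "openin (cspace I) U"
    and "\<And>x e. x \<in> U \<Longrightarrow> e > 0 \<Longrightarrow> \<exists>d>0. \<forall>y\<in>U. near I d x y \<longrightarrow> dist (f y) (f x) < e"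
    and "\<And>x i. x \<in> U \<Longrightarrow> i \<in> I \<Longrightarrow> (\<lambda>w. f (x(i := w))) field_differentiable (at (x i))"
  shows "mholomorphic_on I U f"
  using assms continuous_cspace_near[OF I U, of f] unfolding mholomorphic_on_def by blast

lemma mholomorphic_continuous_near:
  assumes I: "finite I" and f: "mholomorphic_on I U f" and x: "x \<in> U" and e: "e > 0"
  obtains d where "d > 0"
    "\<And>y. y \<in> I \<rightarrow>\<^sub>E UNIV \<Longrightarrow> near I d x y \<Longrightarrow> y \<in> U \<and> dist (f y) (f x) < e"
proof -
  obtain d1 where d1: "d1 > 0" "\<And>y. y \<in> U \<Longrightarrow> near I d1 x y \<Longrightarrow> dist (f y) (f x) < e"
    using mholomorphicD(3)[OF I f x e] by blast
  obtain d2 where d2: "d2 > 0" "\<And>y. y \<in> I \<rightarrow>\<^sub>E UNIV \<Longrightarrow> near I d2 x y \<Longrightarrow> y \<in> U"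
    using mholomorphicD(2)[OF I f x] by blast
  show thesis
    by (rule that[of "min d1 d2"]) (use d1 d2 in \<open>auto simp: near_mono\<close>)
qed

definition pd :: "(('i \<Rightarrow> complex) \<Rightarrow> complex) \<Rightarrow> 'i \<Rightarrow> ('i \<Rightarrow> complex) \<Rightarrow> complex" where
  "pd f i x = deriv (\<lambda>w. f (x(i := w))) (x i)"

lemma PiE_upd: "x \<in> I \<rightarrow>\<^sub>E UNIV \<Longrightarrow> i \<in> I \<Longrightarrow> x(i := w) \<in> I \<rightarrow>\<^sub>E (UNIV :: complex set)"
  by (auto simp: PiE_def extensional_def)

lemma slice_derivative:
  assumes I: "finite I" and f: "mholomorphic_on I U f" and i: "i \<in> I" and x: "x(i := w) \<in> U"
  shows "((\<lambda>w. f (x(i := w))) has_field_derivative pd f i (x(i := w))) (at w)"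
proof -
  have "(\<lambda>v. f (x(i := w, i := v))) field_differentiable (at ((x(i := w)) i))"
    by (rule mholomorphicD(4)[OF I f x i])
  then show ?thesis by (simp add: pd_def field_differentiable_derivI)
qed

lemma slice_holomorphic:
  assumes I: "finite I" and f: "mholomorphic_on I U f" and i: "i \<in> I"
    and S: "\<And>w. w \<in> S \<Longrightarrow> x(i := w) \<in> U"
  shows "(\<lambda>w. f (x(i := w))) holomorphic_on S"
  unfolding holomorphic_on_def
  using slice_derivative[OF I f i S] field_differentiable_at_within field_differentiable_def by blast

text \<open>A form of the tube lemma: it makes a function close to its values on a slice, uniformly for
  the slice coordinate in a compact set.\<close>

lemma slice_uniform:
  assumes I: "finite I" and f: "mholomorphic_on I U f" and k: "k \<in> I" and a: "a \<in> U"
    and K: "compact K" "\<And>w. w \<in> K \<Longrightarrow> a(k := w) \<in> U" and e: "e > 0"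
  obtains d where "d > 0"
    "\<And>y w. y \<in> I \<rightarrow>\<^sub>E UNIV \<Longrightarrow> near I d a y \<Longrightarrow> w \<in> K \<Longrightarrow>
       y(k := w) \<in> U \<and> dist (f (y(k := w))) (f (a(k := w))) < e"
proof -
  have "\<exists>d>0. \<forall>y\<in>I \<rightarrow>\<^sub>E UNIV. near I d (a(k := w)) y \<longrightarrow> y \<in> U \<and> dist (f y) (f (a(k := w))) < e / 2"
    if "w \<in> K" for w
    using mholomorphic_continuous_near[OF I f K(2)[OF that], of "e / 2"] e by (metis half_gt_zero)
  then obtain D where D: "\<And>w. w \<in> K \<Longrightarrow> D w > 0"
    "\<And>w y. w \<in> K \<Longrightarrow> y \<in> I \<rightarrow>\<^sub>E UNIV \<Longrightarrow> near I (D w) (a(k := w)) y \<Longrightarrow>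
      y \<in> U \<and> dist (f y) (f (a(k := w))) < e / 2" by metis
  obtain C where C: "C \<subseteq> K" "finite C" "K \<subseteq> (\<Union>w\<in>C. ball w (D w))"
    using compactE_image[OF K(1), of K "\<lambda>w. ball w (D w)"] D(1)
    by (metis (no_types, lifting) UN_I centre_in_ball open_ball subsetI)
  define d where "d = Min (insert 1 (D ` C))"
  have d: "d > 0" "\<And>w. w \<in> C \<Longrightarrow> d \<le> D w" using C D(1) by (auto simp: d_def)
  have aI: "a \<in> I \<rightarrow>\<^sub>E UNIV" using mholomorphicD(1)[OF I f] a by blast
  show thesis
  proof (rule that[OF d(1)])
    fix y w assume y: "y \<in> I \<rightarrow>\<^sub>E UNIV" "near I d a y" and w: "w \<in> K"
    obtain c where c: "c \<in> C" "dist c w < D c" using C(3) w by auto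
    have cK: "c \<in> K" using c C by auto
    have "near I (D c) (a(k := c)) (y(k := w))" "near I (D c) (a(k := c)) (a(k := w))"
      using y(2) c d(2)[OF c(1)] D(1)[OF cK] by (force simp: near_def dist_commute)+
    from D(2)[OF cK PiE_upd[OF y(1) k] this(1)] D(2)[OF cK PiE_upd[OF aI k] this(2)]
    show "y(k := w) \<in> U \<and> dist (f (y(k := w))) (f (a(k := w))) < e"
      using dist_triangle_half_l by blast
  qed
qed

text \<open>By Cauchy's estimate, the derivatives of two nearby slices differ by little on a disc on which
  the slices themselves are uniformly close.\<close>

lemma pd_continuous:
  assumes I: "finite I" and f: "mholomorphic_on I U f" and k: "k \<in> I" and a: "a \<in> U" and e: "e > 0"
  shows "\<exists>d>0. \<forall>y\<in>U. near I d a y \<longrightarrow> dist (pd f k y) (pd f k a) < e"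
proof -
  have aI: "a \<in> I \<rightarrow>\<^sub>E UNIV" using mholomorphicD(1)[OF I f] a by blast
  obtain r where r: "r > 0" "\<And>y. y \<in> I \<rightarrow>\<^sub>E UNIV \<Longrightarrow> near I r a y \<Longrightarrow> y \<in> U"
    using mholomorphicD(2)[OF I f a] by blast
  \<comment> \<open>The disc of radius \<open>s\<close> around \<open>y k\<close> has to lie in the disc of radius \<open>2 * s\<close> around \<open>a k\<close>,
    on which the slices are compared.\<close>
  define s where "s = r / 4"
  have s: "s > 0" using r by (simp add: s_def)
  let ?K = "cball (a k) (2 * s)"
  have K: "a(k := w) \<in> U" if "w \<in> ?K" for w
  proof (rule r(2)[OF PiE_upd[OF aI k]])
    have "dist w (a k) < r" using that r(1) by (simp add: s_def dist_commute)
    then show "near I r a (a(k := w))" using r(1) by (simp add: near_def)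
  qed
  \<comment> \<open>Cauchy's estimate then bounds the difference of the derivatives by \<open>e / 4\<close>.\<close>
  define B where "B = e * s / 4"
  have B: "B > 0" using e s by (simp add: B_def)
  obtain d1 where d1: "d1 > 0" "\<And>y w. y \<in> I \<rightarrow>\<^sub>E UNIV \<Longrightarrow> near I d1 a y \<Longrightarrow> w \<in> ?K \<Longrightarrow>
       y(k := w) \<in> U \<and> dist (f (y(k := w))) (f (a(k := w))) < B"
    using slice_uniform[OF I f k a compact_cball K B] by blast
  let ?h = "\<lambda>w. f (a(k := w))"
  have hol_a: "?h holomorphic_on ball (a k) (2 * s)"
    by (rule slice_holomorphic[OF I f k]) (auto intro!: K)
  have "continuous (at (a k)) (deriv ?h)"
    using holomorphic_on_imp_continuous_on[OF holomorphic_deriv[OF hol_a open_ball]] s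
    by (simp add: continuous_on_eq_continuous_at)
  then obtain d2 where d2: "d2 > 0" "\<And>w. dist w (a k) < d2 \<Longrightarrow> dist (deriv ?h w) (deriv ?h (a k)) < e / 2"
    using e unfolding continuous_at_eps_delta by (metis half_gt_zero)
  show ?thesis
  proof (intro exI[of _ "Min {d1, d2, s}"] conjI ballI impI)
    show "Min {d1, d2, s} > 0" using d1 d2 s by auto
    fix y assume y: "y \<in> U" "near I (Min {d1, d2, s}) a y"
    have yI: "y \<in> I \<rightarrow>\<^sub>E UNIV" using mholomorphicD(1)[OF I f] y by blast
    have n: "near I d1 a y" "dist (y k) (a k) < d2" "dist (y k) (a k) < s"
      using y(2) k by (auto simp: near_def)
    let ?g = "\<lambda>w. f (y(k := w))"
    have sub: "cball (y k) s \<subseteq> ?K"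
    proof
      fix w assume "w \<in> cball (y k) s"
      then show "w \<in> ?K"
        using n(3) dist_triangle[of "a k" w "y k"] by (simp add: dist_commute)
    qed
    have sub': "ball (y k) s \<subseteq> ball (a k) (2 * s)"
    proof
      fix w assume "w \<in> ball (y k) s"
      then show "w \<in> ball (a k) (2 * s)"
        using n(3) dist_triangle[of "a k" w "y k"] by (simp add: dist_commute)
    qed
    have gK: "?g holomorphic_on cball (y k) s"
      using sub by (intro slice_holomorphic[OF I f k]) (use d1(2)[OF yI n(1)] in blast)
    have hK: "?h holomorphic_on cball (y k) s"
      using sub by (intro slice_holomorphic[OF I f k]) (use K in blast)
    have gb: "?g holomorphic_on ball (y k) s" and hb: "?h holomorphic_on ball (y k) s"
      using gK hK by (auto intro: holomorphic_on_subset)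
    have "cmod ((deriv ^^ 1) (\<lambda>w. ?g w - ?h w) (y k)) \<le> fact 1 * B / s ^ 1"
    proof (rule Cauchy_inequality[OF _ _ s])
      show "(\<lambda>w. ?g w - ?h w) holomorphic_on ball (y k) s"
        using gb hb by (intro holomorphic_intros)
      show "continuous_on (cball (y k) s) (\<lambda>w. ?g w - ?h w)"
        using gK hK by (intro continuous_intros holomorphic_on_imp_continuous_on)
      fix w assume "cmod (y k - w) = s"
      then have "w \<in> ?K" using sub by (auto simp: dist_norm)
      then show "cmod (?g w - ?h w) \<le> B" using d1(2)[OF yI n(1)] by (force simp: dist_norm)
    qed
    moreover have "deriv (\<lambda>w. ?g w - ?h w) (y k) = deriv ?g (y k) - deriv ?h (y k)"
      using gb hb s by (intro deriv_diff) (auto simp: holomorphic_on_imp_differentiable_at)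
    ultimately have "dist (deriv ?g (y k)) (deriv ?h (y k)) \<le> B / s" by (simp add: dist_norm)
    also have "B / s = e / 4" using s by (simp add: B_def)
    finally have "dist (deriv ?g (y k)) (deriv ?h (y k)) < e / 2" using e by simp
    moreover have "dist (deriv ?h (y k)) (deriv ?h (a k)) < e / 2" using d2(2)[OF n(2)] .
    ultimately show "dist (pd f k y) (pd f k a) < e"
      unfolding pd_def using dist_triangle_half_r dist_commute by (metis dist_triangle_half_l)
  qed
qed

lemma continuous_on_curve:
  fixes \<gamma> :: "'t::metric_space \<Rightarrow> 'i \<Rightarrow> complex"
  assumes I: "finite I" and U: "U \<subseteq> I \<rightarrow>\<^sub>E UNIV"
    and f: "\<And>x e. x \<in> U \<Longrightarrow> e > 0 \<Longrightarrow> \<exists>d>0. \<forall>y\<in>U. near I d x y \<longrightarrow> dist (f y) (f x) < e"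
    and \<gamma>: "\<And>t. t \<in> T \<Longrightarrow> \<gamma> t \<in> U" "\<And>i. i \<in> I \<Longrightarrow> continuous_on T (\<lambda>t. \<gamma> t i)"
  shows "continuous_on T (\<lambda>t. f (\<gamma> t) :: complex)"
  unfolding continuous_on_iff
proof (intro ballI allI impI)
  fix t and e :: real assume t: "t \<in> T" and e: "e > 0"
  obtain d where d: "d > 0" "\<And>y. y \<in> U \<Longrightarrow> near I d (\<gamma> t) y \<Longrightarrow> dist (f y) (f (\<gamma> t)) < e"
    using f[OF \<gamma>(1)[OF t] e] by blast
  have "\<exists>r>0. \<forall>s\<in>T. dist s t < r \<longrightarrow> dist (\<gamma> s i) (\<gamma> t i) < d" if "i \<in> I" for i
    using \<gamma>(2)[OF that] t d(1) unfolding continuous_on_iff by blast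
  then obtain r where r: "\<And>i. i \<in> I \<Longrightarrow> r i > 0"
    "\<And>i s. i \<in> I \<Longrightarrow> s \<in> T \<Longrightarrow> dist s t < r i \<Longrightarrow> dist (\<gamma> s i) (\<gamma> t i) < d" by metis
  define q where "q = Min (insert 1 (r ` I))"
  have q: "q > 0" "\<And>i. i \<in> I \<Longrightarrow> q \<le> r i" using I r(1) by (auto simp: q_def)
  show "\<exists>d>0. \<forall>x'\<in>T. dist x' t < d \<longrightarrow> dist (f (\<gamma> x')) (f (\<gamma> t)) < e"
  proof (intro exI[of _ q] conjI q ballI impI)
    fix s assume "s \<in> T" "dist s t < q"
    then show "dist (f (\<gamma> s)) (f (\<gamma> t)) < e"
      using r(2) q(2) \<gamma>(1) by (intro d(2)) (force simp: near_def)+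
  qed
qed

text \<open>In the direction of the variable \<open>k\<close> itself, this is the theorem in one variable. In the
  direction of another variable, \<open>pd f k\<close> is a locally uniform limit of the difference quotients of \<open>f\<close>
  in the variable \<open>k\<close>, which are holomorphic. The limit is uniform because \<open>pd f k\<close> is continuous.\<close>

lemma mholomorphic_pd:
  assumes I: "finite I" and f: "mholomorphic_on I U f" and k: "k \<in> I"
  shows "mholomorphic_on I U (pd f k)"
proof (rule mholomorphicI[OF I])
  show "openin (cspace I) U" using f by (simp add: mholomorphic_on_def)
  show cont: "\<exists>d>0. \<forall>y\<in>U. near I d x y \<longrightarrow> dist (pd f k y) (pd f k x) < e" if "x \<in> U" "e > 0" for x e
    by (rule pd_continuous[OF I f k that])
  fix x j assume x: "x \<in> U" and j: "j \<in> I"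
  have xI: "x \<in> I \<rightarrow>\<^sub>E UNIV" using mholomorphicD(1)[OF I f] x by blast
  obtain r where r: "r > 0" "\<And>y. y \<in> I \<rightarrow>\<^sub>E UNIV \<Longrightarrow> near I r x y \<Longrightarrow> y \<in> U"
    using mholomorphicD(2)[OF I f x] by blast
  define s where "s = r / 2"
  have s: "s > 0" "s < r" using r by (auto simp: s_def)
  have inU: "x(j := w, k := z) \<in> U" "x(j := w) \<in> U"
    if "w \<in> cball (x j) s" "z \<in> cball (x k) s" for w z
  proof -
    have "dist w (x j) < r" "dist z (x k) < r" using that s by (auto simp: dist_commute)
    then show "x(j := w, k := z) \<in> U" "x(j := w) \<in> U"
      using r(1) by (intro r(2) PiE_upd xI j k; simp add: near_def)+
  qed
  show "(\<lambda>w. pd f k (x(j := w))) field_differentiable at (x j)"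
  proof (cases "j = k")
    case True
    have "(\<lambda>w. f (x(k := w))) holomorphic_on ball (x k) s"
      using inU(2)[of _ "x k"] True s by (intro slice_holomorphic[OF I f k]) auto
    then have "deriv (\<lambda>w. f (x(k := w))) holomorphic_on ball (x k) s"
      by (intro holomorphic_deriv) auto
    then show ?thesis
      using s True by (auto simp: pd_def holomorphic_on_imp_differentiable_at)
  next
    case False
    let ?S = "ball (x j) s"
    \<comment> \<open>Any null sequence of nonzero increments that stay in the disc will do.\<close>
    define \<eta> where "\<eta> n = complex_of_real (s / (real n + 2))" for n
    have h: "cmod (\<eta> n) < s" "\<eta> n \<noteq> 0" for n
    proof -
      have "\<bar>s / (real n + 2)\<bar> < s" "s / (real n + 2) \<noteq> 0" using s by (auto simp: field_simps add_pos_nonneg)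
      then show "cmod (\<eta> n) < s" "\<eta> n \<noteq> 0" by (simp_all only: \<eta>_def norm_of_real of_real_eq_0_iff not_False_eq_True)
    qed
    let ?q = "\<lambda>n w. (f (x(j := w, k := x k + \<eta> n)) - f (x(j := w))) / \<eta> n"
    have "(\<lambda>w. pd f k (x(j := w))) holomorphic_on ?S"
    proof (rule holomorphic_uniform_sequence[OF open_ball])
      fix n
      have "(\<lambda>w. f ((x(k := x k + \<eta> n))(j := w))) holomorphic_on ?S"
      proof (rule slice_holomorphic[OF I f j])
        fix w assume "w \<in> ?S"
        then have "x(j := w, k := x k + \<eta> n) \<in> U" using h[of n] by (intro inU) (auto simp: dist_norm)
        then show "x(k := x k + \<eta> n, j := w) \<in> U" using False by (simp add: fun_upd_twist)
      qed
      moreover have "(\<lambda>w. f (x(j := w))) holomorphic_on ?S"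
        using s by (intro slice_holomorphic[OF I f j] inU(2)[of _ "x k"]) auto
      ultimately show "?q n holomorphic_on ?S"
        using h(2)[of n] False by (auto simp: fun_upd_twist intro!: holomorphic_intros)
    next
      fix w0 assume "w0 \<in> ?S"
      then obtain d where d: "d > 0" "cball w0 d \<subseteq> ?S"
        using open_contains_cball by (metis open_ball)
      have "uniform_limit ?S ?q (\<lambda>w. pd f k (x(j := w))) sequentially"
      proof (rule uniform_limitI)
        fix e :: real assume e: "e > 0"
        let ?H = "\<lambda>p. pd f k (x(j := fst p, k := snd p))"
        have "continuous_on (cball (x j) s \<times> cball (x k) s) ?H"
        proof (rule continuous_on_curve[OF I mholomorphicD(1)[OF I f] cont])
          show "x(j := fst p, k := snd p) \<in> U" if "p \<in> cball (x j) s \<times> cball (x k) s" for p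
            using inU that by auto
          show "continuous_on (cball (x j) s \<times> cball (x k) s) (\<lambda>p. (x(j := fst p, k := snd p)) i)" for i
            by (cases "i = k"; cases "i = j") (auto intro!: continuous_intros)
        qed
        then have "uniformly_continuous_on (cball (x j) s \<times> cball (x k) s) ?H"
          by (intro compact_uniformly_continuous compact_Times compact_cball)
        then obtain \<delta> where \<delta>: "\<delta> > 0" "\<And>p q. p \<in> cball (x j) s \<times> cball (x k) s \<Longrightarrow>
            q \<in> cball (x j) s \<times> cball (x k) s \<Longrightarrow> dist q p < \<delta> \<Longrightarrow> dist (?H q) (?H p) < e / 2"
          using e unfolding uniformly_continuous_on_def by (metis half_gt_zero)
        have "(\<lambda>n. s / (real n + 2)) \<longlonglongrightarrow> 0" by real_asymp
        then have "\<eta> \<longlonglongrightarrow> complex_of_real 0" unfolding \<eta>_def by (rule tendsto_of_real)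
        then have "eventually (\<lambda>n. dist (\<eta> n) 0 < \<delta>) sequentially"
          using \<delta>(1) by (simp add: tendsto_iff)
        then show "eventually (\<lambda>n. \<forall>w\<in>?S. dist (?q n w) (pd f k (x(j := w))) < e) sequentially"
        proof eventually_elim
          case (elim n)
          show ?case
          proof
            fix w assume w: "w \<in> ?S"
            let ?c = "pd f k (x(j := w))"
            let ?F = "\<lambda>z. f (x(j := w, k := z)) - z * ?c"
            have "norm (?F (x k + \<eta> n) - ?F (x k)) \<le> e / 2 * norm (x k + \<eta> n - x k)"
            proof (rule field_differentiable_bound)
              show "convex (cball (x k) (cmod (\<eta> n)))" by simp
              fix z assume z: "z \<in> cball (x k) (cmod (\<eta> n))"
              then have zs: "z \<in> cball (x k) s" using h(1)[of n] by auto
              have U: "x(j := w, k := z) \<in> U" using w zs by (intro inU) auto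
              show "(?F has_field_derivative (pd f k (x(j := w, k := z)) - ?c)) (at z within cball (x k) (cmod (\<eta> n)))"
                by (rule has_field_derivative_at_within)
                   (auto intro!: derivative_eq_intros slice_derivative[OF I f k U])
              have "dist (?H (w, z)) (?H (w, x k)) < e / 2"
                using w zs z elim s by (intro \<delta>(2)) (auto simp: dist_prod_def dist_commute)
              then show "norm (pd f k (x(j := w, k := z)) - ?c) \<le> e / 2"
                using False by (simp add: dist_norm fun_upd_twist[of j k] fun_upd_idem)
            qed (auto simp: dist_norm)
            moreover have "?F (x k) = f (x(j := w)) - x k * ?c"
              using False by (simp add: fun_upd_idem)
            ultimately have "cmod (f (x(j := w, k := x k + \<eta> n)) - f (x(j := w)) - \<eta> n * ?c) \<le> e / 2 * cmod (\<eta> n)"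
              by (simp add: algebra_simps)
            moreover have "?q n w - ?c = (f (x(j := w, k := x k + \<eta> n)) - f (x(j := w)) - \<eta> n * ?c) / \<eta> n"
              using h(2)[of n] by (simp add: field_simps)
            ultimately have "cmod (?q n w - ?c) \<le> e / 2"
              using h(2)[of n] by (simp only: norm_divide) (simp add: divide_simps)
            then show "dist (?q n w) ?c < e" using e by (simp add: dist_norm)
          qed
        qed
      qed
      then show "\<exists>d>0. cball w0 d \<subseteq> ?S \<and> uniform_limit (cball w0 d) ?q (\<lambda>w. pd f k (x(j := w))) sequentially"
        using d by (meson uniform_limit_on_subset)
    qed
    then show ?thesis using s by (auto simp: holomorphic_on_imp_differentiable_at)
  qed
qed

section \<open>Chain rule and Wirtinger derivatives\<close>

text \<open>Moving from \<open>a\<close> to \<open>y\<close> one coordinate at a time, the increments are controlled by the partial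
  derivatives, which are continuous at \<open>a\<close>.\<close>

lemma first_order_expansion:
  assumes I: "finite I" and f: "mholomorphic_on I U f" and a: "a \<in> U" and e: "e > 0"
  shows "\<exists>d>0. \<forall>y\<in>I \<rightarrow>\<^sub>E UNIV. near I d a y \<longrightarrow> y \<in> U \<and>
      cmod (f y - f a - (\<Sum>i\<in>I. pd f i a * (y i - a i))) \<le> e * (\<Sum>i\<in>I. cmod (y i - a i))"
proof -
  have aI: "a \<in> I \<rightarrow>\<^sub>E UNIV" using mholomorphicD(1)[OF I f] a by blast
  have "\<exists>d>0. \<forall>y\<in>I \<rightarrow>\<^sub>E UNIV. near I d a y \<longrightarrow> y \<in> U \<and> dist (pd f i y) (pd f i a) < e" if "i \<in> I" for i
    using mholomorphic_continuous_near[OF I mholomorphic_pd[OF I f that] a e] by metis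
  then obtain D where D: "\<And>i. i \<in> I \<Longrightarrow> D i > 0"
    "\<And>i y. i \<in> I \<Longrightarrow> y \<in> I \<rightarrow>\<^sub>E UNIV \<Longrightarrow> near I (D i) a y \<Longrightarrow>
      y \<in> U \<and> dist (pd f i y) (pd f i a) < e" by metis
  obtain d0 where d0: "d0 > 0" "\<And>y. y \<in> I \<rightarrow>\<^sub>E UNIV \<Longrightarrow> near I d0 a y \<Longrightarrow> y \<in> U"
    using mholomorphicD(2)[OF I f a] by blast
  define d where "d = Min (insert d0 (D ` I))"
  have d: "d > 0" "d \<le> d0" "\<And>i. i \<in> I \<Longrightarrow> d \<le> D i" using I D(1) d0 by (auto simp: d_def)
  have dD: "y \<in> U" "\<And>i. i \<in> I \<Longrightarrow> dist (pd f i y) (pd f i a) < e"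
    if "y \<in> I \<rightarrow>\<^sub>E UNIV" "near I d a y" for y
    using that d0(2) D(2) near_mono[OF that(2)] d by blast+
  show ?thesis
  proof (intro exI[of _ d] conjI[OF d(1)] ballI impI)
    fix y assume y: "y \<in> I \<rightarrow>\<^sub>E UNIV" "near I d a y"
    \<comment> \<open>The point at which the coordinates in \<open>J\<close> have already been moved.\<close>
    define p where "p J = (\<lambda>i. if i \<in> J then y i else a i)" for J
    have pI: "p J \<in> I \<rightarrow>\<^sub>E UNIV" and pn: "near I d a (p J)" if "J \<subseteq> I" for J
      using y aI d(1) that by (auto simp: p_def near_def PiE_def extensional_def)
    have "cmod (f (p J) - f a - (\<Sum>i\<in>J. pd f i a * (y i - a i))) \<le> e * (\<Sum>i\<in>J. cmod (y i - a i))"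
      if "J \<subseteq> I" for J
      using finite_subset[OF that I] that
    proof (induction J)
      case empty
      then show ?case by (simp add: p_def)
    next
      case (insert i J)
      then have i: "i \<in> I" and J: "J \<subseteq> I" by auto
      let ?F = "\<lambda>z. f ((p J)(i := z)) - z * pd f i a"
      have pi: "p (insert i J) = (p J)(i := y i)" "p J = (p J)(i := a i)"
        using insert by (auto simp: p_def)
      have "norm (?F (y i) - ?F (a i)) \<le> e * norm (y i - a i)"
      proof (rule field_differentiable_bound)
        show "convex (ball (a i) d)" by simp
        fix z assume z: "z \<in> ball (a i) d"
        have q: "(p J)(i := z) \<in> I \<rightarrow>\<^sub>E UNIV" by (rule PiE_upd[OF pI[OF J] i])
        have qn: "near I d a ((p J)(i := z))" using pn[OF J] z by (auto simp: near_def dist_commute)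
        show "(?F has_field_derivative (pd f i ((p J)(i := z)) - pd f i a)) (at z within ball (a i) d)"
          by (rule has_field_derivative_at_within)
             (auto intro!: derivative_eq_intros slice_derivative[OF I f i] dD(1)[OF q qn])
        show "norm (pd f i ((p J)(i := z)) - pd f i a) \<le> e"
          using dD(2)[OF q qn i] by (simp add: dist_norm)
      qed (use y(2) i d(1) in \<open>auto simp: near_def dist_commute\<close>)
      then have 1: "cmod (f (p (insert i J)) - f (p J) - pd f i a * (y i - a i)) \<le> e * cmod (y i - a i)"
        using pi by (simp add: algebra_simps)
      have eq: "f (p (insert i J)) - f a - (\<Sum>k\<in>insert i J. pd f k a * (y k - a k)) =
          (f (p (insert i J)) - f (p J) - pd f i a * (y i - a i)) +
          (f (p J) - f a - (\<Sum>k\<in>J. pd f k a * (y k - a k)))"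
        using insert.hyps by simp
      have "cmod (f (p (insert i J)) - f a - (\<Sum>k\<in>insert i J. pd f k a * (y k - a k))) \<le>
          e * cmod (y i - a i) + e * (\<Sum>k\<in>J. cmod (y k - a k))"
        unfolding eq using 1 insert.IH[OF J] by (rule norm_triangle_mono)
      then show ?case using insert.hyps by (simp add: algebra_simps)
    qed
    from this[of I] have "cmod (f (p I) - f a - (\<Sum>i\<in>I. pd f i a * (y i - a i))) \<le> e * (\<Sum>i\<in>I. cmod (y i - a i))"
      by simp
    moreover have "p I = y" using y(1) aI by (auto simp: p_def PiE_def extensional_def)
    ultimately show "y \<in> U \<and>
      cmod (f y - f a - (\<Sum>i\<in>I. pd f i a * (y i - a i))) \<le> e * (\<Sum>i\<in>I. cmod (y i - a i))"
      using dD(1)[OF y] by simp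
  qed
qed

text \<open>The parameter ranges over any real normed space, which covers curves with a real and with a
  complex parameter.\<close>

lemma chain_rule:
  fixes \<gamma> :: "'t::real_normed_vector \<Rightarrow> 'i \<Rightarrow> complex"
  assumes I: "finite I" and f: "mholomorphic_on I U f" and t: "\<gamma> t \<in> U"
    and PiE: "\<And>s. \<gamma> s \<in> I \<rightarrow>\<^sub>E UNIV"
    and D: "\<And>i. i \<in> I \<Longrightarrow> ((\<lambda>s. \<gamma> s i) has_derivative D i) (at t)"
  shows "((\<lambda>s. f (\<gamma> s)) has_derivative (\<lambda>h. \<Sum>i\<in>I. pd f i (\<gamma> t) * D i h)) (at t)"
  unfolding has_derivative_at_alt
proof (intro conjI allI impI)
  have bl: "bounded_linear (D i)" if "i \<in> I" for i
    using D[OF that] by (rule has_derivative_bounded_linear)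
  show "bounded_linear (\<lambda>h. \<Sum>i\<in>I. pd f i (\<gamma> t) * D i h)"
    by (intro bounded_linear_sum bounded_linear_const_mult bl)
  fix e :: real assume e: "e > 0"
  have "\<exists>B>0. \<forall>h. norm (D i h) \<le> B * norm h" if "i \<in> I" for i
    using bounded_linear.pos_bounded[OF bl[OF that]] by (metis mult.commute)
  then obtain B where B: "\<And>i. i \<in> I \<Longrightarrow> B i > 0" "\<And>i h. i \<in> I \<Longrightarrow> norm (D i h) \<le> B i * norm h"
    by metis
  define L where "L = (\<Sum>i\<in>I. B i + 1)"
  have L: "L \<ge> 0" unfolding L_def using B(1) by (intro sum_nonneg) (simp add: less_imp_le)
  define P where "P = (\<Sum>i\<in>I. cmod (pd f i (\<gamma> t)))"
  have P: "P \<ge> 0" unfolding P_def by (intro sum_nonneg) auto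
  define e1 where "e1 = e / (2 * (L + 1))"
  have e1: "e1 > 0" using e L by (simp add: e1_def)
  \<comment> \<open>The bound \<open>1\<close> makes \<open>B i + 1\<close> a Lipschitz constant of the coordinate \<open>i\<close> of the curve at \<open>t\<close>.\<close>
  define e2 where "e2 = min 1 (e / (2 * (P + 1)))"
  have e2: "e2 > 0" "e2 \<le> 1" using e P by (auto simp: e2_def)
  obtain d1 where d1: "d1 > 0" "\<And>y. y \<in> I \<rightarrow>\<^sub>E UNIV \<Longrightarrow> near I d1 (\<gamma> t) y \<Longrightarrow>
      cmod (f y - f (\<gamma> t) - (\<Sum>i\<in>I. pd f i (\<gamma> t) * (y i - \<gamma> t i))) \<le> e1 * (\<Sum>i\<in>I. cmod (y i - \<gamma> t i))"
    using first_order_expansion[OF I f t e1] by blast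
  have "\<exists>d>0. \<forall>s. norm (s - t) < d \<longrightarrow> norm (\<gamma> s i - \<gamma> t i - D i (s - t)) \<le> e2 * norm (s - t)" if "i \<in> I" for i
    using D[OF that] e2 unfolding has_derivative_at_alt by blast
  then obtain r where r: "\<And>i. i \<in> I \<Longrightarrow> r i > 0"
    "\<And>i s. i \<in> I \<Longrightarrow> norm (s - t) < r i \<Longrightarrow> norm (\<gamma> s i - \<gamma> t i - D i (s - t)) \<le> e2 * norm (s - t)" by metis
  define q where "q = Min (insert 1 ((\<lambda>i. min (r i) (d1 / (B i + 1))) ` I))"
  have q: "q > 0" "\<And>i. i \<in> I \<Longrightarrow> q \<le> r i" "\<And>i. i \<in> I \<Longrightarrow> q \<le> d1 / (B i + 1)"
  proof -
    have "min (r i) (d1 / (B i + 1)) > 0" if "i \<in> I" for i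
      using r(1)[OF that] B(1)[OF that] d1(1) by simp
    then show "q > 0" using I by (auto simp: q_def)
    fix i assume "i \<in> I"
    then have "q \<le> min (r i) (d1 / (B i + 1))"
      unfolding q_def using I by (intro Min_le) auto
    then show "q \<le> r i" "q \<le> d1 / (B i + 1)" by auto
  qed
  show "\<exists>d>0. \<forall>s. norm (s - t) < d \<longrightarrow>
      norm (f (\<gamma> s) - f (\<gamma> t) - (\<Sum>i\<in>I. pd f i (\<gamma> t) * D i (s - t))) \<le> e * norm (s - t)"
  proof (intro exI[of _ q] conjI allI impI q)
    fix s assume s: "norm (s - t) < q"
    have 1: "cmod (\<gamma> s i - \<gamma> t i - D i (s - t)) \<le> e2 * norm (s - t)" if "i \<in> I" for i
      using r(2)[OF that] s q(2)[OF that] by simp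
    have 2: "cmod (\<gamma> s i - \<gamma> t i) \<le> (B i + 1) * norm (s - t)" if "i \<in> I" for i
    proof -
      have "cmod (\<gamma> s i - \<gamma> t i) \<le> cmod (\<gamma> s i - \<gamma> t i - D i (s - t)) + cmod (D i (s - t))"
        using norm_triangle_ineq[of "\<gamma> s i - \<gamma> t i - D i (s - t)" "D i (s - t)"] by simp
      also have "\<dots> \<le> 1 * norm (s - t) + B i * norm (s - t)"
        using 1[OF that] e2(2) B(2)[OF that] mult_right_mono[OF e2(2) norm_ge_zero[of "s - t"]]
        by (intro add_mono) (auto intro: order_trans)
      finally show ?thesis by (simp add: algebra_simps)
    qed
    have "near I d1 (\<gamma> t) (\<gamma> s)"
      unfolding near_def
    proof
      fix i assume i: "i \<in> I"
      have "cmod (\<gamma> s i - \<gamma> t i) \<le> (B i + 1) * norm (s - t)" by (rule 2[OF i])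
      also have "\<dots> < (B i + 1) * q" using s B(1)[OF i] by (intro mult_strict_left_mono) auto
      also have "\<dots> \<le> d1" using q(3)[OF i] B(1)[OF i] by (simp add: field_simps)
      finally show "dist (\<gamma> s i) (\<gamma> t i) < d1" by (simp add: dist_norm)
    qed
    then have "cmod (f (\<gamma> s) - f (\<gamma> t) - (\<Sum>i\<in>I. pd f i (\<gamma> t) * (\<gamma> s i - \<gamma> t i)))
        \<le> e1 * (\<Sum>i\<in>I. cmod (\<gamma> s i - \<gamma> t i))" by (rule d1(2)[OF PiE])
    also have "\<dots> \<le> e1 * (\<Sum>i\<in>I. (B i + 1) * norm (s - t))"
      using e1 2 by (intro mult_left_mono sum_mono) auto
    also have "\<dots> = e1 * L * norm (s - t)" by (simp add: L_def sum_distrib_right)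
    also have "\<dots> \<le> e / 2 * norm (s - t)"
      using L e by (intro mult_right_mono) (auto simp: e1_def field_simps)
    finally have A: "cmod (f (\<gamma> s) - f (\<gamma> t) - (\<Sum>i\<in>I. pd f i (\<gamma> t) * (\<gamma> s i - \<gamma> t i))) \<le> e / 2 * norm (s - t)" .
    have "cmod (\<Sum>i\<in>I. pd f i (\<gamma> t) * (\<gamma> s i - \<gamma> t i - D i (s - t))) \<le>
        (\<Sum>i\<in>I. cmod (pd f i (\<gamma> t)) * (e2 * norm (s - t)))"
      using 1 by (intro sum_norm_le) (auto simp: norm_mult intro!: mult_left_mono)
    also have "\<dots> = P * e2 * norm (s - t)" by (simp add: P_def sum_distrib_right mult.assoc)
    also have "\<dots> \<le> e / 2 * norm (s - t)"
    proof (rule mult_right_mono)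
      have "P * e2 \<le> P * (e / (2 * (P + 1)))" using P by (intro mult_left_mono) (auto simp: e2_def)
      also have "\<dots> \<le> e / 2" using P e by (simp add: field_simps)
      finally show "P * e2 \<le> e / 2" .
    qed simp
    finally have B': "cmod (\<Sum>i\<in>I. pd f i (\<gamma> t) * (\<gamma> s i - \<gamma> t i - D i (s - t))) \<le> e / 2 * norm (s - t)" .
    have eq: "f (\<gamma> s) - f (\<gamma> t) - (\<Sum>i\<in>I. pd f i (\<gamma> t) * D i (s - t)) =
        (f (\<gamma> s) - f (\<gamma> t) - (\<Sum>i\<in>I. pd f i (\<gamma> t) * (\<gamma> s i - \<gamma> t i))) +
        (\<Sum>i\<in>I. pd f i (\<gamma> t) * (\<gamma> s i - \<gamma> t i - D i (s - t)))"
      by (simp add: right_diff_distrib sum_subtractf)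
    show "norm (f (\<gamma> s) - f (\<gamma> t) - (\<Sum>i\<in>I. pd f i (\<gamma> t) * D i (s - t))) \<le> e * norm (s - t)"
      unfolding eq using norm_triangle_mono[OF A B'] by simp
  qed
qed

lemma chain_rule_complex:
  fixes \<gamma> :: "complex \<Rightarrow> 'i \<Rightarrow> complex"
  assumes I: "finite I" and f: "mholomorphic_on I U f" and t: "\<gamma> t \<in> U"
    and PiE: "\<And>s. \<gamma> s \<in> I \<rightarrow>\<^sub>E UNIV"
    and D: "\<And>i. i \<in> I \<Longrightarrow> ((\<lambda>s. \<gamma> s i) has_field_derivative D i) (at t)"
  shows "((\<lambda>s. f (\<gamma> s)) has_field_derivative (\<Sum>i\<in>I. pd f i (\<gamma> t) * D i)) (at t)"
proof -
  have "(\<lambda>h. \<Sum>i\<in>I. pd f i (\<gamma> t) * (D i * h)) = (*) (\<Sum>i\<in>I. pd f i (\<gamma> t) * D i)"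
    by (simp add: fun_eq_iff sum_distrib_right mult.assoc)
  then show ?thesis
    using chain_rule[where \<gamma> = \<gamma>, OF I f t PiE D[unfolded has_field_derivative_def]]
    unfolding has_field_derivative_def by simp
qed

lemma chain_rule_real:
  fixes \<gamma> :: "real \<Rightarrow> 'i \<Rightarrow> complex"
  assumes I: "finite I" and f: "mholomorphic_on I U f" and t: "\<gamma> t \<in> U"
    and PiE: "\<And>s. \<gamma> s \<in> I \<rightarrow>\<^sub>E UNIV"
    and D: "\<And>i. i \<in> I \<Longrightarrow> ((\<lambda>s. \<gamma> s i) has_vector_derivative D i) (at t)"
  shows "((\<lambda>s. f (\<gamma> s)) has_vector_derivative (\<Sum>i\<in>I. pd f i (\<gamma> t) * D i)) (at t)"
  using chain_rule[where \<gamma> = \<gamma>, OF I f t PiE D[unfolded has_vector_derivative_def]]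
  unfolding has_vector_derivative_def by (simp add: scaleR_sum_right)

lemma mholomorphic_compose:
  assumes I: "finite I" and K: "finite K" and f: "mholomorphic_on K W f" and U: "openin (cspace I) U"
    and G: "\<And>k. k \<in> K \<Longrightarrow> mholomorphic_on I U (\<lambda>x. \<Gamma> x k)"
    and GW: "\<And>x. x \<in> U \<Longrightarrow> \<Gamma> x \<in> W" and GI: "\<And>x. \<Gamma> x \<in> K \<rightarrow>\<^sub>E UNIV"
  shows "mholomorphic_on I U (\<lambda>x. f (\<Gamma> x))"
    and "\<And>x i. x \<in> U \<Longrightarrow> i \<in> I \<Longrightarrow> pd (\<lambda>x. f (\<Gamma> x)) i x = (\<Sum>k\<in>K. pd f k (\<Gamma> x) * pd (\<lambda>x. \<Gamma> x k) i x)"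
proof -
  have *: "((\<lambda>w. f (\<Gamma> (x(i := w)))) has_field_derivative (\<Sum>k\<in>K. pd f k (\<Gamma> x) * pd (\<lambda>x. \<Gamma> x k) i x)) (at (x i))"
    if x: "x \<in> U" and i: "i \<in> I" for x i
  proof -
    have "((\<lambda>w. f (\<Gamma> (x(i := w)))) has_field_derivative
        (\<Sum>k\<in>K. pd f k (\<Gamma> (x(i := x i))) * pd (\<lambda>x. \<Gamma> x k) i x)) (at (x i))"
    proof (rule chain_rule_complex[OF K f])
      show "\<Gamma> (x(i := x i)) \<in> W" using GW[OF x] by simp
      fix k assume k: "k \<in> K"
      show "((\<lambda>w. \<Gamma> (x(i := w)) k) has_field_derivative pd (\<lambda>x. \<Gamma> x k) i x) (at (x i))"
        using slice_derivative[OF I G[OF k] i, of x "x i"] x by simp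
    qed (rule GI)
    then show ?thesis by simp
  qed
  show "pd (\<lambda>x. f (\<Gamma> x)) i x = (\<Sum>k\<in>K. pd f k (\<Gamma> x) * pd (\<lambda>x. \<Gamma> x k) i x)"
    if "x \<in> U" "i \<in> I" for x i
    unfolding pd_def[of "\<lambda>x. f (\<Gamma> x)"] using *[OF that] by (rule DERIV_imp_deriv)
  show "mholomorphic_on I U (\<lambda>x. f (\<Gamma> x))"
  proof (rule mholomorphicI[OF I U])
    show "(\<lambda>w. f (\<Gamma> (x(i := w)))) field_differentiable (at (x i))" if "x \<in> U" "i \<in> I" for x i
      using *[OF that] by (auto simp: field_differentiable_def)
    fix x and e :: real assume x: "x \<in> U" and e: "e > 0"
    obtain d where d: "d > 0" "\<And>y. y \<in> W \<Longrightarrow> near K d (\<Gamma> x) y \<Longrightarrow> dist (f y) (f (\<Gamma> x)) < e"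
      using mholomorphicD(3)[OF K f GW[OF x] e] by blast
    have "\<exists>r>0. \<forall>y\<in>U. near I r x y \<longrightarrow> dist (\<Gamma> y k) (\<Gamma> x k) < d" if "k \<in> K" for k
      using mholomorphicD(3)[OF I G[OF that] x d(1)] .
    then obtain r where r: "\<And>k. k \<in> K \<Longrightarrow> r k > 0"
      "\<And>k y. k \<in> K \<Longrightarrow> y \<in> U \<Longrightarrow> near I (r k) x y \<Longrightarrow> dist (\<Gamma> y k) (\<Gamma> x k) < d" by metis
    define q where "q = Min (insert 1 (r ` K))"
    have q: "q > 0" "\<And>k. k \<in> K \<Longrightarrow> q \<le> r k" using K r(1) by (auto simp: q_def)
    show "\<exists>d>0. \<forall>y\<in>U. near I d x y \<longrightarrow> dist (f (\<Gamma> y)) (f (\<Gamma> x)) < e"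
    proof (intro exI[of _ q] conjI q ballI impI)
      fix y assume "y \<in> U" "near I q x y"
      then show "dist (f (\<Gamma> y)) (f (\<Gamma> x)) < e"
        using r(2) q(2) GW near_mono[of I q x y] by (intro d(2)) (auto simp: near_def[of K])
    qed
  qed
qed

lemma pd_cong:
  assumes I: "finite I" and U: "openin (cspace I) U" and x: "x \<in> U" and i: "i \<in> I"
    and eq: "\<And>y. y \<in> U \<Longrightarrow> f y = g y"
  shows "pd f i x = pd g i x"
proof -
  obtain r where r: "r > 0" "\<And>y. y \<in> I \<rightarrow>\<^sub>E UNIV \<Longrightarrow> near I r x y \<Longrightarrow> y \<in> U"
    using U x unfolding openin_cspace_near[OF I] by blast
  have xI: "x \<in> I \<rightarrow>\<^sub>E UNIV" using openin_subset[OF U] x by auto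
  have "eventually (\<lambda>w. w \<in> ball (x i) r) (nhds (x i))"
    using r(1) by (intro eventually_nhds_in_open) auto
  then have "eventually (\<lambda>w. f (x(i := w)) = g (x(i := w))) (nhds (x i))"
  proof eventually_elim
    case (elim w)
    then have "x(i := w) \<in> U"
      using r(1) by (intro r(2) PiE_upd xI i) (auto simp: near_def dist_commute)
    then show ?case by (rule eq)
  qed
  then show ?thesis unfolding pd_def by (rule deriv_cong_ev) simp
qed

abbreviation diag :: "'i set \<Rightarrow> ('i \<Rightarrow> complex) \<Rightarrow> 'i + 'i \<Rightarrow> complex" where
  "diag I \<xi> \<equiv> case_sum \<xi> (conj_vec I \<xi>)"

lemma diag_PiE: "\<xi> \<in> I \<rightarrow>\<^sub>E UNIV \<Longrightarrow> diag I \<xi> \<in> (I <+> I) \<rightarrow>\<^sub>E UNIV"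
  by (auto simp: PiE_def extensional_def conj_vec_def split: sum.splits)

text \<open>In the real direction \<open>u\<close>, the chain rule for \<open>\<Psi> (\<xi>, cnj \<xi>)\<close> gives
  \<open>\<Psi>\<^sub>\<xi> u + \<Psi>\<^sub>\<zeta> (cnj u)\<close>. The Wirtinger derivatives are the combinations of the cases \<open>u = 1\<close> and \<open>u = \<i>\<close>
  that single out one of the two terms.\<close>

lemma wirtinger_polarized:
  assumes I: "finite I" and V: "openin (cspace I) V" and \<Psi>: "mholomorphic_on (I <+> I) W \<Psi>"
    and g: "\<And>\<xi>. \<xi> \<in> V \<Longrightarrow> diag I \<xi> \<in> W \<and> g \<xi> = \<Psi> (diag I \<xi>)" and \<xi>: "\<xi> \<in> V" and i: "i \<in> I"
  shows "wirt g i \<xi> = pd \<Psi> (Inl i) (diag I \<xi>)" "wirt_bar g i \<xi> = pd \<Psi> (Inr i) (diag I \<xi>)"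
proof -
  have K: "finite (I <+> I)" using I by simp
  have \<xi>I: "\<xi> \<in> I \<rightarrow>\<^sub>E UNIV" using openin_subset[OF V] \<xi> by auto
  have dir: "pderiv_dir g i u \<xi> = pd \<Psi> (Inl i) (diag I \<xi>) * u + pd \<Psi> (Inr i) (diag I \<xi>) * cnj u" for u
  proof -
    let ?\<gamma> = "\<lambda>t::real. diag I (\<xi>(i := \<xi> i + of_real t * u))"
    define D where "D k = (if k = Inl i then u else if k = Inr i then cnj u else 0)" for k :: "'a + 'a"
    have "((\<lambda>t. \<Psi> (?\<gamma> t)) has_vector_derivative (\<Sum>k\<in>I <+> I. pd \<Psi> k (?\<gamma> 0) * D k)) (at 0)"
    proof (rule chain_rule_real[where \<gamma> = ?\<gamma>, OF K \<Psi>])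
      show "?\<gamma> 0 \<in> W" using g[OF \<xi>] by simp
      show "?\<gamma> s \<in> (I <+> I) \<rightarrow>\<^sub>E UNIV" for s by (intro diag_PiE PiE_upd \<xi>I i)
      fix k assume k: "k \<in> I <+> I"
      have 1: "((\<lambda>t. if x = i then \<xi> i + complex_of_real t * u else \<xi> x)
          has_vector_derivative (if x = i then u else 0)) (at 0)" for x
        by (cases "x = i") (auto intro!: derivative_eq_intros)
      have 2: "((\<lambda>t. cnj (if x = i then \<xi> i + complex_of_real t * u else \<xi> x))
          has_vector_derivative cnj (if x = i then u else 0)) (at 0)" for x
        by (rule has_vector_derivative_cnj[OF 1])
      show "((\<lambda>t. ?\<gamma> t k) has_vector_derivative D k) (at 0)"
      proof (cases k)
        case (Inl x)
        then show ?thesis using 1[of x] k by (cases "x = i") (simp_all add: D_def)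
      next
        case (Inr x)
        then show ?thesis
          using 2[of x] k by (cases "x = i") (auto simp: D_def conj_vec_def)
      qed
    qed
    also have "(\<Sum>k\<in>I <+> I. pd \<Psi> k (?\<gamma> 0) * D k) = pd \<Psi> (Inl i) (diag I \<xi>) * u + pd \<Psi> (Inr i) (diag I \<xi>) * cnj u"
      using I i by (simp add: D_def sum.Plus if_distrib[of "\<lambda>x. _ * x"] cong: if_cong)
    finally have 1: "((\<lambda>t. \<Psi> (?\<gamma> t)) has_vector_derivative
        (pd \<Psi> (Inl i) (diag I \<xi>) * u + pd \<Psi> (Inr i) (diag I \<xi>) * cnj u)) (at 0)" .
    obtain r where r: "r > 0" "\<And>y. y \<in> I \<rightarrow>\<^sub>E UNIV \<Longrightarrow> near I r \<xi> y \<Longrightarrow> y \<in> V"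
      using V \<xi> unfolding openin_cspace_near[OF I] by blast
    have "((\<lambda>t::real. of_real t * u) \<longlongrightarrow> 0) (at 0)" by (auto intro!: tendsto_eq_intros)
    then have "eventually (\<lambda>t::real. dist (of_real t * u) 0 < r) (at 0)"
      using r(1) unfolding tendsto_iff by blast
    then have "eventually (\<lambda>t::real. dist (of_real t * u) 0 < r) (nhds 0)"
      using r(1) unfolding eventually_nhds_conv_at by simp
    then have "eventually (\<lambda>t. g (\<xi>(i := \<xi> i + of_real t * u)) = \<Psi> (?\<gamma> t)) (nhds (0::real))"
    proof eventually_elim
      case (elim t)
      then have "\<xi>(i := \<xi> i + of_real t * u) \<in> V"
        using r(1) by (intro r(2) PiE_upd \<xi>I i) (auto simp: near_def dist_norm)
      then show ?case using g by blast
    qed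
    then have "eventually (\<lambda>t::real. t \<in> UNIV \<longrightarrow> g (\<xi>(i := \<xi> i + of_real t * u)) = \<Psi> (?\<gamma> t)) (nhds 0)"
      by simp
    from has_vector_derivative_cong_ev[OF this]
    have "((\<lambda>t. g (\<xi>(i := \<xi> i + of_real t * u))) has_vector_derivative
        (pd \<Psi> (Inl i) (diag I \<xi>) * u + pd \<Psi> (Inr i) (diag I \<xi>) * cnj u)) (at 0)"
      using 1 g[OF \<xi>] by simp
    then show ?thesis unfolding pderiv_dir_def by (rule vector_derivative_at)
  qed
  show "wirt g i \<xi> = pd \<Psi> (Inl i) (diag I \<xi>)" "wirt_bar g i \<xi> = pd \<Psi> (Inr i) (diag I \<xi>)"
    unfolding wirt_def wirt_bar_def dir by (simp_all add: field_simps)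
qed

lemma levi_polarized:
  assumes I: "finite I" and V: "openin (cspace I) V" and \<Psi>: "mholomorphic_on (I <+> I) W \<Psi>"
    and g: "\<And>\<xi>. \<xi> \<in> V \<Longrightarrow> diag I \<xi> \<in> W \<and> of_real (\<phi> \<xi>) = \<Psi> (diag I \<xi>)"
    and \<xi>: "\<xi> \<in> V" and j: "j \<in> I" and k: "k \<in> I"
  shows "levi \<phi> \<xi> j k = pd (pd \<Psi> (Inr k)) (Inl j) (diag I \<xi>)"
  unfolding levi_def
proof (rule wirtinger_polarized(1)[OF I V _ _ \<xi> j])
  show "mholomorphic_on (I <+> I) W (pd \<Psi> (Inr k))"
    using I k \<Psi> by (intro mholomorphic_pd) auto
  fix \<xi> assume "\<xi> \<in> V"
  then show "diag I \<xi> \<in> W \<and> wirt_bar (\<lambda>z. of_real (\<phi> z)) k \<xi> = pd \<Psi> (Inr k) (diag I \<xi>)"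
    using wirtinger_polarized(2)[OF I V \<Psi> g _ k] g by blast
qed

section \<open>Sums, products and compositions\<close>

lemma mholomorphic_tendsto:
  fixes f :: "('i \<Rightarrow> complex) \<Rightarrow> complex"
  assumes "openin (cspace I) U"
  shows "continuous_map (subtopology (cspace I) U) euclidean f \<longleftrightarrow>
    (\<forall>x\<in>U. (f \<longlongrightarrow> f x) (atin (subtopology (cspace I) U) x))"
  using openin_subset[OF assms] by (auto simp: continuous_map_atin inf_absorb2)

lemma
  assumes U: "openin (cspace I) U"
    and f: "mholomorphic_on I U f" and g: "mholomorphic_on I U g"
  shows mholomorphic_add: "mholomorphic_on I U (\<lambda>x. f x + g x)"
    and mholomorphic_mult: "mholomorphic_on I U (\<lambda>x. f x * g x)"
  using f g unfolding mholomorphic_on_def mholomorphic_tendsto[OF U]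
  by (auto intro!: tendsto_add tendsto_mult field_differentiable_add field_differentiable_mult)

lemma mholomorphic_const: "openin (cspace I) U \<Longrightarrow> mholomorphic_on I U (\<lambda>_. c)"
  unfolding mholomorphic_on_def by auto

lemma mholomorphic_sum:
  assumes U: "openin (cspace I) U" and F: "\<And>j. j \<in> J \<Longrightarrow> mholomorphic_on I U (F j)"
  shows "mholomorphic_on I U (\<lambda>x. \<Sum>j\<in>J. F j x)"
  using F by (induction J rule: infinite_finite_induct)
    (auto intro: mholomorphic_const[OF U] mholomorphic_add[OF U])

lemma mholomorphic_comp1:
  assumes U: "openin (cspace I) U" and f: "mholomorphic_on I U f"
    and h: "h holomorphic_on S" "open S" and fS: "\<And>x. x \<in> U \<Longrightarrow> f x \<in> S"
  shows "mholomorphic_on I U (\<lambda>x. h (f x))"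
  unfolding mholomorphic_on_def mholomorphic_tendsto[OF U]
proof (intro conjI ballI U)
  fix x assume x: "x \<in> U"
  have d: "h field_differentiable (at (f x))"
    using h fS[OF x] by (simp add: holomorphic_on_imp_differentiable_at)
  have "(f \<longlongrightarrow> f x) (atin (subtopology (cspace I) U) x)"
    using f x unfolding mholomorphic_on_def mholomorphic_tendsto[OF U] by blast
  then show "((\<lambda>x. h (f x)) \<longlongrightarrow> h (f x)) (atin (subtopology (cspace I) U) x)"
    by (rule isCont_tendsto_compose[OF field_differentiable_imp_continuous_at[OF d]])
  fix i assume i: "i \<in> I"
  have "(\<lambda>w. f (x(i := w))) field_differentiable (at (x i))"
    using f x i unfolding mholomorphic_on_def by blast
  then show "(\<lambda>w. h (f (x(i := w)))) field_differentiable (at (x i))"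
    using d field_differentiable_compose[of "\<lambda>w. f (x(i := w))" "x i" h] by (simp add: o_def)
qed

lemma mholomorphic_proj:
  assumes I: "finite I" and U: "openin (cspace I) U" and i: "i \<in> I"
  shows "mholomorphic_on I U (\<lambda>x. x i)"
proof (rule mholomorphicI[OF I U])
  show "\<exists>d>0. \<forall>y\<in>U. near I d x y \<longrightarrow> dist (y i) (x i) < e" if "e > 0" for x and e :: real
    using that i by (auto simp: near_def intro!: exI[of _ e])
  show "(\<lambda>w. (x(j := w)) i) field_differentiable at (x j)" for x j
    by (cases "i = j") auto
qed

lemma mholomorphic_subset:
  assumes f: "mholomorphic_on I U f" and V: "openin (cspace I) V" "V \<subseteq> U"
  shows "mholomorphic_on I V f"
proof -
  have "continuous_map (subtopology (cspace I) V) euclidean f"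
    using f V(2) unfolding mholomorphic_on_def by (auto intro: continuous_map_from_subtopology_mono)
  then show ?thesis using f V unfolding mholomorphic_on_def by blast
qed

section \<open>Functions on a bidisc\<close>

text \<open>The two coordinates \<open>z\<close> and \<open>w\<close> are indexed by \<open>False\<close> and \<open>True\<close>.\<close>

definition bidisc :: "real \<Rightarrow> (bool \<Rightarrow> complex) set" where
  "bidisc r = {x. cmod (x False) < r \<and> cmod (x True) < r}"

abbreviation pt :: "complex \<Rightarrow> complex \<Rightarrow> bool \<Rightarrow> complex" where
  "pt z w \<equiv> (\<lambda>b. if b then w else z)"

lemma pt_bidisc [simp]: "pt z w \<in> bidisc r \<longleftrightarrow> cmod z < r \<and> cmod w < r"
  by (simp add: bidisc_def)

lemma pt_upd [simp]: "(pt z w)(True := v) = pt z v" "(pt z w)(False := v) = pt v w"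
  by auto

lemma pt_eta: "pt (x False) (x True) = x"
  by (auto simp: fun_eq_iff)

lemma UNIV_PiE: "(UNIV \<rightarrow>\<^sub>E UNIV) = UNIV"
  by auto

lemma openin_bidisc: "openin (cspace UNIV) (bidisc r)"
  unfolding openin_cspace_near[OF finite_class.finite_UNIV] UNIV_PiE
proof (intro conjI ballI)
  fix x assume x: "x \<in> bidisc r"
  define e where "e = min (r - cmod (x False)) (r - cmod (x True))"
  show "\<exists>e>0. \<forall>y\<in>UNIV. near UNIV e x y \<longrightarrow> y \<in> bidisc r"
  proof (intro exI[of _ e] conjI ballI impI)
    fix y assume "near UNIV e x y"
    then have "cmod (y b - x b) < e" for b by (simp add: near_def dist_norm)
    then have "cmod (y b) < e + cmod (x b)" for b
      using norm_triangle_sub[of "y b" "x b"] by (smt (verit))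
    from this[of True] this[of False] show "y \<in> bidisc r" by (auto simp: bidisc_def e_def)
  qed (use x in \<open>auto simp: e_def bidisc_def\<close>)
qed auto

abbreviation bidisc_holo :: "real \<Rightarrow> ((bool \<Rightarrow> complex) \<Rightarrow> complex) \<Rightarrow> bool" where
  "bidisc_holo r F \<equiv> mholomorphic_on UNIV (bidisc r) F"

lemma bidisc_holo_subset: "bidisc_holo r F \<Longrightarrow> s \<le> r \<Longrightarrow> bidisc_holo s F"
  by (rule mholomorphic_subset[OF _ openin_bidisc]) (auto simp: bidisc_def)

lemma bidisc_holo_pd: "bidisc_holo r F \<Longrightarrow> bidisc_holo r (pd F b)"
  by (rule mholomorphic_pd) auto

lemmas bidisc_holo_add = mholomorphic_add[OF openin_bidisc]
lemmas bidisc_holo_mult = mholomorphic_mult[OF openin_bidisc]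
lemmas bidisc_holo_const = mholomorphic_const[OF openin_bidisc]

lemmas bidisc_holo_sum = mholomorphic_sum[OF openin_bidisc]

lemma bidisc_holo_power: "bidisc_holo r F \<Longrightarrow> bidisc_holo r (\<lambda>x. F x ^ n)"
  by (induction n) (auto intro: bidisc_holo_const bidisc_holo_mult)

lemma bidisc_holo_var:
  assumes "f holomorphic_on ball 0 r"
  shows "bidisc_holo r (\<lambda>x. f (x b))"
  by (rule mholomorphic_comp1[OF openin_bidisc mholomorphic_proj[OF _ openin_bidisc] assms])
     (cases b; auto simp: bidisc_def)+

lemma pd_var:
  "pd (\<lambda>x. f (x b)) b' x = (if b = b' then deriv f (x b) else 0)"
  by (simp add: pd_def)

lemma bidisc_holo_slice:
  assumes F: "bidisc_holo r F" and z: "cmod z < r"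
  shows "(\<lambda>w. F (pt z w)) holomorphic_on ball 0 r" "(\<lambda>w. F (pt w z)) holomorphic_on ball 0 r"
proof -
  have "(\<lambda>w. F ((pt z 0)(True := w))) holomorphic_on ball 0 r"
    by (rule slice_holomorphic[OF _ F]) (use z in auto)
  then show "(\<lambda>w. F (pt z w)) holomorphic_on ball 0 r" by simp
  have "(\<lambda>w. F ((pt 0 z)(False := w))) holomorphic_on ball 0 r"
    by (rule slice_holomorphic[OF _ F]) (use z in auto)
  then show "(\<lambda>w. F (pt w z)) holomorphic_on ball 0 r" by simp
qed

abbreviation mixed :: "((bool \<Rightarrow> complex) \<Rightarrow> complex) \<Rightarrow> (bool \<Rightarrow> complex) \<Rightarrow> complex" where
  "mixed F \<equiv> pd (pd F True) False"

lemma deriv_slice: "deriv (\<lambda>w. F (pt z w)) w = pd F True (pt z w)"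
  "deriv (\<lambda>z. F (pt z w)) z = pd F False (pt z w)"
  by (simp_all add: pd_def)

section \<open>Expansion in the second variable\<close>

text \<open>The coefficient of \<open>w\<^sup>n\<close> in the expansion of \<open>F(z, w)\<close>, as a function of \<open>z\<close>.\<close>

definition wcoeff :: "nat \<Rightarrow> ((bool \<Rightarrow> complex) \<Rightarrow> complex) \<Rightarrow> complex \<Rightarrow> complex" where
  "wcoeff n F z = (deriv ^^ n) (\<lambda>w. F (pt z w)) 0 / fact n"

lemma iter_deriv_slice: "(deriv ^^ n) (\<lambda>w. F (pt z w)) = (\<lambda>w. ((\<lambda>F. pd F True) ^^ n) F (pt z w))"
  by (induction n) (auto simp: deriv_slice)

lemma wcoeff_pd: "wcoeff n F z = ((\<lambda>F. pd F True) ^^ n) F (pt z 0) / fact n"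
  by (simp add: wcoeff_def iter_deriv_slice)

lemma bidisc_holo_iter: "bidisc_holo r F \<Longrightarrow> bidisc_holo r (((\<lambda>F. pd F True) ^^ n) F)"
  by (induction n) (auto intro: bidisc_holo_pd)

lemma wcoeff_holomorphic:
  assumes F: "bidisc_holo r F" and r: "r > 0" shows "wcoeff n F holomorphic_on ball 0 r"
  unfolding wcoeff_pd[abs_def] using bidisc_holo_slice(2)[OF bidisc_holo_iter[OF F], of 0 n] r
  by (intro holomorphic_intros) auto

lemma wcoeff_has_fps_expansion:
  assumes F: "bidisc_holo r F" and r: "r > 0" shows "wcoeff n F has_fps_expansion fps_expansion (wcoeff n F) 0"
  using wcoeff_holomorphic[OF F r] r by (intro has_fps_expansion_fps_expansion[of "ball 0 r"]) auto

text \<open>The expansion of \<open>F(z, w)\<close> in powers of \<open>w\<close>. The coefficients are power series in \<open>z\<close>, regarded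
  as Laurent series so that they lie in a field.\<close>

definition wseries :: "((bool \<Rightarrow> complex) \<Rightarrow> complex) \<Rightarrow> complex fls fps" where
  "wseries F = Abs_fps (\<lambda>n. fps_to_fls (fps_expansion (wcoeff n F) 0))"

lemma wseries_nth: "fps_nth (wseries F) n = fps_to_fls (fps_expansion (wcoeff n F) 0)"
  by (simp add: wseries_def)

lemma ev_ball: "r > 0 \<Longrightarrow> (\<And>z. cmod z < r \<Longrightarrow> P z) \<Longrightarrow> eventually P (nhds (0::complex))"
proof -
  assume r: "r > 0" and P: "\<And>z. cmod z < r \<Longrightarrow> P z"
  have "eventually (\<lambda>z. z \<in> ball 0 r) (nhds (0::complex))"
    using r by (intro eventually_nhds_in_open) auto
  then show ?thesis by eventually_elim (use P in auto)
qed

lemma wseries_cong: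
  assumes r: "r > 0" and eq: "\<And>x. x \<in> bidisc r \<Longrightarrow> F x = G x"
  shows "wseries F = wseries G"
proof (rule fps_ext)
  fix n
  have "wcoeff n F z = wcoeff n G z" if "cmod z < r" for z
  proof -
    have "eventually (\<lambda>w. F (pt z w) = G (pt z w)) (nhds 0)"
      using that by (intro ev_ball[OF r] eq) auto
    then show ?thesis unfolding wcoeff_def by (simp add: higher_deriv_cong_ev)
  qed
  then have "fps_expansion (wcoeff n F) 0 = fps_expansion (wcoeff n G) 0"
    by (intro fps_expansion_cong ev_ball[OF r]) auto
  then show "fps_nth (wseries F) n = fps_nth (wseries G) n" by (simp add: wseries_nth)
qed

lemma wseries_eqI:
  assumes r: "r > 0" and w: "\<And>z. cmod z < r \<Longrightarrow> wcoeff n F z = f z" and f: "f has_fps_expansion p"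
    and F: "bidisc_holo r F"
  shows "fps_nth (wseries F) n = fps_to_fls p"
proof -
  have "eventually (\<lambda>z. wcoeff n F z = f z) (nhds 0)" by (rule ev_ball[OF r w])
  then have "wcoeff n F has_fps_expansion p" using f by (subst has_fps_expansion_cong) auto
  then show ?thesis
    unfolding wseries_nth using fps_expansion_unique_complex[OF wcoeff_has_fps_expansion[OF F r]] by simp
qed

context
  fixes r :: real and F G :: "(bool \<Rightarrow> complex) \<Rightarrow> complex"
  assumes r: "r > 0" and F: "bidisc_holo r F" and G: "bidisc_holo r G"
begin

lemma wseries_add: "wseries (\<lambda>x. F x + G x) = wseries F + wseries G"
proof (rule fps_ext)
  fix n
  have "fps_nth (wseries (\<lambda>x. F x + G x)) n =
      fps_to_fls (fps_expansion (wcoeff n F) 0 + fps_expansion (wcoeff n G) 0)"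
  proof (rule wseries_eqI[OF r])
    show "wcoeff n (\<lambda>x. F x + G x) z = wcoeff n F z + wcoeff n G z" if "cmod z < r" for z
      using higher_deriv_add[OF bidisc_holo_slice(1)[OF F that] bidisc_holo_slice(1)[OF G that] open_ball, of 0 n] r
      by (simp add: wcoeff_def add_divide_distrib)
  qed (rule has_fps_expansion_add[OF wcoeff_has_fps_expansion[OF F r] wcoeff_has_fps_expansion[OF G r]]
      bidisc_holo_add[OF F G])+
  then show "fps_nth (wseries (\<lambda>x. F x + G x)) n = fps_nth (wseries F + wseries G) n" by (simp add: wseries_nth)
qed

lemma wseries_mult: "wseries (\<lambda>x. F x * G x) = wseries F * wseries G"
proof (rule fps_ext)
  fix n
  have "fps_nth (wseries (\<lambda>x. F x * G x)) n =
      fps_to_fls (\<Sum>i=0..n. fps_expansion (wcoeff i F) 0 * fps_expansion (wcoeff (n - i) G) 0)"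
  proof (rule wseries_eqI[OF r])
    show "wcoeff n (\<lambda>x. F x * G x) z = (\<Sum>i=0..n. wcoeff i F z * wcoeff (n - i) G z)" if "cmod z < r" for z
      using higher_deriv_mult[OF bidisc_holo_slice(1)[OF F that] bidisc_holo_slice(1)[OF G that] open_ball, of 0 n] r
      unfolding wcoeff_def
      by (auto simp: sum_divide_distrib binomial_fact field_simps intro!: sum.cong)
  qed (rule has_fps_expansion_sum has_fps_expansion_mult[OF wcoeff_has_fps_expansion[OF F r] wcoeff_has_fps_expansion[OF G r]]
      bidisc_holo_mult[OF F G])+
  moreover have "fps_to_fls (\<Sum>i\<in>A. p i) = (\<Sum>i\<in>A. fps_to_fls (p i))" for A :: "nat set" and p :: "nat \<Rightarrow> complex fps"
    by (induction A rule: infinite_finite_induct) auto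
  ultimately show "fps_nth (wseries (\<lambda>x. F x * G x)) n = fps_nth (wseries F * wseries G) n"
    by (simp add: wseries_nth fps_mult_nth fls_times_fps_to_fls)
qed

end

context
  fixes r :: real and F :: "(bool \<Rightarrow> complex) \<Rightarrow> complex"
  assumes r: "r > 0" and F: "bidisc_holo r F"
begin

lemma wseries_pd: "wseries (pd F True) = fps_deriv (wseries F)"
proof (rule fps_ext)
  fix n
  have "fps_nth (wseries (pd F True)) n = fps_to_fls (fps_const (of_nat (Suc n)) * fps_expansion (wcoeff (Suc n) F) 0)"
  proof (rule wseries_eqI[OF r])
    show "wcoeff n (pd F True) z = of_nat (Suc n) * wcoeff (Suc n) F z" for z
      unfolding wcoeff_pd funpow_Suc_right by (simp del: of_nat_Suc)
  qed (rule has_fps_expansion_cmult_left[OF wcoeff_has_fps_expansion[OF F r]] bidisc_holo_pd[OF F])+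
  then show "fps_nth (wseries (pd F True)) n = fps_nth (fps_deriv (wseries F)) n"
    by (simp add: wseries_nth fls_times_fps_to_fls fls_of_nat del: of_nat_Suc)
qed

text \<open>The identity theorem is applied to the coefficients, as functions of \<open>z\<close>, and then in \<open>w\<close>.\<close>

lemma wseries_0_imp: "wseries F = 0 \<Longrightarrow> x \<in> bidisc r \<Longrightarrow> F x = 0"
proof -
  assume z: "wseries F = 0" and x: "x \<in> bidisc r"
  have wz: "wcoeff n F z = 0" if "cmod z < r" for n z
  proof (rule holomorphic_fun_eq_0_on_connected[OF wcoeff_holomorphic[OF F r]])
    fix m
    have "fps_to_fls (fps_expansion (wcoeff n F) 0) = 0" using z wseries_nth[of F n] by simp
    then have "fps_nth (fps_expansion (wcoeff n F) 0) m = 0" by simp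
    then show "(deriv ^^ m) (wcoeff n F) 0 = 0" by (simp add: fps_expansion_def)
  qed (use r that in auto)
  have "(\<lambda>w. F (pt (x False) w)) (x True) = 0"
  proof (rule holomorphic_fun_eq_0_on_connected[OF bidisc_holo_slice(1)[OF F]])
    show "(deriv ^^ n) (\<lambda>w. F (pt (x False) w)) 0 = 0" for n
      using wz[of "x False" n] x by (simp add: wcoeff_def bidisc_def)
  qed (use r x in \<open>auto simp: bidisc_def\<close>)
  then show "F x = 0" by (simp add: pt_eta)
qed

end

lemma wseries_nth_0_0: "fls_nth (fps_nth (wseries F) 0) 0 = F (pt 0 0)"
  by (simp add: wseries_nth fps_expansion_def wcoeff_def)

lemma wseries_const: "wseries (\<lambda>_. c) = fps_const (fls_const c)"
proof (rule fps_ext)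
  fix n
  have "wcoeff n (\<lambda>_. c) = (\<lambda>_. if n = 0 then c else 0)"
    by (auto simp: wcoeff_def fun_eq_iff)
  then have "fps_expansion (wcoeff n (\<lambda>_. c)) 0 = (if n = 0 then fps_const c else 0)"
    by (auto simp: fps_expansion_def fps_eq_iff)
  then show "fps_nth (wseries (\<lambda>_. c)) n = fps_nth (fps_const (fls_const c)) n"
    by (simp add: wseries_nth)
qed

lemma wseries_z:
  "wseries (\<lambda>x. f (x False)) = fps_const (fps_to_fls (fps_expansion f 0))"
proof (rule fps_ext)
  fix n
  have "wcoeff n (\<lambda>x. f (x False)) = (\<lambda>z. if n = 0 then f z else 0)"
    by (auto simp: wcoeff_def fun_eq_iff)
  then have "fps_expansion (wcoeff n (\<lambda>x. f (x False))) 0 = (if n = 0 then fps_expansion f 0 else 0)"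
    by (auto simp: fps_expansion_def fps_eq_iff)
  then show "fps_nth (wseries (\<lambda>x. f (x False))) n = fps_nth (fps_const (fps_to_fls (fps_expansion f 0))) n"
    by (simp add: wseries_nth)
qed

lemma wseries_w: "\<exists>c. fps_nth (wseries (\<lambda>x. f (x True))) n = fls_const c"
proof -
  have "wcoeff n (\<lambda>x. f (x True)) = (\<lambda>z. (deriv ^^ n) f 0 / fact n)"
    by (auto simp: wcoeff_def fun_eq_iff)
  then have "fps_expansion (wcoeff n (\<lambda>x. f (x True))) 0 = fps_const ((deriv ^^ n) f 0 / fact n)"
    by (auto simp: fps_expansion_def fps_eq_iff)
  then show ?thesis by (auto simp: wseries_nth)
qed

text \<open>The coefficient of \<open>w\<close> is the function \<open>\<partial>\<^sub>w F(z, 0)\<close>, and its derivative at \<open>z = 0\<close> is the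
  mixed derivative.\<close>

lemma wseries_1_const_imp:
  assumes r: "r > 0" and F: "bidisc_holo r F" and c: "fps_nth (wseries F) 1 = fls_const c"
  shows "mixed F (pt 0 0) = 0"
proof -
  have "fps_nth (fps_expansion (wcoeff 1 F) 0) 1 = fls_nth (fps_nth (wseries F) 1) 1" by (simp add: wseries_nth)
  also have "\<dots> = 0" unfolding c by simp
  finally have "deriv (wcoeff 1 F) 0 = 0" by (simp add: fps_expansion_def)
  moreover have "wcoeff 1 F = (\<lambda>z. pd F True (pt z 0))" by (simp add: wcoeff_pd fun_eq_iff)
  ultimately show ?thesis by (simp add: deriv_slice)
qed

section \<open>Uniqueness of polarizations\<close>

text \<open>In the coordinates given by \<open>z = s + \<i> t\<close> and \<open>w = s - \<i> t\<close>, the set \<open>w = cnj z\<close> consists of the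
  real points, so the identity theorem in one variable applies first in \<open>t\<close> and then in \<open>s\<close>.\<close>

lemma antidiagonal_zero:
  assumes r: "r > 0" and F: "bidisc_holo r F" and z: "\<And>z. cmod z < r \<Longrightarrow> F (pt z (cnj z)) = 0"
    and x: "x \<in> bidisc (r / 2)"
  shows "F x = 0"
proof -
  define Y where "Y s t = F (pt (s + \<i> * t) (s - \<i> * t))" for s t
  have inb: "pt (s + \<i> * t) (s - \<i> * t) \<in> bidisc r" if "cmod s < r / 2" "cmod t < r / 2" for s t
  proof -
    have "cmod (s + \<i> * t) \<le> cmod s + cmod t" "cmod (s - \<i> * t) \<le> cmod s + cmod t"
      using norm_triangle_ineq[of s "\<i> * t"] norm_triangle_ineq4[of s "\<i> * t"] by (auto simp: norm_mult)
    then show ?thesis using that by auto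
  qed
  have hol: "(\<lambda>t. Y s t) field_differentiable (at t)" "(\<lambda>s. Y s t) field_differentiable (at s)"
    if "cmod s < r / 2" "cmod t < r / 2" for s t
  proof -
    have "((\<lambda>t. F (pt (s + \<i> * t) (s - \<i> * t))) has_field_derivative
        (\<Sum>b\<in>UNIV. pd F b (pt (s + \<i> * t) (s - \<i> * t)) * (if b then - \<i> else \<i>))) (at t)"
    proof (rule chain_rule_complex[where \<gamma> = "\<lambda>t. pt (s + \<i> * t) (s - \<i> * t)", OF _ F inb[OF that]])
      show "((\<lambda>u. pt (s + \<i> * u) (s - \<i> * u) b) has_field_derivative (if b then - \<i> else \<i>)) (at t)" for b
        by (cases b) (auto intro!: derivative_eq_intros)
    qed auto
    then show "(\<lambda>t. Y s t) field_differentiable (at t)" by (auto simp: Y_def field_differentiable_def)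
    have "((\<lambda>s. F (pt (s + \<i> * t) (s - \<i> * t))) has_field_derivative
        (\<Sum>b\<in>UNIV. pd F b (pt (s + \<i> * t) (s - \<i> * t)) * 1)) (at s)"
    proof (rule chain_rule_complex[where \<gamma> = "\<lambda>s. pt (s + \<i> * t) (s - \<i> * t)", OF _ F inb[OF that]])
      show "((\<lambda>u. pt (u + \<i> * t) (u - \<i> * t) b) has_field_derivative 1) (at s)" for b
        by (cases b) (auto intro!: derivative_eq_intros)
    qed auto
    then show "(\<lambda>s. Y s t) field_differentiable (at s)" by (auto simp: Y_def field_differentiable_def)
  qed
  \<comment> \<open>The identity theorem for a function that vanishes on an interval of the real axis.\<close>
  have real_zero: "f u = 0"
    if f: "f holomorphic_on ball 0 (r / 2)" "\<And>a::real. \<bar>a\<bar> < r / 2 \<Longrightarrow> f (of_real a) = 0" and u: "cmod u < r / 2"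
    for f u
  proof (rule analytic_continuation[OF f(1), of "complex_of_real ` {-(r/2)<..<r/2}" 0])
    show "0 islimpt complex_of_real ` {-(r/2)<..<r/2}"
      unfolding islimpt_approachable
    proof (intro allI impI)
      fix e :: real assume e: "e > 0"
      define a where "a = min (e / 2) (r / 4)"
      have "a > 0" "a < e" "a < r / 2" using e r by (auto simp: a_def)
      then show "\<exists>x'\<in>complex_of_real ` {-(r/2)<..<r/2}. x' \<noteq> 0 \<and> dist x' 0 < e"
        by (intro bexI[of _ "of_real a"]) auto
    qed
  qed (use r u f(2) in auto)
  have Yrr: "Y (of_real a) (of_real b) = 0" if "\<bar>a\<bar> < r / 2" "\<bar>b\<bar> < r / 2" for a b
  proof -
    have 1: "cmod (Complex a b) < r" using that cmod_le[of "Complex a b"] by simp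
    have eq: "of_real a + \<i> * of_real b = Complex a b" "of_real a - \<i> * of_real b = cnj (Complex a b)"
      by (simp_all add: complex_eq_iff)
    show ?thesis unfolding Y_def eq by (rule z[OF 1])
  qed
  have Yrc: "Y (of_real a) t = 0" if a: "\<bar>a\<bar> < r / 2" and t: "cmod t < r / 2" for a t
  proof (rule real_zero[OF _ _ t])
    show "Y (complex_of_real a) holomorphic_on ball 0 (r / 2)"
      unfolding holomorphic_on_def using hol(1)[of "of_real a"] a
      by (auto intro: field_differentiable_at_within)
  qed (use Yrr a in auto)
  have Ycc: "Y s t = 0" if s: "cmod s < r / 2" and t: "cmod t < r / 2" for s t
  proof (rule real_zero[OF _ _ s])
    show "(\<lambda>s. Y s t) holomorphic_on ball 0 (r / 2)"
      unfolding holomorphic_on_def using hol(2)[OF _ t] by (auto intro: field_differentiable_at_within)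
  qed (use Yrc t in auto)
  define s t where "s = (x False + x True) / 2" and "t = (x False - x True) / (2 * \<i>)"
  have "cmod (x False + x True) < r" "cmod (x False - x True) < r"
    using x norm_triangle_ineq[of "x False" "x True"] norm_triangle_ineq4[of "x False" "x True"]
    by (auto simp: bidisc_def)
  then have "cmod s < r / 2" "cmod t < r / 2" by (auto simp: s_def t_def norm_divide norm_mult)
  then have 0: "Y s t = 0" by (rule Ycc)
  have eq: "s + \<i> * t = x False" "s - \<i> * t = x True" by (auto simp: s_def t_def field_simps)
  show "F x = 0" using 0 unfolding Y_def eq pt_eta .
qed

section \<open>Pullbacks of Nash algebraic functions\<close>

text \<open>The complex numbers inside the field of Laurent series in \<open>z\<close>.\<close>

abbreviation const_series :: "complex fls set" where "const_series \<equiv> range fls_const"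

lemma subfield_const_series: "is_subfield const_series"
  unfolding is_subfield_def is_subring_def
proof (intro conjI ballI)
  show "(0 :: complex fls) \<in> const_series" "(1 :: complex fls) \<in> const_series"
    by (auto intro: image_eqI[of _ _ 0] image_eqI[of _ _ 1])
  fix x :: "complex fls" assume "x \<in> const_series"
  then obtain a where a: "x = fls_const a" by auto
  show "- x \<in> const_series" "inverse x \<in> const_series" unfolding a fls_inverse_const by (auto simp flip: fls_const_uminus)
  fix y :: "complex fls" assume "y \<in> const_series"
  then obtain b where b: "y = fls_const b" by auto
  show "x + y \<in> const_series" "x * y \<in> const_series" unfolding a b by (auto simp: fls_plus_const)
qed

text \<open>Polynomials over the complex numbers split into linear factors.\<close>

lemma alg_const_series:
  assumes "alg const_series x" shows "x \<in> const_series"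
proof -
  define ev where "ev q = poly (map_poly fls_const q) x" for q
  have ev_pCons: "ev (pCons a q) = fls_const a + x * ev q" for a q
  proof -
    have "map_poly fls_const (pCons a q) = pCons (fls_const a) (map_poly fls_const q)"
      by (rule poly_eqI) (simp add: coeff_map_poly coeff_pCons split: nat.splits)
    then show ?thesis by (simp add: ev_def)
  qed
  have ev_add: "ev (p + q) = ev p + ev q" and ev_smult: "ev (Polynomial.smult a q) = fls_const a * ev q" for p q a
  proof -
    have "map_poly fls_const (p + q) = map_poly fls_const p + map_poly fls_const q"
      by (rule poly_eqI) (simp add: coeff_map_poly fls_plus_const)
    then show "ev (p + q) = ev p + ev q" by (simp add: ev_def)
    have "map_poly fls_const (Polynomial.smult a q) = Polynomial.smult (fls_const a) (map_poly fls_const q)"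
      by (rule poly_eqI) (simp add: coeff_map_poly)
    then show "ev (Polynomial.smult a q) = fls_const a * ev q" by (simp add: ev_def)
  qed
  have main: "x \<in> const_series" if "q \<noteq> 0" "ev q = 0" for q
    using that
  proof (induction "degree q" arbitrary: q)
    case 0
    then obtain a where "q = [:a:]" by (metis degree_eq_zeroE)
    then have "ev q = fls_const a" using ev_pCons[of a 0] by (simp add: ev_def)
    with 0 \<open>q = [:a:]\<close> show ?case by simp
  next
    case (Suc n)
    then have "\<not> constant (poly q)" by (simp add: constant_degree)
    from Fundamental_Theorem_Algebra.fundamental_theorem_of_algebra[OF this] obtain z where "poly q z = 0" by (rule exE)
    then have "[:- z, 1:] dvd q" by (simp add: poly_eq_0_iff_dvd)
    then obtain p where p: "q = [:- z, 1:] * p" by (rule dvdE)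
    have "q = Polynomial.smult (- z) p + pCons 0 p" using p by simp
    then have "ev q = ev (Polynomial.smult (- z) p + pCons 0 p)" by (rule arg_cong)
    also have "\<dots> = fls_const (- z) * ev p + x * ev p" by (simp only: ev_add ev_smult ev_pCons) simp
    finally have "ev q = (x - fls_const z) * ev p" by (simp add: algebra_simps)
    then consider "x = fls_const z" | "ev p = 0" using Suc.prems by auto
    then show ?case
    proof cases
      case 2
      have "p \<noteq> 0" using p Suc.prems by auto
      moreover have "degree q = Suc (degree p)" using \<open>p \<noteq> 0\<close> unfolding p by (subst degree_mult_eq) auto
      then have "n = degree p" using Suc.hyps(2) by simp
      ultimately show ?thesis using Suc.hyps(1) 2 by blast
    qed auto
  qed
  obtain p where p: "p \<in> Polys const_series" "p \<noteq> 0" "poly p x = 0" using assms by (auto simp: alg_def)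
  define q where "q = map_poly (\<lambda>c. fls_nth c 0) p"
  have "map_poly fls_const q = p"
  proof (rule poly_eqI)
    fix n
    obtain a where "coeff p n = fls_const a" using coeff_Polys[OF p(1), of n] by auto
    then show "coeff (map_poly fls_const q) n = coeff p n" by (simp add: q_def coeff_map_poly)
  qed
  then show ?thesis using main[of q] p by (auto simp: ev_def)
qed

text \<open>The expansion as an element of a field, the Laurent series in \<open>w\<close> over the Laurent series in \<open>z\<close>.\<close>

definition germ :: "((bool \<Rightarrow> complex) \<Rightarrow> complex) \<Rightarrow> complex fls fls" where
  "germ F = fps_to_fls (wseries F)"

lemma germ_add: "r > 0 \<Longrightarrow> bidisc_holo r F \<Longrightarrow> bidisc_holo r G \<Longrightarrow> germ (\<lambda>x. F x + G x) = germ F + germ G"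
  by (simp add: germ_def wseries_add)

lemma germ_mult: "r > 0 \<Longrightarrow> bidisc_holo r F \<Longrightarrow> bidisc_holo r G \<Longrightarrow> germ (\<lambda>x. F x * G x) = germ F * germ G"
  by (simp add: germ_def wseries_mult fls_times_fps_to_fls)

lemma germ_pd: "r > 0 \<Longrightarrow> bidisc_holo r F \<Longrightarrow> germ (pd F True) = fls_deriv (germ F)"
  by (simp add: germ_def wseries_pd fls_deriv_fps_to_fls)

lemma germ_const: "germ (\<lambda>_. c) = fls_const (fls_const c)"
  by (simp add: germ_def wseries_const)

lemma germ_cong: "r > 0 \<Longrightarrow> (\<And>x. x \<in> bidisc r \<Longrightarrow> F x = G x) \<Longrightarrow> germ F = germ G"
  unfolding germ_def using wseries_cong by metis

lemma germ_sum:
  "r > 0 \<Longrightarrow> (\<And>i. i \<in> J \<Longrightarrow> bidisc_holo r (F i)) \<Longrightarrow> germ (\<lambda>x. \<Sum>i\<in>J. F i x) = (\<Sum>i\<in>J. germ (F i))"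
proof (induction J rule: infinite_finite_induct)
  case (insert j J)
  then show ?case using germ_add[of r "F j" "\<lambda>x. \<Sum>i\<in>J. F i x"] bidisc_holo_sum[of J r F] by simp
qed (use germ_const[of 0] in simp_all)

lemma germ_power: "r > 0 \<Longrightarrow> bidisc_holo r F \<Longrightarrow> germ (\<lambda>x. F x ^ n) = germ F ^ n"
proof (induction n)
  case (Suc n)
  then show ?case using germ_mult[of r F "\<lambda>x. F x ^ n"] bidisc_holo_power[of r F n] by simp
qed (use germ_const[of 1] in simp)

lemma germ_eq_0_iff:
  assumes "r > 0" "bidisc_holo r F" shows "germ F = 0 \<longleftrightarrow> (\<forall>x\<in>bidisc r. F x = 0)"
proof
  assume "germ F = 0"
  then show "\<forall>x\<in>bidisc r. F x = 0" using wseries_0_imp[OF assms] by (simp add: germ_def)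
next
  assume "\<forall>x\<in>bidisc r. F x = 0"
  then have "germ F = germ (\<lambda>_. 0)" using germ_cong[OF assms(1), of F "\<lambda>_. 0"] by blast
  then show "germ F = 0" by (simp add: germ_const)
qed

lemma subfield_compositum: "is_subfield (compositum C)"
  unfolding is_subfield_def is_subring_def compositum_def by auto

lemma germ_z_compositum: "germ (\<lambda>x. f (x False)) \<in> compositum const_series"
  by (auto simp: germ_def wseries_z compositum_def)

lemma germ_w_nth: "fls_nth (germ (\<lambda>x. f (x True))) n \<in> const_series"
proof -
  obtain c where c: "fps_nth (wseries (\<lambda>x. f (x True))) (nat n) = fls_const c" using wseries_w by blast
  have "(0 :: complex fls) \<in> const_series" by (rule image_eqI[of _ _ 0]) auto
  then show ?thesis using c by (simp add: germ_def)
qed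

lemma germ_w_compositum: "germ (\<lambda>x. f (x True)) \<in> compositum const_series"
  using germ_w_nth unfolding compositum_def by blast

text \<open>This set contains the functions of \<open>z\<close> alone and the functions of \<open>w\<close> alone, and it is closed
  under sums and products. It serves to recognize the ingredients of polarized Hermitian forms as
  elements of the compositum.\<close>

definition compositum_holo :: "real \<Rightarrow> ((bool \<Rightarrow> complex) \<Rightarrow> complex) set" where
  "compositum_holo r = {F. bidisc_holo r F \<and> germ F \<in> compositum const_series}"

context
  fixes r :: real assumes r: "r > 0"
begin

lemma compositum_holo_bidisc_holo: "F \<in> compositum_holo r \<Longrightarrow> bidisc_holo r F" by (simp add: compositum_holo_def)

lemma compositum_holo_add: "F \<in> compositum_holo r \<Longrightarrow> G \<in> compositum_holo r \<Longrightarrow> (\<lambda>x. F x + G x) \<in> compositum_holo r"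
  using subring_add[OF subfield_subring[OF subfield_compositum]]
  by (auto simp: compositum_holo_def germ_add[OF r] bidisc_holo_add)

lemma compositum_holo_mult: "F \<in> compositum_holo r \<Longrightarrow> G \<in> compositum_holo r \<Longrightarrow> (\<lambda>x. F x * G x) \<in> compositum_holo r"
  using subring_mult[OF subfield_subring[OF subfield_compositum]]
  by (auto simp: compositum_holo_def germ_mult[OF r] bidisc_holo_mult)

lemma compositum_holo_const: "(\<lambda>_. c) \<in> compositum_holo r"
  by (auto simp: compositum_holo_def bidisc_holo_const germ_const compositum_def)

lemma compositum_holo_sum: "(\<And>i. i \<in> J \<Longrightarrow> F i \<in> compositum_holo r) \<Longrightarrow> (\<lambda>x. \<Sum>i\<in>J. F i x) \<in> compositum_holo r"
  by (induction J rule: infinite_finite_induct) (auto intro: compositum_holo_const compositum_holo_add)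

lemma compositum_holo_z: "f holomorphic_on ball 0 r \<Longrightarrow> (\<lambda>x. f (x False)) \<in> compositum_holo r"
  using bidisc_holo_var[of f r False] germ_z_compositum[of f] by (simp add: compositum_holo_def)

lemma compositum_holo_w: "f holomorphic_on ball 0 r \<Longrightarrow> (\<lambda>x. f (x True)) \<in> compositum_holo r"
  using bidisc_holo_var[of f r True] germ_w_compositum[of f] by (simp add: compositum_holo_def)

text \<open>Polynomials in an auxiliary variable whose coefficients are functions on the bidisc of the
  kind just considered.\<close>

definition compositum_poly :: "((bool \<Rightarrow> complex) \<Rightarrow> complex poly) \<Rightarrow> bool" where
  "compositum_poly R \<longleftrightarrow> (\<forall>k. (\<lambda>x. coeff (R x) k) \<in> compositum_holo r)"

lemma compositum_poly_const: "compositum_poly (\<lambda>_. p)"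
  by (simp add: compositum_poly_def compositum_holo_const)

lemma compositum_poly_mult: "compositum_poly P \<Longrightarrow> compositum_poly Q \<Longrightarrow> compositum_poly (\<lambda>x. P x * Q x)"
  unfolding compositum_poly_def coeff_mult by (auto intro!: compositum_holo_sum compositum_holo_mult)

lemma compositum_poly_power: "compositum_poly P \<Longrightarrow> compositum_poly (\<lambda>x. P x ^ n)"
  by (induction n) (auto intro: compositum_poly_const compositum_poly_mult)

lemma compositum_poly_prod: "(\<And>i. i \<in> J \<Longrightarrow> compositum_poly (P i)) \<Longrightarrow> compositum_poly (\<lambda>x. \<Prod>i\<in>J. P i x)"
  by (induction J rule: infinite_finite_induct) (auto intro: compositum_poly_const compositum_poly_mult)

lemma compositum_poly_smult: "compositum_poly P \<Longrightarrow> compositum_poly (\<lambda>x. Polynomial.smult c (P x))"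
  unfolding compositum_poly_def by (auto intro!: compositum_holo_mult compositum_holo_const)

lemma compositum_poly_sum: "(\<And>i. i \<in> J \<Longrightarrow> compositum_poly (P i)) \<Longrightarrow> compositum_poly (\<lambda>x. \<Sum>i\<in>J. P i x)"
  unfolding compositum_poly_def coeff_sum by (auto intro!: compositum_holo_sum)

lemma compositum_poly_linear: "F \<in> compositum_holo r \<Longrightarrow> compositum_poly (\<lambda>x. [:F x, v:])"
  unfolding compositum_poly_def
proof
  fix k :: nat assume F: "F \<in> compositum_holo r"
  consider "k = 0" | "k = 1" | "k \<ge> 2" by linarith
  then show "(\<lambda>x. coeff [:F x, v:] k) \<in> compositum_holo r"
  proof cases
    case 3
    then have "coeff [:F x, v:] k = 0" for x by (auto simp: coeff_pCons split: nat.splits)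
    then show ?thesis by (simp add: compositum_holo_const)
  qed (use F in \<open>auto simp: compositum_holo_const\<close>)
qed

end

text \<open>Induction on the number of variables: in the last variable the function is a polynomial with
  infinitely many roots, so its coefficients vanish identically in the other variables.\<close>

lemma mpoly_zero:
  fixes c :: "('i \<Rightarrow> nat) \<Rightarrow> complex"
  assumes "finite K" "finite A" "A \<subseteq> K \<rightarrow>\<^sub>E UNIV"
    "\<And>x. (\<Sum>\<mu>\<in>A. c \<mu> * (\<Prod>i\<in>K. x i ^ \<mu> i)) = 0" "\<mu> \<in> A"
  shows "c \<mu> = 0"
  using assms
proof (induction K arbitrary: A c \<mu> rule: finite_induct)
  case empty
  then have "A = {\<mu>}" by auto
  then show ?case using empty by simp
next
  case (insert i K)
  define m where "m = \<mu> i"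
  \<comment> \<open>The terms that contribute to \<open>x i ^ m\<close>, for the exponent \<open>m\<close> of \<open>x i\<close> in the monomial \<open>\<mu>\<close>.\<close>
  define A' where "A' = {\<nu> \<in> A. \<nu> i = m}"
  define \<rho> where "\<rho> \<nu> = restrict \<nu> K" for \<nu> :: "'i \<Rightarrow> nat"
  have inv: "(\<rho> \<nu>)(i := m) = \<nu>" if "\<nu> \<in> A'" for \<nu>
  proof -
    have "\<nu> \<in> insert i K \<rightarrow>\<^sub>E UNIV" "\<nu> i = m" using that insert.prems by (auto simp: A'_def)
    then show ?thesis by (auto simp: \<rho>_def fun_eq_iff PiE_def extensional_def)
  qed
  have inj: "inj_on \<rho> A'" using inv by (metis inj_onI)
  have fin: "finite A'" using insert.prems by (simp add: A'_def)
  have "(\<lambda>\<nu>. c (\<nu>(i := m))) (\<rho> \<mu>) = 0"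
  proof (rule insert.IH[of "\<rho> ` A'" "\<lambda>\<nu>. c (\<nu>(i := m))" "\<rho> \<mu>"])
    show "\<rho> ` A' \<subseteq> K \<rightarrow>\<^sub>E UNIV" by (auto simp: \<rho>_def)
    show "\<rho> \<mu> \<in> \<rho> ` A'" using insert.prems by (auto simp: A'_def m_def)
    fix x :: "'i \<Rightarrow> complex"
    define p where "p = (\<Sum>\<nu>\<in>A. monom (c \<nu> * (\<Prod>j\<in>K. x j ^ \<nu> j)) (\<nu> i))"
    have "poly p T = 0" for T
    proof -
      have "poly p T = (\<Sum>\<nu>\<in>A. c \<nu> * (\<Prod>j\<in>insert i K. (x(i := T)) j ^ \<nu> j))"
        unfolding p_def poly_sum poly_monom
      proof (rule sum.cong[OF refl])
        fix \<nu>
        have "(\<Prod>j\<in>K. (x(i := T)) j ^ \<nu> j) = (\<Prod>j\<in>K. x j ^ \<nu> j)"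
          using insert.hyps by (intro prod.cong) auto
        then show "c \<nu> * (\<Prod>j\<in>K. x j ^ \<nu> j) * T ^ \<nu> i = c \<nu> * (\<Prod>j\<in>insert i K. (x(i := T)) j ^ \<nu> j)"
          using insert.hyps by simp
      qed
      then show ?thesis using insert.prems(3) by simp
    qed
    then have "p = 0" using poly_all_0_iff_0 by blast
    then have "0 = coeff p m" by simp
    also have "\<dots> = (\<Sum>\<nu>\<in>A. if \<nu> i = m then c \<nu> * (\<Prod>j\<in>K. x j ^ \<nu> j) else 0)"
      by (simp add: p_def coeff_sum coeff_monom)
    also have "\<dots> = (\<Sum>\<nu>\<in>A'. c \<nu> * (\<Prod>j\<in>K. x j ^ \<nu> j))"
      using insert.prems unfolding A'_def by (simp add: sum.inter_filter)
    also have "\<dots> = (\<Sum>\<nu>\<in>A'. c ((\<rho> \<nu>)(i := m)) * (\<Prod>j\<in>K. x j ^ \<rho> \<nu> j))"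
      by (intro sum.cong refl) (simp add: inv, simp add: \<rho>_def)
    also have "\<dots> = (\<Sum>\<nu>\<in>\<rho> ` A'. c (\<nu>(i := m)) * (\<Prod>j\<in>K. x j ^ \<nu> j))"
      by (simp add: sum.reindex[OF inj])
    finally show "(\<Sum>\<nu>\<in>\<rho> ` A'. c (\<nu>(i := m)) * (\<Prod>j\<in>K. x j ^ \<nu> j)) = 0" by simp
  qed (use fin in auto)
  then show ?case using inv[of \<mu>] insert.prems by (simp add: A'_def m_def)
qed

text \<open>Substituting \<open>\<Gamma>\<close> into the polynomial relation \<open>P(x, f(x)) = 0\<close> gives a relation for the pullback,
  but this relation is void if all coefficients of \<open>P\<close>, as a polynomial in \<open>y\<close>, vanish on the image
  of \<open>\<Gamma>\<close>. To get around this, \<open>\<Gamma>\<close> is moved in a direction \<open>v\<close> that leads to a point where some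
  coefficient of \<open>P\<close> is nonzero. The coefficients of \<open>P(\<Gamma> + t v, y)\<close> are polynomials in \<open>t\<close>. The lowest
  power \<open>t\<^sup>k\<close> that occurs in any of them can be divided out, and the limit \<open>t \<rightarrow> 0\<close> gives a nontrivial
  relation for \<open>f(\<Gamma>)\<close>.\<close>

theorem nash_algebraic_pullback:
  assumes K: "finite K" and nash: "nash_algebraic_on K W f" and r: "r > 0"
    and G: "\<And>k. k \<in> K \<Longrightarrow> (\<lambda>p. \<Gamma> p k) \<in> compositum_holo r"
    and GW: "\<And>p. p \<in> bidisc r \<Longrightarrow> \<Gamma> p \<in> W" and GK: "\<And>p. \<Gamma> p \<in> K \<rightarrow>\<^sub>E UNIV"
  shows "alg (compositum const_series) (germ (\<lambda>p. f (\<Gamma> p)))"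
proof -
  obtain A c where A: "finite A" "A \<subseteq> (K \<rightarrow>\<^sub>E UNIV) \<times> UNIV" "\<exists>\<alpha>\<in>A. c \<alpha> \<noteq> (0::complex)"
    "\<And>x. x \<in> W \<Longrightarrow> (\<Sum>(\<mu>, k)\<in>A. c (\<mu>, k) * (\<Prod>i\<in>K. x i ^ \<mu> i) * f x ^ k) = 0"
    and f: "mholomorphic_on K W f"
    using nash unfolding nash_algebraic_on_def by blast
  \<comment> \<open>\<open>Al l\<close> contains the monomials in the coefficient of \<open>y ^ l\<close>.\<close>
  define Al where "Al l = {\<mu>. (\<mu>, l) \<in> A}" for l :: nat
  have finAl: "finite (Al l)" for l
    using finite_subset[of "Al l" "fst ` A"] A(1) by (force simp: Al_def)
  define Ls where "Ls = snd ` A"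
  have finL: "finite Ls" using A(1) by (simp add: Ls_def)
  have Asum: "(\<Sum>(\<mu>, k)\<in>A. h \<mu> k) = (\<Sum>l\<in>Ls. \<Sum>\<mu>\<in>Al l. h \<mu> l)" for h :: "('a \<Rightarrow> nat) \<Rightarrow> nat \<Rightarrow> complex"
  proof -
    have "(\<Sum>l\<in>Ls. \<Sum>\<mu>\<in>Al l. h \<mu> l) = (\<Sum>(l, \<mu>)\<in>(SIGMA l:Ls. Al l). h \<mu> l)"
      using finL finAl by (simp add: sum.Sigma)
    also have "\<dots> = (\<Sum>(\<mu>, k)\<in>A. h \<mu> k)"
      by (rule sum.reindex_bij_witness[of _ "\<lambda>(\<mu>, l). (l, \<mu>)" "\<lambda>(l, \<mu>). (\<mu>, l)"])
         (force simp: Ls_def Al_def)+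
    finally show ?thesis ..
  qed
  obtain \<mu>0 l0 where \<mu>0: "(\<mu>0, l0) \<in> A" "c (\<mu>0, l0) \<noteq> 0" using A(3) by auto
  have "\<exists>x. (\<Sum>\<mu>\<in>Al l0. c (\<mu>, l0) * (\<Prod>i\<in>K. x i ^ \<mu> i)) \<noteq> 0"
  proof (rule ccontr)
    assume "\<not> ?thesis"
    then have "c (\<mu>0, l0) = 0"
      using \<mu>0 A(2) finAl
      by (intro mpoly_zero[OF K finAl, of l0 "\<lambda>\<mu>. c (\<mu>, l0)" \<mu>0]) (auto simp: Al_def)
    then show False using \<mu>0 by simp
  qed
  then obtain x0 where x0: "(\<Sum>\<mu>\<in>Al l0. c (\<mu>, l0) * (\<Prod>i\<in>K. x0 i ^ \<mu> i)) \<noteq> 0" ..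
  \<comment> \<open>At the origin of the bidisc, \<open>t = 1\<close> leads to the point \<open>x0\<close>.\<close>
  define v where "v i = x0 i - \<Gamma> (pt 0 0) i" for i
  \<comment> \<open>The coefficient of \<open>y ^ l\<close> on the line \<open>\<Gamma> p + t v\<close>, as a polynomial in \<open>t\<close>.\<close>
  define R where "R l p = (\<Sum>\<mu>\<in>Al l. Polynomial.smult (c (\<mu>, l)) (\<Prod>i\<in>K. [:\<Gamma> p i, v i:] ^ \<mu> i))" for l p
  have polyR: "poly (R l p) t = (\<Sum>\<mu>\<in>Al l. c (\<mu>, l) * (\<Prod>i\<in>K. (\<Gamma> p i + t * v i) ^ \<mu> i))" for l p t
    by (simp add: R_def poly_sum poly_prod mult.commute)
  define Q where "Q k l = (\<lambda>p. coeff (R l p) k)" for k l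
  have Qgood: "Q k l \<in> compositum_holo r" for k l
  proof -
    have "compositum_poly r (R l)"
      unfolding R_def[abs_def] using G
      by (intro compositum_poly_sum[OF r] compositum_poly_smult[OF r] compositum_poly_prod[OF r] compositum_poly_power[OF r] compositum_poly_linear[OF r])
    then show ?thesis by (simp add: compositum_poly_def[OF r] Q_def)
  qed
  have "poly (R l0 (pt 0 0)) 1 \<noteq> 0" using x0 by (simp add: polyR v_def)
  then have "R l0 (pt 0 0) \<noteq> 0" by auto
  then obtain k1 where "Q k1 l0 (pt 0 0) \<noteq> 0" unfolding Q_def by (metis coeff_0 poly_eqI)
  moreover have "pt 0 0 \<in> bidisc r" using r by (simp add: bidisc_def)
  ultimately have "germ (Q k1 l0) \<noteq> 0"
    using germ_eq_0_iff[OF r compositum_holo_bidisc_holo[OF r Qgood[of k1 l0]]] by blast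
  moreover have "l0 \<in> Ls" using \<mu>0 by (force simp: Ls_def)
  ultimately have ex: "\<exists>l\<in>Ls. germ (Q k1 l) \<noteq> 0" by blast
  \<comment> \<open>The lowest power of \<open>t\<close> that occurs in some coefficient at some point of the bidisc.\<close>
  define k where "k = (LEAST k. \<exists>l\<in>Ls. germ (Q k l) \<noteq> 0)"
  obtain l1 where l1: "l1 \<in> Ls" "germ (Q k l1) \<noteq> 0" using LeastI[of "\<lambda>k. \<exists>l\<in>Ls. germ (Q k l) \<noteq> 0", OF ex] k_def by auto
  have low: "coeff (R l p) k' = 0" if "k' < k" "l \<in> Ls" "p \<in> bidisc r" for k' l p
  proof -
    have "germ (Q k' l) = 0" using not_less_Least[of k' "\<lambda>k. \<exists>l\<in>Ls. germ (Q k l) \<noteq> 0"] that k_def by blast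
    then show ?thesis using germ_eq_0_iff[OF r compositum_holo_bidisc_holo[OF r Qgood], of k' l] that by (simp add: Q_def)
  qed
  have rel: "(\<Sum>l\<in>Ls. Q k l p * f (\<Gamma> p) ^ l) = 0" if p: "p \<in> bidisc r" for p
  proof -
    \<comment> \<open>Outside of \<open>K\<close>, points of the coordinate space are undefined.\<close>
    let ?\<gamma> = "\<lambda>t::complex. (\<lambda>i. if i \<in> K then \<Gamma> p i + t * v i else undefined)"
    have \<gamma>K: "?\<gamma> t \<in> K \<rightarrow>\<^sub>E UNIV" for t by auto
    have \<gamma>0: "?\<gamma> 0 = \<Gamma> p" using GK[of p] by (auto simp: fun_eq_iff PiE_def extensional_def)
    have cont: "((\<lambda>t. f (?\<gamma> t)) has_field_derivative (\<Sum>i\<in>K. pd f i (?\<gamma> 0) * v i)) (at 0)"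
    proof (rule chain_rule_complex[where \<gamma> = ?\<gamma>, OF K f _ \<gamma>K])
      show "?\<gamma> 0 \<in> W" using \<gamma>0 GW[OF p] by simp
      show "((\<lambda>s. ?\<gamma> s i) has_field_derivative v i) (at 0)" if "i \<in> K" for i
        using that by (auto intro!: derivative_eq_intros)
    qed
    define R' where "R' l = poly_shift k (R l p)" for l
    have R': "poly (R l p) t = t ^ k * poly (R' l) t" if "l \<in> Ls" for l t
    proof -
      have "R l p = monom 1 k * R' l"
        using low[OF _ that p] by (intro poly_eqI) (auto simp: coeff_monom_mult R'_def coeff_poly_shift)
      then show ?thesis by (simp add: poly_monom)
    qed
    obtain e where e: "e > 0" "\<And>y. y \<in> K \<rightarrow>\<^sub>E UNIV \<Longrightarrow> near K e (\<Gamma> p) y \<Longrightarrow> y \<in> W"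
      using mholomorphicD(2)[OF K f GW[OF p]] by blast
    have "\<exists>d>0. \<forall>t. cmod t < d \<longrightarrow> ?\<gamma> t \<in> W"
    proof -
      define B where "B = (\<Sum>i\<in>K. cmod (v i)) + 1"
      have B: "B > 0" unfolding B_def by (intro add_nonneg_pos sum_nonneg) auto
      have vB: "cmod (v i) < B" if "i \<in> K" for i
        unfolding B_def using member_le_sum[OF that, of "\<lambda>i. cmod (v i)"] K by simp
      have "?\<gamma> t \<in> W" if t: "cmod t < e / B" for t
      proof (rule e(2)[OF \<gamma>K])
        have "cmod t * cmod (v i) < e" if "i \<in> K" for i
        proof (cases "t = 0")
          case False
          have "cmod t * cmod (v i) \<le> cmod t * B" using vB[OF that] by (intro mult_left_mono) auto
          also have "\<dots> < e" using t B by (simp add: field_simps)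
          finally show ?thesis .
        qed (use e in auto)
        then show "near K e (\<Gamma> p) (?\<gamma> t)" by (auto simp: near_def dist_norm norm_mult)
      qed
      then show ?thesis using e(1) B by (intro exI[of _ "e / B"]) auto
    qed
    then obtain d where d: "d > 0" "\<And>t. cmod t < d \<Longrightarrow> ?\<gamma> t \<in> W" by blast
    have zero: "(\<Sum>l\<in>Ls. poly (R' l) t * f (?\<gamma> t) ^ l) = 0" if t: "t \<noteq> 0" "cmod t < d" for t
    proof -
      have "0 = (\<Sum>(\<mu>, k)\<in>A. c (\<mu>, k) * (\<Prod>i\<in>K. ?\<gamma> t i ^ \<mu> i) * f (?\<gamma> t) ^ k)"
        using A(4)[OF d(2)[OF t(2)]] by simp
      also have "\<dots> = (\<Sum>l\<in>Ls. \<Sum>\<mu>\<in>Al l. c (\<mu>, l) * (\<Prod>i\<in>K. ?\<gamma> t i ^ \<mu> i) * f (?\<gamma> t) ^ l)"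
        by (rule Asum)
      also have "\<dots> = (\<Sum>l\<in>Ls. poly (R l p) t * f (?\<gamma> t) ^ l)"
        by (simp add: polyR sum_distrib_right)
      also have "\<dots> = t ^ k * (\<Sum>l\<in>Ls. poly (R' l) t * f (?\<gamma> t) ^ l)"
        by (simp add: R' sum_distrib_left mult.assoc)
      finally show ?thesis using t by simp
    qed
    have "isCont (\<lambda>t. f (?\<gamma> t)) 0" using cont by (rule DERIV_isCont)
    then have "isCont (\<lambda>t. \<Sum>l\<in>Ls. poly (R' l) t * f (?\<gamma> t) ^ l) 0" by (intro continuous_intros)
    then have lim: "((\<lambda>t. \<Sum>l\<in>Ls. poly (R' l) t * f (?\<gamma> t) ^ l) \<longlongrightarrow> (\<Sum>l\<in>Ls. poly (R' l) 0 * f (?\<gamma> 0) ^ l)) (at 0)"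
      by (simp add: isCont_def)
    have "eventually (\<lambda>t. (\<Sum>l\<in>Ls. poly (R' l) t * f (?\<gamma> t) ^ l) = 0) (at 0)"
      unfolding eventually_at using d(1) zero by (intro exI[of _ d]) (auto simp: dist_norm)
    then have "(\<Sum>l\<in>Ls. poly (R' l) 0 * f (?\<gamma> 0) ^ l) = 0"
      by (rule tendsto_unique[OF at_neq_bot lim tendsto_eventually])
    then show ?thesis unfolding \<gamma>0 by (simp add: R'_def poly_0_coeff_0 coeff_poly_shift Q_def)
  qed
  have bf: "bidisc_holo r (\<lambda>p. f (\<Gamma> p))"
    by (rule mholomorphic_compose(1)[OF _ K f openin_bidisc _ GW GK]) (use G compositum_holo_bidisc_holo[OF r] in auto)
  have bterm: "bidisc_holo r (\<lambda>p. Q k l p * f (\<Gamma> p) ^ l)" for l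
    by (intro bidisc_holo_mult bidisc_holo_power bf compositum_holo_bidisc_holo[OF r Qgood])
  have "0 = germ (\<lambda>p. \<Sum>l\<in>Ls. Q k l p * f (\<Gamma> p) ^ l)"
    using germ_cong[OF r, of "\<lambda>p. \<Sum>l\<in>Ls. Q k l p * f (\<Gamma> p) ^ l" "\<lambda>_. 0"] rel by (simp add: germ_const)
  also have "\<dots> = (\<Sum>l\<in>Ls. germ (Q k l) * germ (\<lambda>p. f (\<Gamma> p)) ^ l)"
    using bterm by (simp add: germ_sum[OF r] germ_mult[OF r compositum_holo_bidisc_holo[OF r Qgood] bidisc_holo_power[OF bf]] germ_power[OF r bf])
  finally have eq: "(\<Sum>l\<in>Ls. germ (Q k l) * germ (\<lambda>p. f (\<Gamma> p)) ^ l) = 0" by simp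
  define P where "P = (\<Sum>l\<in>Ls. monom (germ (Q k l)) l)"
  have coeffP: "coeff P l = (if l \<in> Ls then germ (Q k l) else 0)" for l
    using finL by (simp add: P_def coeff_sum coeff_monom)
  have "P \<noteq> 0" using l1 coeffP[of l1] by auto
  moreover have "P \<in> Polys (compositum const_series)"
    using Qgood subring_0[OF subfield_subring[OF subfield_compositum]]
    by (auto simp: Polys_def coeffP compositum_holo_def)
  moreover have "poly P (germ (\<lambda>p. f (\<Gamma> p))) = 0" using eq by (simp add: P_def poly_sum poly_monom)
  ultimately show ?thesis unfolding alg_def by blast
qed

section \<open>Polarized curves\<close>

lemma chain_rule_local:
  fixes \<gamma> :: "complex \<Rightarrow> 'i \<Rightarrow> complex"
  assumes I: "finite I" and f: "mholomorphic_on I U f" and T: "open T" "t \<in> T" and t: "\<gamma> t \<in> U"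
    and PiE: "\<And>s. s \<in> T \<Longrightarrow> \<gamma> s \<in> I \<rightarrow>\<^sub>E UNIV"
    and D: "\<And>i. i \<in> I \<Longrightarrow> ((\<lambda>s. \<gamma> s i) has_field_derivative D i) (at t)"
  shows "((\<lambda>s. f (\<gamma> s)) has_field_derivative (\<Sum>i\<in>I. pd f i (\<gamma> t) * D i)) (at t)"
proof -
  define \<gamma>' where "\<gamma>' s = (if s \<in> T then \<gamma> s else \<gamma> t)" for s
  have "((\<lambda>s. f (\<gamma>' s)) has_field_derivative (\<Sum>i\<in>I. pd f i (\<gamma>' t) * D i)) (at t)"
  proof (rule chain_rule_complex[where \<gamma> = \<gamma>', OF I f])
    show "\<gamma>' t \<in> U" using t by (simp add: \<gamma>'_def)
    show "\<gamma>' s \<in> I \<rightarrow>\<^sub>E UNIV" for s using PiE T(2) unfolding \<gamma>'_def by presburger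
    fix i assume "i \<in> I"
    show "((\<lambda>s. \<gamma>' s i) has_field_derivative D i) (at t)"
      by (rule has_field_derivative_transform_within_open[OF D[OF \<open>i \<in> I\<close>] T]) (simp add: \<gamma>'_def)
  qed
  then have 1: "((\<lambda>s. f (\<gamma>' s)) has_field_derivative (\<Sum>i\<in>I. pd f i (\<gamma> t) * D i)) (at t)"
    using T by (simp add: \<gamma>'_def)
  show ?thesis
    by (rule has_field_derivative_transform_within_open[OF 1 T]) (simp add: \<gamma>'_def)
qed

lemma openin_cspaceD:
  assumes "finite I" "openin (cspace I) U" "x \<in> U"
  shows "\<exists>e>0. \<forall>y\<in>I \<rightarrow>\<^sub>E UNIV. near I e x y \<longrightarrow> y \<in> U"
  using assms(2,3) by (simp add: openin_cspace_near[OF assms(1)])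

text \<open>The polarization of a curve \<open>f\<close>: the coordinates \<open>\<xi>\<close> follow the curve with parameter \<open>z\<close>, and the
  coordinates \<open>\<zeta>\<close> follow the conjugate curve, whose parameter \<open>w\<close> is conjugated twice to make it
  holomorphic in \<open>w\<close>. For \<open>w = cnj z\<close> it is the point \<open>(f(z), cnj f(z))\<close>.\<close>

definition polarized :: "'i set \<Rightarrow> (complex \<Rightarrow> 'i \<Rightarrow> complex) \<Rightarrow> (bool \<Rightarrow> complex) \<Rightarrow> 'i + 'i \<Rightarrow> complex" where
  "polarized I f p = case_sum (restrict (f (p False)) I) (conj_vec I (f (cnj (p True))))"

lemma polarized_PiE: "polarized I f p \<in> (I <+> I) \<rightarrow>\<^sub>E UNIV"
  by (auto simp: polarized_def PiE_def extensional_def conj_vec_def split: sum.splits)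

lemma polarized_antidiagonal: "f z \<in> I \<rightarrow>\<^sub>E UNIV \<Longrightarrow> polarized I f (pt z (cnj z)) = diag I (f z)"
  by (simp add: polarized_def PiE_restrict)

lemma holomorphic_star:
  assumes f: "f holomorphic_on ball 0 r"
  shows "(\<lambda>w. cnj (f (cnj w))) holomorphic_on ball 0 r"
    and "w \<in> ball 0 r \<Longrightarrow> deriv (\<lambda>w. cnj (f (cnj w))) w = cnj (deriv f (cnj w))"
proof -
  have *: "((\<lambda>w. cnj (f (cnj w))) has_field_derivative cnj (deriv f (cnj w))) (at w)" if "w \<in> ball 0 r" for w
  proof -
    have "(f has_field_derivative deriv f (cnj w)) (at (cnj w))"
      using that by (intro holomorphic_derivI[OF f open_ball]) simp
    from has_field_derivative_cnj_cnj[OF this] show ?thesis by (simp add: o_def)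
  qed
  then show "(\<lambda>w. cnj (f (cnj w))) holomorphic_on ball 0 r"
    unfolding holomorphic_on_open[OF open_ball] by blast
  show "w \<in> ball 0 r \<Longrightarrow> deriv (\<lambda>w. cnj (f (cnj w))) w = cnj (deriv f (cnj w))"
    using * by (intro DERIV_imp_deriv)
qed

context
  fixes I :: "'i set" and f :: "complex \<Rightarrow> 'i \<Rightarrow> complex" and r :: real
  assumes I: "finite I" and r: "r > 0"
    and f: "\<And>i. i \<in> I \<Longrightarrow> (\<lambda>z. f z i) holomorphic_on ball 0 r"
begin

lemma polarized_compositum_holo:
  assumes "k \<in> I <+> I" shows "(\<lambda>p. polarized I f p k) \<in> compositum_holo r"
proof (cases k)
  case (Inl i)
  then show ?thesis using assms compositum_holo_z[OF r f] by (auto simp: polarized_def)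
next
  case (Inr i)
  then show ?thesis
    using assms compositum_holo_w[OF r holomorphic_star(1)[OF f]] by (auto simp: polarized_def conj_vec_def)
qed

lemma polarized_pd:
  assumes p: "p \<in> bidisc r" and k: "k \<in> I <+> I"
  shows "pd (\<lambda>p. polarized I f p k) False p = (case k of Inl i \<Rightarrow> deriv (\<lambda>z. f z i) (p False) | Inr i \<Rightarrow> 0)"
    "pd (\<lambda>p. polarized I f p k) True p = (case k of Inl i \<Rightarrow> 0 | Inr i \<Rightarrow> cnj (deriv (\<lambda>z. f z i) (cnj (p True))))"
proof -
  have c: "(\<lambda>p. polarized I f p k) = (case k of Inl i \<Rightarrow> (\<lambda>p. f (p False) i) | Inr i \<Rightarrow> (\<lambda>p. cnj (f (cnj (p True)) i)))"
    using k by (auto simp: polarized_def conj_vec_def fun_eq_iff split: sum.splits)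
  have "p True \<in> ball 0 r" using p by (simp add: bidisc_def)
  then show "pd (\<lambda>p. polarized I f p k) False p = (case k of Inl i \<Rightarrow> deriv (\<lambda>z. f z i) (p False) | Inr i \<Rightarrow> 0)"
    "pd (\<lambda>p. polarized I f p k) True p = (case k of Inl i \<Rightarrow> 0 | Inr i \<Rightarrow> cnj (deriv (\<lambda>z. f z i) (cnj (p True))))"
    unfolding c using k holomorphic_star(2)[OF f]
    by (auto split: sum.splits simp: pd_var[of "\<lambda>z. f z _" False] pd_var[of "\<lambda>w. cnj (f (cnj w) _)" True])
qed

lemma polarized_nbhd:
  assumes W: "openin (cspace (I <+> I)) W" and 0: "polarized I f (pt 0 0) \<in> W"
  obtains s where "s > 0" "s \<le> r" "\<And>p. p \<in> bidisc s \<Longrightarrow> polarized I f p \<in> W"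
proof -
  have K: "finite (I <+> I)" using I by simp
  obtain e where e: "e > 0" "\<And>y. y \<in> (I <+> I) \<rightarrow>\<^sub>E UNIV \<Longrightarrow> near (I <+> I) e (polarized I f (pt 0 0)) y \<Longrightarrow> y \<in> W"
    using openin_cspaceD[OF K W 0] by blast
  have 00: "pt 0 0 \<in> bidisc r" using r by (simp add: bidisc_def)
  have "\<exists>d>0. \<forall>p\<in>bidisc r. near UNIV d (pt 0 0) p \<longrightarrow> dist (polarized I f p k) (polarized I f (pt 0 0) k) < e"
    if "k \<in> I <+> I" for k
    using mholomorphicD(3)[OF finite_class.finite_UNIV compositum_holo_bidisc_holo[OF r polarized_compositum_holo[OF that]] 00 e(1)] .
  then obtain D where D: "\<And>k. k \<in> I <+> I \<Longrightarrow> D k > 0"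
    "\<And>k p. k \<in> I <+> I \<Longrightarrow> p \<in> bidisc r \<Longrightarrow> near UNIV (D k) (pt 0 0) p \<Longrightarrow> dist (polarized I f p k) (polarized I f (pt 0 0) k) < e"
    by metis
  define s where "s = Min (insert r (D ` (I <+> I)))"
  have s: "s > 0" "s \<le> r" "\<And>k. k \<in> I <+> I \<Longrightarrow> s \<le> D k" using K D(1) r by (auto simp: s_def)
  show thesis
  proof (rule that[OF s(1,2)])
    fix p assume p: "p \<in> bidisc s"
    have n: "near UNIV s (pt 0 0) p"
      unfolding near_def
    proof
      fix b :: bool show "dist (p b) (pt 0 0 b) < s" using p by (cases b) (auto simp: bidisc_def)
    qed
    have pr: "p \<in> bidisc r" using p s(2) by (auto simp: bidisc_def)
    show "polarized I f p \<in> W"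
    proof (rule e(2)[OF polarized_PiE], unfold near_def[of "I <+> I"], rule ballI)
      fix k assume k: "k \<in> I <+> I"
      show "dist (polarized I f p k) (polarized I f (pt 0 0) k) < e"
        by (rule D(2)[OF k pr near_mono[OF n s(3)[OF k]]])
    qed
  qed
qed

end

text \<open>Second derivatives of the curve do not enter into the mixed derivative, because each coordinate
  of the polarized curve depends on only one of \<open>z\<close> and \<open>w\<close>.\<close>

lemma curve_levi:
  assumes I: "finite I" and s: "s > 0"
    and f: "\<And>i. i \<in> I \<Longrightarrow> (\<lambda>z. f z i) holomorphic_on ball 0 s"
    and \<Psi>: "mholomorphic_on (I <+> I) W \<Psi>"
    and W: "\<And>p. p \<in> bidisc s \<Longrightarrow> polarized I f p \<in> W"
  shows "bidisc_holo s (\<lambda>p. \<Psi> (polarized I f p))"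
    and "\<And>p. p \<in> bidisc s \<Longrightarrow> mixed (\<lambda>p. \<Psi> (polarized I f p)) p =
      (\<Sum>j\<in>I. \<Sum>k\<in>I. pd (pd \<Psi> (Inr k)) (Inl j) (polarized I f p) *
         deriv (\<lambda>z. f z j) (p False) * cnj (deriv (\<lambda>z. f z k) (cnj (p True))))"
proof -
  have K: "finite (I <+> I)" using I by simp
  have G: "bidisc_holo s (\<lambda>p. polarized I f p k)" if "k \<in> I <+> I" for k
    by (rule compositum_holo_bidisc_holo[OF s polarized_compositum_holo[OF I s _ that]]) (rule f)
  have comp1: "bidisc_holo s (\<lambda>p. g (polarized I f p))" if g: "mholomorphic_on (I <+> I) W g" for g
    by (rule mholomorphic_compose(1)[OF finite_class.finite_UNIV K g openin_bidisc _ _ polarized_PiE]) (use G W in auto)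
  have comp2: "pd (\<lambda>p. g (polarized I f p)) b p = (\<Sum>k\<in>I <+> I. pd g k (polarized I f p) * pd (\<lambda>p. polarized I f p k) b p)"
    if g: "mholomorphic_on (I <+> I) W g" and p: "p \<in> bidisc s" for g b p
    by (rule mholomorphic_compose(2)[OF finite_class.finite_UNIV K g openin_bidisc _ _ polarized_PiE]) (use G W p in auto)
  have polarized_pd': "pd (\<lambda>p. polarized I f p k) False p = (case k of Inl i \<Rightarrow> deriv (\<lambda>z. f z i) (p False) | Inr i \<Rightarrow> 0)"
    "pd (\<lambda>p. polarized I f p k) True p = (case k of Inl i \<Rightarrow> 0 | Inr i \<Rightarrow> cnj (deriv (\<lambda>z. f z i) (cnj (p True))))"
    if "p \<in> bidisc s" "k \<in> I <+> I" for p k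
    by (rule polarized_pd[OF I s f that]; assumption)+
  show "bidisc_holo s (\<lambda>p. \<Psi> (polarized I f p))" by (rule comp1[OF \<Psi>])
  fix p assume p: "p \<in> bidisc s"
  let ?g = "\<lambda>k w. cnj (deriv (\<lambda>z. f z k) (cnj w))"
  let ?F = "\<lambda>k p. pd \<Psi> (Inr k) (polarized I f p)"
  have pd\<Psi>: "mholomorphic_on (I <+> I) W (pd \<Psi> (Inr k))" if "k \<in> I" for k
    using that by (intro mholomorphic_pd[OF K \<Psi>]) auto
  have F: "bidisc_holo s (?F k)" if "k \<in> I" for k by (rule comp1[OF pd\<Psi>[OF that]])
  have 1: "pd (\<lambda>p. \<Psi> (polarized I f p)) True q = (\<Sum>k\<in>I. ?F k q * ?g k (q True))" if "q \<in> bidisc s" for q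
  proof -
    have "pd (\<lambda>p. \<Psi> (polarized I f p)) True q = (\<Sum>k\<in>I <+> I. pd \<Psi> k (polarized I f q) * pd (\<lambda>p. polarized I f p k) True q)"
      by (rule comp2[OF \<Psi> that])
    also have "\<dots> = (\<Sum>k\<in>I <+> I. pd \<Psi> k (polarized I f q) * (case k of Inl i \<Rightarrow> 0 | Inr i \<Rightarrow> ?g i (q True)))"
      by (intro sum.cong refl) (simp add: polarized_pd'[OF that])
    also have "\<dots> = (\<Sum>k\<in>I. ?F k q * ?g k (q True))" using I by (simp add: sum.Plus)
    finally show ?thesis .
  qed
  have "mixed (\<lambda>p. \<Psi> (polarized I f p)) p = pd (\<lambda>q. \<Sum>k\<in>I. ?F k q * ?g k (q True)) False p"
    by (rule pd_cong[OF finite_class.finite_UNIV openin_bidisc p]) (auto simp: 1)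
  also have "\<dots> = (\<Sum>k\<in>I. pd (?F k) False p * ?g k (p True))"
    unfolding pd_def[of "\<lambda>q. \<Sum>k\<in>I. ?F k q * ?g k (q True)"]
  proof (rule DERIV_imp_deriv)
    have "((\<lambda>w. ?F k (p(False := w))) has_field_derivative pd (?F k) False p) (at (p False))" if "k \<in> I" for k
      using slice_derivative[OF finite_class.finite_UNIV F[OF that], of False p "p False"] p by simp
    then have "((\<lambda>w. \<Sum>k\<in>I. ?F k (p(False := w)) * ?g k (p True)) has_field_derivative
        (\<Sum>k\<in>I. pd (?F k) False p * ?g k (p True))) (at (p False))"
      by (intro DERIV_sum DERIV_cmult_right)
    then show "((\<lambda>w. \<Sum>k\<in>I. ?F k (p(False := w)) * ?g k ((p(False := w)) True)) has_field_derivative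
        (\<Sum>k\<in>I. pd (?F k) False p * ?g k (p True))) (at (p False))" by simp
  qed
  also have "\<dots> = (\<Sum>k\<in>I. (\<Sum>j\<in>I. pd (pd \<Psi> (Inr k)) (Inl j) (polarized I f p) * deriv (\<lambda>z. f z j) (p False)) * ?g k (p True))"
  proof (rule sum.cong[OF refl])
    fix k assume k: "k \<in> I"
    have "pd (?F k) False p = (\<Sum>j\<in>I <+> I. pd (pd \<Psi> (Inr k)) j (polarized I f p) * pd (\<lambda>p. polarized I f p j) False p)"
      by (rule comp2[OF pd\<Psi>[OF k] p])
    also have "\<dots> = (\<Sum>j\<in>I <+> I. pd (pd \<Psi> (Inr k)) j (polarized I f p) * (case j of Inl i \<Rightarrow> deriv (\<lambda>z. f z i) (p False) | Inr i \<Rightarrow> 0))"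
      by (intro sum.cong refl) (simp add: polarized_pd'[OF p])
    also have "\<dots> = (\<Sum>j\<in>I. pd (pd \<Psi> (Inr k)) (Inl j) (polarized I f p) * deriv (\<lambda>z. f z j) (p False))"
      using I by (simp add: sum.Plus)
    finally show "pd (?F k) False p * ?g k (p True) =
      (\<Sum>j\<in>I. pd (pd \<Psi> (Inr k)) (Inl j) (polarized I f p) * deriv (\<lambda>z. f z j) (p False)) * ?g k (p True)" by simp
  qed
  also have "\<dots> = (\<Sum>j\<in>I. \<Sum>k\<in>I. pd (pd \<Psi> (Inr k)) (Inl j) (polarized I f p) *
         deriv (\<lambda>z. f z j) (p False) * ?g k (p True))"
    unfolding sum_distrib_right by (rule sum.swap)
  finally show "mixed (\<lambda>p. \<Psi> (polarized I f p)) p =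
      (\<Sum>j\<in>I. \<Sum>k\<in>I. pd (pd \<Psi> (Inr k)) (Inl j) (polarized I f p) *
         deriv (\<lambda>z. f z j) (p False) * cnj (deriv (\<lambda>z. f z k) (cnj (p True))))" .
qed

lemma curve_levi_antidiagonal:
  assumes I: "finite I" and s: "s > 0"
    and f: "\<And>i. i \<in> I \<Longrightarrow> (\<lambda>z. f z i) holomorphic_on ball 0 s"
    and V: "openin (cspace I) V" "\<And>z. cmod z < s \<Longrightarrow> f z \<in> V"
    and \<Psi>: "mholomorphic_on (I <+> I) W \<Psi>"
    and g: "\<And>\<xi>. \<xi> \<in> V \<Longrightarrow> diag I \<xi> \<in> W \<and> of_real (\<phi> \<xi>) = \<Psi> (diag I \<xi>)"
    and W: "\<And>p. p \<in> bidisc s \<Longrightarrow> polarized I f p \<in> W" and z: "cmod z < s"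
  shows "mixed (\<lambda>p. \<Psi> (polarized I f p)) (pt z (cnj z)) =
    (\<Sum>j\<in>I. \<Sum>k\<in>I. levi \<phi> (f z) j k * deriv (\<lambda>z. f z j) z * cnj (deriv (\<lambda>z. f z k) z))"
proof -
  have fz: "f z \<in> V" by (rule V(2)[OF z])
  then have "f z \<in> I \<rightarrow>\<^sub>E UNIV" using openin_subset[OF V(1)] by auto
  then have d: "polarized I f (pt z (cnj z)) = diag I (f z)" by (rule polarized_antidiagonal)
  have p: "pt z (cnj z) \<in> bidisc s" using z by simp
  have 1: "levi \<phi> (f z) j k = pd (pd \<Psi> (Inr k)) (Inl j) (diag I (f z))" if "j \<in> I" "k \<in> I" for j k
    by (rule levi_polarized[OF I V(1) \<Psi> g fz that])
  have "mixed (\<lambda>p. \<Psi> (polarized I f p)) (pt z (cnj z)) =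
      (\<Sum>j\<in>I. \<Sum>k\<in>I. pd (pd \<Psi> (Inr k)) (Inl j) (polarized I f (pt z (cnj z))) *
         deriv (\<lambda>z. f z j) ((pt z (cnj z)) False) * cnj (deriv (\<lambda>z. f z k) (cnj ((pt z (cnj z)) True))))"
    by (rule curve_levi(2)[OF I s _ \<Psi> _ p]) (use f W in auto)
  then show ?thesis unfolding d by (simp add: 1)
qed

section \<open>Mixed derivatives and algebraicity\<close>

text \<open>Two functions with equal mixed derivatives have derivatives in \<open>w\<close> that differ by a function
  of \<open>w\<close> alone, and the expansion of the latter has constant coefficients.\<close>

lemma mixed_derivative_eq_imp:
  assumes s: "s > 0" and A: "bidisc_holo s A" and B: "bidisc_holo s B"
    and eq: "\<And>z. cmod z < s \<Longrightarrow> mixed A (pt z (cnj z)) = mixed B (pt z (cnj z))"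
  obtains q where "\<And>n. fls_nth q n \<in> const_series" "germ (pd A True) = germ (pd B True) + q"
proof -
  define X where "X p = mixed A p + (- 1) * mixed B p" for p
  have bX: "bidisc_holo s X" unfolding X_def by (intro bidisc_holo_add bidisc_holo_mult bidisc_holo_const bidisc_holo_pd A B)
  \<comment> \<open>The identity theorem on \<open>w = cnj z\<close> loses half of the radius.\<close>
  define h where "h = s / 2"
  have h: "h > 0" "h \<le> s" using s by (auto simp: h_def)
  have X0: "X p = 0" if "p \<in> bidisc h" for p
    using antidiagonal_zero[OF s bX, of p] eq that by (simp add: X_def h_def)
  define q where "q w = pd A True (pt 0 w) - pd B True (pt 0 w)" for w
  have A': "bidisc_holo h (pd A True)" and B': "bidisc_holo h (pd B True)"
    using bidisc_holo_subset[OF bidisc_holo_pd[OF A] h(2)] bidisc_holo_subset[OF bidisc_holo_pd[OF B] h(2)] by auto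
  have const: "pd A True x = pd B True x + q (x True)" if x: "x \<in> bidisc h" for x
  proof -
    let ?D = "\<lambda>z. pd A True (pt z (x True)) - pd B True (pt z (x True))"
    have "((\<lambda>z. pd A True (pt z (x True)) - pd B True (pt z (x True))) has_field_derivative 0) (at z within ball 0 h)"
      if z: "z \<in> ball 0 h" for z
    proof -
      have b: "pt z (x True) \<in> bidisc h" using z x by (auto simp: bidisc_def)
      have sl: "((\<lambda>w. F ((pt z (x True))(False := w))) has_field_derivative pd F False (pt z (x True))) (at z)"
        if "bidisc_holo h F" for F
        using slice_derivative[OF finite_class.finite_UNIV that, of False "pt z (x True)" z] b by simp
      have "(?D has_field_derivative mixed A (pt z (x True)) - mixed B (pt z (x True))) (at z)"
        using DERIV_diff[OF sl[OF A'] sl[OF B']] by simp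
      then show ?thesis using X0[OF b] by (auto simp: X_def intro: has_field_derivative_at_within)
    qed
    then obtain c where c: "\<And>z. z \<in> ball 0 h \<Longrightarrow> ?D z = c"
      using has_field_derivative_zero_constant[of "ball 0 h" ?D] by auto
    have "?D (x False) = ?D 0" using c[of "x False"] c[of 0] x h by (simp add: bidisc_def)
    then show ?thesis by (simp add: q_def pt_eta algebra_simps)
  qed
  have bq: "bidisc_holo h (\<lambda>x. q (x True))"
  proof (rule bidisc_holo_var)
    have "(\<lambda>w. pd A True (pt 0 w)) holomorphic_on ball 0 h" "(\<lambda>w. pd B True (pt 0 w)) holomorphic_on ball 0 h"
      using bidisc_holo_slice(1)[OF A', of 0] bidisc_holo_slice(1)[OF B', of 0] h by auto
    then show "q holomorphic_on ball 0 h" unfolding q_def by (intro holomorphic_intros)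
  qed
  have "germ (pd A True) = germ (\<lambda>x. pd B True x + q (x True))" by (rule germ_cong[OF h(1) const])
  also have "\<dots> = germ (pd B True) + germ (\<lambda>x. q (x True))" by (rule germ_add[OF h(1) B' bq])
  finally show thesis using that[of "germ (\<lambda>x. q (x True))"] germ_w_nth by blast
qed

lemma pd_linear_combination:
  assumes F: "\<And>j. j \<in> J \<Longrightarrow> bidisc_holo s (F j)" and p: "p \<in> bidisc s"
  shows "pd (\<lambda>p. \<Sum>j\<in>J. c j * F j p) b p = (\<Sum>j\<in>J. c j * pd (F j) b p)"
  unfolding pd_def[of "\<lambda>p. \<Sum>j\<in>J. c j * F j p"]
proof (rule DERIV_imp_deriv)
  have "((\<lambda>w. F j (p(b := w))) has_field_derivative pd (F j) b p) (at (p b))" if "j \<in> J" for j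
    using slice_derivative[OF finite_class.finite_UNIV F[OF that], of b p "p b"] p by simp
  then show "((\<lambda>w. \<Sum>j\<in>J. c j * F j (p(b := w))) has_field_derivative (\<Sum>j\<in>J. c j * pd (F j) b p)) (at (p b))"
    by (intro DERIV_sum DERIV_cmult)
qed

lemma mixed_linear_combination:
  assumes F: "\<And>j. j \<in> J \<Longrightarrow> bidisc_holo s (F j)" and p: "p \<in> bidisc s"
  shows "mixed (\<lambda>p. \<Sum>j\<in>J. c j * F j p) p = (\<Sum>j\<in>J. c j * mixed (F j) p)"
proof -
  have "mixed (\<lambda>p. \<Sum>j\<in>J. c j * F j p) p = pd (\<lambda>p. \<Sum>j\<in>J. c j * pd (F j) True p) False p"
    by (rule pd_cong[OF finite_class.finite_UNIV openin_bidisc p]) (auto simp: pd_linear_combination[OF F])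
  also have "\<dots> = (\<Sum>j\<in>J. c j * mixed (F j) p)"
    by (rule pd_linear_combination[OF bidisc_holo_pd[OF F] p])
  finally show ?thesis .
qed

text \<open>By \<open>mixed_derivative_eq_imp\<close>, the expansions of \<open>A\<close> and of the \<open>H j\<close> satisfy the equation in
  \<open>log_derivative_coefficients\<close>, with the complex numbers in the role of \<open>C\<close>.\<close>

theorem algebraic_versus_log:
  assumes s: "s > 0" and A: "bidisc_holo s A" and algA: "alg (compositum const_series) (germ A)"
    and J: "finite J" and H: "\<And>j. j \<in> J \<Longrightarrow> H j \<in> compositum_holo s"
    and Hpos: "\<And>j p. j \<in> J \<Longrightarrow> p \<in> bidisc s \<Longrightarrow> Re (H j p) > 0"
    and eq: "\<And>z. cmod z < s \<Longrightarrow> mixed A (pt z (cnj z)) =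
      (\<Sum>j\<in>J. c j * mixed (\<lambda>p. Ln (H j p)) (pt z (cnj z)))"
  shows "mixed A (pt 0 0) = 0"
proof -
  have 00: "pt 0 0 \<in> bidisc s" using s by (simp add: bidisc_def)
  have bH: "bidisc_holo s (H j)" if "j \<in> J" for j using compositum_holo_bidisc_holo[OF s H[OF that]] .
  define L where "L j p = Ln (H j p)" for j p
  have bL: "bidisc_holo s (L j)" if j: "j \<in> J" for j
    unfolding L_def
  proof (rule mholomorphic_comp1[OF openin_bidisc bH[OF j]])
    show "Ln holomorphic_on {z. Re z > 0}"
      by (intro holomorphic_on_Ln) (auto simp: complex_nonpos_Reals_iff)
    show "open {z. Re z > 0}" by (rule open_halfspace_Re_gt)
  qed (use Hpos[OF j] in auto)
  define B where "B p = (\<Sum>j\<in>J. c j * L j p)" for p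
  have bB: "bidisc_holo s B" unfolding B_def by (intro bidisc_holo_sum bidisc_holo_mult bidisc_holo_const bL)
  have pdB1: "pd B True p = (\<Sum>j\<in>J. c j * pd (L j) True p)" if "p \<in> bidisc s" for p
    unfolding B_def using pd_linear_combination[OF bL that] .
  have pdB2: "mixed B p = (\<Sum>j\<in>J. c j * mixed (L j) p)" if "p \<in> bidisc s" for p
    unfolding B_def using mixed_linear_combination[OF bL that] .
  obtain q where q: "\<And>n. fls_nth q n \<in> const_series" "germ (pd A True) = germ (pd B True) + q"
    using mixed_derivative_eq_imp[OF s A bB] eq pdB2 by (auto simp: L_def[abs_def])
  have H0: "germ (H j) \<noteq> 0" if "j \<in> J" for j
    using germ_eq_0_iff[OF s bH[OF that]] 00 Hpos[OF that 00] by fastforce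
  have SL: "germ (pd (L j) True) = fls_deriv (germ (H j)) / germ (H j)" if j: "j \<in> J" for j
  proof -
    have "pd (L j) True p * H j p = pd (H j) True p" if p: "p \<in> bidisc s" for p
    proof -
      have 1: "((\<lambda>w. H j (p(True := w))) has_field_derivative pd (H j) True p) (at (p True))"
        using slice_derivative[OF finite_class.finite_UNIV bH[OF j], of True p "p True"] p by simp
      have Hp: "H j p \<notin> \<real>\<^sub>\<le>\<^sub>0" "H j p \<noteq> 0" using Hpos[OF j p] by (auto simp: complex_nonpos_Reals_iff)
      have "((\<lambda>w. Ln (H j (p(True := w)))) has_field_derivative pd (H j) True p / H j p) (at (p True))"
        using 1 Hp by (auto intro!: derivative_eq_intros simp: field_simps)
      then have "pd (L j) True p = pd (H j) True p / H j p"
        unfolding pd_def[of "L j"] L_def by (rule DERIV_imp_deriv)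
      then show ?thesis using Hp by simp
    qed
    then have "germ (\<lambda>p. pd (L j) True p * H j p) = germ (pd (H j) True)" by (rule germ_cong[OF s])
    then have "germ (pd (L j) True) * germ (H j) = fls_deriv (germ (H j))"
      using germ_mult[OF s bidisc_holo_pd[OF bL[OF j]] bH[OF j]] germ_pd[OF s bH[OF j]] by simp
    then show ?thesis using H0[OF j] by (simp add: field_simps)
  qed
  have "germ (pd B True) = germ (\<lambda>p. \<Sum>j\<in>J. c j * pd (L j) True p)" by (rule germ_cong[OF s pdB1])
  also have "\<dots> = (\<Sum>j\<in>J. germ (\<lambda>p. c j * pd (L j) True p))"
    by (intro germ_sum[OF s] bidisc_holo_mult bidisc_holo_const bidisc_holo_pd bL)
  also have "\<dots> = (\<Sum>j\<in>J. fls_const (fls_const (c j)) * (fls_deriv (germ (H j)) / germ (H j)))"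
    by (intro sum.cong refl) (simp only: germ_mult[OF s bidisc_holo_const bidisc_holo_pd[OF bL]] germ_const SL)
  finally have eqS: "fls_deriv (fps_to_fls (wseries A)) =
      (\<Sum>j\<in>J. fls_const (fls_const (c j)) * (fls_deriv (fps_to_fls (wseries (H j))) / fps_to_fls (wseries (H j)))) + q"
    using q(2) germ_pd[OF s A] by (simp add: germ_def)
  have "fps_nth (wseries A) 1 \<in> const_series"
  proof (rule log_derivative_coefficients[OF subfield_const_series alg_const_series J _ _ _ q(1) eqS])
    show "fls_const (c j) \<in> const_series" for j by simp
    show "alg (compositum const_series) (fps_to_fls (wseries A))" using algA by (simp add: germ_def)
    fix j assume j: "j \<in> J"
    have "alg (compositum const_series) (germ (H j))"
      using H[OF j] by (intro alg_base subfield_subring[OF subfield_compositum]) (simp add: compositum_holo_def)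
    moreover have "fps_nth (wseries (H j)) 0 \<noteq> 0"
      using wseries_nth_0_0[of "H j"] Hpos[OF j 00] by auto
    ultimately show "alg (compositum const_series) (fps_to_fls (wseries (H j))) \<and> fps_nth (wseries (H j)) 0 \<noteq> 0"
      by (simp add: germ_def)
  qed
  then obtain a where "fps_nth (wseries A) 1 = fls_const a" by auto
  then show ?thesis by (rule wseries_1_const_imp[OF s A])
qed

text \<open>Compared to \<open>algebraic_versus_log\<close>, the roles are interchanged. The derivative of \<open>A\<close> in \<open>w\<close> is
  the logarithmic derivative of \<open>exp A\<close>, and \<open>B\<close> is the function whose linear coefficient is shown to
  be constant.\<close>

theorem exp_algebraic_versus_polynomial:
  assumes s: "s > 0" and A: "bidisc_holo s A" and algA: "alg (compositum const_series) (germ (\<lambda>p. exp (A p)))"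
    and B: "B \<in> compositum_holo s"
    and eq: "\<And>z. cmod z < s \<Longrightarrow> mixed A (pt z (cnj z)) = mixed B (pt z (cnj z))"
  shows "mixed B (pt 0 0) = 0"
proof -
  have 00: "pt 0 0 \<in> bidisc s" using s by (simp add: bidisc_def)
  have bB: "bidisc_holo s B" by (rule compositum_holo_bidisc_holo[OF s B])
  obtain q where q: "\<And>n. fls_nth q n \<in> const_series" "germ (pd B True) = germ (pd A True) + q"
    using mixed_derivative_eq_imp[OF s bB A] eq by metis
  define E where "E p = exp (A p)" for p
  have bE: "bidisc_holo s E"
    unfolding E_def by (rule mholomorphic_comp1[OF openin_bidisc A holomorphic_on_exp open_UNIV]) auto
  have "pd E True p = pd A True p * E p" if p: "p \<in> bidisc s" for p
  proof -
    have 1: "((\<lambda>w. A (p(True := w))) has_field_derivative pd A True p) (at (p True))"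
      using slice_derivative[OF finite_class.finite_UNIV A, of True p "p True"] p by simp
    show ?thesis unfolding pd_def[of E] E_def
      by (rule DERIV_imp_deriv) (use 1 in \<open>auto intro!: derivative_eq_intros\<close>)
  qed
  then have "germ (pd E True) = germ (\<lambda>p. pd A True p * E p)" by (rule germ_cong[OF s])
  then have "fls_deriv (germ E) = germ (pd A True) * germ E"
    using germ_mult[OF s bidisc_holo_pd[OF A] bE] germ_pd[OF s bE] by simp
  moreover have "germ E \<noteq> 0" using germ_eq_0_iff[OF s bE] 00 by (auto simp: E_def)
  \<comment> \<open>A sum with a single term, to match the general form of the equation.\<close>
  ultimately have eqS: "fls_deriv (fps_to_fls (wseries B)) =
      (\<Sum>j\<in>{()}. fls_const (fls_const 1) * (fls_deriv (fps_to_fls (wseries E)) / fps_to_fls (wseries E))) + q"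
    using q(2) germ_pd[OF s bB] by (simp add: germ_def field_simps)
  have "fps_nth (wseries B) 1 \<in> const_series"
  proof (rule log_derivative_coefficients[OF subfield_const_series alg_const_series _ _ _ _ q(1) eqS])
    show "alg (compositum const_series) (fps_to_fls (wseries B))"
      using B by (intro alg_base subfield_subring[OF subfield_compositum]) (simp add: compositum_holo_def germ_def)
    show "alg (compositum const_series) (fps_to_fls (wseries E)) \<and> fps_nth (wseries E) 0 \<noteq> 0"
      using algA wseries_nth_0_0[of E] by (auto simp: germ_def E_def[abs_def])
  qed auto
  then obtain a where "fps_nth (wseries B) 1 = fls_const a" by auto
  then show ?thesis by (rule wseries_1_const_imp[OF s bB])
qed

section \<open>Curves in a common submanifold\<close>

text \<open>The values of the form at \<open>a e\<^sub>j + b e\<^sub>k\<close>, for a few choices of \<open>a\<close> and \<open>b\<close>, determine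
  \<open>t j k\<close>.\<close>

lemma sesquilinear_nonzero:
  fixes t :: "'i \<Rightarrow> 'i \<Rightarrow> complex"
  assumes I: "finite I" and jk: "j \<in> I" "k \<in> I" "t j k \<noteq> 0"
  obtains v where "(\<Sum>j\<in>I. \<Sum>k\<in>I. t j k * v j * cnj (v k)) \<noteq> 0"
proof -
  have "\<exists>v. (\<Sum>j\<in>I. \<Sum>k\<in>I. t j k * v j * cnj (v k)) \<noteq> 0"
  proof (rule ccontr)
    assume "\<not> ?thesis"
    then have zero: "(\<Sum>j\<in>I. \<Sum>k\<in>I. t j k * v j * cnj (v k)) = 0" for v by blast
    have expand: "t j j * a * cnj a + t k k * b * cnj b + t j k * a * cnj b + t k j * b * cnj a = 0" for a b
    proof -
      define v where "v i = (if i = j then a else 0) + (if i = k then b else 0)" for i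
      have "(\<Sum>m\<in>I. t i m * v i * cnj (v m)) = t i j * v i * cnj a + t i k * v i * cnj b" for i
        using I jk by (simp add: v_def[of "_ :: 'i"] distrib_left sum.distrib if_distrib[of cnj]
            if_distrib[of "\<lambda>x. _ * x"] cong: if_cong)
      then have "0 = (\<Sum>i\<in>I. t i j * v i * cnj a + t i k * v i * cnj b)" using zero[of v] by simp
      also have "\<dots> = t j j * a * cnj a + t k j * b * cnj a + (t j k * a * cnj b + t k k * b * cnj b)"
        using I jk by (simp add: v_def distrib_left distrib_right sum.distrib if_distrib[of cnj]
            if_distrib[of "\<lambda>x. _ * x"] if_distrib[of "\<lambda>x. x * _"] cong: if_cong)
      finally show ?thesis by (simp add: algebra_simps)
    qed
    have j: "t j j = 0" and k: "t k k = 0" using expand[of 1 0] expand[of 0 1] by auto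
    have "t j k + t k j = 0" "t j k * - \<i> + t k j * \<i> = 0"
      using expand[of 1 1] expand[of 1 \<i>] by (auto simp: j k)
    then have "t j k = 0" by (simp add: complex_eq_iff)
    then show False using jk by simp
  qed
  then show thesis using that by blast
qed

lemma pullback_sum:
  fixes w :: "'a \<Rightarrow> 'a \<Rightarrow> complex"
  shows "(\<Sum>j\<in>I. \<Sum>k\<in>I. (\<Sum>a\<in>A. \<Sum>b\<in>A. w a b * J a j * cnj (J b k)) * v j * cnj (v k)) =
    (\<Sum>a\<in>A. \<Sum>b\<in>A. w a b * (\<Sum>j\<in>I. J a j * v j) * cnj (\<Sum>k\<in>I. J b k * v k))"
proof -
  have "(\<Sum>j\<in>I. \<Sum>k\<in>I. (\<Sum>a\<in>A. \<Sum>b\<in>A. w a b * J a j * cnj (J b k)) * v j * cnj (v k)) =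
      (\<Sum>j\<in>I. \<Sum>k\<in>I. \<Sum>a\<in>A. \<Sum>b\<in>A. w a b * J a j * cnj (J b k) * v j * cnj (v k))"
    by (simp add: sum_distrib_right)
  also have "\<dots> = (\<Sum>j\<in>I. \<Sum>a\<in>A. \<Sum>k\<in>I. \<Sum>b\<in>A. w a b * J a j * cnj (J b k) * v j * cnj (v k))"
    by (intro sum.cong refl sum.swap)
  also have "\<dots> = (\<Sum>a\<in>A. \<Sum>j\<in>I. \<Sum>k\<in>I. \<Sum>b\<in>A. w a b * J a j * cnj (J b k) * v j * cnj (v k))"
    by (rule sum.swap)
  also have "\<dots> = (\<Sum>a\<in>A. \<Sum>j\<in>I. \<Sum>b\<in>A. \<Sum>k\<in>I. w a b * J a j * cnj (J b k) * v j * cnj (v k))"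
    by (intro sum.cong refl sum.swap)
  also have "\<dots> = (\<Sum>a\<in>A. \<Sum>b\<in>A. \<Sum>j\<in>I. \<Sum>k\<in>I. w a b * J a j * cnj (J b k) * v j * cnj (v k))"
    by (intro sum.cong refl sum.swap)
  also have "\<dots> = (\<Sum>a\<in>A. \<Sum>b\<in>A. w a b * (\<Sum>j\<in>I. J a j * v j) * cnj (\<Sum>k\<in>I. J b k * v k))"
    by (simp add: sum_distrib_left sum_distrib_right mult_ac)
  finally show ?thesis .
qed

text \<open>The coefficient of \<open>\<i> dz \<and> d(cnj z)\<close> in the pullback of \<open>\<omega>\<close> along the curve \<open>f\<close>.\<close>

definition cform :: "(('i \<Rightarrow> complex) \<Rightarrow> 'i \<Rightarrow> 'i \<Rightarrow> complex) \<Rightarrow> 'i set \<Rightarrow> (complex \<Rightarrow> 'i \<Rightarrow> complex) \<Rightarrow> complex \<Rightarrow> complex" where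
  "cform \<omega> I f z = (\<Sum>a\<in>I. \<Sum>b\<in>I. \<omega> (f z) a b * deriv (\<lambda>z. f z a) z * cnj (deriv (\<lambda>z. f z b) z))"

lemma curve_stays_in_open:
  assumes I: "finite I" and U: "openin (cspace I) U" and 0: "\<gamma> 0 \<in> U" and r: "r > 0"
    and \<gamma>: "\<And>z. cmod z < r \<Longrightarrow> \<gamma> z \<in> I \<rightarrow>\<^sub>E UNIV"
    and c: "\<And>i. i \<in> I \<Longrightarrow> (\<lambda>z. \<gamma> z i) holomorphic_on ball 0 r"
  obtains s where "s > 0" "s \<le> r" "\<And>z::complex. cmod z < s \<Longrightarrow> \<gamma> z \<in> U"
proof -
  obtain e where e: "e > 0" "\<And>y. y \<in> I \<rightarrow>\<^sub>E UNIV \<Longrightarrow> near I e (\<gamma> 0) y \<Longrightarrow> y \<in> U"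
    using openin_cspaceD[OF I U 0] by blast
  have "\<exists>d>0. \<forall>z\<in>ball 0 r. dist z 0 < d \<longrightarrow> dist (\<gamma> z i) (\<gamma> 0 i) < e" if "i \<in> I" for i
  proof -
    have "\<forall>x\<in>ball 0 r. \<forall>e>0. \<exists>d>0. \<forall>z\<in>ball 0 r. dist z x < d \<longrightarrow> dist (\<gamma> z i) (\<gamma> x i) < e"
      using holomorphic_on_imp_continuous_on[OF c[OF that]] unfolding continuous_on_iff .
    moreover have "0 \<in> ball (0::complex) r" using r by simp
    ultimately show ?thesis using e(1) by blast
  qed
  then obtain D where D: "\<And>i. i \<in> I \<Longrightarrow> D i > 0"
    "\<And>i z. i \<in> I \<Longrightarrow> z \<in> ball 0 r \<Longrightarrow> dist z 0 < D i \<Longrightarrow> dist (\<gamma> z i) (\<gamma> 0 i) < e" by metis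
  define s where "s = Min (insert r (D ` I))"
  have s: "s > 0" "s \<le> r" "\<And>i. i \<in> I \<Longrightarrow> s \<le> D i" using I D(1) r by (auto simp: s_def)
  show thesis
  proof (rule that[OF s(1,2)])
    fix z :: complex assume z: "cmod z < s"
    show "\<gamma> z \<in> U"
    proof (rule e(2)[OF \<gamma>])
      show zr: "cmod z < r" using z s(2) by simp
      show "near I e (\<gamma> 0) (\<gamma> z)"
        unfolding near_def
      proof
        fix i assume i: "i \<in> I"
        show "dist (\<gamma> z i) (\<gamma> 0 i) < e"
          using D(2)[OF i, of z] s(3)[OF i] z zr by simp
      qed
    qed
  qed
qed

lemma chart_inj:
  assumes "complex_manifold M" "\<alpha> \<in> cm_index M"
  shows "inj_on (cm_chart M \<alpha>) (cm_dom M \<alpha>)" "cm_image M \<alpha> \<subseteq> cm_coords M \<rightarrow>\<^sub>E UNIV"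
proof -
  have h: "homeomorphic_map (subtopology (cm_top M) (cm_dom M \<alpha>))
          (subtopology (cspace (cm_coords M)) (cm_image M \<alpha>)) (cm_chart M \<alpha>)"
    and o: "openin (cm_top M) (cm_dom M \<alpha>)" "openin (cspace (cm_coords M)) (cm_image M \<alpha>)"
    using assms unfolding complex_manifold_def by blast+
  have "topspace (subtopology (cm_top M) (cm_dom M \<alpha>)) = cm_dom M \<alpha>"
    using openin_subset[OF o(1)] by auto
  then show "inj_on (cm_chart M \<alpha>) (cm_dom M \<alpha>)"
    using homeomorphic_imp_injective_map[OF h] by simp
  show "cm_image M \<alpha> \<subseteq> cm_coords M \<rightarrow>\<^sub>E UNIV" using openin_subset[OF o(2)] by simp
qed

lemma holomorphic_mapD:
  assumes "holomorphic_map M N f" "\<alpha> \<in> cm_index M" "\<beta> \<in> cm_index N" "a \<in> cm_coords N"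
  shows "mholomorphic_on (cm_coords M) (cm_chart M \<alpha> ` {p \<in> cm_dom M \<alpha>. f p \<in> cm_dom N \<beta>})
          (\<lambda>x. loc_rep M \<alpha> f N \<beta> x a)"
  using assms unfolding holomorphic_map_def by blast

lemma jac_pd: "jac M \<alpha> f N \<beta> x a j = pd (\<lambda>x. loc_rep M \<alpha> f N \<beta> x a) j x"
  by (simp add: jac_def pd_def)

lemma is_pullbackD:
  assumes "is_pullback M f N \<theta> \<omega>" "\<alpha> \<in> cm_index M" "\<beta> \<in> cm_index N" "p \<in> cm_dom M \<alpha>" "f p \<in> cm_dom N \<beta>"
    "j \<in> cm_coords M" "k \<in> cm_coords M"
  shows "\<theta> \<alpha> (cm_chart M \<alpha> p) j k = (\<Sum>a\<in>cm_coords N. \<Sum>b\<in>cm_coords N.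
                \<omega> \<beta> (cm_chart N \<beta> (f p)) a b *
                jac M \<alpha> f N \<beta> (cm_chart M \<alpha> p) a j *
                cnj (jac M \<alpha> f N \<beta> (cm_chart M \<alpha> p) b k))"
  using assms unfolding is_pullback_def by blast

text \<open>This carries a curve from a submanifold to the ambient manifold, and from one of the two
  isometric submanifolds to the other. The derivatives of the image curve come from the chain rule.\<close>

lemma curve_through_map:
  assumes finM: "finite (cm_coords M)" and injM: "inj_on (cm_chart M \<alpha>) (cm_dom M \<alpha>)"
    and f: "holomorphic_map M N f" and \<alpha>: "\<alpha> \<in> cm_index M" and \<beta>: "\<beta> \<in> cm_index N"
    and ne: "cm_coords N \<noteq> {}"
    and r: "r > 0" and P: "\<And>z. cmod z < r \<Longrightarrow> P z \<in> cm_dom M \<alpha>"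
    and PiE: "\<And>z. cmod z < r \<Longrightarrow> cm_chart M \<alpha> (P z) \<in> cm_coords M \<rightarrow>\<^sub>E UNIV"
    and hol: "\<And>i. i \<in> cm_coords M \<Longrightarrow> (\<lambda>z. cm_chart M \<alpha> (P z) i) holomorphic_on ball 0 r"
    and f0: "f (P 0) \<in> cm_dom N \<beta>"
    and pb: "is_pullback M f N \<theta> \<omega>"
  obtains s where "s > 0" "s \<le> r" "\<And>z. cmod z < s \<Longrightarrow> f (P z) \<in> cm_dom N \<beta>"
    "\<And>a. a \<in> cm_coords N \<Longrightarrow> (\<lambda>z. cm_chart N \<beta> (f (P z)) a) holomorphic_on ball 0 s"
    "\<And>z. cmod z < s \<Longrightarrow> cform (\<theta> \<alpha>) (cm_coords M) (\<lambda>z. cm_chart M \<alpha> (P z)) z =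
       cform (\<omega> \<beta>) (cm_coords N) (\<lambda>z. cm_chart N \<beta> (f (P z))) z"
proof -
  let ?U = "cm_chart M \<alpha> ` {p \<in> cm_dom M \<alpha>. f p \<in> cm_dom N \<beta>}"
  let ?\<gamma> = "\<lambda>z. cm_chart M \<alpha> (P z)"
  let ?L = "\<lambda>a x. loc_rep M \<alpha> f N \<beta> x a"
  obtain a0 where "a0 \<in> cm_coords N" using ne by blast
  then have U: "openin (cspace (cm_coords M)) ?U"
    using holomorphic_mapD[OF f \<alpha> \<beta>] by (simp add: mholomorphic_on_def)
  have 0: "?\<gamma> 0 \<in> ?U" using P[of 0] r f0 by auto
  obtain s where s: "s > 0" "s \<le> r" "\<And>z. cmod z < s \<Longrightarrow> ?\<gamma> z \<in> ?U"
    using curve_stays_in_open[where \<gamma> = ?\<gamma>, OF finM U 0 r PiE hol] by blast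
  have dom: "f (P z) \<in> cm_dom N \<beta>" if z: "cmod z < s" for z
  proof -
    obtain q where q: "q \<in> cm_dom M \<alpha>" "f q \<in> cm_dom N \<beta>" "?\<gamma> z = cm_chart M \<alpha> q" using s(3)[OF z] by auto
    have "q = P z" using injM q P[of z] z s(2) by (auto dest: inj_onD)
    then show ?thesis using q by simp
  qed
  have L: "?L a (?\<gamma> z) = cm_chart N \<beta> (f (P z)) a" if "cmod z < r" for a z
    using inv_into_f_f[OF injM P[OF that]] by (simp add: loc_rep_def)
  have D: "((\<lambda>z. cm_chart N \<beta> (f (P z)) a) has_field_derivative
      (\<Sum>j\<in>cm_coords M. jac M \<alpha> f N \<beta> (?\<gamma> z) a j * deriv (\<lambda>z. ?\<gamma> z j) z)) (at z)"
    if a: "a \<in> cm_coords N" and z: "cmod z < s" for a z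
  proof -
    have 1: "((\<lambda>z. ?L a (?\<gamma> z)) has_field_derivative
      (\<Sum>j\<in>cm_coords M. pd (?L a) j (?\<gamma> z) * deriv (\<lambda>z. ?\<gamma> z j) z)) (at z)"
    proof (rule chain_rule_local[where \<gamma> = ?\<gamma>, OF finM holomorphic_mapD[OF f \<alpha> \<beta> a] open_ball, of z 0 s])
      show "z \<in> ball 0 s" using z by simp
      show "?\<gamma> z \<in> ?U" by (rule s(3)[OF z])
      show "?\<gamma> u \<in> cm_coords M \<rightarrow>\<^sub>E UNIV" if "u \<in> ball 0 s" for u
        using that s(2) by (intro PiE) simp
      show "((\<lambda>z. ?\<gamma> z i) has_field_derivative deriv (\<lambda>z. ?\<gamma> z i) z) (at z)" if "i \<in> cm_coords M" for i
        using z s(2) by (intro holomorphic_derivI[OF hol[OF that] open_ball]) simp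
    qed
    have "((\<lambda>z. cm_chart N \<beta> (f (P z)) a) has_field_derivative
      (\<Sum>j\<in>cm_coords M. pd (?L a) j (?\<gamma> z) * deriv (\<lambda>z. ?\<gamma> z j) z)) (at z)"
      by (rule has_field_derivative_transform_within_open[OF 1 open_ball, of 0 s]) (use z s(2) L in auto)
    then show ?thesis by (simp add: jac_pd)
  qed
  show thesis
  proof (rule that[OF s(1,2) dom])
    show "(\<lambda>z. cm_chart N \<beta> (f (P z)) a) holomorphic_on ball 0 s" if "a \<in> cm_coords N" for a
      unfolding holomorphic_on_open[OF open_ball]
    proof
      fix z :: complex assume "z \<in> ball 0 s"
      then show "\<exists>f'. ((\<lambda>z. cm_chart N \<beta> (f (P z)) a) has_field_derivative f') (at z)"
        using D[OF that, of z] by auto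
    qed
    fix z assume z: "cmod z < s"
    have dv: "deriv (\<lambda>z. cm_chart N \<beta> (f (P z)) a) z =
        (\<Sum>j\<in>cm_coords M. jac M \<alpha> f N \<beta> (?\<gamma> z) a j * deriv (\<lambda>z. ?\<gamma> z j) z)"
      if "a \<in> cm_coords N" for a
      by (rule DERIV_imp_deriv[OF D[OF that z]])
    have Pz: "P z \<in> cm_dom M \<alpha>" using P z s(2) by simp
    have "cform (\<theta> \<alpha>) (cm_coords M) ?\<gamma> z =
      (\<Sum>j\<in>cm_coords M. \<Sum>k\<in>cm_coords M. (\<Sum>a\<in>cm_coords N. \<Sum>b\<in>cm_coords N.
        \<omega> \<beta> (cm_chart N \<beta> (f (P z))) a b * jac M \<alpha> f N \<beta> (?\<gamma> z) a j * cnj (jac M \<alpha> f N \<beta> (?\<gamma> z) b k)) *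
        deriv (\<lambda>z. ?\<gamma> z j) z * cnj (deriv (\<lambda>z. ?\<gamma> z k) z))"
      unfolding cform_def by (intro sum.cong refl) (simp add: is_pullbackD[OF pb \<alpha> \<beta> Pz dom[OF z]])
    also have "\<dots> = cform (\<omega> \<beta>) (cm_coords N) (\<lambda>z. cm_chart N \<beta> (f (P z))) z"
      unfolding pullback_sum cform_def by (intro sum.cong refl) (simp add: dv)
    finally show "cform (\<theta> \<alpha>) (cm_coords M) ?\<gamma> z = cform (\<omega> \<beta>) (cm_coords N) (\<lambda>z. cm_chart N \<beta> (f (P z))) z" .
  qed
qed

text \<open>The curve is a line in a chart of the submanifold of \<open>M\<^sub>1\<close>, in the direction of a vector at
  which the induced form is nonzero, and its images under the inclusions and the isometry. The base
  points come before the charts, so that the charts can be chosen to suit given potentials.\<close>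

theorem common_curve:
  fixes M\<^sub>1 :: "('a, 'i, 'c) cmanifold" and M\<^sub>2 :: "('b, 'j, 'd) cmanifold"
  assumes share: "share_common_submanifold M\<^sub>1 \<omega>\<^sub>1 M\<^sub>2 \<omega>\<^sub>2"
  obtains p\<^sub>1 p\<^sub>2 where "p\<^sub>1 \<in> topspace (cm_top M\<^sub>1)" "p\<^sub>2 \<in> topspace (cm_top M\<^sub>2)"
    "\<And>\<alpha> \<beta>. \<alpha> \<in> cm_index M\<^sub>1 \<Longrightarrow> p\<^sub>1 \<in> cm_dom M\<^sub>1 \<alpha> \<Longrightarrow> \<beta> \<in> cm_index M\<^sub>2 \<Longrightarrow> p\<^sub>2 \<in> cm_dom M\<^sub>2 \<beta> \<Longrightarrow>
      \<exists>r>0. \<exists>P Q. P 0 = p\<^sub>1 \<and> Q 0 = p\<^sub>2 \<and>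
        (\<forall>z\<in>ball 0 r. P z \<in> cm_dom M\<^sub>1 \<alpha> \<and> Q z \<in> cm_dom M\<^sub>2 \<beta> \<and>
           cform (\<omega>\<^sub>1 \<alpha>) (cm_coords M\<^sub>1) (\<lambda>z. cm_chart M\<^sub>1 \<alpha> (P z)) z =
           cform (\<omega>\<^sub>2 \<beta>) (cm_coords M\<^sub>2) (\<lambda>z. cm_chart M\<^sub>2 \<beta> (Q z)) z) \<and>
        (\<forall>a\<in>cm_coords M\<^sub>1. (\<lambda>z. cm_chart M\<^sub>1 \<alpha> (P z) a) holomorphic_on ball 0 r) \<and>
        (\<forall>a\<in>cm_coords M\<^sub>2. (\<lambda>z. cm_chart M\<^sub>2 \<beta> (Q z) a) holomorphic_on ball 0 r) \<and>
        cform (\<omega>\<^sub>1 \<alpha>) (cm_coords M\<^sub>1) (\<lambda>z. cm_chart M\<^sub>1 \<alpha> (P z)) 0 \<noteq> 0"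
proof -
  obtain S\<^sub>1 :: "('a, nat, 'a) cmanifold" and \<theta>\<^sub>1 and S\<^sub>2 :: "('b, nat, 'b) cmanifold" and \<theta>\<^sub>2 F where
    sh: "complex_submanifold S\<^sub>1 M\<^sub>1" "is_pullback S\<^sub>1 id M\<^sub>1 \<theta>\<^sub>1 \<omega>\<^sub>1"
    "complex_submanifold S\<^sub>2 M\<^sub>2" "is_pullback S\<^sub>2 id M\<^sub>2 \<theta>\<^sub>2 \<omega>\<^sub>2"
    "biholomorphism S\<^sub>1 S\<^sub>2 F" "is_pullback S\<^sub>1 F S\<^sub>2 \<theta>\<^sub>1 \<theta>\<^sub>2"
    "\<exists>\<alpha>\<in>cm_index S\<^sub>1. \<exists>x\<in>cm_image S\<^sub>1 \<alpha>. \<exists>j\<in>cm_coords S\<^sub>1. \<exists>k\<in>cm_coords S\<^sub>1. \<theta>\<^sub>1 \<alpha> x j k \<noteq> 0"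
    using share unfolding share_common_submanifold_def by blast
  then obtain \<alpha>\<^sub>s x j k where \<alpha>\<^sub>s: "\<alpha>\<^sub>s \<in> cm_index S\<^sub>1" and x: "x \<in> cm_image S\<^sub>1 \<alpha>\<^sub>s"
    and jk: "j \<in> cm_coords S\<^sub>1" "k \<in> cm_coords S\<^sub>1" "\<theta>\<^sub>1 \<alpha>\<^sub>s x j k \<noteq> 0" by blast
  have S\<^sub>1: "complex_manifold S\<^sub>1" "topspace (cm_top S\<^sub>1) \<subseteq> topspace (cm_top M\<^sub>1)" "holomorphic_map S\<^sub>1 M\<^sub>1 id"
    and S\<^sub>2: "complex_manifold S\<^sub>2" "topspace (cm_top S\<^sub>2) \<subseteq> topspace (cm_top M\<^sub>2)" "holomorphic_map S\<^sub>2 M\<^sub>2 id"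
    using sh(1,3) unfolding complex_submanifold_def by blast+
  have F: "holomorphic_map S\<^sub>1 S\<^sub>2 F" using sh(5) unfolding biholomorphism_def by blast
  have fin: "finite (cm_coords S\<^sub>1)" "finite (cm_coords S\<^sub>2)"
    using S\<^sub>1(1) S\<^sub>2(1) unfolding complex_manifold_def by blast+
  note inj1 = chart_inj[OF S\<^sub>1(1) \<alpha>\<^sub>s]
  have open1: "openin (cspace (cm_coords S\<^sub>1)) (cm_image S\<^sub>1 \<alpha>\<^sub>s)"
    and dom1: "openin (cm_top S\<^sub>1) (cm_dom S\<^sub>1 \<alpha>\<^sub>s)"
    using S\<^sub>1(1) \<alpha>\<^sub>s unfolding complex_manifold_def by blast+
  define p where "p = inv_into (cm_dom S\<^sub>1 \<alpha>\<^sub>s) (cm_chart S\<^sub>1 \<alpha>\<^sub>s) x"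
  have p: "p \<in> cm_dom S\<^sub>1 \<alpha>\<^sub>s" "cm_chart S\<^sub>1 \<alpha>\<^sub>s p = x"
    using x unfolding cm_image_def p_def by (auto intro: inv_into_into f_inv_into_f)
  have pS: "p \<in> topspace (cm_top S\<^sub>1)" using openin_subset[OF dom1] p by blast
  have "F p \<in> topspace (cm_top S\<^sub>2)"
    using F pS continuous_map_image_subset_topspace unfolding holomorphic_map_def by blast
  then obtain \<beta>\<^sub>s where \<beta>\<^sub>s: "\<beta>\<^sub>s \<in> cm_index S\<^sub>2" "F p \<in> cm_dom S\<^sub>2 \<beta>\<^sub>s"
    using S\<^sub>2(1) unfolding complex_manifold_def by blast
  note inj2 = chart_inj[OF S\<^sub>2(1) \<beta>\<^sub>s(1)]
  obtain v where v: "(\<Sum>j\<in>cm_coords S\<^sub>1. \<Sum>k\<in>cm_coords S\<^sub>1. \<theta>\<^sub>1 \<alpha>\<^sub>s x j k * v j * cnj (v k)) \<noteq> 0"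
    using sesquilinear_nonzero[where t = "\<theta>\<^sub>1 \<alpha>\<^sub>s x", OF fin(1) jk] by blast
  define \<gamma> where "\<gamma> z = (\<lambda>i\<in>cm_coords S\<^sub>1. x i + z * v i)" for z
  have xE: "x \<in> cm_coords S\<^sub>1 \<rightarrow>\<^sub>E UNIV" using inj1(2) x by blast
  have \<gamma>0: "\<gamma> 0 = x" using xE by (auto simp: \<gamma>_def fun_eq_iff PiE_def extensional_def)
  have \<gamma>E: "\<gamma> z \<in> cm_coords S\<^sub>1 \<rightarrow>\<^sub>E UNIV" for z by (simp add: \<gamma>_def)
  have \<gamma>h: "(\<lambda>z. \<gamma> z i) holomorphic_on ball 0 1" if "i \<in> cm_coords S\<^sub>1" for i
    using that by (auto simp: \<gamma>_def intro!: holomorphic_intros)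
  obtain r1 where r1: "r1 > 0" "r1 \<le> 1" "\<And>z. cmod z < r1 \<Longrightarrow> \<gamma> z \<in> cm_image S\<^sub>1 \<alpha>\<^sub>s"
    using curve_stays_in_open[where \<gamma> = \<gamma> and r = 1, OF fin(1) open1 _ _ \<gamma>E \<gamma>h] \<gamma>0 x by auto
  define P where "P z = inv_into (cm_dom S\<^sub>1 \<alpha>\<^sub>s) (cm_chart S\<^sub>1 \<alpha>\<^sub>s) (\<gamma> z)" for z
  have P: "P z \<in> cm_dom S\<^sub>1 \<alpha>\<^sub>s" "cm_chart S\<^sub>1 \<alpha>\<^sub>s (P z) = \<gamma> z" if "cmod z < r1" for z
    using r1(3)[OF that] unfolding cm_image_def P_def by (auto intro: inv_into_into f_inv_into_f)
  have P0: "P 0 = p" by (simp add: P_def p_def \<gamma>0)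
  have PE: "cm_chart S\<^sub>1 \<alpha>\<^sub>s (P z) \<in> cm_coords S\<^sub>1 \<rightarrow>\<^sub>E UNIV" if "cmod z < r1" for z
    using P(2)[OF that] \<gamma>E by simp
  have Ph: "(\<lambda>z. cm_chart S\<^sub>1 \<alpha>\<^sub>s (P z) i) holomorphic_on ball 0 r1" if "i \<in> cm_coords S\<^sub>1" for i
  proof (rule holomorphic_transform)
    show "(\<lambda>z. \<gamma> z i) holomorphic_on ball 0 r1"
      using \<gamma>h[OF that] r1(2) by (auto intro: holomorphic_on_subset)
  qed (use P in auto)
  have nz: "cform (\<theta>\<^sub>1 \<alpha>\<^sub>s) (cm_coords S\<^sub>1) (\<lambda>z. cm_chart S\<^sub>1 \<alpha>\<^sub>s (P z)) 0 \<noteq> 0"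
  proof -
    have "deriv (\<lambda>z. cm_chart S\<^sub>1 \<alpha>\<^sub>s (P z) i) 0 = v i" if i: "i \<in> cm_coords S\<^sub>1" for i
    proof (rule DERIV_imp_deriv, rule has_field_derivative_transform_within_open[OF _ open_ball, of _ _ 0 0 r1])
      show "((\<lambda>z. x i + z * v i) has_field_derivative v i) (at 0)" by (auto intro!: derivative_eq_intros)
    qed (use r1(1) P(2) i in \<open>auto simp: \<gamma>_def\<close>)
    then show ?thesis using v P0 p(2) unfolding cform_def by simp
  qed
  \<comment> \<open>Without coordinates, the pulled back form would vanish.\<close>
  have ne2: "cm_coords S\<^sub>2 \<noteq> {}"
    using is_pullbackD[OF sh(6) \<alpha>\<^sub>s \<beta>\<^sub>s(1) p(1) \<beta>\<^sub>s(2) jk(1,2)] jk(3) p(2) by auto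
  obtain r2 where r2: "r2 > 0" "r2 \<le> r1" "\<And>z. cmod z < r2 \<Longrightarrow> F (P z) \<in> cm_dom S\<^sub>2 \<beta>\<^sub>s"
    "\<And>a. a \<in> cm_coords S\<^sub>2 \<Longrightarrow> (\<lambda>z. cm_chart S\<^sub>2 \<beta>\<^sub>s (F (P z)) a) holomorphic_on ball 0 r2"
    "\<And>z. cmod z < r2 \<Longrightarrow> cform (\<theta>\<^sub>1 \<alpha>\<^sub>s) (cm_coords S\<^sub>1) (\<lambda>z. cm_chart S\<^sub>1 \<alpha>\<^sub>s (P z)) z =
       cform (\<theta>\<^sub>2 \<beta>\<^sub>s) (cm_coords S\<^sub>2) (\<lambda>z. cm_chart S\<^sub>2 \<beta>\<^sub>s (F (P z))) z"
    using curve_through_map[where P = P, OF fin(1) inj1(1) F \<alpha>\<^sub>s \<beta>\<^sub>s(1) ne2 r1(1) P(1) PE Ph _ sh(6)] \<beta>\<^sub>s(2) P0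
    by metis
  have QE: "cm_chart S\<^sub>2 \<beta>\<^sub>s (F (P z)) \<in> cm_coords S\<^sub>2 \<rightarrow>\<^sub>E UNIV" if "cmod z < r2" for z
    using r2(3)[OF that] inj2(2) by (auto simp: cm_image_def)
  show thesis
  proof (rule that)
    show "p \<in> topspace (cm_top M\<^sub>1)" using pS S\<^sub>1(2) by blast
    show "F p \<in> topspace (cm_top M\<^sub>2)" using \<open>F p \<in> topspace (cm_top S\<^sub>2)\<close> S\<^sub>2(2) by blast
    fix \<alpha> \<beta> assume \<alpha>: "\<alpha> \<in> cm_index M\<^sub>1" "p \<in> cm_dom M\<^sub>1 \<alpha>" and \<beta>: "\<beta> \<in> cm_index M\<^sub>2" "F p \<in> cm_dom M\<^sub>2 \<beta>"
    have id: "id p \<in> cm_dom M\<^sub>1 \<alpha>" "id (F p) \<in> cm_dom M\<^sub>2 \<beta>" using \<alpha> \<beta> by auto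
    have neM1: "cm_coords M\<^sub>1 \<noteq> {}"
      using is_pullbackD[OF sh(2) \<alpha>\<^sub>s \<alpha>(1) p(1) id(1) jk(1,2)] jk(3) p(2) by auto
    have neM2: "cm_coords M\<^sub>2 \<noteq> {}"
    proof
      assume e: "cm_coords M\<^sub>2 = {}"
      have "\<theta>\<^sub>2 \<beta>\<^sub>s (cm_chart S\<^sub>2 \<beta>\<^sub>s (F p)) a b = 0" if "a \<in> cm_coords S\<^sub>2" "b \<in> cm_coords S\<^sub>2" for a b
        using is_pullbackD[OF sh(4) \<beta>\<^sub>s(1) \<beta>(1) \<beta>\<^sub>s(2) id(2) that] e by simp
      then have "\<theta>\<^sub>1 \<alpha>\<^sub>s (cm_chart S\<^sub>1 \<alpha>\<^sub>s p) j k = 0"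
        using is_pullbackD[OF sh(6) \<alpha>\<^sub>s \<beta>\<^sub>s(1) p(1) \<beta>\<^sub>s(2) jk(1,2)] by simp
      then show False using jk(3) p(2) by simp
    qed
    obtain s1 where s1: "s1 > 0" "s1 \<le> r1" "\<And>z. cmod z < s1 \<Longrightarrow> id (P z) \<in> cm_dom M\<^sub>1 \<alpha>"
      "\<And>a. a \<in> cm_coords M\<^sub>1 \<Longrightarrow> (\<lambda>z. cm_chart M\<^sub>1 \<alpha> (id (P z)) a) holomorphic_on ball 0 s1"
      "\<And>z. cmod z < s1 \<Longrightarrow> cform (\<theta>\<^sub>1 \<alpha>\<^sub>s) (cm_coords S\<^sub>1) (\<lambda>z. cm_chart S\<^sub>1 \<alpha>\<^sub>s (P z)) z =
       cform (\<omega>\<^sub>1 \<alpha>) (cm_coords M\<^sub>1) (\<lambda>z. cm_chart M\<^sub>1 \<alpha> (id (P z))) z"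
      using curve_through_map[where P = P, OF fin(1) inj1(1) S\<^sub>1(3) \<alpha>\<^sub>s \<alpha>(1) neM1 r1(1) P(1) PE Ph _ sh(2)] id(1) P0
      by metis
    obtain s2 where s2: "s2 > 0" "s2 \<le> r2" "\<And>z. cmod z < s2 \<Longrightarrow> id (F (P z)) \<in> cm_dom M\<^sub>2 \<beta>"
      "\<And>a. a \<in> cm_coords M\<^sub>2 \<Longrightarrow> (\<lambda>z. cm_chart M\<^sub>2 \<beta> (id (F (P z))) a) holomorphic_on ball 0 s2"
      "\<And>z. cmod z < s2 \<Longrightarrow> cform (\<theta>\<^sub>2 \<beta>\<^sub>s) (cm_coords S\<^sub>2) (\<lambda>z. cm_chart S\<^sub>2 \<beta>\<^sub>s (F (P z))) z =
       cform (\<omega>\<^sub>2 \<beta>) (cm_coords M\<^sub>2) (\<lambda>z. cm_chart M\<^sub>2 \<beta> (id (F (P z)))) z"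
      using curve_through_map[where P = "\<lambda>z. F (P z)", OF fin(2) inj2(1) S\<^sub>2(3) \<beta>\<^sub>s(1) \<beta>(1) neM2 r2(1) r2(3) QE r2(4) _ sh(4)] id(2) P0
      by metis
    define r where "r = min s1 s2"
    have r: "r > 0" "r \<le> s1" "r \<le> s2" "r \<le> r2" using s1 s2 by (auto simp: r_def)
    show "\<exists>r>0. \<exists>P Q. P 0 = p \<and> Q 0 = F p \<and>
        (\<forall>z\<in>ball 0 r. P z \<in> cm_dom M\<^sub>1 \<alpha> \<and> Q z \<in> cm_dom M\<^sub>2 \<beta> \<and>
           cform (\<omega>\<^sub>1 \<alpha>) (cm_coords M\<^sub>1) (\<lambda>z. cm_chart M\<^sub>1 \<alpha> (P z)) z =
           cform (\<omega>\<^sub>2 \<beta>) (cm_coords M\<^sub>2) (\<lambda>z. cm_chart M\<^sub>2 \<beta> (Q z)) z) \<and>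
        (\<forall>a\<in>cm_coords M\<^sub>1. (\<lambda>z. cm_chart M\<^sub>1 \<alpha> (P z) a) holomorphic_on ball 0 r) \<and>
        (\<forall>a\<in>cm_coords M\<^sub>2. (\<lambda>z. cm_chart M\<^sub>2 \<beta> (Q z) a) holomorphic_on ball 0 r) \<and>
        cform (\<omega>\<^sub>1 \<alpha>) (cm_coords M\<^sub>1) (\<lambda>z. cm_chart M\<^sub>1 \<alpha> (P z)) 0 \<noteq> 0"
    proof (intro exI[of _ r] conjI r(1) exI[of _ P] exI[of _ "\<lambda>z. F (P z)"] ballI P0)
      show "F (P 0) = F p" using P0 by simp
      show "cform (\<omega>\<^sub>1 \<alpha>) (cm_coords M\<^sub>1) (\<lambda>z. cm_chart M\<^sub>1 \<alpha> (P z)) 0 \<noteq> 0"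
        using nz s1(5)[of 0] s1(1) by simp
      show "(\<lambda>z. cm_chart M\<^sub>1 \<alpha> (P z) a) holomorphic_on ball 0 r" if "a \<in> cm_coords M\<^sub>1" for a
        by (rule holomorphic_on_subset[OF s1(4)[OF that, unfolded id_apply]]) (use r in auto)
      show "(\<lambda>z. cm_chart M\<^sub>2 \<beta> (F (P z)) a) holomorphic_on ball 0 r" if "a \<in> cm_coords M\<^sub>2" for a
        by (rule holomorphic_on_subset[OF s2(4)[OF that, unfolded id_apply]]) (use r in auto)
      fix z assume "z \<in> ball (0::complex) r"
      then have z: "cmod z < s1" "cmod z < s2" "cmod z < r2" using r by auto
      show "P z \<in> cm_dom M\<^sub>1 \<alpha>" "F (P z) \<in> cm_dom M\<^sub>2 \<beta>" using s1(3)[OF z(1)] s2(3)[OF z(2)] by auto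
      show "cform (\<omega>\<^sub>1 \<alpha>) (cm_coords M\<^sub>1) (\<lambda>z. cm_chart M\<^sub>1 \<alpha> (P z)) z =
           cform (\<omega>\<^sub>2 \<beta>) (cm_coords M\<^sub>2) (\<lambda>z. cm_chart M\<^sub>2 \<beta> (F (P z))) z"
        using s1(5)[OF z(1)] r2(5)[OF z(3)] s2(5)[OF z(2)] by simp
    qed
  qed
qed

section \<open>Products of manifolds with polarized potentials\<close>

lemma polarized_curve_nbhd:
  assumes I: "finite I" and r: "r > 0"
    and f: "\<And>i. i \<in> I \<Longrightarrow> (\<lambda>z. f z i) holomorphic_on ball 0 r"
    and fE: "\<And>z. cmod z < r \<Longrightarrow> f z \<in> I \<rightarrow>\<^sub>E UNIV"
    and V: "openin (cspace I) V" "f 0 \<in> V"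
    and W: "openin (cspace (I <+> I)) W" and g: "\<And>\<xi>. \<xi> \<in> V \<Longrightarrow> diag I \<xi> \<in> W"
  shows "\<exists>s>0. s \<le> r \<and> (\<forall>z. cmod z < s \<longrightarrow> f z \<in> V) \<and> (\<forall>p\<in>bidisc s. polarized I f p \<in> W)"
proof -
  obtain s1 where s1: "s1 > 0" "s1 \<le> r" "\<And>z. cmod z < s1 \<Longrightarrow> f z \<in> V"
    using curve_stays_in_open[where \<gamma> = f, OF I V(1,2) r fE f] by blast
  have 0: "polarized I f (pt 0 0) \<in> W"
  proof -
    have "f 0 \<in> I \<rightarrow>\<^sub>E UNIV" using fE[of 0] r by simp
    from polarized_antidiagonal[where f = f and z = 0, OF this]
    have e: "polarized I f (pt 0 0) = diag I (f 0)" unfolding complex_cnj_zero .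
    show ?thesis unfolding e by (rule g[OF V(2)])
  qed
  obtain s2 where s2: "s2 > 0" "s2 \<le> r" "\<And>p. p \<in> bidisc s2 \<Longrightarrow> polarized I f p \<in> W"
    using polarized_nbhd[where f = f, OF I r f W 0] by blast
  show ?thesis
  proof (intro exI[of _ "min s1 s2"] conjI allI impI ballI)
    fix p assume "p \<in> bidisc (min s1 s2)"
    then show "polarized I f p \<in> W" by (intro s2(3)) (auto simp: bidisc_def)
  qed (use s1 s2 in auto)
qed

lemma cform_levi:
  assumes I: "finite I" and s: "s > 0"
    and f: "\<And>i. i \<in> I \<Longrightarrow> (\<lambda>z. f z i) holomorphic_on ball 0 s"
    and V: "openin (cspace I) V" "\<And>z. cmod z < s \<Longrightarrow> f z \<in> V"
    and \<Psi>: "mholomorphic_on (I <+> I) W \<Psi>"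
    and g: "\<And>\<xi>. \<xi> \<in> V \<Longrightarrow> diag I \<xi> \<in> W \<and> of_real (\<phi> \<xi>) = \<Psi> (diag I \<xi>)"
    and W: "\<And>p. p \<in> bidisc s \<Longrightarrow> polarized I f p \<in> W"
    and \<omega>: "\<And>\<xi> j k. \<xi> \<in> V \<Longrightarrow> j \<in> I \<Longrightarrow> k \<in> I \<Longrightarrow> \<omega> \<xi> j k = c * levi \<phi> \<xi> j k"
    and z: "cmod z < s"
  shows "cform \<omega> I f z = c * mixed (\<lambda>p. \<Psi> (polarized I f p)) (pt z (cnj z))"
proof -
  have "mixed (\<lambda>p. \<Psi> (polarized I f p)) (pt z (cnj z)) =
    (\<Sum>j\<in>I. \<Sum>k\<in>I. levi \<phi> (f z) j k * deriv (\<lambda>z. f z j) z * cnj (deriv (\<lambda>z. f z k) z))"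
    by (rule curve_levi_antidiagonal[OF I s _ V(1) _ \<Psi>]) (use f V g W z in auto)
  then show ?thesis
    unfolding cform_def using \<omega>[OF V(2)[OF z]] by (simp add: sum_distrib_left mult.assoc)
qed

lemma cform_prod:
  assumes fin: "\<And>j. j < m \<Longrightarrow> finite (cm_coords (N j))"
  shows "cform (prod_form m N c \<omega> \<gamma>) (cm_coords (prod_cm m N)) f z =
    (\<Sum>j<m. of_real (c j) * cform (\<omega> j (\<gamma> j)) (cm_coords (N j)) (\<lambda>z. \<lambda>i\<in>cm_coords (N j). f z (j, i)) z)"
proof -
  let ?I = "\<lambda>j. cm_coords (N j)"
  let ?D = "\<lambda>p. deriv (\<lambda>z. f z p) z"
  have "cform (prod_form m N c \<omega> \<gamma>) (cm_coords (prod_cm m N)) f z =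
    (\<Sum>j<m. \<Sum>a\<in>?I j. \<Sum>k<m. \<Sum>b\<in>?I k. prod_form m N c \<omega> \<gamma> (f z) (j, a) (k, b) * ?D (j, a) * cnj (?D (k, b)))"
    using fin by (simp add: cform_def prod_cm_def sum.Sigma case_prod_beta)
  also have "\<dots> = (\<Sum>j<m. \<Sum>a\<in>?I j. \<Sum>b\<in>?I j. of_real (c j) * \<omega> j (\<gamma> j) (\<lambda>i\<in>?I j. f z (j, i)) a b * ?D (j, a) * cnj (?D (j, b)))"
  proof (intro sum.cong refl)
    fix j a assume j: "j \<in> {..<m}"
    have "(\<Sum>k<m. \<Sum>b\<in>?I k. prod_form m N c \<omega> \<gamma> (f z) (j, a) (k, b) * ?D (j, a) * cnj (?D (k, b))) =
      (\<Sum>k<m. if k = j then (\<Sum>b\<in>?I j. of_real (c j) * \<omega> j (\<gamma> j) (\<lambda>i\<in>?I j. f z (j, i)) a b * ?D (j, a) * cnj (?D (j, b))) else 0)"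
      by (intro sum.cong refl) (auto simp: prod_form_def)
    also have "\<dots> = (\<Sum>b\<in>?I j. of_real (c j) * \<omega> j (\<gamma> j) (\<lambda>i\<in>?I j. f z (j, i)) a b * ?D (j, a) * cnj (?D (j, b)))"
      using j by simp
    finally show "(\<Sum>k<m. \<Sum>b\<in>?I k. prod_form m N c \<omega> \<gamma> (f z) (j, a) (k, b) * ?D (j, a) * cnj (?D (k, b))) =
      (\<Sum>b\<in>?I j. of_real (c j) * \<omega> j (\<gamma> j) (\<lambda>i\<in>?I j. f z (j, i)) a b * ?D (j, a) * cnj (?D (j, b)))" .
  qed
  also have "\<dots> = (\<Sum>j<m. of_real (c j) * cform (\<omega> j (\<gamma> j)) (?I j) (\<lambda>z. \<lambda>i\<in>?I j. f z (j, i)) z)"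
    by (simp add: cform_def sum_distrib_left mult.assoc)
  finally show ?thesis .
qed

lemma openin_diag_preimage:
  assumes I: "finite I" and W: "openin (cspace (I <+> I)) W"
  shows "openin (cspace I) {\<xi> \<in> I \<rightarrow>\<^sub>E UNIV. diag I \<xi> \<in> W}"
  unfolding openin_cspace_near[OF I]
proof (intro conjI ballI)
  fix \<xi> assume "\<xi> \<in> {\<xi> \<in> I \<rightarrow>\<^sub>E UNIV. diag I \<xi> \<in> W}"
  then have \<xi>: "\<xi> \<in> I \<rightarrow>\<^sub>E UNIV" "diag I \<xi> \<in> W" by auto
  have K: "finite (I <+> I)" using I by simp
  obtain e where e: "e > 0" "\<And>y. y \<in> (I <+> I) \<rightarrow>\<^sub>E UNIV \<Longrightarrow> near (I <+> I) e (diag I \<xi>) y \<Longrightarrow> y \<in> W"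
    using openin_cspaceD[OF K W \<xi>(2)] by blast
  show "\<exists>e>0. \<forall>y\<in>I \<rightarrow>\<^sub>E UNIV. near I e \<xi> y \<longrightarrow> y \<in> {\<xi> \<in> I \<rightarrow>\<^sub>E UNIV. diag I \<xi> \<in> W}"
  proof (intro exI[of _ e] conjI e(1) ballI impI)
    fix y assume y: "y \<in> I \<rightarrow>\<^sub>E UNIV" "near I e \<xi> y"
    have "dist (diag I y k) (diag I \<xi> k) < e" if "k \<in> I <+> I" for k
      using that y(2) by (auto simp: near_def conj_vec_def dist_norm simp flip: complex_cnj_diff)
    then show "y \<in> {\<xi> \<in> I \<rightarrow>\<^sub>E UNIV. diag I \<xi> \<in> W}"
      using y(1) e(2)[OF diag_PiE[OF y(1)]] by (simp add: near_def)
  qed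
qed auto

text \<open>The identity between mixed derivatives that a common curve yields when all factors have
  polarized potentials \<open>\<Psi> j i\<close> in their charts. The Euclidean and the projective case differ only in
  these potentials.\<close>

theorem product_curve:
  fixes M\<^sub>1 :: "('a, 'i, 'c) cmanifold" and \<omega>\<^sub>1 :: "('i, 'c) form11"
    and N :: "nat \<Rightarrow> ('b, nat, 'd) cmanifold" and \<omega> :: "nat \<Rightarrow> (nat, 'd) form11"
    and \<phi>\<^sub>N :: "nat \<Rightarrow> 'd \<Rightarrow> (nat \<Rightarrow> complex) \<Rightarrow> real"
    and \<Psi> :: "nat \<Rightarrow> 'd \<Rightarrow> (nat + nat \<Rightarrow> complex) \<Rightarrow> complex"
  assumes M1: "complex_manifold M\<^sub>1"
    and pot: "\<And>p. p \<in> topspace (cm_top M\<^sub>1) \<Longrightarrow> local_potential M\<^sub>1 \<omega>\<^sub>1 p (\<alpha> p) (V p) (\<phi> p) (W p) (\<Phi> p)"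
    and coords: "\<And>j. j < m \<Longrightarrow> cm_coords (N j) = {..<n j}"
    and cover: "\<And>j q. j < m \<Longrightarrow> q \<in> topspace (cm_top (N j)) \<Longrightarrow> \<exists>i\<in>cm_index (N j). q \<in> cm_dom (N j) i"
    and chart: "\<And>j i q. j < m \<Longrightarrow> i \<in> cm_index (N j) \<Longrightarrow> q \<in> cm_dom (N j) i \<Longrightarrow> cm_chart (N j) i q \<in> V\<^sub>N j i"
    and V\<^sub>N: "\<And>j i. j < m \<Longrightarrow> i \<in> cm_index (N j) \<Longrightarrow> openin (cspace {..<n j}) (V\<^sub>N j i)"
    and \<Psi>: "\<And>j i. j < m \<Longrightarrow> i \<in> cm_index (N j) \<Longrightarrow>
      mholomorphic_on ({..<n j} <+> {..<n j}) (W\<^sub>N j i) (\<Psi> j i)"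
    and diag\<^sub>N: "\<And>j i \<xi>. j < m \<Longrightarrow> i \<in> cm_index (N j) \<Longrightarrow> \<xi> \<in> V\<^sub>N j i \<Longrightarrow>
      diag {..<n j} \<xi> \<in> W\<^sub>N j i \<and> of_real (\<phi>\<^sub>N j i \<xi>) = \<Psi> j i (diag {..<n j} \<xi>)"
    and \<omega>\<^sub>N: "\<And>j i \<xi> a b. j < m \<Longrightarrow> \<omega> j i \<xi> a b = 4 * of_real (e j) * levi (\<phi>\<^sub>N j i) \<xi> a b"
    and share: "share_common_submanifold M\<^sub>1 \<omega>\<^sub>1 (prod_cm m N) (prod_form m N c \<omega>)"
  obtains p s f l \<beta> where "p \<in> topspace (cm_top M\<^sub>1)" "s > 0"
    "\<And>a. a \<in> cm_coords M\<^sub>1 \<Longrightarrow> (\<lambda>z. f z a) holomorphic_on ball 0 s"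
    "\<And>x. x \<in> bidisc s \<Longrightarrow> polarized (cm_coords M\<^sub>1) f x \<in> W p"
    "\<And>j. j < m \<Longrightarrow> \<beta> j \<in> cm_index (N j)"
    "\<And>j a. j < m \<Longrightarrow> a \<in> {..<n j} \<Longrightarrow> (\<lambda>z. l j z a) holomorphic_on ball 0 s"
    "\<And>j x. j < m \<Longrightarrow> x \<in> bidisc s \<Longrightarrow> polarized {..<n j} (l j) x \<in> W\<^sub>N j (\<beta> j)"
    "\<And>z. cmod z < s \<Longrightarrow> mixed (\<lambda>x. \<Phi> p (polarized (cm_coords M\<^sub>1) f x)) (pt z (cnj z)) =
      (\<Sum>j<m. of_real (c j * e j) * mixed (\<lambda>x. \<Psi> j (\<beta> j) (polarized {..<n j} (l j) x)) (pt z (cnj z)))"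
    "mixed (\<lambda>x. \<Phi> p (polarized (cm_coords M\<^sub>1) f x)) (pt 0 0) \<noteq> 0"
proof -
  obtain p\<^sub>1 p\<^sub>2 where p1: "p\<^sub>1 \<in> topspace (cm_top M\<^sub>1)" and p2: "p\<^sub>2 \<in> topspace (cm_top (prod_cm m N))"
    and curve: "\<And>\<alpha> \<beta>. \<alpha> \<in> cm_index M\<^sub>1 \<Longrightarrow> p\<^sub>1 \<in> cm_dom M\<^sub>1 \<alpha> \<Longrightarrow> \<beta> \<in> cm_index (prod_cm m N) \<Longrightarrow>
      p\<^sub>2 \<in> cm_dom (prod_cm m N) \<beta> \<Longrightarrow>
      \<exists>r>0. \<exists>P Q. P 0 = p\<^sub>1 \<and> Q 0 = p\<^sub>2 \<and>
        (\<forall>z\<in>ball 0 r. P z \<in> cm_dom M\<^sub>1 \<alpha> \<and> Q z \<in> cm_dom (prod_cm m N) \<beta> \<and>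
           cform (\<omega>\<^sub>1 \<alpha>) (cm_coords M\<^sub>1) (\<lambda>z. cm_chart M\<^sub>1 \<alpha> (P z)) z =
           cform (prod_form m N c \<omega> \<beta>) (cm_coords (prod_cm m N)) (\<lambda>z. cm_chart (prod_cm m N) \<beta> (Q z)) z) \<and>
        (\<forall>a\<in>cm_coords M\<^sub>1. (\<lambda>z. cm_chart M\<^sub>1 \<alpha> (P z) a) holomorphic_on ball 0 r) \<and>
        (\<forall>a\<in>cm_coords (prod_cm m N). (\<lambda>z. cm_chart (prod_cm m N) \<beta> (Q z) a) holomorphic_on ball 0 r) \<and>
        cform (\<omega>\<^sub>1 \<alpha>) (cm_coords M\<^sub>1) (\<lambda>z. cm_chart M\<^sub>1 \<alpha> (P z)) 0 \<noteq> 0"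
    using common_curve[OF share] by blast
  let ?I = "cm_coords M\<^sub>1"
  have I: "finite ?I" using M1 by (simp add: complex_manifold_def)
  note lp = pot[OF p1, unfolded local_potential_def is_polarization_def]
  have \<alpha>: "\<alpha> p\<^sub>1 \<in> cm_index M\<^sub>1" "p\<^sub>1 \<in> cm_dom M\<^sub>1 (\<alpha> p\<^sub>1)"
    and V: "openin (cspace ?I) (V p\<^sub>1)" "cm_chart M\<^sub>1 (\<alpha> p\<^sub>1) p\<^sub>1 \<in> V p\<^sub>1"
    and \<Phi>: "mholomorphic_on (?I <+> ?I) (W p\<^sub>1) (\<Phi> p\<^sub>1)"
    and diag: "\<And>\<xi>. \<xi> \<in> V p\<^sub>1 \<Longrightarrow> diag ?I \<xi> \<in> W p\<^sub>1 \<and> of_real (\<phi> p\<^sub>1 \<xi>) = \<Phi> p\<^sub>1 (diag ?I \<xi>)"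
    and \<omega>1: "\<And>\<xi> j k. \<xi> \<in> V p\<^sub>1 \<Longrightarrow> j \<in> ?I \<Longrightarrow> k \<in> ?I \<Longrightarrow> \<omega>\<^sub>1 (\<alpha> p\<^sub>1) \<xi> j k = 4 * levi (\<phi> p\<^sub>1) \<xi> j k"
    using lp by auto
  have Wo: "openin (cspace (?I <+> ?I)) (W p\<^sub>1)" using \<Phi> by (simp add: mholomorphic_on_def)
  have "\<exists>i. i \<in> cm_index (N j) \<and> p\<^sub>2 j \<in> cm_dom (N j) i" if j: "j < m" for j
  proof -
    have "p\<^sub>2 j \<in> topspace (cm_top (N j))" using p2 j by (auto simp: prod_cm_def PiE_def Pi_def)
    from cover[OF j this] show ?thesis by blast
  qed
  then obtain \<beta>0 where \<beta>0: "\<And>j. j < m \<Longrightarrow> \<beta>0 j \<in> cm_index (N j) \<and> p\<^sub>2 j \<in> cm_dom (N j) (\<beta>0 j)" by metis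
  define \<beta> where "\<beta> = (\<lambda>j\<in>{..<m}. \<beta>0 j)"
  have \<beta>: "\<beta> \<in> cm_index (prod_cm m N)" "p\<^sub>2 \<in> cm_dom (prod_cm m N) \<beta>"
    using \<beta>0 p2 by (auto simp: \<beta>_def prod_cm_def PiE_def extensional_def Pi_def)
  obtain r P Q where r: "r > 0" and P0: "P 0 = p\<^sub>1"
    and PQ: "\<And>z. cmod z < r \<Longrightarrow> P z \<in> cm_dom M\<^sub>1 (\<alpha> p\<^sub>1) \<and> Q z \<in> cm_dom (prod_cm m N) \<beta>"
    and eq: "\<And>z. cmod z < r \<Longrightarrow> cform (\<omega>\<^sub>1 (\<alpha> p\<^sub>1)) ?I (\<lambda>z. cm_chart M\<^sub>1 (\<alpha> p\<^sub>1) (P z)) z =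
           cform (prod_form m N c \<omega> \<beta>) (cm_coords (prod_cm m N)) (\<lambda>z. cm_chart (prod_cm m N) \<beta> (Q z)) z"
    and Ph: "\<And>a. a \<in> ?I \<Longrightarrow> (\<lambda>z. cm_chart M\<^sub>1 (\<alpha> p\<^sub>1) (P z) a) holomorphic_on ball 0 r"
    and Qh: "\<And>a. a \<in> cm_coords (prod_cm m N) \<Longrightarrow> (\<lambda>z. cm_chart (prod_cm m N) \<beta> (Q z) a) holomorphic_on ball 0 r"
    and nz: "cform (\<omega>\<^sub>1 (\<alpha> p\<^sub>1)) ?I (\<lambda>z. cm_chart M\<^sub>1 (\<alpha> p\<^sub>1) (P z)) 0 \<noteq> 0"
    using curve[OF \<alpha> \<beta>] unfolding Ball_def mem_ball_0 by metis
  define f where "f z = cm_chart M\<^sub>1 (\<alpha> p\<^sub>1) (P z)" for z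
  define l where "l j z = cm_chart (N j) (\<beta> j) (Q z j)" for j z
  have fE: "f z \<in> ?I \<rightarrow>\<^sub>E UNIV" if "cmod z < r" for z
    using chart_inj(2)[OF M1 \<alpha>(1)] PQ[OF that] by (auto simp: f_def cm_image_def)
  have f0: "f 0 \<in> V p\<^sub>1" using V(2) P0 by (simp add: f_def)
  have \<beta>i: "\<beta> j \<in> cm_index (N j)" if "j < m" for j
    using \<beta>0[OF that] that by (simp add: \<beta>_def)
  have lV: "l j z \<in> V\<^sub>N j (\<beta> j)" if "j < m" "cmod z < r" for j z
  proof -
    have "Q z j \<in> cm_dom (N j) (\<beta> j)" using PQ[OF that(2)] that(1) by (auto simp: prod_cm_def)
    then show ?thesis unfolding l_def by (rule chart[OF that(1) \<beta>i[OF that(1)]])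
  qed
  have lE: "l j z \<in> {..<n j} \<rightarrow>\<^sub>E UNIV" if "j < m" "cmod z < r" for j z
    using lV[OF that] openin_subset[OF V\<^sub>N[OF that(1) \<beta>i[OF that(1)]]] by auto
  have lh: "(\<lambda>z. l j z a) holomorphic_on ball 0 r" if "j < m" "a \<in> {..<n j}" for j a
  proof -
    have "(j, a) \<in> cm_coords (prod_cm m N)" using that coords by (simp add: prod_cm_def)
    from Qh[OF this] show ?thesis using that coords by (simp add: l_def prod_cm_def)
  qed
  have l_eq: "(\<lambda>i\<in>{..<n j}. cm_chart (prod_cm m N) \<beta> (Q z) (j, i)) = restrict (l j z) {..<n j}"
    if "j < m" for j z
    using that coords by (auto simp: prod_cm_def l_def fun_eq_iff)
  obtain s0 where s0: "s0 > 0" "s0 \<le> r" "\<And>z. cmod z < s0 \<Longrightarrow> f z \<in> V p\<^sub>1"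
    "\<And>p. p \<in> bidisc s0 \<Longrightarrow> polarized ?I f p \<in> W p\<^sub>1"
    using polarized_curve_nbhd[where f = f, OF I r Ph[folded f_def] fE V(1) f0 Wo] diag by metis
  have "\<exists>s>0. s \<le> r \<and> (\<forall>z. cmod z < s \<longrightarrow> l j z \<in> V\<^sub>N j (\<beta> j)) \<and>
      (\<forall>p\<in>bidisc s. polarized {..<n j} (l j) p \<in> W\<^sub>N j (\<beta> j))" if j: "j < m" for j
  proof (rule polarized_curve_nbhd)
    show "openin (cspace {..<n j}) (V\<^sub>N j (\<beta> j))" by (rule V\<^sub>N[OF j \<beta>i[OF j]])
    show "openin (cspace ({..<n j} <+> {..<n j})) (W\<^sub>N j (\<beta> j))"
      using \<Psi>[OF j \<beta>i[OF j]] by (simp add: mholomorphic_on_def)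
    show "diag {..<n j} \<xi> \<in> W\<^sub>N j (\<beta> j)" if "\<xi> \<in> V\<^sub>N j (\<beta> j)" for \<xi>
      using diag\<^sub>N[OF j \<beta>i[OF j] that] by blast
  qed (use r lh[OF j] lE[OF j] lV[OF j, of 0] in auto)
  then obtain s1 where s1: "\<And>j. j < m \<Longrightarrow> s1 j > 0"
    "\<And>j p. j < m \<Longrightarrow> p \<in> bidisc (s1 j) \<Longrightarrow> polarized {..<n j} (l j) p \<in> W\<^sub>N j (\<beta> j)" by metis
  define s where "s = Min (insert s0 (s1 ` {..<m}))"
  have s: "s > 0" "s \<le> s0" "\<And>j. j < m \<Longrightarrow> s \<le> s1 j" using s0(1) s1(1) by (auto simp: s_def)
  have sr: "s \<le> r" using s(2) s0(2) by simp
  have bidisc_mono: "p \<in> bidisc t" if "p \<in> bidisc s" "s \<le> t" for p t using that by (auto simp: bidisc_def)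
  have fh: "(\<lambda>z. f z a) holomorphic_on ball 0 s" if "a \<in> ?I" for a
    unfolding f_def by (rule holomorphic_on_subset[OF Ph[OF that]]) (use sr in auto)
  have lhs: "(\<lambda>z. l j z a) holomorphic_on ball 0 s" if "j < m" "a \<in> {..<n j}" for j a
    by (rule holomorphic_on_subset[OF lh[OF that]]) (use sr in auto)
  have fW: "polarized ?I f p \<in> W p\<^sub>1" if "p \<in> bidisc s" for p using s0(4) bidisc_mono[OF that s(2)] by blast
  have lW: "polarized {..<n j} (l j) p \<in> W\<^sub>N j (\<beta> j)" if "j < m" "p \<in> bidisc s" for j p
    using s1(2)[OF that(1)] bidisc_mono[OF that(2) s(3)[OF that(1)]] by blast
  let ?A = "\<lambda>x. \<Phi> p\<^sub>1 (polarized ?I f x)"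
  let ?B = "\<lambda>j x. \<Psi> j (\<beta> j) (polarized {..<n j} (l j) x)"
  have c1: "cform (\<omega>\<^sub>1 (\<alpha> p\<^sub>1)) ?I f z = 4 * mixed ?A (pt z (cnj z))" if "cmod z < s" for z
    by (rule cform_levi[OF I s(1) fh V(1) _ \<Phi> diag fW \<omega>1 that]) (use s0(3) s(2) in auto)
  have c2: "cform (\<omega> j (\<beta> j)) {..<n j} (l j) z = 4 * of_real (e j) * mixed (?B j) (pt z (cnj z))"
    if j: "j < m" and z: "cmod z < s" for j z
  proof (rule cform_levi[OF _ s(1) lhs[OF j] V\<^sub>N[OF j \<beta>i[OF j]] _ \<Psi>[OF j \<beta>i[OF j]] diag\<^sub>N[OF j \<beta>i[OF j]] lW[OF j] \<omega>\<^sub>N[OF j] z])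
    show "l j u \<in> V\<^sub>N j (\<beta> j)" if "cmod u < s" for u using lV[OF j] that sr by simp
  qed auto
  have eq': "mixed ?A (pt z (cnj z)) =
      (\<Sum>j<m. of_real (c j * e j) * mixed (?B j) (pt z (cnj z)))" if z: "cmod z < s" for z
  proof -
    have "4 * mixed ?A (pt z (cnj z)) =
        cform (prod_form m N c \<omega> \<beta>) (cm_coords (prod_cm m N)) (\<lambda>z. cm_chart (prod_cm m N) \<beta> (Q z)) z"
      using c1[OF z] eq[of z] z sr by (simp add: f_def[abs_def])
    also have "\<dots> = (\<Sum>j<m. of_real (c j) * cform (\<omega> j (\<beta> j)) {..<n j} (\<lambda>z. restrict (l j z) {..<n j}) z)"
    proof (subst cform_prod)
      show "(\<Sum>j<m. of_real (c j) * cform (\<omega> j (\<beta> j)) (cm_coords (N j))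
          (\<lambda>z. \<lambda>i\<in>cm_coords (N j). cm_chart (prod_cm m N) \<beta> (Q z) (j, i)) z) =
        (\<Sum>j<m. of_real (c j) * cform (\<omega> j (\<beta> j)) {..<n j} (\<lambda>z. restrict (l j z) {..<n j}) z)"
        by (rule sum.cong[OF refl]) (simp only: coords l_eq lessThan_iff)
    qed (simp add: coords)
    also have "\<dots> = (\<Sum>j<m. of_real (c j) * cform (\<omega> j (\<beta> j)) {..<n j} (l j) z)"
    proof (intro sum.cong refl arg_cong2[of _ _ _ _ "(*)"])
      fix j assume "j \<in> {..<m}"
      then have "restrict (l j z) {..<n j} = l j z" using lE[of j z] z sr by (simp add: PiE_restrict)
      then show "cform (\<omega> j (\<beta> j)) {..<n j} (\<lambda>z. restrict (l j z) {..<n j}) z = cform (\<omega> j (\<beta> j)) {..<n j} (l j) z"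
        by (simp add: cform_def)
    qed
    also have "\<dots> = (\<Sum>j<m. 4 * (of_real (c j * e j) * mixed (?B j) (pt z (cnj z))))"
      by (intro sum.cong refl) (simp add: c2 z)
    finally have "4 * mixed ?A (pt z (cnj z)) =
        4 * (\<Sum>j<m. of_real (c j * e j) * mixed (?B j) (pt z (cnj z)))"
      unfolding sum_distrib_left .
    then show ?thesis by (rule mult_left_cancel[THEN iffD1, rotated]) simp
  qed
  have "4 * mixed ?A (pt 0 (cnj 0)) \<noteq> 0"
    using nz c1[of 0] s(1) by (simp only: f_def[abs_def]) simp
  then have "mixed ?A (pt 0 0) \<noteq> 0" unfolding complex_cnj_zero by (rule contrapos_nn) simp
  then show thesis using that[of p\<^sub>1 s f \<beta> l] p1 s(1) fh fW \<beta>i lhs lW eq' by blast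
qed

section \<open>Products of projective and hyperbolic spaces\<close>

text \<open>The homogeneous coordinates in \<open>hlift\<close>, one at a time; they are also applied to the second half
  of the variables of a polarization.\<close>

definition hcoord :: "nat \<Rightarrow> nat \<Rightarrow> (nat \<Rightarrow> complex) \<Rightarrow> complex" where
  "hcoord i k \<xi> = (if k < i then \<xi> k else if k = i then 1 else \<xi> (k - 1))"

text \<open>The polarization of the Hermitian form \<open>hquad\<close> in an affine chart. The difference is written
  with a factor \<open>- 1\<close> so that closure under sums and products applies.\<close>

definition hquad_pol :: "nat \<Rightarrow> nat \<Rightarrow> nat \<Rightarrow> (nat + nat \<Rightarrow> complex) \<Rightarrow> complex" where
  "hquad_pol n \<kappa> i x = (\<Sum>k\<in>{..n - \<kappa>}. hcoord i k (\<lambda>j. x (Inl j)) * hcoord i k (\<lambda>j. x (Inr j))) +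
     (- 1) * (\<Sum>j\<in>{..<\<kappa>}. hcoord i (n - j) (\<lambda>j. x (Inl j)) * hcoord i (n - j) (\<lambda>j. x (Inr j)))"

lemma hlift_hcoord: "k \<le> n \<Longrightarrow> hlift n i z k = hcoord i k z"
  by (simp add: hlift_def hcoord_def)

lemma hcoord_conj: "k \<le> n \<Longrightarrow> i \<le> n \<Longrightarrow> hcoord i k (conj_vec {..<n} \<xi>) = cnj (hcoord i k \<xi>)"
  by (auto simp: hcoord_def conj_vec_def)

lemma hquad_pol_diag:
  assumes "i \<le> n" "\<kappa> \<le> n"
  shows "hquad_pol n \<kappa> i (diag {..<n} \<xi>) = of_real (hquad n \<kappa> (hlift n i \<xi>))"
proof -
  have *: "hcoord i k \<xi> * hcoord i k (conj_vec {..<n} \<xi>) = of_real ((cmod (hlift n i \<xi> k))\<^sup>2)" if "k \<le> n" for k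
    using that assms by (simp add: hcoord_conj hlift_hcoord complex_norm_square[symmetric] del: of_real_power)
  show ?thesis
    unfolding hquad_pol_def hquad_def using assms
    by (simp add: *)
qed

context
  fixes n \<kappa> i :: nat
  assumes i: "i \<le> n" and \<kappa>: "\<kappa> \<le> n"
begin

lemma mholomorphic_hcoord:
  assumes U: "openin (cspace ({..<n} <+> {..<n})) U" and k: "k \<le> n"
  shows "mholomorphic_on ({..<n} <+> {..<n}) U (\<lambda>x. hcoord i k (\<lambda>j. x (Inl j)))"
    "mholomorphic_on ({..<n} <+> {..<n}) U (\<lambda>x. hcoord i k (\<lambda>j. x (Inr j)))"
proof -
  consider "k < i" | "k = i" | "k > i" by linarith
  then have "mholomorphic_on ({..<n} <+> {..<n}) U (\<lambda>x. hcoord i k (\<lambda>j. x (Inl j))) \<and>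
      mholomorphic_on ({..<n} <+> {..<n}) U (\<lambda>x. hcoord i k (\<lambda>j. x (Inr j)))"
    by cases (use i k in \<open>auto simp: hcoord_def intro!: mholomorphic_proj[OF _ U] mholomorphic_const[OF U]\<close>)
  then show "mholomorphic_on ({..<n} <+> {..<n}) U (\<lambda>x. hcoord i k (\<lambda>j. x (Inl j)))"
    "mholomorphic_on ({..<n} <+> {..<n}) U (\<lambda>x. hcoord i k (\<lambda>j. x (Inr j)))" by auto
qed

lemma mholomorphic_hquad_pol:
  assumes U: "openin (cspace ({..<n} <+> {..<n})) U"
  shows "mholomorphic_on ({..<n} <+> {..<n}) U (hquad_pol n \<kappa> i)"
  unfolding hquad_pol_def[abs_def] using \<kappa>
  by (intro mholomorphic_add[OF U] mholomorphic_mult[OF U] mholomorphic_const[OF U]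
      mholomorphic_sum[OF U] mholomorphic_hcoord[OF U]) auto

text \<open>On the right half plane, the principal branch of the logarithm is holomorphic. The values of
  the polarized form on the diagonal are real, and there the condition says that the point belongs
  to the affine chart.\<close>

definition hquad_pol_pos :: "(nat + nat \<Rightarrow> complex) set" where
  "hquad_pol_pos = {x \<in> ({..<n} <+> {..<n}) \<rightarrow>\<^sub>E UNIV. Re (hquad_pol n \<kappa> i x) > 0}"

lemma openin_hquad_pol_pos: "openin (cspace ({..<n} <+> {..<n})) hquad_pol_pos"
proof -
  let ?X = "cspace ({..<n} <+> {..<n})"
  have "openin ?X (topspace ?X)" by blast
  from mholomorphic_hquad_pol[OF this] have "continuous_map ?X euclidean (hquad_pol n \<kappa> i)"
    unfolding mholomorphic_on_def by (simp only: subtopology_topspace)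
  then have "openin ?X {x \<in> topspace ?X. hquad_pol n \<kappa> i x \<in> {z. Re z > 0}}"
    by (rule openin_continuous_map_preimage) (simp add: open_halfspace_Re_gt)
  then show ?thesis by (simp add: hquad_pol_pos_def)
qed

lemma mholomorphic_Ln_hquad_pol: "mholomorphic_on ({..<n} <+> {..<n}) hquad_pol_pos (\<lambda>x. Ln (hquad_pol n \<kappa> i x))"
proof (rule mholomorphic_comp1[OF openin_hquad_pol_pos mholomorphic_hquad_pol[OF openin_hquad_pol_pos]])
  show "Ln holomorphic_on {z. Re z > 0}"
    by (intro holomorphic_on_Ln) (auto simp: complex_nonpos_Reals_iff)
  show "open {z. Re z > 0}" by (rule open_halfspace_Re_gt)
qed (auto simp: hquad_pol_pos_def)

lemma affine_part_eq: "affine_part n \<kappa> i = {\<xi> \<in> {..<n} \<rightarrow>\<^sub>E UNIV. diag {..<n} \<xi> \<in> hquad_pol_pos}"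
  using i \<kappa> diag_PiE[of _ "{..<n}"]
  by (auto simp: affine_part_def hcone_def hquad_pol_pos_def hquad_pol_diag) (auto simp: hlift_def)

lemma openin_affine_part: "openin (cspace {..<n}) (affine_part n \<kappa> i)"
  unfolding affine_part_eq by (rule openin_diag_preimage[OF _ openin_hquad_pol_pos]) simp

lemma affine_part_polarized:
  assumes "\<xi> \<in> affine_part n \<kappa> i"
  shows "diag {..<n} \<xi> \<in> hquad_pol_pos \<and> of_real (ln (hquad n \<kappa> (hlift n i \<xi>))) = Ln (hquad_pol n \<kappa> i (diag {..<n} \<xi>))"
  using assms i \<kappa> by (auto simp: affine_part_eq hquad_pol_pos_def hquad_pol_diag Ln_of_real)

lemma compositum_holo_hquad_pol:
  assumes r: "r > 0" and f: "\<And>a. a \<in> {..<n} \<Longrightarrow> (\<lambda>z. f z a) holomorphic_on ball 0 r"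
  shows "(\<lambda>p. hquad_pol n \<kappa> i (polarized {..<n} f p)) \<in> compositum_holo r"
proof -
  have P: "(\<lambda>p. polarized {..<n} f p (Inl a)) \<in> compositum_holo r" "(\<lambda>p. polarized {..<n} f p (Inr a)) \<in> compositum_holo r" if "a < n" for a
    using that by (auto intro!: polarized_compositum_holo[OF _ r f])
  have "(\<lambda>p. hcoord i k (\<lambda>j. polarized {..<n} f p (Inl j))) \<in> compositum_holo r" "(\<lambda>p. hcoord i k (\<lambda>j. polarized {..<n} f p (Inr j))) \<in> compositum_holo r"
    if "k \<le> n" for k
  proof -
    consider "k < i" | "k = i" | "k > i" by linarith
    then have "(\<lambda>p. hcoord i k (\<lambda>j. polarized {..<n} f p (Inl j))) \<in> compositum_holo r \<and>
        (\<lambda>p. hcoord i k (\<lambda>j. polarized {..<n} f p (Inr j))) \<in> compositum_holo r"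
      by cases (use i that in \<open>auto simp: hcoord_def intro!: P compositum_holo_const[OF r]\<close>)
    then show "(\<lambda>p. hcoord i k (\<lambda>j. polarized {..<n} f p (Inl j))) \<in> compositum_holo r"
      "(\<lambda>p. hcoord i k (\<lambda>j. polarized {..<n} f p (Inr j))) \<in> compositum_holo r" by auto
  qed
  then show ?thesis
    unfolding hquad_pol_def using \<kappa>
    by (intro compositum_holo_add[OF r] compositum_holo_mult[OF r] compositum_holo_sum[OF r] compositum_holo_const[OF r]) auto
qed

end

text \<open>Divide by a homogeneous coordinate that is not \<open>0\<close>.\<close>

lemma cp_cover:
  assumes q: "q \<in> topspace (cm_top (cp n \<kappa>))" and \<kappa>: "\<kappa> \<le> n"
  obtains i where "i \<in> cm_index (cp n \<kappa>)" "q \<in> cm_dom (cp n \<kappa>) i"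
proof -
  have "openin (proj_top n \<kappa>) (topspace (proj_top n \<kappa>))" by blast
  then have "q \<in> hclass n ` hcone n \<kappa>"
    using q unfolding openin_proj_top by (auto simp: cp_def)
  then obtain \<xi> where \<xi>: "\<xi> \<in> {..n} \<rightarrow>\<^sub>E UNIV" "hquad n \<kappa> \<xi> > 0" "q = hclass n \<xi>"
    by (auto simp: hcone_def)
  have "\<exists>i\<le>n. \<xi> i \<noteq> 0"
  proof (rule ccontr)
    assume "\<not> ?thesis"
    then have "hquad n \<kappa> \<xi> = 0" by (simp add: hquad_def)
    then show False using \<xi> by simp
  qed
  then obtain i where i: "i \<le> n" "\<xi> i \<noteq> 0" by blast
  \<comment> \<open>The affine coordinates skip the index \<open>i\<close>.\<close>
  define z where "z = (\<lambda>k\<in>{..<n}. if k < i then \<xi> k / \<xi> i else \<xi> (Suc k) / \<xi> i)"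
  have h: "hlift n i z k = \<xi> k / \<xi> i" if "k \<le> n" for k
    using that i by (auto simp: hlift_def z_def)
  have sq: "(cmod (hlift n i z k))\<^sup>2 = (cmod (\<xi> k))\<^sup>2 / (cmod (\<xi> i))\<^sup>2" if "k \<le> n" for k
    using h[OF that] by (simp add: norm_divide power_divide)
  have "hquad n \<kappa> (hlift n i z) = hquad n \<kappa> \<xi> / (cmod (\<xi> i))\<^sup>2"
    unfolding hquad_def by (simp add: sq sum_divide_distrib diff_divide_distrib)
  then have pos: "hquad n \<kappa> (hlift n i z) > 0" using \<xi> i by simp
  have "z \<in> affine_part n \<kappa> i"
    using pos by (auto simp: affine_part_def hcone_def z_def hlift_def)
  moreover have "hclass n (hlift n i z) = q"
  proof -
    have 1: "(\<lambda>k\<in>{..n}. t * hlift n i z k) = (\<lambda>k\<in>{..n}. (t / \<xi> i) * \<xi> k)" for t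
      using h by (auto simp: fun_eq_iff)
    have 2: "(\<lambda>k\<in>{..n}. t * \<xi> k) = (\<lambda>k\<in>{..n}. (t * \<xi> i) * hlift n i z k)" for t
      using h i by (auto simp: fun_eq_iff)
    show ?thesis
      unfolding \<xi>(3) hclass_def
    proof (intro equalityI subsetI)
      fix y assume "y \<in> {\<lambda>k\<in>{..n}. t * hlift n i z k |t. t \<noteq> 0}"
      then obtain t where "t \<noteq> 0" "y = (\<lambda>k\<in>{..n}. (t / \<xi> i) * \<xi> k)" using 1 by auto
      then show "y \<in> {\<lambda>k\<in>{..n}. t * \<xi> k |t. t \<noteq> 0}"
        using i by (intro CollectI exI[of _ "t / \<xi> i"]) auto
    next
      fix y assume "y \<in> {\<lambda>k\<in>{..n}. t * \<xi> k |t. t \<noteq> 0}"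
      then obtain t where "t \<noteq> 0" "y = (\<lambda>k\<in>{..n}. (t * \<xi> i) * hlift n i z k)" using 2 by auto
      then show "y \<in> {\<lambda>k\<in>{..n}. t * hlift n i z k |t. t \<noteq> 0}"
        using i by (intro CollectI exI[of _ "t * \<xi> i"]) auto
    qed
  qed
  ultimately have "q \<in> cm_dom (cp n \<kappa>) i" by (auto simp: cp_def)
  then show thesis using i by (intro that[of i]) (auto simp: cp_def)
qed

lemma cp_chart_affine:
  assumes "q \<in> cm_dom (cp n \<kappa>) i" shows "cm_chart (cp n \<kappa>) i q \<in> affine_part n \<kappa> i"
  using assms unfolding cp_def by (simp add: inv_into_into)

text \<open>The two minus signs in the form of a hyperbolic space cancel.\<close>

lemma ch_form_cp_form: "ch_form n \<kappa> b = cp_form n (n - \<kappa>) b"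
  by (intro ext) (simp add: ch_form_def cp_form_def)

text \<open>The common curve supplies the equation in \<open>algebraic_versus_log\<close>, with the polarized Hermitian
  forms as \<open>H j\<close>. The sign of \<open>b j\<close> is arbitrary, so that hyperbolic spaces are included.\<close>

theorem no_common_submanifold_projective:
  fixes M\<^sub>1 :: "('a, 'i, 'c) cmanifold" and \<omega>\<^sub>1 :: "('i, 'c) form11"
  assumes M1: "complex_manifold M\<^sub>1"
    and pot: "\<And>p. p \<in> topspace (cm_top M\<^sub>1) \<Longrightarrow> local_potential M\<^sub>1 \<omega>\<^sub>1 p (\<alpha> p) (V p) (\<phi> p) (W p) (\<Phi> p)"
    and nash: "\<And>p. p \<in> topspace (cm_top M\<^sub>1) \<Longrightarrow>
      nash_algebraic_on (cm_coords M\<^sub>1 <+> cm_coords M\<^sub>1) (W p) (\<Phi> p)"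
    and N: "\<And>j. j < m \<Longrightarrow> \<kappa> j \<le> n j \<and> N j = cp (n j) (\<kappa> j) \<and> \<omega> j = cp_form (n j) (\<kappa> j) (b j)"
  shows "\<not> share_common_submanifold M\<^sub>1 \<omega>\<^sub>1 (prod_cm m N) (prod_form m N c \<omega>)"
proof
  assume share: "share_common_submanifold M\<^sub>1 \<omega>\<^sub>1 (prod_cm m N) (prod_form m N c \<omega>)"
  let ?I = "cm_coords M\<^sub>1"
  have I: "finite ?I" using M1 by (simp add: complex_manifold_def)
  have k: "\<kappa> j \<le> n j" if "j < m" for j using N[OF that] by blast
  have idx: "i \<le> n j" if "j < m" "i \<in> cm_index (N j)" for i j using N[OF that(1)] that(2) by (simp add: cp_def)
  obtain p s f l \<beta> where p: "p \<in> topspace (cm_top M\<^sub>1)" and s: "s > 0"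
    and fh: "\<And>a. a \<in> ?I \<Longrightarrow> (\<lambda>z. f z a) holomorphic_on ball 0 s"
    and fW: "\<And>x. x \<in> bidisc s \<Longrightarrow> polarized ?I f x \<in> W p"
    and \<beta>: "\<And>j. j < m \<Longrightarrow> \<beta> j \<in> cm_index (N j)"
    and lh: "\<And>j a. j < m \<Longrightarrow> a \<in> {..<n j} \<Longrightarrow> (\<lambda>z. l j z a) holomorphic_on ball 0 s"
    and lW: "\<And>j x. j < m \<Longrightarrow> x \<in> bidisc s \<Longrightarrow> polarized {..<n j} (l j) x \<in> hquad_pol_pos (n j) (\<kappa> j) (\<beta> j)"
    and eq: "\<And>z. cmod z < s \<Longrightarrow> mixed (\<lambda>x. \<Phi> p (polarized ?I f x)) (pt z (cnj z)) =
      (\<Sum>j<m. of_real (c j * (1 / b j)) *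
         mixed (\<lambda>x. Ln (hquad_pol (n j) (\<kappa> j) (\<beta> j) (polarized {..<n j} (l j) x))) (pt z (cnj z)))"
    and nz: "mixed (\<lambda>x. \<Phi> p (polarized ?I f x)) (pt 0 0) \<noteq> 0"
  proof (rule product_curve[OF M1 pot, where m = m and N = N and n = n and \<omega> = \<omega> and c = c
        and V\<^sub>N = "\<lambda>j. affine_part (n j) (\<kappa> j)" and W\<^sub>N = "\<lambda>j. hquad_pol_pos (n j) (\<kappa> j)"
        and \<Psi> = "\<lambda>j i x. Ln (hquad_pol (n j) (\<kappa> j) i x)" and e = "\<lambda>j. 1 / b j"
        and \<phi>\<^sub>N = "\<lambda>j i z. ln (hquad (n j) (\<kappa> j) (hlift (n j) i z))"])
    fix j assume j: "j < m"
    show "cm_coords (N j) = {..<n j}" using N[OF j] by (simp add: cp_def)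
    show "\<exists>i\<in>cm_index (N j). q \<in> cm_dom (N j) i" if "q \<in> topspace (cm_top (N j))" for q
      using cp_cover[of q "n j" "\<kappa> j"] that N[OF j] by metis
    fix i
    show "\<omega> j i \<xi> a a' = 4 * of_real (1 / b j) * levi (\<lambda>z. ln (hquad (n j) (\<kappa> j) (hlift (n j) i z))) \<xi> a a'" for \<xi> a a'
      using N[OF j] by (simp add: cp_form_def)
    assume i: "i \<in> cm_index (N j)"
    show "cm_chart (N j) i q \<in> affine_part (n j) (\<kappa> j) i" if "q \<in> cm_dom (N j) i" for q
      using cp_chart_affine[of q "n j" "\<kappa> j" i] that N[OF j] by simp
    show "openin (cspace {..<n j}) (affine_part (n j) (\<kappa> j) i)"
      by (rule openin_affine_part[OF idx[OF j i] k[OF j]])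
    show "mholomorphic_on ({..<n j} <+> {..<n j}) (hquad_pol_pos (n j) (\<kappa> j) i) (\<lambda>x. Ln (hquad_pol (n j) (\<kappa> j) i x))"
      by (rule mholomorphic_Ln_hquad_pol[OF idx[OF j i] k[OF j]])
    show "diag {..<n j} \<xi> \<in> hquad_pol_pos (n j) (\<kappa> j) i \<and>
        of_real (ln (hquad (n j) (\<kappa> j) (hlift (n j) i \<xi>))) = Ln (hquad_pol (n j) (\<kappa> j) i (diag {..<n j} \<xi>))"
      if "\<xi> \<in> affine_part (n j) (\<kappa> j) i" for \<xi>
      by (rule affine_part_polarized[OF idx[OF j i] k[OF j] that])
  qed (use share in assumption | blast)+
  have \<Phi>: "mholomorphic_on (?I <+> ?I) (W p) (\<Phi> p)"
    using nash[OF p] by (simp add: nash_algebraic_on_def)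
  have "mixed (\<lambda>x. \<Phi> p (polarized ?I f x)) (pt 0 0) = 0"
  proof (rule algebraic_versus_log[OF s _ _ finite_lessThan[of m] _ _ eq])
    show "bidisc_holo s (\<lambda>x. \<Phi> p (polarized ?I f x))" by (rule curve_levi(1)[OF I s fh \<Phi> fW])
    show "alg (compositum const_series) (germ (\<lambda>x. \<Phi> p (polarized ?I f x)))"
    proof (rule nash_algebraic_pullback[OF _ nash[OF p] s _ _ polarized_PiE])
      show "(\<lambda>p. polarized ?I f p k) \<in> compositum_holo s" if "k \<in> ?I <+> ?I" for k by (rule polarized_compositum_holo[OF I s fh that])
    qed (use I fW in auto)
    show "(\<lambda>x. hquad_pol (n j) (\<kappa> j) (\<beta> j) (polarized {..<n j} (l j) x)) \<in> compositum_holo s" if "j \<in> {..<m}" for j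
      using that by (intro compositum_holo_hquad_pol idx \<beta> k s lh) auto
    show "Re (hquad_pol (n j) (\<kappa> j) (\<beta> j) (polarized {..<n j} (l j) x)) > 0" if "j \<in> {..<m}" "x \<in> bidisc s" for j x
      using lW[of j x] that by (simp add: hquad_pol_pos_def[OF idx[OF _ \<beta>] k])
  qed
  then show False using nz by simp
qed

section \<open>Products of Euclidean spaces\<close>

text \<open>The polarization of the potential of the indefinite Euclidean form.\<close>

definition euclid_pol :: "nat \<Rightarrow> nat \<Rightarrow> (nat + nat \<Rightarrow> complex) \<Rightarrow> complex" where
  "euclid_pol n \<kappa> x = (\<Sum>i\<in>{\<kappa>..<n}. x (Inl i) * x (Inr i)) + (- 1) * (\<Sum>i\<in>{..<\<kappa>}. x (Inl i) * x (Inr i))"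

text \<open>The common curve supplies the equation in \<open>exp_algebraic_versus_polynomial\<close>, with the sum of the
  polarized Euclidean potentials as \<open>B\<close>.\<close>

theorem no_common_submanifold_euclidean:
  fixes M\<^sub>1 :: "('a, 'i, 'c) cmanifold" and \<omega>\<^sub>1 :: "('i, 'c) form11"
  assumes M1: "complex_manifold M\<^sub>1"
    and pot: "\<And>p. p \<in> topspace (cm_top M\<^sub>1) \<Longrightarrow> local_potential M\<^sub>1 \<omega>\<^sub>1 p (\<alpha> p) (V p) (\<phi> p) (W p) (\<Phi> p)"
    and nash: "\<And>p. p \<in> topspace (cm_top M\<^sub>1) \<Longrightarrow>
      nash_algebraic_on (cm_coords M\<^sub>1 <+> cm_coords M\<^sub>1) (W p) (\<lambda>x. exp (\<Phi> p x))"
    and N: "\<And>j. j < m \<Longrightarrow> \<kappa> j \<le> n j \<and> N j = euclid (n j) \<and> \<omega> j = euclid_form (n j) (\<kappa> j)"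
  shows "\<not> share_common_submanifold M\<^sub>1 \<omega>\<^sub>1 (prod_cm m N) (prod_form m N c \<omega>)"
proof
  assume share: "share_common_submanifold M\<^sub>1 \<omega>\<^sub>1 (prod_cm m N) (prod_form m N c \<omega>)"
  let ?I = "cm_coords M\<^sub>1"
  have I: "finite ?I" using M1 by (simp add: complex_manifold_def)
  have k: "\<kappa> j \<le> n j" if "j < m" for j using N[OF that] by blast
  have full: "openin (cspace J) (J \<rightarrow>\<^sub>E UNIV)" for J :: "'k set"
    using openin_topspace[of "cspace J"] by simp
  obtain p s f l \<beta> where p: "p \<in> topspace (cm_top M\<^sub>1)" and s: "s > 0"
    and fh: "\<And>a. a \<in> ?I \<Longrightarrow> (\<lambda>z. f z a) holomorphic_on ball 0 s"
    and fW: "\<And>x. x \<in> bidisc s \<Longrightarrow> polarized ?I f x \<in> W p"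
    and lh: "\<And>j a. j < m \<Longrightarrow> a \<in> {..<n j} \<Longrightarrow> (\<lambda>z. l j z a) holomorphic_on ball 0 s"
    and eq: "\<And>z. cmod z < s \<Longrightarrow> mixed (\<lambda>x. \<Phi> p (polarized ?I f x)) (pt z (cnj z)) =
      (\<Sum>j<m. of_real (c j * 1) * mixed (\<lambda>x. euclid_pol (n j) (\<kappa> j) (polarized {..<n j} (l j) x)) (pt z (cnj z)))"
    and nz: "mixed (\<lambda>x. \<Phi> p (polarized ?I f x)) (pt 0 0) \<noteq> 0"
  proof (rule product_curve[OF M1 pot, where m = m and N = N and n = n and \<omega> = \<omega> and c = c
        and V\<^sub>N = "\<lambda>j _. {..<n j} \<rightarrow>\<^sub>E UNIV" and W\<^sub>N = "\<lambda>j _. ({..<n j} <+> {..<n j}) \<rightarrow>\<^sub>E UNIV"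
        and \<Psi> = "\<lambda>j _. euclid_pol (n j) (\<kappa> j)" and e = "\<lambda>j. 1"
        and \<phi>\<^sub>N = "\<lambda>j _ z. (\<Sum>i\<in>{\<kappa> j..<n j}. (cmod (z i))\<^sup>2) - (\<Sum>i\<in>{..<\<kappa> j}. (cmod (z i))\<^sup>2)"])
    fix j assume j: "j < m"
    show "cm_coords (N j) = {..<n j}" using N[OF j] by (simp add: euclid_def)
    show "\<exists>i\<in>cm_index (N j). q \<in> cm_dom (N j) i" if "q \<in> topspace (cm_top (N j))" for q
      using that N[OF j] by (simp add: euclid_def)
    fix i :: unit
    show "\<omega> j i \<xi> a a' = 4 * of_real 1 * levi (\<lambda>z. (\<Sum>i\<in>{\<kappa> j..<n j}. (cmod (z i))\<^sup>2) - (\<Sum>i\<in>{..<\<kappa> j}. (cmod (z i))\<^sup>2)) \<xi> a a'"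
      for \<xi> a a'
      using N[OF j] by (simp add: euclid_form_def)
    show "cm_chart (N j) i q \<in> {..<n j} \<rightarrow>\<^sub>E UNIV" if "q \<in> cm_dom (N j) i" for q
      using that N[OF j] by (simp add: euclid_def)
    show "openin (cspace {..<n j}) ({..<n j} \<rightarrow>\<^sub>E UNIV)" by (rule full)
    show "mholomorphic_on ({..<n j} <+> {..<n j}) (({..<n j} <+> {..<n j}) \<rightarrow>\<^sub>E UNIV) (euclid_pol (n j) (\<kappa> j))"
      unfolding euclid_pol_def[abs_def] using k[OF j]
      by (intro mholomorphic_add[OF full] mholomorphic_mult[OF full] mholomorphic_const[OF full]
          mholomorphic_sum[OF full] mholomorphic_proj[OF _ full]) auto
    show "diag {..<n j} \<xi> \<in> ({..<n j} <+> {..<n j}) \<rightarrow>\<^sub>E UNIV \<and>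
        of_real ((\<Sum>i\<in>{\<kappa> j..<n j}. (cmod (\<xi> i))\<^sup>2) - (\<Sum>i\<in>{..<\<kappa> j}. (cmod (\<xi> i))\<^sup>2)) = euclid_pol (n j) (\<kappa> j) (diag {..<n j} \<xi>)"
      if "\<xi> \<in> {..<n j} \<rightarrow>\<^sub>E UNIV" for \<xi>
    proof
      show "diag {..<n j} \<xi> \<in> ({..<n j} <+> {..<n j}) \<rightarrow>\<^sub>E UNIV" by (rule diag_PiE[OF that])
      have "\<xi> i * conj_vec {..<n j} \<xi> i = of_real ((cmod (\<xi> i))\<^sup>2)" if "i < n j" for i
        using that by (simp add: conj_vec_def complex_norm_square[symmetric] del: of_real_power)
      then show "of_real ((\<Sum>i\<in>{\<kappa> j..<n j}. (cmod (\<xi> i))\<^sup>2) - (\<Sum>i\<in>{..<\<kappa> j}. (cmod (\<xi> i))\<^sup>2)) = euclid_pol (n j) (\<kappa> j) (diag {..<n j} \<xi>)"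
        using k[OF j] by (simp add: euclid_pol_def)
    qed
  qed (use share in assumption | blast)+
  define B where "B x = (\<Sum>j<m. of_real (c j * 1) * euclid_pol (n j) (\<kappa> j) (polarized {..<n j} (l j) x))" for x
  have compositum_holo_E: "(\<lambda>x. euclid_pol (n j) (\<kappa> j) (polarized {..<n j} (l j) x)) \<in> compositum_holo s" if j: "j < m" for j
  proof -
    have "(\<lambda>x. polarized {..<n j} (l j) x (Inl a)) \<in> compositum_holo s" "(\<lambda>x. polarized {..<n j} (l j) x (Inr a)) \<in> compositum_holo s" if "a < n j" for a
      using that by (auto intro!: polarized_compositum_holo[OF _ s lh[OF j]])
    then show ?thesis
      unfolding euclid_pol_def using k[OF j]
      by (intro compositum_holo_add[OF s] compositum_holo_mult[OF s] compositum_holo_sum[OF s] compositum_holo_const[OF s]) auto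
  qed
  have compositum_holo_B: "B \<in> compositum_holo s"
    unfolding B_def[abs_def] by (intro compositum_holo_sum[OF s] compositum_holo_mult[OF s] compositum_holo_const[OF s] compositum_holo_E) auto
  have mixed_B: "mixed B x =
      (\<Sum>j<m. of_real (c j * 1) * mixed (\<lambda>x. euclid_pol (n j) (\<kappa> j) (polarized {..<n j} (l j) x)) x)"
    if "x \<in> bidisc s" for x
    unfolding B_def[abs_def] by (rule mixed_linear_combination[OF compositum_holo_bidisc_holo[OF s compositum_holo_E] that]) auto
  have \<Phi>: "mholomorphic_on (?I <+> ?I) (W p) (\<Phi> p)"
    using pot[OF p] by (simp add: local_potential_def is_polarization_def)
  have "mixed B (pt 0 0) = 0"
  proof (rule exp_algebraic_versus_polynomial[OF s _ _ compositum_holo_B])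
    show "bidisc_holo s (\<lambda>x. \<Phi> p (polarized ?I f x))" by (rule curve_levi(1)[OF I s fh \<Phi> fW])
    show "alg (compositum const_series) (germ (\<lambda>x. exp (\<Phi> p (polarized ?I f x))))"
    proof (rule nash_algebraic_pullback[OF _ nash[OF p] s _ _ polarized_PiE])
      show "(\<lambda>p. polarized ?I f p k) \<in> compositum_holo s" if "k \<in> ?I <+> ?I" for k by (rule polarized_compositum_holo[OF I s fh that])
    qed (use I fW in auto)
    fix z assume "cmod z < s"
    then show "mixed (\<lambda>x. \<Phi> p (polarized ?I f x)) (pt z (cnj z)) = mixed B (pt z (cnj z))"
      using eq[of z] mixed_B[of "pt z (cnj z)"] by simp
  qed
  moreover have "mixed (\<lambda>x. \<Phi> p (polarized ?I f x)) (pt 0 (cnj 0)) = mixed B (pt 0 (cnj 0))"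
    using eq[of 0] mixed_B[of "pt 0 (cnj 0)"] s by simp
  ultimately show False using nz unfolding complex_cnj_zero by simp
qed

section \<open>Absence of common submanifolds\<close>

theorem corollary3p3:
  fixes M\<^sub>1 :: "('a, 'i, 'c) cmanifold" and \<omega>\<^sub>1 :: "('i, 'c) form11"
    and \<alpha> :: "'a \<Rightarrow> 'c"
    and V :: "'a \<Rightarrow> ('i \<Rightarrow> complex) set" and \<phi> :: "'a \<Rightarrow> ('i \<Rightarrow> complex) \<Rightarrow> real"
    and W :: "'a \<Rightarrow> ('i + 'i \<Rightarrow> complex) set" and \<Phi> :: "'a \<Rightarrow> ('i + 'i \<Rightarrow> complex) \<Rightarrow> complex"
  assumes "complex_manifold M\<^sub>1"
    and "closed_real_analytic_form11 M\<^sub>1 \<omega>\<^sub>1"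
    and "\<forall>p\<in>topspace (cm_top M\<^sub>1). local_potential M\<^sub>1 \<omega>\<^sub>1 p (\<alpha> p) (V p) (\<phi> p) (W p) (\<Phi> p)"
  shows "((\<forall>p\<in>topspace (cm_top M\<^sub>1).
             nash_algebraic_on (cm_coords M\<^sub>1 <+> cm_coords M\<^sub>1) (W p) (\<Phi> p)) \<longrightarrow>
          (\<forall>(m :: nat) (c :: nat \<Rightarrow> real) (n :: nat \<Rightarrow> nat) (\<kappa> :: nat \<Rightarrow> nat) (b :: nat \<Rightarrow> real) N \<omega>.
             (\<forall>j<m. \<kappa> j \<le> n j \<and>
                (b j > 0 \<and> N j = cp (n j) (\<kappa> j) \<and> \<omega> j = cp_form (n j) (\<kappa> j) (b j) \<or>
                 b j < 0 \<and> N j = ch (n j) (\<kappa> j) \<and> \<omega> j = ch_form (n j) (\<kappa> j) (b j))) \<longrightarrow>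
             \<not> share_common_submanifold M\<^sub>1 \<omega>\<^sub>1 (prod_cm m N) (prod_form m N c \<omega>)))
       \<and> ((\<forall>p\<in>topspace (cm_top M\<^sub>1).
             nash_algebraic_on (cm_coords M\<^sub>1 <+> cm_coords M\<^sub>1) (W p) (\<lambda>x. exp (\<Phi> p x))) \<longrightarrow>
          (\<forall>(m :: nat) (c :: nat \<Rightarrow> real) (n :: nat \<Rightarrow> nat) (\<kappa> :: nat \<Rightarrow> nat) N \<omega>.
             (\<forall>j<m. \<kappa> j \<le> n j \<and> N j = euclid (n j) \<and> \<omega> j = euclid_form (n j) (\<kappa> j)) \<longrightarrow>
             \<not> share_common_submanifold M\<^sub>1 \<omega>\<^sub>1 (prod_cm m N) (prod_form m N c \<omega>)))"
proof (intro conjI impI allI)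
  fix m :: nat and c :: "nat \<Rightarrow> real" and n \<kappa> :: "nat \<Rightarrow> nat" and b :: "nat \<Rightarrow> real"
    and N :: "nat \<Rightarrow> ((nat \<Rightarrow> complex) set, nat, nat) cmanifold" and \<omega> :: "nat \<Rightarrow> (nat, nat) form11"
  assume nash: "\<forall>p\<in>topspace (cm_top M\<^sub>1). nash_algebraic_on (cm_coords M\<^sub>1 <+> cm_coords M\<^sub>1) (W p) (\<Phi> p)"
    and N: "\<forall>j<m. \<kappa> j \<le> n j \<and>
      (b j > 0 \<and> N j = cp (n j) (\<kappa> j) \<and> \<omega> j = cp_form (n j) (\<kappa> j) (b j) \<or>
       b j < 0 \<and> N j = ch (n j) (\<kappa> j) \<and> \<omega> j = ch_form (n j) (\<kappa> j) (b j))"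
  show "\<not> share_common_submanifold M\<^sub>1 \<omega>\<^sub>1 (prod_cm m N) (prod_form m N c \<omega>)"
  \<comment> \<open>A hyperbolic space is a projective space of complementary index with \<open>b < 0\<close>.\<close>
  proof (rule no_common_submanifold_projective[OF assms(1)])
    fix j assume "j < m"
    then show "(if b j > 0 then \<kappa> j else n j - \<kappa> j) \<le> n j \<and>
        N j = cp (n j) (if b j > 0 then \<kappa> j else n j - \<kappa> j) \<and>
        \<omega> j = cp_form (n j) (if b j > 0 then \<kappa> j else n j - \<kappa> j) (b j)"
      using N by (auto simp: ch_def ch_form_cp_form)
  qed (use assms(3) nash in blast)+
next
  fix m :: nat and c :: "nat \<Rightarrow> real" and n \<kappa> :: "nat \<Rightarrow> nat"
    and N :: "nat \<Rightarrow> (nat \<Rightarrow> complex, nat, unit) cmanifold" and \<omega> :: "nat \<Rightarrow> (nat, unit) form11"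
  assume nash: "\<forall>p\<in>topspace (cm_top M\<^sub>1).
      nash_algebraic_on (cm_coords M\<^sub>1 <+> cm_coords M\<^sub>1) (W p) (\<lambda>x. exp (\<Phi> p x))"
    and N: "\<forall>j<m. \<kappa> j \<le> n j \<and> N j = euclid (n j) \<and> \<omega> j = euclid_form (n j) (\<kappa> j)"
  show "\<not> share_common_submanifold M\<^sub>1 \<omega>\<^sub>1 (prod_cm m N) (prod_form m N c \<omega>)"
    by (rule no_common_submanifold_euclidean[OF assms(1)]) (use assms(3) nash N in blast)+
qed

end
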